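(* Let $M\in\mathcal{Q}_2^\theta$, $\omega\in A_{p(M)}$ and $\beta\in\mathbb{R}$. Then for functions $f\in L_{M,\omega}$ the following hold, where $C$ denotes constants independent of $n$ and of $f$. 1. If $\psi\in\mathfrak{M}_0$ and the series $\sum_{k=1}^\infty E_k(f)_{M,\omega}\,|k\psi(k)|^{-1}$ converges, then there exists a derivative $f^\psi_\beta$ such that for $r=0,1,2,\dots$ and every $n\in\mathbb{N}$ $$\Omega_r\Big(f^\psi_\beta;\frac1n\Big)_{M,\omega}\le\frac{C}{n^{2r}}\sum_{\nu=0}^{n}\frac{\nu^{2r}}{\psi(\nu)}E_\nu(f)_{M,\omega}+C\sum_{\nu=n+1}^\infty\frac{E_\nu(f)_{M,\omega}}{\nu\,\psi(\nu)}.$$ 2. If $\psi\in F$, $\eta(\psi;t)-t\ge c_0$ for all $t\ge1$ with some constant $c_0>0$, and the series $\sum_{k=1}^\infty E_k(f)_{M,\omega}\,|\psi(k)(\eta(k)-k)|^{-1}$ converges, where $\eta(k)=\eta(\psi;k)$, then there exists a derivative $f^\psi_\beta$ such that for $r=0,1,2,\dots$ and every $n\in\mathbb{N}$ $$\Omega_r\Big(f^\psi_\beta;\frac1n\Big)_{M,\omega}\le C\Bigg(\frac1{n^{2r}}\sum_{\nu=1}^{n}\frac{\nu^{2r}}{\psi(\nu)}E_\nu(f)_{M,\omega}+\sum_{\nu=n+1}^\infty\frac{E_\nu(f)_{M,\omega}}{\psi(\nu)(\eta(\nu)-\nu)}\Bigg).$$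
   Context: Young functions. A Young function is a continuous, convex, even function $\Phi$ on $\mathbb{R}$ with $\lim_{x\to0}\Phi(x)/x=0$ and $\lim_{x\to\infty}\Phi(x)/x=\infty$. A nonnegative function $M=M(t)$, $t\ge0$, is a quasiconvex Young function if there are a convex Young function $\Phi$ and a constant $c>1$ with $\Phi(x)\le M(x)\le\Phi(cx)$ for all $x\ge0$; the set of all such $M$ is $\mathcal{Q}$. The condition $\Delta_2$ on $M$ means that there is $c>0$ with $M(2x)\le cM(x)$ for all $x$. $\mathcal{Q}_2^\theta$ is the class of functions $M\in\mathcal{Q}$ that satisfy $\Delta_2$ and for which $M^\theta$ is quasiconvex (i.e. $M^\theta\in\mathcal Q$) for some $\theta\in(0,1)$. For quasiconvex $M$ define $p(M)$ by $\frac1{p(M)}=\inf\{p>0: M^p\in\mathcal{Q}\}$. Weights. A weight is a $2\pi$-periodic, measurable, almost everywhere positive function $\omega$. For $1<p<\infty$, $\omega$ belongs to the Muckenhoupt class $A_p$ if there is a constant $c$ such that $$\Big(\frac1{b-a}\int_a^b\omega(t)\,dt\Big)\Big(\frac1{b-a}\int_a^b\omega(t)^{-1/(p-1)}\,dt\Big)^{p-1}\le c$$ for every interval $[a,b]$ with $0<b-a\le2\pi$. Spaces. $L$ is the space of $2\pi$-periodic functions integrable over a period. $\tilde L_{M,\omega}$ is the class of $2\pi$-periodic measurable $f$ with $\int_0^{2\pi}M(|f(x)|)\omega(x)\,dx<\infty$; the weighted Orlicz space $L_{M,\omega}$ is its linear span, with norm $$\|f\|_{M,\omega}=\sup\Big\{\int_0^{2\pi}|f(t)g(t)|\omega(t)\,dt:\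 \int_0^{2\pi}\tilde M(|g(t)|)\omega(t)\,dt\le1\Big\},\qquad \tilde M(y)=\sup_{x\ge0}(xy-M(x)),\ y\ge 0.$$ If $\omega\in A_{p(M)}$ then $L_{M,\omega}\subset L$. Best approximation. For $\varphi\in L_{M,\omega}$ and $n\in\mathbb{N}$, $E_n(\varphi)_{M,\omega}=\inf_{t\in\mathcal{T}_{n-1}}\|\varphi-t\|_{M,\omega}$, where $\mathcal{T}_{n-1}$ is the space of trigonometric polynomials of order at most $n-1$. Convention: $1/\psi(0):=0$, so terms with $\nu=0$ containing $1/\psi(\nu)$ vanish. Moduli of smoothness. For $g\in L_{M,\omega}$ and $0<h<\pi$ let $(\sigma_hg)(x)=\frac1{2h}\int_{-h}^hg(x+t)\,dt$, let $I$ be the identity operator, and for $\delta>0$ let $$\Omega_r(g;\delta)_{M,\omega}=\sup_{0<h_i<\delta,\ 1\le i\le r}\Big\|\prod_{i=1}^r(I-\sigma_{h_i})g\Big\|_{M,\omega},\quad r=1,2,\dots,$$ and $\Omega_0(g;\delta)_{M,\omega}=\|g\|_{M,\omega}$ (empty product). Writing $\Omega_r(g;\delta)_{M,\omega}$ presupposes $g\in L_{M,\omega}$. Sequences and the function $\eta$. $\mathfrak{M}$ is the set of sequences $\psi(k)>0$, $k\in\mathbb{N}$, with $\psi(k)-\psi(k+1)\ge0$ and $\psi(k+2)-2\psi(k+1)+\psi(k)>0$ for all $k$, and $\lim_{k\to\infty}\psi(k)=0$. Each $\psi\in\mathfrak{M}$ is regarded as the restriction to $\mathbb{N}$ of a continuous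 function $\psi(t)$, $t\ge1$, strictly decreasing to $0$. Then $\eta(t)=\eta(\psi;t)=\psi^{-1}\big(\tfrac12\psi(t)\big)$, $t\ge1$, where $\psi^{-1}$ is the inverse function of $\psi$; that is, $\psi(\eta(t))=\frac12\psi(t)$. With $\eta'$ the derivative of $\eta$ in $t$, $$\mathfrak{M}_0=\Big\{\psi\in\mathfrak{M}:\ 0<\frac{t}{\eta(\psi;t)-t}\le K\ \ (t\ge1)\Big\},\qquad F=\{\psi\in\mathfrak{M}:\ \eta'(\psi;t)\le K\ \ (t\ge1)\},$$ where $K$ is a constant that may depend on $\psi$. $(\psi;\beta)$-derivative. Let $f\in L$ have Fourier coefficients $a_k(f),b_k(f)$ and let $\beta\in\mathbb{R}$. If the series $$\sum_{k=1}^\infty\frac1{\psi(k)}\Big(a_k(f)\cos\big(kx+\tfrac{\beta\pi}2\big)+b_k(f)\sin\big(kx+\tfrac{\beta\pi}2\big)\Big)$$ is the Fourier series of a function in $L$, this function is called the $(\psi;\beta)$-derivative of $f$ and denoted $f^\psi_\beta$. *)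

theory Defs
  imports "HOL-Analysis.Analysis"
begin

definition young_function :: "(real \<Rightarrow> real) \<Rightarrow> bool" where
  "young_function \<Phi> \<longleftrightarrow>
     continuous_on UNIV \<Phi> \<and> convex_on UNIV \<Phi> \<and> (\<forall>x. \<Phi> (- x) = \<Phi> x) \<and>
     ((\<lambda>x. \<Phi> x / x) \<longlongrightarrow> 0) (at 0) \<and> filterlim (\<lambda>x. \<Phi> x / x) at_top at_top"

text \<open>
  A function on the half-line \<open>t \<ge> 0\<close> is a total function \<open>real \<Rightarrow> real\<close> of which only the values at
  \<open>t \<ge> 0\<close> are ever used.
\<close>

definition quasiconvex_young :: "(real \<Rightarrow> real) set" where
  "quasiconvex_young =
     {M. (\<forall>x\<ge>0. 0 \<le> M x) \<and>
         (\<exists>\<Phi> c. young_function \<Phi> \<and> 1 < c \<and> (\<forall>x\<ge>0. \<Phi> x \<le> M x \<and> M x \<le> \<Phi> (c * x)))}"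

definition delta2 :: "(real \<Rightarrow> real) \<Rightarrow> bool" where
  "delta2 M \<longleftrightarrow> (\<exists>c>0. \<forall>x\<ge>0. M (2 * x) \<le> c * M x)"

definition quasiconvex_young_theta2 :: "(real \<Rightarrow> real) set" where
  "quasiconvex_young_theta2 =
     {M \<in> quasiconvex_young. delta2 M \<and>
        (\<exists>\<theta>. 0 < \<theta> \<and> \<theta> < 1 \<and> (\<lambda>x. M x powr \<theta>) \<in> quasiconvex_young)}"

definition young_index :: "(real \<Rightarrow> real) \<Rightarrow> real" where
  "young_index M = 1 / Inf {p. 0 < p \<and> (\<lambda>x. M x powr p) \<in> quasiconvex_young}"

text \<open>
  The supremum is finite for every quasiconvex Young function, because \<open>M x / x\<close> tends to infinity.
\<close>

definition complementary :: "(real \<Rightarrow> real) \<Rightarrow> real \<Rightarrow> real" where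
  "complementary M y = (SUP x\<in>{0..}. x * y - M x)"

definition periodic_measurable :: "(real \<Rightarrow> real) set" where
  "periodic_measurable = {f \<in> borel_measurable lebesgue. \<forall>x. f (x + 2 * pi) = f x}"

definition weight :: "(real \<Rightarrow> real) \<Rightarrow> bool" where
  "weight \<omega> \<longleftrightarrow> \<omega> \<in> periodic_measurable \<and> (AE x in lebesgue. 0 < \<omega> x)"

text \<open>
  Both factors in the Muckenhoupt condition are positive, so boundedness of the product
  includes finiteness of both integrals; with the real-valued integral (which is \<open>0\<close> for
  non-integrable functions) this has to be required separately.
\<close>

definition muckenhoupt :: "real \<Rightarrow> (real \<Rightarrow> real) set" where
  "muckenhoupt p =
     {\<omega>. weight \<omega> \<and>
        (\<exists>c. \<forall>a b. 0 < b - a \<and> b - a \<le> 2 * pi \<longrightarrow>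
           set_integrable lebesgue {a..b} \<omega> \<and>
           set_integrable lebesgue {a..b} (\<lambda>t. \<omega> t powr (- 1 / (p - 1))) \<and>
           (1 / (b - a) * (LINT t:{a..b}|lebesgue. \<omega> t)) *
           (1 / (b - a) * (LINT t:{a..b}|lebesgue. \<omega> t powr (- 1 / (p - 1)))) powr (p - 1) \<le> c)}"

definition L_per :: "(real \<Rightarrow> real) set" where
  "L_per = {f \<in> periodic_measurable. set_integrable lebesgue {0..2 * pi} f}"

text \<open>
  \<open>M\<close> is not assumed measurable. In that case \<open>nn_integral\<close> is the lower integral; as \<open>M\<close> lies
  between two dilations of a convex function, the linear span of the class is not affected.
\<close>

definition orlicz_class :: "(real \<Rightarrow> real) \<Rightarrow> (real \<Rightarrow> real) \<Rightarrow> (real \<Rightarrow> real) set" where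
  "orlicz_class M \<omega> =
     {f \<in> periodic_measurable. (\<integral>\<^sup>+x\<in>{0..2 * pi}. ennreal (M \<bar>f x\<bar> * \<omega> x) \<partial>lebesgue) < \<infinity>}"

definition orlicz_space :: "(real \<Rightarrow> real) \<Rightarrow> (real \<Rightarrow> real) \<Rightarrow> (real \<Rightarrow> real) set" where
  "orlicz_space M \<omega> =
     {f. \<exists>(m::nat) c u. (\<forall>i<m. u i \<in> orlicz_class M \<omega>) \<and> f = (\<lambda>x. \<Sum>i<m. c i * u i x)}"

text \<open>
  The norm and all quantities built from it take values in \<open>[0, \<infinity>]\<close>, so that suprema
  and series of them are always meaningful.
\<close>

definition orlicz_norm :: "(real \<Rightarrow> real) \<Rightarrow> (real \<Rightarrow> real) \<Rightarrow> (real \<Rightarrow> real) \<Rightarrow> ennreal" where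
  "orlicz_norm M \<omega> f =
     (SUP g \<in> {g \<in> periodic_measurable.
                 (\<integral>\<^sup>+t\<in>{0..2 * pi}. ennreal (complementary M \<bar>g t\<bar> * \<omega> t) \<partial>lebesgue) \<le> 1}.
        \<integral>\<^sup>+t\<in>{0..2 * pi}. ennreal (\<bar>f t * g t\<bar> * \<omega> t) \<partial>lebesgue)"

definition trig_polys :: "nat \<Rightarrow> (real \<Rightarrow> real) set" where
  "trig_polys m = {\<lambda>x. \<Sum>k\<le>m. a k * cos (real k * x) + b k * sin (real k * x) | a b. True}"

text \<open>
  Meaningful for \<open>n \<ge> 1\<close>; the value at \<open>n = 0\<close> only ever occurs multiplied by \<open>0\<close>.
\<close>

definition best_approx ::
  "(real \<Rightarrow> real) \<Rightarrow> (real \<Rightarrow> real) \<Rightarrow> (real \<Rightarrow> real) \<Rightarrow> nat \<Rightarrow> ennreal" where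
  "best_approx M \<omega> \<phi> n = (INF t \<in> trig_polys (n - 1). orlicz_norm M \<omega> (\<lambda>x. \<phi> x - t x))"

definition steklov :: "real \<Rightarrow> (real \<Rightarrow> real) \<Rightarrow> real \<Rightarrow> real" where
  "steklov h g x = 1 / (2 * h) * (LINT t:{-h..h}|lebesgue. g (x + t))"

text \<open>\<open>steklov_diff h r g\<close> is the product of the operators \<open>I - steklov (h i)\<close>, \<open>i < r\<close>, applied to \<open>g\<close>.\<close>

primrec steklov_diff :: "(nat \<Rightarrow> real) \<Rightarrow> nat \<Rightarrow> (real \<Rightarrow> real) \<Rightarrow> real \<Rightarrow> real" where
  "steklov_diff h 0 g = g"
| "steklov_diff h (Suc r) g = (\<lambda>x. steklov_diff h r g x - steklov (h r) (steklov_diff h r g) x)"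

definition modulus ::
  "(real \<Rightarrow> real) \<Rightarrow> (real \<Rightarrow> real) \<Rightarrow> nat \<Rightarrow> (real \<Rightarrow> real) \<Rightarrow> real \<Rightarrow> ennreal" where
  "modulus M \<omega> r g \<delta> =
     (SUP h \<in> {h. \<forall>i<r. 0 < h i \<and> h i < \<delta>}. orlicz_norm M \<omega> (steklov_diff h r g))"

text \<open>
  An element of \<open>psi_class\<close> is the continuous extension \<open>\<psi>(t)\<close>, \<open>t \<ge> 1\<close>, of the sequence \<open>\<psi>(k)\<close>.
\<close>

definition psi_class :: "(real \<Rightarrow> real) set" where
  "psi_class =
     {\<psi>. (\<forall>k::nat. 1 \<le> k \<longrightarrow>
            0 < \<psi> (real k) \<and>
            0 \<le> \<psi> (real k) - \<psi> (real (k + 1)) \<and>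
            0 < \<psi> (real (k + 2)) - 2 * \<psi> (real (k + 1)) + \<psi> (real k)) \<and>
         (\<lambda>k::nat. \<psi> (real k)) \<longlonglongrightarrow> 0 \<and>
         continuous_on {1..} \<psi> \<and> strict_antimono_on {1..} \<psi> \<and> (\<psi> \<longlongrightarrow> 0) at_top}"

definition eta :: "(real \<Rightarrow> real) \<Rightarrow> real \<Rightarrow> real" where
  "eta \<psi> t = inv_into {1..} \<psi> (\<psi> t / 2)"

definition psi_class0 :: "(real \<Rightarrow> real) set" where
  "psi_class0 =
     {\<psi> \<in> psi_class. \<exists>K. \<forall>t\<ge>1. 0 < t / (eta \<psi> t - t) \<and> t / (eta \<psi> t - t) \<le> K}"

text \<open>\<open>eta \<psi>\<close> lives on \<open>t \<ge> 1\<close>, hence its derivative is the one within \<open>{1..}\<close>, one-sided at \<open>1\<close>.\<close>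

definition psi_classF :: "(real \<Rightarrow> real) set" where
  "psi_classF =
     {\<psi> \<in> psi_class. \<exists>K. \<forall>t\<ge>1. \<exists>D. (eta \<psi> has_real_derivative D) (at t within {1..}) \<and> D \<le> K}"

text \<open>The convention \<open>1 / \<psi>(0) = 0\<close>.\<close>

definition recip :: "(real \<Rightarrow> real) \<Rightarrow> nat \<Rightarrow> real" where
  "recip \<psi> \<nu> = (if \<nu> = 0 then 0 else 1 / \<psi> (real \<nu>))"

definition fourier_a :: "(real \<Rightarrow> real) \<Rightarrow> nat \<Rightarrow> real" where
  "fourier_a f k = 1 / pi * (LINT x:{0..2 * pi}|lebesgue. f x * cos (real k * x))"

definition fourier_b :: "(real \<Rightarrow> real) \<Rightarrow> nat \<Rightarrow> real" where
  "fourier_b f k = 1 / pi * (LINT x:{0..2 * pi}|lebesgue. f x * sin (real k * x))"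

text \<open>
  \<open>g\<close> is a \<open>(\<psi>;\<beta>)\<close>-derivative of \<open>f\<close>: the Fourier series of \<open>g\<close> coincides, harmonic by harmonic,
  with the defining trigonometric series, which has no constant term.
\<close>

definition is_psi_beta_derivative ::
  "(real \<Rightarrow> real) \<Rightarrow> real \<Rightarrow> (real \<Rightarrow> real) \<Rightarrow> (real \<Rightarrow> real) \<Rightarrow> bool" where
  "is_psi_beta_derivative \<psi> \<beta> f g \<longleftrightarrow>
     f \<in> L_per \<and> g \<in> L_per \<and> fourier_a g 0 = 0 \<and>
     (\<forall>k\<ge>1. \<forall>x. fourier_a g k * cos (real k * x) + fourier_b g k * sin (real k * x) =
        1 / \<psi> (real k) *
          (fourier_a f k * cos (real k * x + \<beta> * pi / 2) +
           fourier_b f k * sin (real k * x + \<beta> * pi / 2)))"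

end

theory Submission
  imports Defs
begin

text \<open>
  Up to the rotation of phases by \<open>\<beta> * pi / 2\<close>, the \<open>(\<psi>;\<beta>)\<close>-derivative is the Fourier multiplier
  \<open>u k = 1 / \<psi> k\<close>. It is built as a series of blocks: a piecewise linear partition of unity on the
  frequencies, with peaks at nodes \<open>\<nu> 0 < \<nu> 1 < \<dots>\<close>, splits \<open>u\<close> into pieces \<open>u * hat i\<close>, and block \<open>i\<close>
  is the piece \<open>i\<close> applied to \<open>f\<close>. The nodes are the powers of \<open>2\<close> for \<open>psi_class0\<close> and the iterates
  of \<open>\<lceil>eta\<rceil>\<close> for \<open>psi_classF\<close>; in both cases \<open>\<psi>\<close>, the nodes and the gaps between them change by
  bounded factors from one index to the next (\<open>block_scale_dyadic\<close>, \<open>block_scale_eta\<close>).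

  Two facts about a block give the estimate. The hat with index \<open>i\<close> vanishes at all frequencies below
  \<open>\<nu> (i - 1)\<close>, so a polynomial of order less than \<open>\<nu> (i - 1)\<close> may be subtracted from \<open>f\<close>: the norm of
  the block is at most a constant times \<open>u (\<nu> (i + 1))\<close> times the best approximation of order
  \<open>\<nu> (i - 1)\<close> (\<open>block_norm\<close>). And the block is itself a polynomial, of order at most \<open>\<nu> (i + 1)\<close>, on
  which each factor \<open>I - steklov h\<close> gains \<open>(h * \<nu> (i + 1))\<^sup>2\<close> (\<open>steklov_diff_poly_approx\<close>). For the modulus
  at \<open>1 / n\<close> this gain is used for the blocks with nodes up to about \<open>n\<close>, and the mere boundedness of
  the Steklov means (\<open>steklov_diff_bounded\<close>) for the others. Charging the blocks to indices in
  neighbouring gaps turns the two parts into the two sums of the theorem (\<open>deriv_sum_modulus\<close>).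

  All norm estimates rest on a single family of operators, the window means: the period is cut into
  \<open>N\<close> cells, and \<open>\<bar>f\<bar>\<close> is averaged over each cell together with its two neighbours. A kernel bounded
  by \<open>B * W\<close> and by \<open>B / (W * t\<^sup>2)\<close> is dominated by window means with \<open>3 * 2 ^ i\<close> cells and
  weights in geometric progression. Hence a multiplier is bounded by a constant times \<open>B\<close> as soon as
  its absolute sum is at most \<open>B * W\<close> and the absolute sum of its second differences at most \<open>B / W\<close>
  (\<open>multiplier_bound\<close>).

  Window means are bounded on the weighted space because \<open>M\<close> is comparable to \<open>\<Psi> powr q\<close> with a convex
  \<open>\<Psi>\<close> and \<open>\<omega>\<close> in \<open>muckenhoupt q\<close>: on a single interval this is Jensen's inequality for \<open>\<Psi>\<close> followed
  by Hoelder's inequality (\<open>weighted_jensen\<close>). Such a \<open>\<Psi>\<close> exists for every \<open>q\<close> below \<open>young_index M\<close>,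
  while the weight is given in the class of \<open>young_index M\<close> itself. The difference is bridged by the
  openness of the Muckenhoupt condition (\<open>muckenhoupt_open\<close>), which follows from a reverse Hoelder
  inequality proved with an explicit Bellman function.
\<close>

section \<open>Openness of the Muckenhoupt condition\<close>

lemma two_point_power_upper:
  fixes d x :: real
  assumes d: "0 < d" "d \<le> 1" and x: "\<bar>x\<bar> < 1"
  shows "(1 + x) powr (1 + d) + (1 - x) powr (1 + d) \<le> 2 + 2 * d * x\<^sup>2"
proof -
  have bern: "(1 + y) powr d \<le> 1 + d * y" if "\<bar>y\<bar> < 1" for y
    using Youngs_inequality_0[of d "1 - d" "1 + y" 1] d that by (simp add: algebra_simps)
  have "(1 + y) powr (1 + d) \<le> 1 + (1 + d) * y + d * y\<^sup>2" if "\<bar>y\<bar> < 1" for y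
  proof -
    have "(1 + y) powr (1 + d) = (1 + y) * (1 + y) powr d" using that by (simp add: powr_add)
    also have "\<dots> \<le> (1 + y) * (1 + d * y)" using bern[OF that] that by (intro mult_left_mono) auto
    finally show ?thesis by (simp add: algebra_simps power2_eq_square)
  qed
  from this[of x] this[of "- x"] x show ?thesis by (simp add: algebra_simps)
qed

text \<open>
  By the inequality of the arithmetic and geometric means it suffices to look at the product of the
  two summands, in which only \<open>1 - x\<^sup>2\<close> and \<open>1 - y\<^sup>2\<close> are left.
\<close>

lemma two_point_power_lower:
  fixes a L x y :: real
  assumes "a \<le> - 2" "0 \<le> L" and x: "\<bar>x\<bar> < 1" and y: "\<bar>y\<bar> < 1"
  shows "2 + 2 * x\<^sup>2 \<le> (1 + x) powr a * (1 + y) powr (- L) + (1 - x) powr a * (1 - y) powr (- L)"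
proof -
  define u where "u = (1 + x) powr a * (1 + y) powr (- L)"
  define v where "v = (1 - x) powr a * (1 - y) powr (- L)"
  have x2: "x\<^sup>2 < 1" "y\<^sup>2 < 1" using x y by (simp_all add: abs_square_less_1)
  have "u * v = ((1 + x) * (1 - x)) powr a * ((1 + y) * (1 - y)) powr (- L)"
    using x y unfolding u_def v_def by (simp add: powr_mult)
  also have "\<dots> = (1 - x\<^sup>2) powr a * (1 - y\<^sup>2) powr (- L)"
    by (simp add: algebra_simps power2_eq_square)
  also have "\<dots> \<ge> (1 - x\<^sup>2) powr (- 2) * 1"
  proof (rule mult_mono)
    show "(1 - x\<^sup>2) powr (- 2) \<le> (1 - x\<^sup>2) powr a"
      using assms x2 by (intro powr_mono') auto
    have "(1 - y\<^sup>2) powr 0 \<le> (1 - y\<^sup>2) powr (- L)"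
      using assms x2 by (intro powr_mono') auto
    then show "1 \<le> (1 - y\<^sup>2) powr (- L)" using x2 by simp
  qed auto
  also have "(1 - x\<^sup>2) powr (- 2) * 1 = (1 / (1 - x\<^sup>2))\<^sup>2"
    using x2 by (simp add: powr_minus powr_numeral power_one_over field_simps)
  finally have uv: "(1 / (1 - x\<^sup>2))\<^sup>2 \<le> u * v" .
  have "1 + x\<^sup>2 \<le> 1 / (1 - x\<^sup>2)"
    using x2 by (simp add: field_simps)
  then have "(1 + x\<^sup>2)\<^sup>2 \<le> (1 / (1 - x\<^sup>2))\<^sup>2" by (intro power_mono) auto
  with uv have "(1 + x\<^sup>2)\<^sup>2 \<le> u * v" by linarith
  moreover have "4 * (u * v) \<le> (u + v)\<^sup>2" 
    using zero_le_power2[of "u - v"] by (simp add: power2_eq_square algebra_simps)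
  ultimately have "(2 + 2 * x\<^sup>2)\<^sup>2 \<le> (u + v)\<^sup>2"
    by (simp add: power2_eq_square algebra_simps)
  moreover have "0 \<le> u + v" unfolding u_def v_def by simp
  ultimately show ?thesis unfolding u_def v_def by (rule power2_le_imp_le)
qed

text \<open>
  \<open>B\<close> is the Bellman function of the reverse Hoelder inequality: \<open>s\<close> and \<open>o'\<close> stand for the averages
  of the dual weight and of the weight over an interval, and \<open>o' * s powr e\<close> is then the Muckenhoupt
  product. Passing to the two halves of an interval must not increase the average of \<open>B\<close>. The convex
  factor \<open>s powr (1 + d)\<close> violates this by at most \<open>2 * d * x\<^sup>2\<close> times its value, \<open>x\<close> being the relative
  deviation; the subtracted term restores it, provided that its relative size is at least \<open>2 * d\<close>, which is
  the assumption \<open>lev\<close>.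
\<close>

lemma bellman_midpoint:
  fixes d e L s1 s2 o1 o2 :: real
  defines "B \<equiv> \<lambda>s o'. s powr (1 + d) * (2 - (o' * s powr e) powr (- L))"
  assumes d: "0 < d" "d \<le> 1" and L: "0 \<le> L" "L * e \<ge> 3 + d"
    and pos: "0 < s1" "0 < s2" "0 < o1" "0 < o2"
    and lev: "2 * d \<le> ((o1 + o2) / 2 * ((s1 + s2) / 2) powr e) powr (- L)"
  shows "B s1 o1 + B s2 o2 \<le> 2 * B ((s1 + s2) / 2) ((o1 + o2) / 2)"
proof -
  define s where "s = (s1 + s2) / 2"
  define w where "w = (o1 + o2) / 2"
  define x where "x = (s1 - s2) / (s1 + s2)"
  define y where "y = (o1 - o2) / (o1 + o2)"
  define a where "a = 1 + d - L * e"
  have sw: "0 < s" "0 < w" using pos by (auto simp: s_def w_def)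
  have x: "\<bar>x\<bar> < 1" and y: "\<bar>y\<bar> < 1" using pos by (auto simp: x_def y_def abs_if field_simps)
  have s12: "s1 = s * (1 + x)" "s2 = s * (1 - x)"
    using pos by (auto simp: s_def x_def field_simps)
  have o12: "o1 = w * (1 + y)" "o2 = w * (1 - y)"
    using pos by (auto simp: w_def y_def field_simps)
  have Bq: "B q o' = 2 * q powr (1 + d) - q powr a * o' powr (- L)" if "0 < q" "0 < o'" for q o'
  proof -
    have "q powr (1 + d) * (o' * q powr e) powr (- L) = q powr (1 + d) * q powr (e * (- L)) * o' powr (- L)"
      using that by (simp add: powr_mult powr_powr)
    also have "\<dots> = q powr a * o' powr (- L)"
      by (simp add: a_def algebra_simps flip: powr_add)
    finally show ?thesis unfolding B_def by (simp add: algebra_simps)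
  qed
  define U where "U = s powr (1 + d)"
  define V where "V = s powr a * w powr (- L)"
  have UV: "2 * d * U \<le> V"
  proof -
    have "V = U * (w * s powr e) powr (- L)"
      using Bq[OF sw] unfolding B_def U_def V_def by (simp add: algebra_simps)
    moreover have "2 * d \<le> (w * s powr e) powr (- L)" using lev by (simp add: s_def w_def)
    moreover have "0 \<le> U" by (simp add: U_def)
    ultimately show ?thesis by (metis mult.commute mult_left_mono)
  qed
  have "B s1 o1 + B s2 o2 = 2 * U * ((1 + x) powr (1 + d) + (1 - x) powr (1 + d))
      - V * ((1 + x) powr a * (1 + y) powr (- L) + (1 - x) powr a * (1 - y) powr (- L))"
  proof -
    have "s1 powr r = s powr r * (1 + x) powr r" "s2 powr r = s powr r * (1 - x) powr r"
         "o1 powr r = w powr r * (1 + y) powr r" "o2 powr r = w powr r * (1 - y) powr r" for r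
      unfolding s12 o12 using x y sw by (simp_all only: powr_mult)
    then show ?thesis unfolding Bq[OF pos(1,3)] Bq[OF pos(2,4)] U_def V_def
      by (simp only: algebra_simps)
  qed
  also have "\<dots> \<le> 2 * U * (2 + 2 * d * x\<^sup>2) - V * (2 + 2 * x\<^sup>2)"
    by (intro diff_mono mult_left_mono two_point_power_upper two_point_power_lower d x y L)
       (use L in \<open>auto simp: U_def V_def a_def\<close>)
  also have "\<dots> = 2 * (2 * U - V) + 2 * x\<^sup>2 * (2 * d * U - V)" by (simp add: algebra_simps)
  also have "\<dots> \<le> 2 * (2 * U - V) + 0"
    using UV by (intro add_left_mono mult_nonneg_nonpos) auto
  also have "\<dots> = 2 * B ((s1 + s2) / 2) ((o1 + o2) / 2)"
    using Bq[OF sw] by (simp add: s_def w_def U_def V_def)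
  finally show ?thesis .
qed

text \<open>
  Left end point of the cell containing \<open>x\<close> after \<open>{a..b}\<close> has been halved \<open>n\<close> times. Composing a
  function with it freezes the function on these cells.
\<close>

primrec dyadic_left :: "nat \<Rightarrow> real \<Rightarrow> real \<Rightarrow> real \<Rightarrow> real" where
  "dyadic_left 0 a b x = a"
| "dyadic_left (Suc n) a b x =
     (if x < (a + b) / 2 then dyadic_left n a ((a + b) / 2) x else dyadic_left n ((a + b) / 2) b x)"

lemma dyadic_left_bounds:
  assumes "a \<le> x" "x \<le> b"
  shows "a \<le> dyadic_left n a b x" "dyadic_left n a b x \<le> x" "x - dyadic_left n a b x \<le> (b - a) / 2 ^ n"
  using assms
proof (induction n arbitrary: a b)
  case (Suc n)
  { case 1 then show ?case using Suc.IH(1)[of a "(a+b)/2"] Suc.IH(1)[of "(a+b)/2" b] by auto }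
  { case 2 then show ?case using Suc.IH(2)[of a "(a+b)/2"] Suc.IH(2)[of "(a+b)/2" b] by auto }
  { case 3 then show ?case using Suc.IH(3)[of a "(a+b)/2"] Suc.IH(3)[of "(a+b)/2" b]
      by (auto simp: field_simps) }
qed auto

lemma dyadic_left_measurable [measurable]: "dyadic_left n a b \<in> borel_measurable borel"
proof (induction n arbitrary: a b)
  case 0
  have "dyadic_left 0 a b = (\<lambda>x. a)" by auto
  then show ?case by simp
next
  case (Suc n)
  note Suc.IH[measurable]
  have "dyadic_left (Suc n) a b = (\<lambda>x. if x < (a + b) / 2 then dyadic_left n a ((a + b) / 2) x
      else dyadic_left n ((a + b) / 2) b x)" by auto
  then show ?case by simp
qed

lemma set_integrable_mono_interval:
  fixes f :: "real \<Rightarrow> real"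
  assumes "set_integrable lebesgue {a..b} f" "{c..d} \<subseteq> {a..b}"
  shows "set_integrable lebesgue {c..d} f"
  using assms by (meson set_integrable_subset lmeasurable_cbox fmeasurableD lmeasurable_interval)

lemma set_integral_split:
  fixes f :: "real \<Rightarrow> real"
  assumes "set_integrable lebesgue {a..b} f" "a \<le> m" "m \<le> b"
  shows "(LINT x:{a..b}|lebesgue. f x) = (LINT x:{a..m}|lebesgue. f x) + (LINT x:{m..b}|lebesgue. f x)"
proof -
  have i: "set_integrable lebesgue {a..m} f" "set_integrable lebesgue {m..b} f"
    using assms by (auto intro: set_integrable_mono_interval)
  show ?thesis
    using Henstock_Kurzweil_Integration.integral_combine[OF assms(2,3) set_lebesgue_integral_eq_integral(1)[OF assms(1)]]
    using set_lebesgue_integral_eq_integral(2)[OF assms(1)]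
      set_lebesgue_integral_eq_integral(2)[OF i(1)] set_lebesgue_integral_eq_integral(2)[OF i(2)] by simp
qed

lemma set_integrable_join:
  fixes f :: "real \<Rightarrow> real"
  assumes "set_integrable lebesgue {a..m} f" "set_integrable lebesgue {m..b} f" "a \<le> m" "m \<le> b"
  shows "set_integrable lebesgue {a..b} f"
proof -
  have "{a..b} = {a..m} \<union> {m..b}" using assms by auto
  with assms show ?thesis by (simp add: set_integrable_Un)
qed



lemma borel_imp_lebesgue_measurable: "f \<in> borel_measurable borel \<Longrightarrow> f \<in> borel_measurable lebesgue"
  by (intro measurable_completion) simp

lemma ident_lebesgue_measurable [measurable]: "(\<lambda>x. x) \<in> borel_measurable lebesgue"
  by (rule borel_imp_lebesgue_measurable) simp

lemma AE_lebesgue_neq: "AE x in lebesgue. x \<noteq> (m::real)"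
  by (metis AE_completion AE_lborel_singleton)

text \<open>
  The tangent of the convex function \<open>s powr (1 + d)\<close> at \<open>h\<close>. It is linear in \<open>s\<close>, so that its
  averages over an interval only involve averages of \<open>s\<close>, and equality holds for \<open>h = s\<close>.
\<close>

lemma tangent_power_le:
  fixes d h s :: real
  assumes "0 < d" "0 \<le> h" "0 \<le> s"
  shows "(1 + d) * h powr d * s - d * h powr (1 + d) \<le> s powr (1 + d)"
proof -
  have "s * h powr d \<le> s powr (1 + d) / (1 + d) + (h powr d) powr ((1 + d) / d) / ((1 + d) / d)"
    using assms by (intro Youngs_inequality) (auto simp: field_simps)
  also have "(h powr d) powr ((1 + d) / d) = h powr (1 + d)" using assms by (simp add: powr_powr)
  finally have "(1 + d) * (s * h powr d)
      \<le> (1 + d) * (s powr (1 + d) / (1 + d) + h powr (1 + d) / ((1 + d) / d))"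
    using assms by (intro mult_left_mono) auto
  also have "\<dots> = s powr (1 + d) + d * h powr (1 + d)" using assms by (simp add: distrib_left)
  finally show ?thesis by (simp add: algebra_simps)
qed

lemma set_integrable_const_Icc: "set_integrable lebesgue {a..b} (\<lambda>x. c)" for a b c :: real
proof -
  have "integrable lebesgue (indicator {a..b} :: real \<Rightarrow> real)"
    by (rule integrable_real_indicator) (auto simp: emeasure_lborel_Icc_eq)
  then show ?thesis by (simp add: set_integrable_def)
qed

text \<open>
  On a single cell the integrand is a fixed tangent at \<open>\<sigma>\<close>, and its average is at most
  \<open>S powr (1 + d)\<close>, which the Bellman function dominates because the Muckenhoupt product is at least
  \<open>1\<close>. The halves of an interval are put together with \<open>bellman_midpoint\<close>. The bound does not depend
  on the number \<open>n\<close> of halvings.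
\<close>

lemma dyadic_step_estimate:
  fixes \<sigma> \<omega> h :: "real \<Rightarrow> real" and A B d e Q L :: real
  defines "S \<equiv> \<lambda>a b. (LINT x:{a..b}|lebesgue. \<sigma> x) / (b - a)"
    and "T \<equiv> \<lambda>a b. (LINT x:{a..b}|lebesgue. \<omega> x) / (b - a)"
  assumes int: "set_integrable lebesgue {A..B} \<sigma>" "set_integrable lebesgue {A..B} \<omega>"
    and meas [measurable]: "\<sigma> \<in> borel_measurable lebesgue"
    and pos: "\<And>a b. A \<le> a \<Longrightarrow> a < b \<Longrightarrow> b \<le> B \<Longrightarrow> 0 < S a b \<and> 0 < T a b"
    and bal: "\<And>a b. A \<le> a \<Longrightarrow> a < b \<Longrightarrow> b \<le> B \<Longrightarrow> 1 \<le> T a b * S a b powr e \<and> T a b * S a b powr e \<le> Q"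
    and d: "0 < d" "d \<le> 1" and L: "0 \<le> L" "L * e \<ge> 3 + d" and dL: "2 * d \<le> Q powr (- L)"
    and h [measurable]: "h \<in> borel_measurable borel" and h0: "\<And>x. 0 \<le> h x"
    and ab: "A \<le> a" "a < b" "b \<le> B"
  shows "set_integrable lebesgue {a..b} (\<lambda>x. (1 + d) * h (dyadic_left n a b x) powr d * \<sigma> x
            - d * h (dyadic_left n a b x) powr (1 + d)) \<and>
    (LINT x:{a..b}|lebesgue. (1 + d) * h (dyadic_left n a b x) powr d * \<sigma> x
            - d * h (dyadic_left n a b x) powr (1 + d))
      \<le> (b - a) * (S a b powr (1 + d) * (2 - (T a b * S a b powr e) powr (- L)))"
  using ab
proof (induction n arbitrary: a b)
  case 0
  have i: "set_integrable lebesgue {a..b} \<sigma>"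
    using int(1) 0 by (auto intro: set_integrable_mono_interval)
  have c: "set_integrable lebesgue {a..b} (\<lambda>x. c)" for c :: real
    by (rule set_integrable_const_Icc)
  have S: "(LINT x:{a..b}|lebesgue. \<sigma> x) = (b - a) * S a b" using 0 by (simp add: S_def)
  have "(LINT x:{a..b}|lebesgue. (1 + d) * h a powr d * \<sigma> x - d * h a powr (1 + d))
      = (b - a) * ((1 + d) * h a powr d * S a b - d * h a powr (1 + d))"
  proof -
    have "(LINT x:{a..b}|lebesgue. p * \<sigma> x - q) = (b - a) * (p * S a b - q)" for p q
    proof -
      have q: "(LINT x:{a..b}|lebesgue. q) = (b - a) * q"
        using 0 by (simp add: set_lebesgue_integral_def)
      show ?thesis
        using i c[of q] by (subst set_integral_diff) (auto simp: q S algebra_simps)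
    qed
    then show ?thesis by simp
  qed
  also have "\<dots> \<le> (b - a) * (S a b powr (1 + d) * 1)"
    using tangent_power_le[OF d(1) h0[of a], of "S a b"] pos[of a b] 0 by (intro mult_left_mono) auto
  also have "\<dots> \<le> (b - a) * (S a b powr (1 + d) * (2 - (T a b * S a b powr e) powr (- L)))"
  proof (intro mult_left_mono)
    have "(T a b * S a b powr e) powr (- L) \<le> 1"
      using ge_one_powr_ge_zero[of "T a b * S a b powr e" L] bal[of a b] 0 L
      by (simp add: powr_minus inverse_le_1_iff)
    then show "1 \<le> 2 - (T a b * S a b powr e) powr (- L)" by simp
  qed (use 0 in auto)
  finally show ?case using i c by (auto intro!: set_integral_diff)
next
  case (Suc n)
  define m where "m = (a + b) / 2"
  have m: "A \<le> a" "a < m" "m < b" "m \<le> B" "A \<le> m" "b \<le> B" "m - a = (b - a) / 2" "b - m = (b - a) / 2"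
    using Suc.prems by (auto simp: m_def field_simps)
  define G where "G = (\<lambda>y x. (1 + d) * h y powr d * \<sigma> x - d * h y powr (1 + d))"
  have [measurable]: "dyadic_left k p q \<in> borel_measurable lebesgue" for k p q
    using dyadic_left_measurable by (rule borel_imp_lebesgue_measurable)
  have hm [measurable]: "(\<lambda>x. h (dyadic_left k p q x)) \<in> borel_measurable lebesgue" for k p q
    by (rule measurable_compose[OF _ h]) simp
  have Gm [measurable]: "(\<lambda>x. G (dyadic_left k p q x) x) \<in> borel_measurable lebesgue" for k p q
    unfolding G_def by measurable
  have L1: "set_integrable lebesgue {a..m} (\<lambda>x. G (dyadic_left n a m x) x)"
    and L2: "(LINT x:{a..m}|lebesgue. G (dyadic_left n a m x) x)
        \<le> (m - a) * (S a m powr (1 + d) * (2 - (T a m * S a m powr e) powr (- L)))"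
    using Suc.IH[of a m] m(1-6) unfolding G_def by auto
  have R1: "set_integrable lebesgue {m..b} (\<lambda>x. G (dyadic_left n m b x) x)"
    and R2: "(LINT x:{m..b}|lebesgue. G (dyadic_left n m b x) x)
        \<le> (b - m) * (S m b powr (1 + d) * (2 - (T m b * S m b powr e) powr (- L)))"
    using Suc.IH[of m b] m(1-6) unfolding G_def by auto
  let ?F = "\<lambda>x. G (dyadic_left (Suc n) a b x) x"
  have EL: "AE x\<in>{a..m} in lebesgue. ?F x = G (dyadic_left n a m x) x"
    using AE_lebesgue_neq[of m] by eventually_elim (auto simp: m_def)
  have ER: "x \<in> {m..b} \<Longrightarrow> ?F x = G (dyadic_left n m b x) x" for x by (auto simp: m_def)
  have l1: "set_integrable lebesgue {a..m} ?F"
    by (rule set_integrable_cong_AE[THEN iffD2, OF Gm Gm EL _ L1]) simp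
  have r1: "set_integrable lebesgue {m..b} ?F"
    using R1 ER by (subst set_integrable_cong[OF refl refl ER]) auto
  have l2: "(LINT x:{a..m}|lebesgue. ?F x) = (LINT x:{a..m}|lebesgue. G (dyadic_left n a m x) x)"
    by (rule set_lebesgue_integral_cong_AE[OF _ Gm Gm EL]) simp
  have r2: "(LINT x:{m..b}|lebesgue. ?F x) = (LINT x:{m..b}|lebesgue. G (dyadic_left n m b x) x)"
    by (rule set_lebesgue_integral_cong) (use ER in auto)
  have j: "set_integrable lebesgue {a..b} ?F" using set_integrable_join[OF l1 r1] m by auto
  have halves: "(u / (D / 2) + v / (D / 2)) / 2 = (u + v) / D" for u D v :: real
    by (cases "D = 0") (simp_all add: field_simps)
  have sp: "(S a m + S m b) / 2 = S a b" "(T a m + T m b) / 2 = T a b"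
    unfolding S_def T_def m(7,8) halves
    using set_integral_split[of a b \<sigma> m] set_integral_split[of a b \<omega> m] m(1-6)
      set_integrable_mono_interval[OF int(1), of a b] set_integrable_mono_interval[OF int(2), of a b]
    by simp_all
  have lev: "2 * d \<le> (T a b * S a b powr e) powr (- L)"
  proof -
    have "Q powr (- L) \<le> (T a b * S a b powr e) powr (- L)"
      using bal[of a b] Suc.prems L by (intro powr_mono2') auto
    then show ?thesis using dL by linarith
  qed
  have "(LINT x:{a..b}|lebesgue. ?F x) = (LINT x:{a..m}|lebesgue. G (dyadic_left n a m x) x)
      + (LINT x:{m..b}|lebesgue. G (dyadic_left n m b x) x)"
    by (simp only: set_integral_split[OF j less_imp_le[OF m(2)] less_imp_le[OF m(3)]] l2 r2)
  also have "\<dots> \<le> (b - a) / 2 * (S a m powr (1 + d) * (2 - (T a m * S a m powr e) powr (- L))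
       + S m b powr (1 + d) * (2 - (T m b * S m b powr e) powr (- L)))"
    using add_mono[OF L2 R2] unfolding m(7,8) by (simp only: distrib_left)
  also have "\<dots> \<le> (b - a) / 2 * (2 * (S a b powr (1 + d) * (2 - (T a b * S a b powr e) powr (- L))))"
    using bellman_midpoint[OF d L, of "S a m" "S m b" "T a m" "T m b"] pos[of a m] pos[of m b] m lev
    unfolding sp by (intro mult_left_mono) auto
  finally show ?case using j unfolding G_def by simp
qed

text \<open>
  If \<open>h\<close> could be chosen equal to \<open>\<sigma>\<close>, the tangent in \<open>dyadic_step_estimate\<close> would be
  \<open>\<sigma> powr (1 + d)\<close>. The estimate passes to this case in three limits: to bounded continuous \<open>h\<close> as
  the cells shrink, to \<open>min \<sigma> k\<close> as an almost everywhere limit of such functions, and to \<open>\<sigma>\<close> as \<open>k\<close>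
  tends to infinity.
\<close>

lemma reverse_holder:
  fixes \<sigma> \<omega> :: "real \<Rightarrow> real" and A B d e Q L :: real
  defines "S \<equiv> \<lambda>a b. (LINT x:{a..b}|lebesgue. \<sigma> x) / (b - a)"
    and "T \<equiv> \<lambda>a b. (LINT x:{a..b}|lebesgue. \<omega> x) / (b - a)"
  assumes int: "set_integrable lebesgue {A..B} \<sigma>" "set_integrable lebesgue {A..B} \<omega>"
    and meas [measurable]: "\<sigma> \<in> borel_measurable lebesgue" and \<sigma>0: "\<And>x. 0 \<le> \<sigma> x"
    and pos: "\<And>a b. A \<le> a \<Longrightarrow> a < b \<Longrightarrow> b \<le> B \<Longrightarrow> 0 < S a b \<and> 0 < T a b"
    and bal: "\<And>a b. A \<le> a \<Longrightarrow> a < b \<Longrightarrow> b \<le> B \<Longrightarrow> 1 \<le> T a b * S a b powr e \<and> T a b * S a b powr e \<le> Q"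
    and d: "0 < d" "d \<le> 1" and L: "0 \<le> L" "L * e \<ge> 3 + d" and dL: "2 * d \<le> Q powr (- L)"
    and AB: "A < B"
  shows "set_integrable lebesgue {A..B} (\<lambda>x. \<sigma> x powr (1 + d))"
    and "(LINT x:{A..B}|lebesgue. \<sigma> x powr (1 + d)) \<le> 2 * (B - A) * S A B powr (1 + d)"
proof -
  define G where "G = (\<lambda>y s. (1 + d) * y powr d * s - d * y powr (1 + d))"
  define R where "R = 2 * (B - A) * S A B powr (1 + d)"
  have R0: "0 \<le> R" using AB by (simp add: R_def)
  have Gbd: "\<bar>G y s\<bar> \<le> (1 + d) * k powr d * s + d * k powr (1 + d)" if "0 \<le> y" "y \<le> k" "0 \<le> s" for y k s
  proof -
    have "y powr d \<le> k powr d" "y powr (1 + d) \<le> k powr (1 + d)" using that d by (auto intro!: powr_mono2)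
    then have "(1 + d) * y powr d * s \<le> (1 + d) * k powr d * s" "d * y powr (1 + d) \<le> d * k powr (1 + d)"
      using d that by (auto intro!: mult_right_mono mult_left_mono)
    moreover have "0 \<le> (1 + d) * y powr d * s" "0 \<le> d * y powr (1 + d)" using d that by auto
    ultimately show ?thesis unfolding G_def by (simp add: abs_le_iff)
  qed
  have dom: "integrable lebesgue (\<lambda>x. indicator {A..B} x * ((1 + d) * k powr d * \<sigma> x + d * k powr (1 + d)))" for k
  proof -
    have "set_integrable lebesgue {A..B} (\<lambda>x. (1 + d) * k powr d * \<sigma> x + d * k powr (1 + d))"
      using int(1) by (intro set_integral_add set_integrable_const_Icc set_integrable_mult_right)
    then show ?thesis by (simp add: set_integrable_def)
  qed
  have Gmeas: "(\<lambda>x. indicator {A..B} x * G (f x) (\<sigma> x)) \<in> borel_measurable lebesgue"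
    if [measurable]: "f \<in> borel_measurable lebesgue" for f
  proof -
    have "(\<lambda>x. G (f x) (\<sigma> x)) \<in> borel_measurable lebesgue"
      unfolding G_def by measurable
    then show ?thesis by (intro borel_measurable_times borel_measurable_indicator) auto
  qed
  have Gcont: "(\<lambda>n. G (u n) s) \<longlonglongrightarrow> G v s" if "u \<longlonglongrightarrow> v" "\<And>n. 0 \<le> u n" for u v s
  proof -
    have v: "0 \<le> v" using LIMSEQ_le_const[OF that(1)] that(2) by blast
    have "(\<lambda>n. u n powr r) \<longlonglongrightarrow> v powr r" if "0 < r" for r
      using \<open>u \<longlonglongrightarrow> v\<close> that \<open>\<And>n. 0 \<le> u n\<close> by (intro tendsto_powr2) auto
    then show ?thesis 
      unfolding G_def using d by (intro tendsto_diff tendsto_mult tendsto_const) auto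
  qed
  have cont: "(LINT x|lebesgue. indicator {A..B} x * G (h x) (\<sigma> x)) \<le> R"
    if hc: "continuous_on UNIV h" and h: "\<And>x. 0 \<le> h x" "\<And>x. h x \<le> k" for h :: "real \<Rightarrow> real" and k
  proof -
    have hb [measurable]: "h \<in> borel_measurable borel" using hc by (rule borel_measurable_continuous_onI)
    have hl [measurable]: "h \<in> borel_measurable lebesgue" using hb by (rule borel_imp_lebesgue_measurable)
    have hd [measurable]: "(\<lambda>x. h (dyadic_left n A B x)) \<in> borel_measurable lebesgue" for n
      using measurable_compose[OF borel_imp_lebesgue_measurable[OF dyadic_left_measurable] hb] by simp
    have lim: "(\<lambda>n. dyadic_left n A B x) \<longlonglongrightarrow> x" if "x \<in> {A..B}" for x
    proof (rule tendsto_sandwich)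
      show "\<forall>\<^sub>F n in sequentially. x - (B - A) / 2 ^ n \<le> dyadic_left n A B x"
        using dyadic_left_bounds(3)[of A x B] that by (intro always_eventually allI) (smt (verit) atLeastAtMost_iff)
      show "\<forall>\<^sub>F n in sequentially. dyadic_left n A B x \<le> x"
        using dyadic_left_bounds(2)[of A x B] that by (intro always_eventually allI) auto
      have "(\<lambda>n. x - (B - A) * (1 / 2) ^ n) \<longlonglongrightarrow> x - (B - A) * 0"
        by (intro tendsto_intros LIMSEQ_power_zero) auto
      then show "(\<lambda>n. x - (B - A) / 2 ^ n) \<longlonglongrightarrow> x" by (simp add: power_one_over)
    qed simp
    have "(\<lambda>n. LINT x|lebesgue. indicator {A..B} x * G (h (dyadic_left n A B x)) (\<sigma> x))
        \<longlonglongrightarrow> (LINT x|lebesgue. indicator {A..B} x * G (h x) (\<sigma> x))"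
    proof (rule integral_dominated_convergence[OF _ _ dom[of k]])
      show "AE x in lebesgue. (\<lambda>n. indicator {A..B} x * G (h (dyadic_left n A B x)) (\<sigma> x))
          \<longlonglongrightarrow> indicator {A..B} x * G (h x) (\<sigma> x)"
      proof (intro AE_I2)
        fix x
        show "(\<lambda>n. indicator {A..B} x * G (h (dyadic_left n A B x)) (\<sigma> x))
          \<longlonglongrightarrow> indicator {A..B} x * G (h x) (\<sigma> x)"
        proof (cases "x \<in> {A..B}")
          case True
          have "(\<lambda>n. h (dyadic_left n A B x)) \<longlonglongrightarrow> h x"
            using hc lim[OF True] continuous_on_tendsto_compose by fastforce
          then show ?thesis by (intro tendsto_mult_left Gcont h)
        qed auto
      qed
      show "AE x in lebesgue. norm (indicator {A..B} x * G (h (dyadic_left n A B x)) (\<sigma> x))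
          \<le> indicator {A..B} x * ((1 + d) * k powr d * \<sigma> x + d * k powr (1 + d))" for n
        using Gbd[OF h \<sigma>0] by (intro AE_I2) (auto simp: indicator_def)
    qed (intro Gmeas; measurable)+
    moreover have "(LINT x|lebesgue. indicator {A..B} x * G (h (dyadic_left n A B x)) (\<sigma> x)) \<le> R" for n
    proof -
      have "(LINT x:{A..B}|lebesgue. G (h (dyadic_left n A B x)) (\<sigma> x))
          \<le> (B - A) * (S A B powr (1 + d) * (2 - (T A B * S A B powr e) powr (- L)))"
        using dyadic_step_estimate[of A B \<sigma> \<omega> e Q d L h A B n] int pos bal d L dL h(1) AB
        unfolding S_def T_def G_def by simp
      also have "\<dots> \<le> (B - A) * (S A B powr (1 + d) * 2)"
        using AB by (intro mult_left_mono) auto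
      also have "\<dots> = R" by (simp add: R_def)
      finally show ?thesis by (simp add: set_lebesgue_integral_def)
    qed
    ultimately show ?thesis by (intro LIMSEQ_le_const2) auto
  qed
  have trunc: "(\<integral>\<^sup>+x\<in>{A..B}. ennreal (min (\<sigma> x) (real k) powr (1 + d)) \<partial>lebesgue) \<le> ennreal R" for k :: nat
  proof -
    have "\<sigma> measurable_on UNIV" using meas by (intro lebesgue_measurable_imp_measurable_on) auto
    then obtain N g where N: "negligible N" and g: "\<And>n::nat. continuous_on UNIV (g n)"
        and gl: "\<And>x. x \<notin> N \<Longrightarrow> (\<lambda>n. g n x) \<longlonglongrightarrow> \<sigma> x"
      unfolding measurable_on_def by auto
    define u where "u = (\<lambda>n x. max 0 (min (g n x) (real k)))"
    have uc: "continuous_on UNIV (u n)" for n unfolding u_def by (intro continuous_intros g)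
    have ub: "0 \<le> u n x" "u n x \<le> real k" for n x unfolding u_def by auto
    have um [measurable]: "u n \<in> borel_measurable lebesgue" for n
      using borel_measurable_continuous_onI[OF uc] by (rule borel_imp_lebesgue_measurable)
    have lim: "(\<lambda>n. u n x) \<longlonglongrightarrow> min (\<sigma> x) (real k)" if "x \<notin> N" for x
    proof -
      have "(\<lambda>n. u n x) \<longlonglongrightarrow> max 0 (min (\<sigma> x) (real k))"
        unfolding u_def by (intro tendsto_intros gl that)
      then show ?thesis using \<sigma>0[of x] by (simp add: max_def)
    qed
    have AEN: "AE x in lebesgue. x \<notin> N" using N by (simp add: negligible_iff_null_sets AE_not_in)
    have "(\<lambda>n. LINT x|lebesgue. indicator {A..B} x * G (u n x) (\<sigma> x))
        \<longlonglongrightarrow> (LINT x|lebesgue. indicator {A..B} x * G (min (\<sigma> x) (real k)) (\<sigma> x))"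
    proof (rule integral_dominated_convergence[OF _ _ dom[of "real k"]])
      show "AE x in lebesgue. (\<lambda>n. indicator {A..B} x * G (u n x) (\<sigma> x))
          \<longlonglongrightarrow> indicator {A..B} x * G (min (\<sigma> x) (real k)) (\<sigma> x)"
        using AEN by eventually_elim (intro tendsto_mult_left Gcont lim ub)
      show "AE x in lebesgue. norm (indicator {A..B} x * G (u n x) (\<sigma> x))
          \<le> indicator {A..B} x * ((1 + d) * real k powr d * \<sigma> x + d * real k powr (1 + d))" for n
        using Gbd[OF ub \<sigma>0] by (intro AE_I2) (auto simp: indicator_def)
    qed (intro Gmeas; measurable)+
    then have le: "(LINT x|lebesgue. indicator {A..B} x * G (min (\<sigma> x) (real k)) (\<sigma> x)) \<le> R"
      using cont[OF uc ub] by (intro LIMSEQ_le_const2) auto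
    have i: "integrable lebesgue (\<lambda>x. indicator {A..B} x * G (min (\<sigma> x) (real k)) (\<sigma> x))"
    proof (rule Bochner_Integration.integrable_bound[OF dom[of "real k"]])
      show "AE x in lebesgue. norm (indicator {A..B} x * G (min (\<sigma> x) (real k)) (\<sigma> x))
          \<le> norm (indicator {A..B} x * ((1 + d) * real k powr d * \<sigma> x + d * real k powr (1 + d)))"
        using Gbd[of "min (\<sigma> _) (real k)" "real k", OF _ _ \<sigma>0] \<sigma>0
        by (intro AE_I2) (fastforce simp: indicator_def intro: order_trans)
    qed (intro Gmeas, measurable)
    have ge: "min (\<sigma> x) (real k) powr (1 + d) \<le> G (min (\<sigma> x) (real k)) (\<sigma> x)" for x
    proof -
      define y where "y = min (\<sigma> x) (real k)"
      have y: "0 \<le> y" "y \<le> \<sigma> x" using \<sigma>0[of x] by (auto simp: y_def)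
      have "y powr (1 + d) = (1 + d) * y powr d * y - d * y powr (1 + d)"
        using y by (cases "y = 0") (auto simp: powr_add algebra_simps)
      also have "\<dots> \<le> G y (\<sigma> x)" unfolding G_def using y d by (intro diff_mono mult_left_mono) auto
      finally show ?thesis by (simp add: y_def)
    qed
    have "(\<integral>\<^sup>+x\<in>{A..B}. ennreal (min (\<sigma> x) (real k) powr (1 + d)) \<partial>lebesgue)
      \<le> (\<integral>\<^sup>+x. ennreal (indicator {A..B} x * G (min (\<sigma> x) (real k)) (\<sigma> x)) \<partial>lebesgue)"
      using ge by (intro nn_integral_mono) (auto simp: indicator_def intro!: ennreal_leI)
    also have "\<dots> = ennreal (LINT x|lebesgue. indicator {A..B} x * G (min (\<sigma> x) (real k)) (\<sigma> x))"
      using ge by (intro nn_integral_eq_integral i AE_I2)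
        (auto simp: indicator_def intro: order_trans[OF powr_ge_zero])
    also have "\<dots> \<le> ennreal R" using le by (rule ennreal_leI)
    finally show ?thesis .
  qed
  have "(\<integral>\<^sup>+x\<in>{A..B}. ennreal (\<sigma> x powr (1 + d)) \<partial>lebesgue) =
      (\<integral>\<^sup>+x. (SUP k::nat. ennreal (min (\<sigma> x) (real k) powr (1 + d)) * indicator {A..B} x) \<partial>lebesgue)"
  proof (intro nn_integral_cong)
    fix x
    obtain k :: nat where k: "\<sigma> x \<le> real k" using real_arch_simple by blast
    have "(SUP k::nat. ennreal (min (\<sigma> x) (real k) powr (1 + d)) * indicator {A..B} x)
        = ennreal (\<sigma> x powr (1 + d)) * indicator {A..B} x"
    proof (intro antisym SUP_least)
      show "ennreal (min (\<sigma> x) (real i) powr (1 + d)) * indicator {A..B} x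
          \<le> ennreal (\<sigma> x powr (1 + d)) * indicator {A..B} x" for i :: nat
        using \<sigma>0[of x] d by (intro mult_right_mono ennreal_leI powr_mono2) auto
      show "ennreal (\<sigma> x powr (1 + d)) * indicator {A..B} x
          \<le> (SUP k::nat. ennreal (min (\<sigma> x) (real k) powr (1 + d)) * indicator {A..B} x)"
        using k by (intro SUP_upper2[of k]) (auto simp: min_def)
    qed
    then show "ennreal (\<sigma> x powr (1 + d)) * indicator {A..B} x
      = (SUP k::nat. ennreal (min (\<sigma> x) (real k) powr (1 + d)) * indicator {A..B} x)" by simp
  qed
  also have "\<dots> = (SUP k::nat. \<integral>\<^sup>+x\<in>{A..B}. ennreal (min (\<sigma> x) (real k) powr (1 + d)) \<partial>lebesgue)"
  proof (rule nn_integral_monotone_convergence_SUP)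
    show "incseq (\<lambda>k x. ennreal (min (\<sigma> x) (real k) powr (1 + d)) * indicator {A..B} x)"
      using \<sigma>0 d by (auto simp: incseq_def le_fun_def intro!: mult_right_mono ennreal_leI powr_mono2)
  qed measurable
  also have "\<dots> \<le> ennreal R" using trunc by (intro SUP_least)
  finally have nn: "(\<integral>\<^sup>+x\<in>{A..B}. ennreal (\<sigma> x powr (1 + d)) \<partial>lebesgue) \<le> ennreal R" .
  have nn': "(\<integral>\<^sup>+x. ennreal (indicator {A..B} x * \<sigma> x powr (1 + d)) \<partial>lebesgue) \<le> ennreal R"
  proof -
    have "(\<integral>\<^sup>+x. ennreal (indicator {A..B} x * \<sigma> x powr (1 + d)) \<partial>lebesgue)
        = (\<integral>\<^sup>+x\<in>{A..B}. ennreal (\<sigma> x powr (1 + d)) \<partial>lebesgue)"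
      by (intro nn_integral_cong) (auto simp: indicator_def)
    then show ?thesis using nn by simp
  qed
  show I: "set_integrable lebesgue {A..B} (\<lambda>x. \<sigma> x powr (1 + d))"
    unfolding set_integrable_def real_scaleR_def
    by (rule integrableI_nonneg) (use nn' in \<open>auto intro: le_less_trans\<close>)
  have "ennreal (LINT x:{A..B}|lebesgue. \<sigma> x powr (1 + d)) \<le> ennreal R"
    using nn' I unfolding set_integrable_def set_lebesgue_integral_def real_scaleR_def
    by (subst nn_integral_eq_integral[symmetric]) auto
  then show "(LINT x:{A..B}|lebesgue. \<sigma> x powr (1 + d)) \<le> 2 * (B - A) * S A B powr (1 + d)"
    using R0 unfolding R_def by simp
qed

lemma set_integral_pos:
  fixes f :: "real \<Rightarrow> real"
  assumes i: "set_integrable lebesgue {a..b} f" and "a < b" and pos: "AE x in lebesgue. 0 < f x"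
  shows "0 < (LINT x:{a..b}|lebesgue. f x)"
proof (rule ccontr)
  assume neg: "\<not> 0 < (LINT x:{a..b}|lebesgue. f x)"
  have nonneg: "AE x in lebesgue. 0 \<le> indicator {a..b} x *\<^sub>R f x"
    using pos by eventually_elim (auto simp: indicator_def)
  have "(LINT x|lebesgue. indicator {a..b} x *\<^sub>R f x) = 0"
    using neg integral_nonneg_AE[OF nonneg] by (simp add: set_lebesgue_integral_def)
  then have "AE x in lebesgue. indicator {a..b} x *\<^sub>R f x = 0"
    using integral_nonneg_eq_0_iff_AE[OF _ nonneg] i by (simp add: set_integrable_def)
  with pos have "AE x in lebesgue. x \<notin> {a..b}"
    by eventually_elim (auto simp: indicator_def)
  then have "emeasure lebesgue {a..b} = 0"
    by (subst (asm) AE_iff_measurable[of "{a..b}"]) auto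
  then show False using \<open>a < b\<close> by simp
qed

text \<open>
  Hoelder's inequality for the product \<open>1 = \<omega> powr \<alpha> * \<sigma> powr \<beta>\<close> with \<open>\<alpha> = 1 / (1 + e)\<close> and
  \<open>\<beta> = e / (1 + e)\<close>, both weights being normalized by their averages.
\<close>

lemma dual_weight_averages_ge_1:
  fixes \<omega> :: "real \<Rightarrow> real" and e a b :: real
  defines "\<sigma> \<equiv> \<lambda>x. \<omega> x powr (- 1 / e)"
  defines "T \<equiv> (LINT x:{a..b}|lebesgue. \<omega> x) / (b - a)" and "S \<equiv> (LINT x:{a..b}|lebesgue. \<sigma> x) / (b - a)"
  assumes e: "0 < e" and ab: "a < b" and pos: "AE x in lebesgue. 0 < \<omega> x"
    and i: "set_integrable lebesgue {a..b} \<omega>" "set_integrable lebesgue {a..b} \<sigma>"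
  shows "0 < S" "0 < T" "1 \<le> T * S powr e"
proof -
  have pos': "AE x in lebesgue. 0 < \<sigma> x" using pos by eventually_elim (simp add: \<sigma>_def)
  show S: "0 < S" and T: "0 < T"
    using set_integral_pos[OF i(1) ab pos] set_integral_pos[OF i(2) ab pos'] ab by (simp_all add: S_def T_def)
  define \<alpha> where "\<alpha> = 1 / (1 + e)"
  define \<beta> where "\<beta> = e / (1 + e)"
  have ab1: "0 < \<alpha>" "0 < \<beta>" "\<alpha> + \<beta> = 1" using e by (auto simp: \<alpha>_def \<beta>_def field_simps)
  have "(LINT x:{a..b}|lebesgue. T powr - \<alpha> * S powr - \<beta>)
      \<le> (LINT x:{a..b}|lebesgue. \<alpha> / T * \<omega> x + \<beta> / S * \<sigma> x)"
  proof (rule set_integral_mono_AE)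
    show "AE x\<in>{a..b} in lebesgue. T powr - \<alpha> * S powr - \<beta> \<le> \<alpha> / T * \<omega> x + \<beta> / S * \<sigma> x"
      using pos
    proof eventually_elim
      case (elim x)
      have "\<sigma> x powr \<beta> = \<omega> x powr (- \<alpha>)"
        using e elim by (simp add: \<sigma>_def powr_powr \<alpha>_def \<beta>_def)
      then have "\<omega> x powr \<alpha> * \<sigma> x powr \<beta> = 1" using elim by (simp flip: powr_add)
      then have "T powr - \<alpha> * S powr - \<beta> = (\<omega> x / T) powr \<alpha> * (\<sigma> x / S) powr \<beta>"
      proof -
        have "0 < \<sigma> x" using elim by (simp add: \<sigma>_def)
        then have "(\<omega> x / T) powr \<alpha> * (\<sigma> x / S) powr \<beta>
            = (\<omega> x powr \<alpha> * \<sigma> x powr \<beta>) * (T powr - \<alpha> * S powr - \<beta>)"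
          using elim S T by (simp add: powr_divide powr_minus_divide)
        then show ?thesis using \<open>\<omega> x powr \<alpha> * \<sigma> x powr \<beta> = 1\<close> by simp
      qed
      also have "\<dots> \<le> \<alpha> * (\<omega> x / T) + \<beta> * (\<sigma> x / S)"
        using ab1 S T elim by (intro Youngs_inequality_0) (auto simp: \<sigma>_def)
      finally show ?case by simp
    qed
  qed (use i in \<open>auto intro!: set_integrable_const_Icc set_integral_add\<close>)
  also have "\<dots> = (b - a) * (\<alpha> / T * T + \<beta> / S * S)"
  proof -
    have TS: "(LINT x:{a..b}|lebesgue. \<omega> x) = (b - a) * T" "(LINT x:{a..b}|lebesgue. \<sigma> x) = (b - a) * S"
      using ab by (simp_all add: S_def T_def)
    have "(LINT x:{a..b}|lebesgue. \<alpha> / T * \<omega> x + \<beta> / S * \<sigma> x)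
        = \<alpha> / T * (LINT x:{a..b}|lebesgue. \<omega> x) + \<beta> / S * (LINT x:{a..b}|lebesgue. \<sigma> x)"
      using i by (subst set_integral_add) auto
    also have "\<dots> = (b - a) * (\<alpha> / T * T + \<beta> / S * S)" unfolding TS by (simp only: algebra_simps)
    finally show ?thesis .
  qed
  also have "\<dots> = b - a" using ab1 S T by simp
  finally have "T powr - \<alpha> * S powr - \<beta> \<le> 1"
    using ab by (simp add: set_lebesgue_integral_def)
  then have "(T powr - \<alpha> * S powr - \<beta>) powr (1 + e) \<le> 1" using e by (simp add: powr_le1)
  moreover have "(T powr - \<alpha> * S powr - \<beta>) powr (1 + e) = inverse (T * S powr e)"
  proof -
    have "- \<alpha> * (1 + e) = - 1" "- \<beta> * (1 + e) = - e" using e by (simp_all add: \<alpha>_def \<beta>_def)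
    then have "(T powr - \<alpha> * S powr - \<beta>) powr (1 + e) = T powr - 1 * S powr - e"
      using S T by (simp only: powr_mult powr_powr powr_ge_zero)
    also have "\<dots> = inverse (T * S powr e)" using T by (simp add: powr_minus)
    finally show ?thesis .
  qed
  ultimately have "inverse (T * S powr e) \<le> 1" by simp
  moreover have "0 < T * S powr e" using S T by simp
  ultimately show "1 \<le> T * S powr e" by (simp only: inverse_le_1_iff) linarith
qed

text \<open>
  The reverse Hoelder inequality is applied to the dual weight \<open>\<sigma> = \<omega> powr (- 1 / (p - 1))\<close>, because
  \<open>\<sigma> powr (1 + d)\<close> is the dual weight of \<open>\<omega>\<close> for the smaller exponent \<open>q = 1 + (p - 1) / (1 + d)\<close>.
\<close>

theorem muckenhoupt_open:
  assumes p: "1 < p" and \<omega>: "\<omega> \<in> muckenhoupt p"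
  obtains q where "1 < q" "q < p" "\<omega> \<in> muckenhoupt q"
proof -
  define e where "e = p - 1"
  define \<sigma> where "\<sigma> = (\<lambda>x. \<omega> x powr (- 1 / e))"
  define T where "T = (\<lambda>a b. (LINT x:{a..b}|lebesgue. \<omega> x) / (b - a))"
  define S where "S = (\<lambda>a b. (LINT x:{a..b}|lebesgue. \<sigma> x) / (b - a))"
  have e: "0 < e" using p by (simp add: e_def)
  obtain c where W: "weight \<omega>" and i: "\<And>a b. 0 < b - a \<Longrightarrow> b - a \<le> 2 * pi \<Longrightarrow>
       set_integrable lebesgue {a..b} \<omega> \<and> set_integrable lebesgue {a..b} \<sigma>"
    and c: "\<And>a b. 0 < b - a \<Longrightarrow> b - a \<le> 2 * pi \<Longrightarrow> T a b * S a b powr e \<le> c"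
    using \<omega> unfolding muckenhoupt_def e_def \<sigma>_def S_def T_def by auto
  have pos: "AE x in lebesgue. 0 < \<omega> x" and meas: "\<omega> \<in> borel_measurable lebesgue"
    using W by (auto simp: weight_def periodic_measurable_def)
  have meas\<sigma>: "\<sigma> \<in> borel_measurable lebesgue" unfolding \<sigma>_def using meas by measurable
  have ST: "0 < S a b" "0 < T a b" "1 \<le> T a b * S a b powr e" if "0 < b - a" "b - a \<le> 2 * pi" for a b
    using dual_weight_averages_ge_1[OF e _ pos, of a b] i[OF that] that unfolding S_def T_def \<sigma>_def by auto
  (* L makes the exponent L * e large enough for every d up to 1; d is then small enough for the
     level condition of the Bellman function at the largest value c of the Muckenhoupt product. *)
  define L where "L = 4 / e"
  define d where "d = min 1 (c powr (- L) / 2)"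
  have c1: "1 \<le> c" using order_trans[OF ST(3) c, of 1 0] pi_gt3 by simp
  have d: "0 < d" "d \<le> 1" "2 * d \<le> c powr (- L)" using c1 by (auto simp: d_def)
  have L: "0 \<le> L" "L * e \<ge> 3 + d" using e d by (auto simp: L_def)
  define q where "q = 1 + e / (1 + d)"
  have q1: "q - 1 = e / (1 + d)" by (simp add: q_def)
  have dual: "\<omega> x powr (- 1 / (q - 1)) = \<sigma> x powr (1 + d)" for x
  proof -
    have "u / (q - 1) = u / e * (1 + d)" for u by (simp add: q1)
    from this[of "- 1"] have "- 1 / (q - 1) = (- 1 / e) * (1 + d)" .
    then show ?thesis unfolding \<sigma>_def by (simp only: powr_powr)
  qed
  have main: "set_integrable lebesgue {a..b} \<omega> \<and>
           set_integrable lebesgue {a..b} (\<lambda>t. \<omega> t powr (- 1 / (q - 1))) \<and>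
           (1 / (b - a) * (LINT t:{a..b}|lebesgue. \<omega> t)) *
           (1 / (b - a) * (LINT t:{a..b}|lebesgue. \<omega> t powr (- 1 / (q - 1)))) powr (q - 1) \<le> 2 powr (q - 1) * c"
    if ab: "0 < b - a" "b - a \<le> 2 * pi" for a b
  proof -
    note rh = reverse_holder[of a b \<sigma> \<omega> e c d L]
    have R1: "set_integrable lebesgue {a..b} (\<lambda>x. \<sigma> x powr (1 + d))"
      using i[OF ab] ST c ab d L meas\<sigma> unfolding S_def T_def
      by (intro rh(1)) (auto simp: \<sigma>_def)
    have R2: "(LINT x:{a..b}|lebesgue. \<sigma> x powr (1 + d)) \<le> 2 * (b - a) * S a b powr (1 + d)"
      using i[OF ab] ST c ab d L meas\<sigma> unfolding S_def T_def
      by (intro rh(2)) (auto simp: \<sigma>_def)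
    have "1 / (b - a) * (LINT x:{a..b}|lebesgue. \<sigma> x powr (1 + d)) \<le> 2 * S a b powr (1 + d)"
      using R2 ab by (simp add: field_simps)
    moreover have "0 \<le> 1 / (b - a) * (LINT x:{a..b}|lebesgue. \<sigma> x powr (1 + d))"
      using ab by (auto simp: set_lebesgue_integral_def intro!: divide_nonneg_pos integral_nonneg)
    ultimately have "(1 / (b - a) * (LINT x:{a..b}|lebesgue. \<sigma> x powr (1 + d))) powr (q - 1)
        \<le> (2 * S a b powr (1 + d)) powr (q - 1)"
      using e d by (intro powr_mono2) (auto simp: q1)
    also have "\<dots> = 2 powr (q - 1) * S a b powr e"
      using d by (simp add: powr_mult powr_powr q1)
    finally have "T a b * (1 / (b - a) * (LINT x:{a..b}|lebesgue. \<sigma> x powr (1 + d))) powr (q - 1)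
        \<le> T a b * (2 powr (q - 1) * S a b powr e)"
      using ST(2)[OF ab] by (intro mult_left_mono) auto
    also have "\<dots> \<le> 2 powr (q - 1) * c" using c[OF ab] by simp
    finally show ?thesis using R1 i[OF ab] unfolding dual T_def by simp
  qed
  show thesis
  proof (rule that[of q])
    show "1 < q" using e d by (simp add: q_def)
    have "e / (1 + d) < e" using e d by (simp add: field_simps)
    then show "q < p" by (simp add: q_def e_def)
    show "\<omega> \<in> muckenhoupt q" unfolding muckenhoupt_def using W main by blast
  qed
qed

section \<open>Orlicz norms and modulars\<close>

text \<open>
  Convex even functions of superlinear growth: the features of a Young function that matter for
  duality, for Jensen's inequality and for integrability.
\<close>

definition gauge_function :: "(real \<Rightarrow> real) \<Rightarrow> bool" where
  "gauge_function \<Phi> \<longleftrightarrow> convex_on UNIV \<Phi> \<and> (\<forall>x. \<Phi> (- x) = \<Phi> x) \<and> \<Phi> 0 = 0 \<and>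
     filterlim (\<lambda>x. \<Phi> x / x) at_top at_top"

lemma gauge_nonneg: "gauge_function \<Phi> \<Longrightarrow> 0 \<le> \<Phi> x"
  using convex_onD[of UNIV \<Phi> "1 / 2" x "- x"] by (auto simp: gauge_function_def)

lemma gauge_mono:
  assumes "gauge_function \<Phi>" "0 \<le> x" "x \<le> y"
  shows "\<Phi> x \<le> \<Phi> y"
proof (cases "y = 0")
  case False
  with assms have y: "0 < y" by simp
  have "\<Phi> x \<le> (1 - x / y) * \<Phi> 0 + x / y * \<Phi> y"
    using convex_onD[of UNIV \<Phi> "x / y" 0 y] assms y by (auto simp: gauge_function_def)
  also have "\<dots> \<le> 1 * \<Phi> y"
    using mult_right_mono[of "x / y" 1 "\<Phi> y"] assms y gauge_nonneg[of \<Phi> y]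
    by (auto simp: gauge_function_def)
  finally show ?thesis by simp
qed (use assms in auto)

lemma gauge_abs: "gauge_function \<Phi> \<Longrightarrow> \<Phi> \<bar>x\<bar> = \<Phi> x"
  by (auto simp: gauge_function_def abs_if)

lemma gauge_measurable:
  assumes "gauge_function \<Phi>"
  shows "\<Phi> \<in> borel_measurable borel"
proof -
  have "mono (\<lambda>x. \<Phi> (max 0 x))" by (intro monoI gauge_mono[OF assms]) auto
  then have [measurable]: "(\<lambda>x. \<Phi> (max 0 x)) \<in> borel_measurable borel" by (rule borel_measurable_mono)
  have "\<Phi> = (\<lambda>x. (\<lambda>x. \<Phi> (max 0 x)) \<bar>x\<bar>)" using gauge_abs[OF assms] by (auto simp: max_def)
  also have "\<dots> \<in> borel_measurable borel" by measurable
  finally show ?thesis .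
qed

lemma gauge_large:
  assumes "gauge_function \<Phi>"
  obtains X where "0 < X" "\<And>x. X \<le> x \<Longrightarrow> K * x \<le> \<Phi> x"
proof -
  have "\<forall>\<^sub>F x in at_top. K \<le> \<Phi> x / x"
    using assms by (auto simp: gauge_function_def filterlim_at_top)
  then obtain X where X: "\<And>x. X \<le> x \<Longrightarrow> K \<le> \<Phi> x / x" by (auto simp: eventually_at_top_linorder)
  show thesis
  proof (rule that[of "max X 1"])
    show "K * x \<le> \<Phi> x" if "max X 1 \<le> x" for x using X[of x] that by (auto simp: field_simps)
  qed auto
qed

lemma gauge_powr:
  assumes \<Phi>: "gauge_function \<Phi>" and e: "1 \<le> e"
  shows "gauge_function (\<lambda>x. \<Phi> x powr e)"
proof (cases "e = 1")
  case True
  then show ?thesis using \<Phi> gauge_nonneg[OF \<Phi>] by simp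
next
  case False
  then have e: "0 < e - 1" using e by simp
  have conv: "convex_on UNIV (\<lambda>x. \<Phi> x powr e)"
  proof (intro convex_onI)
    fix t x y :: real assume t: "0 < t" "t < 1"
    define z where "z = (1 - t) * \<Phi> x + t * \<Phi> y"
    have z: "0 \<le> z" using t gauge_nonneg[OF \<Phi>] by (simp add: z_def)
    have tan: "e * z powr (e - 1) * w - (e - 1) * z powr e \<le> w powr e" if "0 \<le> w" for w
      using tangent_power_le[OF e z that] by simp
    have "\<Phi> ((1 - t) * x + t * y) \<le> z"
      using convex_onD[of UNIV \<Phi> t x y] \<Phi> t by (auto simp: gauge_function_def z_def)
    then have "\<Phi> ((1 - t) * x + t * y) powr e \<le> z powr e"
      using gauge_nonneg[OF \<Phi>] e by (intro powr_mono2) auto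
    also have "\<dots> = (1 - t) * (e * z powr (e - 1) * \<Phi> x - (e - 1) * z powr e)
        + t * (e * z powr (e - 1) * \<Phi> y - (e - 1) * z powr e)"
    proof -
      have "z powr e = z powr (e - 1) * z"
        using z e by (cases "z = 0") (simp_all add: powr_diff)
      then have "z powr e = e * (z powr (e - 1) * z) - (e - 1) * z powr e" by (simp add: algebra_simps)
      moreover have "(1 - t) * (e * D * u - E) + t * (e * D * v - E) = e * (D * ((1 - t) * u + t * v)) - E"
        for D E u v by (simp add: algebra_simps)
      ultimately show ?thesis by (simp only: z_def[symmetric])
    qed
    also have "\<dots> \<le> (1 - t) * \<Phi> x powr e + t * \<Phi> y powr e"
      using t gauge_nonneg[OF \<Phi>] by (intro add_mono mult_left_mono tan) auto
    finally show "\<Phi> ((1 - t) *\<^sub>R x + t *\<^sub>R y) powr e \<le> (1 - t) * \<Phi> x powr e + t * \<Phi> y powr e" by simp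
  qed auto
  obtain X where X: "0 < X" "\<And>x. X \<le> x \<Longrightarrow> 1 * x \<le> \<Phi> x" using gauge_large[OF \<Phi>] by blast
  have "filterlim (\<lambda>x. \<Phi> x powr e / x) at_top at_top"
  proof (rule filterlim_at_top_mono)
    show "filterlim (\<lambda>x. \<Phi> x / x) at_top at_top" using \<Phi> by (simp add: gauge_function_def)
    show "\<forall>\<^sub>F x in at_top. \<Phi> x / x \<le> \<Phi> x powr e / x"
      using eventually_ge_at_top[of "max X 1"]
    proof eventually_elim
      case (elim x)
      then have "\<Phi> x powr 1 \<le> \<Phi> x powr e" using X(2)[of x] e by (intro powr_mono) auto
      then show ?case using elim gauge_nonneg[OF \<Phi>, of x] by (intro divide_right_mono) auto
    qed
  qed
  with conv \<Phi> e show ?thesis by (simp add: gauge_function_def)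
qed

text \<open>
  The infimum of the difference quotients to the right is the right derivative, which is nonnegative
  at \<open>x \<ge> 0\<close>. The maximum with \<open>0\<close> makes it nonnegative everywhere.
\<close>

definition gauge_slope :: "(real \<Rightarrow> real) \<Rightarrow> real \<Rightarrow> real" where
  "gauge_slope \<Phi> x = max 0 (Inf ((\<lambda>t. (\<Phi> x - \<Phi> t) / (x - t)) ` ({x<..} \<inter> UNIV)))"

lemma gauge_slope_tangent:
  assumes \<Phi>: "gauge_function \<Phi>" and x: "0 \<le> x"
  shows "\<Phi> x + gauge_slope \<Phi> x * (y - x) \<le> \<Phi> y"
proof -
  define k where "k = Inf ((\<lambda>t. (\<Phi> x - \<Phi> t) / (x - t)) ` ({x<..} \<inter> UNIV))"
  have k: "\<Phi> x + k * (z - x) \<le> \<Phi> z" for z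
    using convex_le_Inf_differential[of UNIV \<Phi> x z] \<Phi> by (simp add: gauge_function_def k_def)
  have slope: "gauge_slope \<Phi> x = max 0 k" by (simp only: gauge_slope_def k_def)
  show ?thesis
  proof (cases "0 \<le> k")
    case True then show ?thesis using k[of y] by (simp add: slope)
  next
    case False
    have "x = 0"
    proof (rule ccontr)
      assume "x \<noteq> 0"
      with x False have "k * x < 0" by (simp add: mult_neg_pos)
      then show False using k[of 0] gauge_nonneg[OF \<Phi>, of x] \<Phi> by (simp add: gauge_function_def)
    qed
    moreover have "gauge_slope \<Phi> x = 0" using False slope by simp
    ultimately show ?thesis using gauge_nonneg[OF \<Phi>, of y] \<Phi>
      by (simp add: gauge_function_def)
  qed
qed

lemma gauge_slope_nonneg: "0 \<le> gauge_slope \<Phi> x"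
  by (simp add: gauge_slope_def)

lemma gauge_slope_mono:
  assumes "gauge_function \<Phi>" "0 \<le> x" "x \<le> y"
  shows "gauge_slope \<Phi> x \<le> gauge_slope \<Phi> y"
proof (cases "x = y")
  case False
  with assms have xy: "0 < y - x" by simp
  have "gauge_slope \<Phi> x * (y - x) \<le> gauge_slope \<Phi> y * (y - x)"
    using gauge_slope_tangent[OF assms(1,2), of y] gauge_slope_tangent[OF assms(1), of y x] assms
    by (simp add: algebra_simps)
  then show ?thesis using xy by simp
qed simp

lemma gauge_slope_measurable:
  assumes "gauge_function \<Phi>"
  shows "(\<lambda>x. gauge_slope \<Phi> \<bar>x\<bar>) \<in> borel_measurable borel"
proof -
  have "mono (\<lambda>x. gauge_slope \<Phi> (max 0 x))" by (intro monoI gauge_slope_mono[OF assms]) auto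
  then have [measurable]: "(\<lambda>x. gauge_slope \<Phi> (max 0 x)) \<in> borel_measurable borel"
    by (rule borel_measurable_mono)
  have "(\<lambda>x. gauge_slope \<Phi> \<bar>x\<bar>) = (\<lambda>x. (\<lambda>x. gauge_slope \<Phi> (max 0 x)) \<bar>x\<bar>)" by (auto simp: max_def)
  also have "\<dots> \<in> borel_measurable borel" by measurable
  finally show ?thesis .
qed

lemma complementary_bdd:
  assumes \<Phi>: "gauge_function \<Phi>" and M: "\<And>x. 0 \<le> x \<Longrightarrow> \<Phi> x \<le> M x"
  shows "bdd_above ((\<lambda>x. x * y - M x) ` {0..})"
proof -
  obtain X where X: "0 < X" "\<And>x. X \<le> x \<Longrightarrow> \<bar>y\<bar> * x \<le> \<Phi> x" using gauge_large[OF \<Phi>] by blast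
  have "x * y - M x \<le> X * \<bar>y\<bar>" if "0 \<le> x" for x
  proof (cases "x \<le> X")
    case True
    have "x * y \<le> x * \<bar>y\<bar>" using that by (intro mult_left_mono) auto
    also have "\<dots> \<le> X * \<bar>y\<bar>" using True by (intro mult_right_mono) auto
    finally show ?thesis using M[OF that] gauge_nonneg[OF \<Phi>, of x] by linarith
  next
    case False
    have "x * y \<le> x * \<bar>y\<bar>" using that by (intro mult_left_mono) auto
    also have "\<dots> \<le> \<Phi> x" using X(2)[of x] False by (simp add: mult.commute)
    finally show ?thesis using M[OF that] X(1) by (smt (verit) abs_ge_zero mult_nonneg_nonneg)
  qed
  then show ?thesis by (auto intro!: bdd_aboveI2)
qed

lemma complementary_young:
  assumes \<Phi>: "gauge_function \<Phi>" and M: "\<And>x. 0 \<le> x \<Longrightarrow> \<Phi> x \<le> M x" and x: "0 \<le> x"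
  shows "x * y \<le> M x + complementary M y"
  using cSUP_upper[OF _ complementary_bdd[OF \<Phi> M, of y], of x] x by (simp add: complementary_def)

lemma complementary_least:
  assumes "\<And>x. 0 \<le> x \<Longrightarrow> x * y - M x \<le> B"
  shows "complementary M y \<le> B"
  unfolding complementary_def using assms by (intro cSUP_least) auto

lemma complementary_mono:
  assumes \<Phi>: "gauge_function \<Phi>" and M: "\<And>x. 0 \<le> x \<Longrightarrow> \<Phi> x \<le> M x" and yz: "y \<le> z"
  shows "complementary M y \<le> complementary M z"
proof (rule complementary_least)
  fix x :: real assume x: "0 \<le> x"
  have "x * y \<le> x * z" using x yz by (intro mult_left_mono)
  then show "x * y - M x \<le> complementary M z" using complementary_young[OF \<Phi> M x, of z] by linarith
qed

lemma complementary_measurable: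
  assumes \<Phi>: "gauge_function \<Phi>" and M: "\<And>x. 0 \<le> x \<Longrightarrow> \<Phi> x \<le> M x"
  shows "complementary M \<in> borel_measurable borel"
  by (intro borel_measurable_mono monoI complementary_mono[OF assms])

lemma ennreal_abs_mult3: "ennreal (\<bar>a * b\<bar> * c) = ennreal \<bar>a\<bar> * ennreal (\<bar>b\<bar> * c)"
  by (simp add: abs_mult mult.assoc ennreal_mult')

text \<open>
  For a single test function this is monotone convergence. Infinite sums are allowed because the
  derivative is the sum of infinitely many blocks.
\<close>

lemma orlicz_norm_countable_subadditive:
  fixes u :: "nat \<Rightarrow> real \<Rightarrow> real"
  assumes [measurable]: "\<omega> \<in> borel_measurable lebesgue" "\<And>i. u i \<in> borel_measurable lebesgue"
    and le: "AE x in lebesgue. ennreal \<bar>v x\<bar> \<le> (\<Sum>i. ennreal \<bar>u i x\<bar>)"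
  shows "orlicz_norm M \<omega> v \<le> (\<Sum>i. orlicz_norm M \<omega> (u i))"
  unfolding orlicz_norm_def
proof (rule SUP_least)
  fix g assume "g \<in> {g \<in> periodic_measurable.
    (\<integral>\<^sup>+t\<in>{0..2 * pi}. ennreal (complementary M \<bar>g t\<bar> * \<omega> t) \<partial>lebesgue) \<le> 1}" (is "g \<in> ?G")
  then have g: "g \<in> ?G" and [measurable]: "g \<in> borel_measurable lebesgue"
    by (auto simp: periodic_measurable_def)
  have "(\<integral>\<^sup>+t\<in>{0..2 * pi}. ennreal (\<bar>v t * g t\<bar> * \<omega> t) \<partial>lebesgue)
     \<le> (\<integral>\<^sup>+t. (\<Sum>i. ennreal (\<bar>u i t * g t\<bar> * \<omega> t) * indicator {0..2 * pi} t) \<partial>lebesgue)"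
  proof (rule nn_integral_mono_AE)
    show "AE t in lebesgue. ennreal (\<bar>v t * g t\<bar> * \<omega> t) * indicator {0..2 * pi} t
        \<le> (\<Sum>i. ennreal (\<bar>u i t * g t\<bar> * \<omega> t) * indicator {0..2 * pi} t)"
      using le
    proof eventually_elim
      case (elim t)
      have "ennreal \<bar>v t\<bar> * (ennreal (\<bar>g t\<bar> * \<omega> t) * indicator {0..2 * pi} t)
          \<le> (\<Sum>i. ennreal \<bar>u i t\<bar>) * (ennreal (\<bar>g t\<bar> * \<omega> t) * indicator {0..2 * pi} t)"
        using elim by (rule mult_right_mono) simp
      also have "\<dots> = (\<Sum>i. ennreal \<bar>u i t\<bar> * (ennreal (\<bar>g t\<bar> * \<omega> t) * indicator {0..2 * pi} t))"
        by (rule ennreal_suminf_multc[symmetric])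
      finally show ?case by (simp only: ennreal_abs_mult3 mult.assoc)
    qed
  qed
  also have "\<dots> = (\<Sum>i. \<integral>\<^sup>+t\<in>{0..2 * pi}. ennreal (\<bar>u i t * g t\<bar> * \<omega> t) \<partial>lebesgue)"
    by (rule nn_integral_suminf) measurable
  also have "\<dots> \<le> (\<Sum>i. SUP g\<in>?G. \<integral>\<^sup>+t\<in>{0..2 * pi}. ennreal (\<bar>u i t * g t\<bar> * \<omega> t) \<partial>lebesgue)"
    by (intro suminf_le SUP_upper g) auto
  finally show "(\<integral>\<^sup>+t\<in>{0..2 * pi}. ennreal (\<bar>v t * g t\<bar> * \<omega> t) \<partial>lebesgue)
      \<le> (\<Sum>i. SUP g\<in>?G. \<integral>\<^sup>+t\<in>{0..2 * pi}. ennreal (\<bar>u i t * g t\<bar> * \<omega> t) \<partial>lebesgue)" .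
qed

lemma orlicz_norm_cmult:
  assumes [measurable]: "\<omega> \<in> borel_measurable lebesgue" "f \<in> borel_measurable lebesgue"
  shows "orlicz_norm M \<omega> (\<lambda>x. c * f x) = ennreal \<bar>c\<bar> * orlicz_norm M \<omega> f"
  unfolding orlicz_norm_def SUP_mult_left_ennreal
proof (intro SUP_cong refl)
  fix g assume "g \<in> {g \<in> periodic_measurable.
    (\<integral>\<^sup>+t\<in>{0..2 * pi}. ennreal (complementary M \<bar>g t\<bar> * \<omega> t) \<partial>lebesgue) \<le> 1}"
  then have [measurable]: "g \<in> borel_measurable lebesgue" by (auto simp: periodic_measurable_def)
  have "(\<integral>\<^sup>+t\<in>{0..2 * pi}. ennreal (\<bar>c * f t * g t\<bar> * \<omega> t) \<partial>lebesgue)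
      = (\<integral>\<^sup>+t. ennreal \<bar>c\<bar> * (ennreal (\<bar>f t * g t\<bar> * \<omega> t) * indicator {0..2 * pi} t) \<partial>lebesgue)"
    by (intro nn_integral_cong) (simp add: abs_mult ennreal_mult' mult.assoc)
  also have "\<dots> = ennreal \<bar>c\<bar> * (\<integral>\<^sup>+t\<in>{0..2 * pi}. ennreal (\<bar>f t * g t\<bar> * \<omega> t) \<partial>lebesgue)"
    by (rule nn_integral_cmult) measurable
  finally show "(\<integral>\<^sup>+t\<in>{0..2 * pi}. ennreal (\<bar>c * f t * g t\<bar> * \<omega> t) \<partial>lebesgue)
     = ennreal \<bar>c\<bar> * (\<integral>\<^sup>+t\<in>{0..2 * pi}. ennreal (\<bar>f t * g t\<bar> * \<omega> t) \<partial>lebesgue)" .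
qed

lemma orlicz_norm_mono:
  assumes \<omega>m: "\<omega> \<in> borel_measurable lebesgue" and fm: "f \<in> borel_measurable lebesgue"
    and le: "AE x in lebesgue. \<bar>h x\<bar> \<le> \<bar>f x\<bar>"
  shows "orlicz_norm M \<omega> h \<le> orlicz_norm M \<omega> f"
proof -
  have "orlicz_norm M \<omega> h \<le> (\<Sum>i. orlicz_norm M \<omega> (\<lambda>x. if i = 0 then f x else 0 * f x))"
  proof (rule orlicz_norm_countable_subadditive)
    show "AE x in lebesgue. ennreal \<bar>h x\<bar> \<le> (\<Sum>i. ennreal \<bar>if i = 0 then f x else 0 * f x\<bar>)"
      using le
    proof eventually_elim
      case (elim x)
      have "(\<Sum>i. ennreal \<bar>if i = 0 then f x else 0 * f x\<bar>) = (\<Sum>i\<in>{0::nat}. ennreal \<bar>f x\<bar>)"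
        by (subst suminf_finite[of "{0::nat}"]) auto
      then show ?case using elim by (auto intro!: ennreal_leI)
    qed
    show "(\<lambda>x. if i = 0 then f x else 0 * f x) \<in> borel_measurable lebesgue" for i :: nat
      using fm by (cases "i = 0") simp_all
  qed (rule \<omega>m)
  also have "\<dots> = (\<Sum>i\<in>{0::nat}. orlicz_norm M \<omega> f)"
    using orlicz_norm_cmult[OF \<omega>m fm, of M 0] by (subst suminf_finite[of "{0::nat}"]) auto
  finally show ?thesis by simp
qed

text \<open>
  Young's inequality \<open>x * y \<le> M x + complementary M y\<close> at \<open>x = \<bar>f\<bar> / c\<close>, where \<open>M x \<le> \<Phi> f\<close>.
\<close>

lemma orlicz_norm_le_modular:
  assumes \<Phi>: "gauge_function \<Phi>" and M: "\<And>x. 0 \<le> x \<Longrightarrow> \<Phi> x \<le> M x \<and> M x \<le> \<Phi> (c * x)" and c: "0 < c"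
    and [measurable]: "\<omega> \<in> borel_measurable lebesgue" "f \<in> borel_measurable lebesgue"
    and \<omega>: "AE x in lebesgue. 0 < \<omega> x"
    and le: "(\<integral>\<^sup>+t\<in>{0..2 * pi}. ennreal (\<Phi> (f t) * \<omega> t) \<partial>lebesgue) \<le> ennreal C" and C: "0 \<le> C"
  shows "orlicz_norm M \<omega> f \<le> ennreal (c * (C + 1))"
  unfolding orlicz_norm_def
proof (rule SUP_least)
  fix g assume "g \<in> {g \<in> periodic_measurable.
    (\<integral>\<^sup>+t\<in>{0..2 * pi}. ennreal (complementary M \<bar>g t\<bar> * \<omega> t) \<partial>lebesgue) \<le> 1}"
  then have g: "(\<integral>\<^sup>+t\<in>{0..2 * pi}. ennreal (complementary M \<bar>g t\<bar> * \<omega> t) \<partial>lebesgue) \<le> 1"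
    and [measurable]: "g \<in> borel_measurable lebesgue"
    by (auto simp: periodic_measurable_def)
  have M1: "\<Phi> x \<le> M x" if "0 \<le> x" for x using M that by blast
  have [measurable]: "\<Phi> \<in> borel_measurable borel" "complementary M \<in> borel_measurable borel"
    using gauge_measurable[OF \<Phi>] complementary_measurable[OF \<Phi> M1] by auto
  have "(\<integral>\<^sup>+t\<in>{0..2 * pi}. ennreal (\<bar>f t * g t\<bar> * \<omega> t) \<partial>lebesgue)
     \<le> (\<integral>\<^sup>+t. ennreal c * (ennreal (\<Phi> (f t) * \<omega> t) * indicator {0..2 * pi} t
          + ennreal (complementary M \<bar>g t\<bar> * \<omega> t) * indicator {0..2 * pi} t) \<partial>lebesgue)"
  proof (rule nn_integral_mono_AE)
    show "AE t in lebesgue. ennreal (\<bar>f t * g t\<bar> * \<omega> t) * indicator {0..2 * pi} t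
        \<le> ennreal c * (ennreal (\<Phi> (f t) * \<omega> t) * indicator {0..2 * pi} t
          + ennreal (complementary M \<bar>g t\<bar> * \<omega> t) * indicator {0..2 * pi} t)"
      using \<omega>
    proof eventually_elim
      case (elim t)
      have "\<bar>f t\<bar> / c * \<bar>g t\<bar> \<le> M (\<bar>f t\<bar> / c) + complementary M \<bar>g t\<bar>"
        using complementary_young[OF \<Phi> M1, of "\<bar>f t\<bar> / c" "\<bar>g t\<bar>"] M c by simp
      also have "\<dots> \<le> \<Phi> (f t) + complementary M \<bar>g t\<bar>"
        using M[of "\<bar>f t\<bar> / c"] c gauge_abs[OF \<Phi>] by simp
      finally have "\<bar>f t * g t\<bar> \<le> c * (\<Phi> (f t) + complementary M \<bar>g t\<bar>)"
        using c by (simp add: abs_mult field_simps)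
      then have "\<bar>f t * g t\<bar> * \<omega> t \<le> c * (\<Phi> (f t) + complementary M \<bar>g t\<bar>) * \<omega> t"
        using elim by (intro mult_right_mono) auto
      then have "\<bar>f t * g t\<bar> * \<omega> t \<le> c * (\<Phi> (f t) * \<omega> t + complementary M \<bar>g t\<bar> * \<omega> t)"
        by (simp add: algebra_simps)
      moreover have "0 \<le> complementary M \<bar>g t\<bar>"
        using complementary_young[OF \<Phi> M1, of 0 "\<bar>g t\<bar>"] M[of 0] \<Phi> by (simp add: gauge_function_def)
      ultimately show ?case using c elim gauge_nonneg[OF \<Phi>]
        by (auto simp: indicator_def simp flip: ennreal_plus ennreal_mult' intro!: ennreal_leI)
    qed
  qed
  also have "\<dots> = ennreal c * ((\<integral>\<^sup>+t\<in>{0..2 * pi}. ennreal (\<Phi> (f t) * \<omega> t) \<partial>lebesgue)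
      + (\<integral>\<^sup>+t\<in>{0..2 * pi}. ennreal (complementary M \<bar>g t\<bar> * \<omega> t) \<partial>lebesgue))"
    by (simp add: nn_integral_cmult nn_integral_add)
  also have "\<dots> \<le> ennreal c * (ennreal C + 1)"
    using le g by (intro mult_left_mono add_mono) auto
  also have "\<dots> = ennreal (c * (C + 1))"
    using c C by (simp add: ennreal_mult flip: ennreal_1 ennreal_plus)
  finally show "(\<integral>\<^sup>+t\<in>{0..2 * pi}. ennreal (\<bar>f t * g t\<bar> * \<omega> t) \<partial>lebesgue) \<le> ennreal (c * (C + 1))" .
qed

text \<open>
  The slope \<open>g\<close> of \<open>\<Phi>\<close> at \<open>\<bar>f\<bar>\<close> turns Young's inequality into an equality,
  \<open>\<bar>f\<bar> * g = \<Phi> f + Y\<close> with \<open>complementary M g \<le> Y\<close>. Let \<open>J\<close> be the integral of \<open>Y * \<omega>\<close>. If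
  \<open>J \<le> 1\<close>, then \<open>g\<close> is an admissible test function and already bounds the modular of \<open>f\<close> plus \<open>J\<close>
  by \<open>1\<close>. If \<open>J > 1\<close>, then \<open>g / J\<close> is admissible and bounds the same quantity by \<open>J\<close>, so that the
  modular is \<open>0\<close>; here \<open>J\<close> must be finite, which the boundedness of \<open>f\<close> ensures.
\<close>

lemma modular_le_one_bounded:
  assumes \<Phi>: "gauge_function \<Phi>" and M: "\<And>x. 0 \<le> x \<Longrightarrow> \<Phi> x \<le> M x"
    and [measurable]: "\<omega> \<in> borel_measurable lebesgue"
    and f: "f \<in> periodic_measurable"
    and \<omega>: "AE x in lebesgue. 0 < \<omega> x" and \<omega>i: "set_integrable lebesgue {0..2 * pi} \<omega>"
    and bd: "\<And>x. \<bar>f x\<bar> \<le> B"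
    and le: "orlicz_norm M \<omega> f \<le> 1"
  shows "(\<integral>\<^sup>+t\<in>{0..2 * pi}. ennreal (\<Phi> (f t) * \<omega> t) \<partial>lebesgue) \<le> 1"
proof -
  have [measurable]: "f \<in> borel_measurable lebesgue" and per: "\<And>x. f (x + 2 * pi) = f x"
    using f by (auto simp: periodic_measurable_def)
  have \<Phi>m [measurable]: "\<Phi> \<in> borel_measurable borel" by (rule gauge_measurable[OF \<Phi>])
  have sm [measurable]: "(\<lambda>x. gauge_slope \<Phi> \<bar>x\<bar>) \<in> borel_measurable borel" by (rule gauge_slope_measurable[OF \<Phi>])
  have B0: "0 \<le> B" using bd[of 0] by linarith
  define g where "g = (\<lambda>x. gauge_slope \<Phi> \<bar>f x\<bar>)"
  have [measurable]: "g \<in> borel_measurable lebesgue"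
    unfolding g_def by (rule measurable_compose[OF _ sm]) simp
  have g0: "0 \<le> g x" for x by (simp add: g_def gauge_slope_nonneg)
  define Y where "Y = (\<lambda>x. \<bar>f x\<bar> * g x - \<Phi> (f x))"
  have [measurable]: "Y \<in> borel_measurable lebesgue" unfolding Y_def by measurable
  have tan: "\<Phi> (f x) + g x * (y - \<bar>f x\<bar>) \<le> \<Phi> y" for x y
    using gauge_slope_tangent[OF \<Phi>, of "\<bar>f x\<bar>" y] gauge_abs[OF \<Phi>, of "f x"] by (simp add: g_def)
  have Y0: "0 \<le> Y x" for x using tan[of x 0] \<Phi> by (simp add: Y_def gauge_function_def algebra_simps)
  have young: "y * g x - M y \<le> Y x" if "0 \<le> y" for x y
    using tan[of x y] M[OF that] by (simp add: Y_def algebra_simps)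
  define J where "J = (\<integral>\<^sup>+t\<in>{0..2 * pi}. ennreal (Y t * \<omega> t) \<partial>lebesgue)"
  define P where "P = (\<integral>\<^sup>+t\<in>{0..2 * pi}. ennreal (\<Phi> (f t) * \<omega> t) \<partial>lebesgue)"
  have PJ: "P + J = (\<integral>\<^sup>+t\<in>{0..2 * pi}. ennreal (\<bar>f t * g t\<bar> * \<omega> t) \<partial>lebesgue)"
  proof -
    have "P + J = (\<integral>\<^sup>+t. ennreal (\<Phi> (f t) * \<omega> t) * indicator {0..2 * pi} t
        + ennreal (Y t * \<omega> t) * indicator {0..2 * pi} t \<partial>lebesgue)"
      unfolding P_def J_def by (rule nn_integral_add[symmetric]) measurable
    also have "\<dots> = (\<integral>\<^sup>+t\<in>{0..2 * pi}. ennreal (\<bar>f t * g t\<bar> * \<omega> t) \<partial>lebesgue)"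
    proof (rule nn_integral_cong_AE)
      show "AE t in lebesgue. ennreal (\<Phi> (f t) * \<omega> t) * indicator {0..2 * pi} t
        + ennreal (Y t * \<omega> t) * indicator {0..2 * pi} t
        = ennreal (\<bar>f t * g t\<bar> * \<omega> t) * indicator {0..2 * pi} t"
        using \<omega>
      proof eventually_elim
        case (elim t)
        have "\<Phi> (f t) * \<omega> t + Y t * \<omega> t = \<bar>f t * g t\<bar> * \<omega> t"
          using g0[of t] by (simp add: Y_def abs_mult algebra_simps)
        then show ?case using elim gauge_nonneg[OF \<Phi>] Y0[of t]
          by (auto simp: indicator_def simp flip: ennreal_plus)
      qed
    qed
    finally show ?thesis .
  qed
  have test: "(\<integral>\<^sup>+t\<in>{0..2 * pi}. ennreal (\<bar>f t * k t\<bar> * \<omega> t) \<partial>lebesgue) \<le> 1"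
    if "k \<in> periodic_measurable" "(\<integral>\<^sup>+t\<in>{0..2 * pi}. ennreal (complementary M \<bar>k t\<bar> * \<omega> t) \<partial>lebesgue) \<le> 1" for k
    using le that unfolding orlicz_norm_def by (auto dest: SUP_lessD simp: SUP_le_iff)
  have gper: "(\<lambda>x. s * g x) \<in> periodic_measurable" for s
    using per by (auto simp: periodic_measurable_def g_def[symmetric]) (simp add: g_def)
  have Jfin: "J < \<infinity>"
  proof -
    have Yb: "Y x \<le> B * gauge_slope \<Phi> B" for x
    proof -
      have "\<bar>f x\<bar> * g x \<le> B * gauge_slope \<Phi> B"
        using bd[of x] B0 g0 unfolding g_def by (intro mult_mono gauge_slope_mono[OF \<Phi>] gauge_slope_nonneg) auto
      then show ?thesis using gauge_nonneg[OF \<Phi>, of "f x"] by (simp add: Y_def)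
    qed
    have "J \<le> (\<integral>\<^sup>+t. ennreal (norm (B * gauge_slope \<Phi> B * (indicator {0..2 * pi} t * \<omega> t))) \<partial>lebesgue)"
      unfolding J_def
    proof (rule nn_integral_mono_AE)
      show "AE t in lebesgue. ennreal (Y t * \<omega> t) * indicator {0..2 * pi} t
          \<le> ennreal (norm (B * gauge_slope \<Phi> B * (indicator {0..2 * pi} t * \<omega> t)))"
        using \<omega>
      proof eventually_elim
        case (elim t)
        have "Y t * \<omega> t \<le> B * gauge_slope \<Phi> B * \<omega> t" using Yb elim by (intro mult_right_mono) auto
        then show ?case by (auto simp: indicator_def intro!: ennreal_leI)
      qed
    qed
    also have "\<dots> < \<infinity>"
    proof -
      have "integrable lebesgue (\<lambda>t. B * gauge_slope \<Phi> B * (indicator {0..2 * pi} t * \<omega> t))"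
        using \<omega>i by (intro integrable_mult_right) (simp add: set_integrable_def)
      then show ?thesis unfolding integrable_iff_bounded by simp
    qed
    finally show ?thesis .
  qed
  show ?thesis
  proof (cases "J \<le> 1")
    case True
    have "(\<integral>\<^sup>+t\<in>{0..2 * pi}. ennreal (complementary M \<bar>g t\<bar> * \<omega> t) \<partial>lebesgue) \<le> J"
      unfolding J_def
    proof (rule nn_integral_mono_AE)
      show "AE t in lebesgue. ennreal (complementary M \<bar>g t\<bar> * \<omega> t) * indicator {0..2 * pi} t
          \<le> ennreal (Y t * \<omega> t) * indicator {0..2 * pi} t"
        using \<omega> by eventually_elim
          (use g0 young in \<open>auto simp: indicator_def intro!: ennreal_leI mult_right_mono complementary_least\<close>)
    qed
    then have "P + J \<le> 1" unfolding PJ using True gper[of 1] by (intro test) auto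
    then show ?thesis unfolding P_def[symmetric] by (metis add.right_neutral add_left_mono order_trans zero_le)
  next
    case False
    then obtain j where j: "J = ennreal j" "1 < j"
      using Jfin by (cases J) auto
    have "(\<integral>\<^sup>+t\<in>{0..2 * pi}. ennreal (complementary M \<bar>1 / j * g t\<bar> * \<omega> t) \<partial>lebesgue)
       \<le> (\<integral>\<^sup>+t. ennreal (1 / j) * (ennreal (Y t * \<omega> t) * indicator {0..2 * pi} t) \<partial>lebesgue)"
    proof (rule nn_integral_mono_AE)
      show "AE t in lebesgue. ennreal (complementary M \<bar>1 / j * g t\<bar> * \<omega> t) * indicator {0..2 * pi} t
          \<le> ennreal (1 / j) * (ennreal (Y t * \<omega> t) * indicator {0..2 * pi} t)"
        using \<omega>
      proof eventually_elim
        case (elim t)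
        have "complementary M \<bar>1 / j * g t\<bar> \<le> 1 / j * Y t"
        proof (rule complementary_least)
          fix y :: real assume y: "0 \<le> y"
          have "M y / j \<le> M y"
            using j(2) M[OF y] gauge_nonneg[OF \<Phi>, of y] mult_right_mono[of 1 j "M y"]
            by (simp add: field_simps)
          then have "y * \<bar>1 / j * g t\<bar> - M y \<le> (y * g t - M y) / j"
            using g0[of t] j by (simp add: diff_divide_distrib)
          also have "\<dots> \<le> Y t / j" using young[OF y, of t] j by (intro divide_right_mono) auto
          finally show "y * \<bar>1 / j * g t\<bar> - M y \<le> 1 / j * Y t" by simp
        qed
        then have "complementary M \<bar>1 / j * g t\<bar> * \<omega> t \<le> 1 / j * (Y t * \<omega> t)"
          using mult_right_mono[of "complementary M \<bar>1 / j * g t\<bar>" "1 / j * Y t" "\<omega> t"] elim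
          by (simp only: mult.assoc less_imp_le)
        then have "ennreal (complementary M \<bar>1 / j * g t\<bar> * \<omega> t) \<le> ennreal (1 / j) * ennreal (Y t * \<omega> t)"
          using j by (subst ennreal_mult'[symmetric]) (auto intro!: ennreal_leI)
        then show ?case by (auto simp: indicator_def)
      qed
    qed
    also have "\<dots> = ennreal (1 / j) * J" unfolding J_def by (rule nn_integral_cmult) measurable
    also have "\<dots> = 1" using j by (simp flip: ennreal_mult)
    finally have "(\<integral>\<^sup>+t\<in>{0..2 * pi}. ennreal (\<bar>f t * (1 / j * g t)\<bar> * \<omega> t) \<partial>lebesgue) \<le> 1"
      by (intro test gper)
    moreover have "(\<integral>\<^sup>+t\<in>{0..2 * pi}. ennreal (\<bar>f t * (1 / j * g t)\<bar> * \<omega> t) \<partial>lebesgue)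
        = (\<integral>\<^sup>+t. ennreal (1 / j) * (ennreal (\<bar>f t * g t\<bar> * \<omega> t) * indicator {0..2 * pi} t) \<partial>lebesgue)"
    proof (intro nn_integral_cong)
      fix t
      have "\<bar>f t * (1 / j * g t)\<bar> * \<omega> t = 1 / j * (\<bar>f t * g t\<bar> * \<omega> t)" using j by (simp add: abs_mult)
      moreover have "ennreal (1 / j * (\<bar>f t * g t\<bar> * \<omega> t)) = ennreal (1 / j) * ennreal (\<bar>f t * g t\<bar> * \<omega> t)"
        using j by (intro ennreal_mult') auto
      ultimately show "ennreal (\<bar>f t * (1 / j * g t)\<bar> * \<omega> t) * indicator {0..2 * pi} t
        = ennreal (1 / j) * (ennreal (\<bar>f t * g t\<bar> * \<omega> t) * indicator {0..2 * pi} t)"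
        by (simp only: mult.assoc)
    qed
    moreover have "\<dots> = ennreal (1 / j) * (P + J)" unfolding PJ by (rule nn_integral_cmult) measurable
    ultimately have "ennreal (1 / j) * (P + J) \<le> 1" by simp
    then have "ennreal j * (ennreal (1 / j) * (P + J)) \<le> ennreal j * 1" by (intro mult_left_mono) auto
    then have "P + J \<le> J" using j by (simp flip: mult.assoc ennreal_mult')
    then have "P = 0" using Jfin by (metis add.commute add_0 ennreal_add_left_cancel_le infinity_ennreal_def le_zero_eq less_irrefl)
    then show ?thesis by (simp add: P_def)
  qed
qed

lemma modular_le_one:
  assumes \<Phi>: "gauge_function \<Phi>" and M: "\<And>x. 0 \<le> x \<Longrightarrow> \<Phi> x \<le> M x"
    and \<omega>m [measurable]: "\<omega> \<in> borel_measurable lebesgue"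
    and f: "f \<in> periodic_measurable"
    and \<omega>: "AE x in lebesgue. 0 < \<omega> x" and \<omega>i: "set_integrable lebesgue {0..2 * pi} \<omega>"
    and le: "orlicz_norm M \<omega> f \<le> 1"
  shows "(\<integral>\<^sup>+t\<in>{0..2 * pi}. ennreal (\<Phi> (f t) * \<omega> t) \<partial>lebesgue) \<le> 1"
proof -
  have fm [measurable]: "f \<in> borel_measurable lebesgue" and per: "\<And>x. f (x + 2 * pi) = f x"
    using f by (auto simp: periodic_measurable_def)
  have \<Phi>m [measurable]: "\<Phi> \<in> borel_measurable borel" by (rule gauge_measurable[OF \<Phi>])
  define h where "h = (\<lambda>k x. min \<bar>f x\<bar> (real k))"
  have hm [measurable]: "h k \<in> borel_measurable lebesgue" for k unfolding h_def by measurable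
  have hp: "h k \<in> periodic_measurable" for k using hm per by (auto simp: periodic_measurable_def h_def)
  have hn: "orlicz_norm M \<omega> (h k) \<le> 1" for k
  proof -
    have "orlicz_norm M \<omega> (h k) \<le> orlicz_norm M \<omega> f"
      by (rule orlicz_norm_mono) (auto simp: h_def fm)
    then show ?thesis using le by simp
  qed
  have bound: "(\<integral>\<^sup>+t\<in>{0..2 * pi}. ennreal (\<Phi> (h k t) * \<omega> t) \<partial>lebesgue) \<le> 1" for k
    by (rule modular_le_one_bounded[OF \<Phi> M \<omega>m hp \<omega> \<omega>i _ hn, where B = "real k"]) (auto simp: h_def)
  have "(\<integral>\<^sup>+t\<in>{0..2 * pi}. ennreal (\<Phi> (f t) * \<omega> t) \<partial>lebesgue)
      \<le> (\<integral>\<^sup>+t. (SUP k. ennreal (\<Phi> (h k t) * max 0 (\<omega> t)) * indicator {0..2 * pi} t) \<partial>lebesgue)"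
  proof (rule nn_integral_mono)
    fix t
    obtain k :: nat where k: "\<bar>f t\<bar> \<le> real k" using real_arch_simple by blast
    then have "h k t = \<bar>f t\<bar>" by (simp add: h_def)
    then have "ennreal (\<Phi> (f t) * \<omega> t) * indicator {0..2 * pi} t
        \<le> ennreal (\<Phi> (h k t) * max 0 (\<omega> t)) * indicator {0..2 * pi} t"
      using gauge_abs[OF \<Phi>] gauge_nonneg[OF \<Phi>] by (auto intro!: mult_right_mono ennreal_leI mult_left_mono)
    then show "ennreal (\<Phi> (f t) * \<omega> t) * indicator {0..2 * pi} t
        \<le> (SUP k. ennreal (\<Phi> (h k t) * max 0 (\<omega> t)) * indicator {0..2 * pi} t)"
      by (rule SUP_upper2[rotated]) simp
  qed
  also have "\<dots> = (SUP k. \<integral>\<^sup>+t\<in>{0..2 * pi}. ennreal (\<Phi> (h k t) * max 0 (\<omega> t)) \<partial>lebesgue)"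
  proof (rule nn_integral_monotone_convergence_SUP)
    show "incseq (\<lambda>k t. ennreal (\<Phi> (h k t) * max 0 (\<omega> t)) * indicator {0..2 * pi} t)"
      unfolding incseq_def le_fun_def
    proof (intro allI impI mult_right_mono ennreal_leI gauge_mono[OF \<Phi>])
      show "h m t \<le> h n t" if "m \<le> n" for m n t using that by (auto simp: h_def)
    qed (auto simp: h_def)
  qed measurable
  also have "\<dots> \<le> 1"
  proof (rule SUP_least)
    fix k
    have "(\<integral>\<^sup>+t\<in>{0..2 * pi}. ennreal (\<Phi> (h k t) * max 0 (\<omega> t)) \<partial>lebesgue)
       = (\<integral>\<^sup>+t\<in>{0..2 * pi}. ennreal (\<Phi> (h k t) * \<omega> t) \<partial>lebesgue)"
      by (rule nn_integral_cong_AE) (use \<omega> in eventually_elim, simp)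
    then show "(\<integral>\<^sup>+t\<in>{0..2 * pi}. ennreal (\<Phi> (h k t) * max 0 (\<omega> t)) \<partial>lebesgue) \<le> 1"
      using bound[of k] by simp
  qed
  finally show ?thesis .
qed

section \<open>Window means on the weighted Orlicz space\<close>

lemma lebesgue_distr_shift: "distr lebesgue lebesgue (\<lambda>x. s + x) = (lebesgue :: real measure)"
  using lebesgue_real_affine[of 1 s] by (simp add: density_1)

lemma measurable_shift_lebesgue: "(\<lambda>x. s + x) \<in> lebesgue \<rightarrow>\<^sub>M (lebesgue :: real measure)"
  using lebesgue_affine_measurable[of "\<lambda>_. 1::real" s] by simp

lemma set_nn_integral_shift:
  fixes a b s :: real
  assumes "F \<in> borel_measurable lebesgue"
  shows "(\<integral>\<^sup>+x\<in>{a + s..<b + s}. F x \<partial>lebesgue) = (\<integral>\<^sup>+x\<in>{a..<b}. F (s + x) \<partial>lebesgue)"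
proof -
  have "(\<integral>\<^sup>+x\<in>{a + s..<b + s}. F x \<partial>lebesgue)
      = (\<integral>\<^sup>+x. F (s + x) * indicator {a + s..<b + s} (s + x) \<partial>lebesgue)"
    using assms nn_integral_real_affine_lebesgue[of "\<lambda>x. F x * indicator {a + s..<b + s} x" 1 s] by simp
  also have "\<dots> = (\<integral>\<^sup>+x\<in>{a..<b}. F (s + x) \<partial>lebesgue)"
    by (intro nn_integral_cong) (auto simp: indicator_def)
  finally show ?thesis .
qed

lemma set_nn_integral_split:
  assumes [measurable]: "F \<in> borel_measurable lebesgue" and "a \<le> m" "m \<le> (b::real)"
  shows "(\<integral>\<^sup>+x\<in>{a..<b}. F x \<partial>lebesgue) = (\<integral>\<^sup>+x\<in>{a..<m}. F x \<partial>lebesgue) + (\<integral>\<^sup>+x\<in>{m..<b}. F x \<partial>lebesgue)"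
proof -
  have "(\<integral>\<^sup>+x\<in>{a..<b}. F x \<partial>lebesgue)
     = (\<integral>\<^sup>+x. F x * indicator {a..<m} x + F x * indicator {m..<b} x \<partial>lebesgue)"
    using assms by (intro nn_integral_cong) (auto simp: indicator_def)
  also have "\<dots> = (\<integral>\<^sup>+x\<in>{a..<m}. F x \<partial>lebesgue) + (\<integral>\<^sup>+x\<in>{m..<b}. F x \<partial>lebesgue)"
    by (rule nn_integral_add) measurable
  finally show ?thesis .
qed

lemma set_nn_integral_Icc: "(\<integral>\<^sup>+x\<in>{a..b}. F x \<partial>lebesgue) = (\<integral>\<^sup>+x\<in>{a..<b}. F x \<partial>lebesgue)" for a b :: real
  by (rule nn_integral_cong_AE) (use AE_lebesgue_neq[of b] in eventually_elim, auto simp: indicator_def)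

lemma set_nn_integral_cells:
  assumes F: "F \<in> borel_measurable lebesgue" and h: "0 \<le> (h::real)"
  shows "(\<Sum>j<n. \<integral>\<^sup>+x\<in>{a + real j * h..<a + real j * h + h}. F x \<partial>lebesgue) = (\<integral>\<^sup>+x\<in>{a..<a + real n * h}. F x \<partial>lebesgue)"
proof (induction n)
  case (Suc n)
  show ?case using Suc set_nn_integral_split[OF F, of a "a + real n * h" "a + real (Suc n) * h"] h
    by (simp add: algebra_simps)
qed simp

lemma periodic_set_nn_integral:
  assumes F: "F \<in> borel_measurable lebesgue" and per: "\<And>x. F (x + 2 * pi) = F x"
  shows "(\<integral>\<^sup>+x\<in>{a..<a + 2 * pi}. F x \<partial>lebesgue) = (\<integral>\<^sup>+x\<in>{0..<2 * pi}. F x \<partial>lebesgue)"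
proof -
  define G where "G = (\<lambda>a. \<integral>\<^sup>+x\<in>{a..<a + 2 * pi}. F x \<partial>lebesgue)"
  have step: "G (a + h) = G a" if h: "0 \<le> h" "h \<le> 2 * pi" for a h
  proof -
    have "G (a + h) = (\<integral>\<^sup>+x\<in>{a + h..<a + 2 * pi}. F x \<partial>lebesgue) + (\<integral>\<^sup>+x\<in>{a + 2 * pi..<a + h + 2 * pi}. F x \<partial>lebesgue)"
      unfolding G_def using h by (intro set_nn_integral_split[OF F]) auto
    also have "(\<integral>\<^sup>+x\<in>{a + 2 * pi..<a + h + 2 * pi}. F x \<partial>lebesgue) = (\<integral>\<^sup>+x\<in>{a..<a + h}. F x \<partial>lebesgue)"
      using per by (subst set_nn_integral_shift[OF F]) (simp add: add.commute)
    finally show ?thesis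
      unfolding G_def using set_nn_integral_split[OF F, of a "a + h" "a + 2 * pi"] h by (simp add: add.commute)
  qed
  have mult: "G (a + real n * h) = G a" if "0 \<le> h" "h \<le> 2 * pi" for a h n
  proof (induction n)
    case (Suc n)
    then show ?case using step[OF that, of "a + real n * h"] by (simp add: algebra_simps)
  qed simp
  have pos: "G (a + s) = G a" if s: "0 \<le> s" for a s
  proof -
    obtain n :: nat where n: "s / (2 * pi) < real n" using reals_Archimedean2 by blast
    have n0: "0 < real n" using n s by (smt (verit) divide_nonneg_pos pi_gt_zero)
    have "s / real n \<le> 2 * pi" using n n0 by (simp add: field_simps)
    then show ?thesis using mult[of "s / real n" a n] s n0 by simp
  qed
  have "G a = G 0"
    using pos[of a 0] pos[of "- a" a] by (cases "0 \<le> a") auto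
  then show ?thesis by (simp add: G_def)
qed

lemma periodic_set_nn_integral_multiple:
  assumes F: "F \<in> borel_measurable lebesgue" and per: "\<And>x. F (x + 2 * pi) = F x"
  shows "(\<integral>\<^sup>+x\<in>{a..<a + real n * (2 * pi)}. F x \<partial>lebesgue) = of_nat n * (\<integral>\<^sup>+x\<in>{0..<2 * pi}. F x \<partial>lebesgue)"
proof -
  have "(\<integral>\<^sup>+x\<in>{a..<a + real n * (2 * pi)}. F x \<partial>lebesgue)
     = (\<Sum>j<n. \<integral>\<^sup>+x\<in>{a + real j * (2 * pi)..<a + real j * (2 * pi) + 2 * pi}. F x \<partial>lebesgue)"
    by (rule set_nn_integral_cells[OF F, symmetric]) simp
  also have "\<dots> = (\<Sum>j<n. \<integral>\<^sup>+x\<in>{0..<2 * pi}. F x \<partial>lebesgue)"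
    by (intro sum.cong refl periodic_set_nn_integral[OF F per])
  finally show ?thesis by simp
qed

lemma L_per_iff_nn:
  "f \<in> L_per \<longleftrightarrow> f \<in> periodic_measurable \<and> (\<integral>\<^sup>+x\<in>{0..2 * pi}. ennreal \<bar>f x\<bar> \<partial>lebesgue) < \<infinity>"
proof -
  have "(\<integral>\<^sup>+x. ennreal (norm (indicator {0..2 * pi} x *\<^sub>R f x)) \<partial>lebesgue) = (\<integral>\<^sup>+x\<in>{0..2 * pi}. ennreal \<bar>f x\<bar> \<partial>lebesgue)"
    by (intro nn_integral_cong) (auto simp: indicator_def)
  then show ?thesis
    by (auto simp: L_per_def set_integrable_def integrable_iff_bounded periodic_measurable_def)
qed

lemma L_per_set_integrable:
  assumes f: "f \<in> L_per"
  shows "set_integrable lebesgue {a..b} f"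
proof -
  have m [measurable]: "f \<in> borel_measurable lebesgue" and per: "\<And>x. f (x + 2 * pi) = f x"
    using f by (auto simp: L_per_def periodic_measurable_def)
  have fin: "(\<integral>\<^sup>+x\<in>{0..<2 * pi}. ennreal \<bar>f x\<bar> \<partial>lebesgue) < \<infinity>"
    using f by (simp add: L_per_iff_nn set_nn_integral_Icc)
  obtain n :: nat where n: "(b - a) / (2 * pi) < real n" using reals_Archimedean2 by blast
  have "(\<integral>\<^sup>+x. ennreal (norm (indicator {a..b} x *\<^sub>R f x)) \<partial>lebesgue)
      \<le> (\<integral>\<^sup>+x\<in>{a..<a + real n * (2 * pi)}. ennreal \<bar>f x\<bar> \<partial>lebesgue)"
    using n by (intro nn_integral_mono) (auto simp: indicator_def field_simps)
  also have "\<dots> = of_nat n * (\<integral>\<^sup>+x\<in>{0..<2 * pi}. ennreal \<bar>f x\<bar> \<partial>lebesgue)"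
    using per by (intro periodic_set_nn_integral_multiple) auto
  also have "\<dots> < \<infinity>" using fin by (simp add: ennreal_mult_less_top of_nat_less_top)
  finally have "(\<integral>\<^sup>+x. ennreal (norm (indicator {a..b} x *\<^sub>R f x)) \<partial>lebesgue) < \<infinity>" .
  moreover have "(\<lambda>x. indicator {a..b} x *\<^sub>R f x) \<in> borel_measurable lebesgue" by measurable
  ultimately show ?thesis
    unfolding set_integrable_def integrable_iff_bounded by blast
qed

lemma set_nn_integral_abs_eq:
  assumes "set_integrable lebesgue {a..b} f"
  shows "(\<integral>\<^sup>+x\<in>{a..b}. ennreal \<bar>f x\<bar> \<partial>lebesgue) = ennreal (LINT x:{a..b}|lebesgue. \<bar>f x :: real\<bar>)"
proof -
  have "(\<integral>\<^sup>+x\<in>{a..b}. ennreal \<bar>f x\<bar> \<partial>lebesgue) = (\<integral>\<^sup>+x. ennreal (indicator {a..b} x *\<^sub>R \<bar>f x\<bar>) \<partial>lebesgue)"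
    by (intro nn_integral_cong) (auto simp: indicator_def)
  also have "\<dots> = ennreal (LINT x:{a..b}|lebesgue. \<bar>f x\<bar>)"
    unfolding set_lebesgue_integral_def
    using set_integrable_abs[OF assms] by (intro nn_integral_eq_integral) (auto simp: set_integrable_def)
  finally show ?thesis .
qed

text \<open>
  Minimizing the right-hand side of the hypothesis over \<open>l\<close> turns Young's inequality with a parameter
  into Hoelder's inequality. For \<open>x = 0\<close> the minimum is not attained; therefore the best \<open>l\<close> is taken
  for a larger value \<open>y\<close>, and \<open>y\<close> then decreases to \<open>x\<close>.
\<close>

lemma holder_parameter:
  fixes A x D q :: real
  assumes q: "1 < q" and A: "0 \<le> A" and x: "0 \<le> x" and D: "0 < D"
    and le: "\<And>l. 0 < l \<Longrightarrow> A \<le> l powr q * x / q + l powr (- (q / (q - 1))) * D / (q / (q - 1))"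
  shows "A powr q \<le> D powr (q - 1) * x"
proof -
  define q' where "q' = q / (q - 1)"
  have q': "1 < q'" "1 / q + 1 / q' = 1" using q by (auto simp: q'_def field_simps)
  have main: "A powr q \<le> D powr (q - 1) * y" if y: "x < y" for y
  proof -
    have y0: "0 < y" using x y by linarith
    define l where "l = (D / y) powr (1 / (q * q'))"
    have l: "0 < l" using D y0 by (simp add: l_def)
    have l1: "l powr q = (D / y) powr (1 / q')" using q q' by (simp add: l_def powr_powr)
    have l2: "l powr (- q') = (D / y) powr (- 1 / q)" using q q' by (simp add: l_def powr_powr)
    have "A \<le> l powr q * x / q + l powr (- q') * D / q'" using le[OF l] by (simp add: q'_def)
    also have "\<dots> \<le> l powr q * y / q + l powr (- q') * D / q'"
      using y q by (intro add_right_mono divide_right_mono mult_left_mono) auto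
    also have "l powr q * y = D powr (1 / q') * y powr (1 / q)"
    proof -
      have "1 / q = 1 - 1 / q'" using q' by simp
      then have "y powr (1 / q) = y / y powr (1 / q')" using y0 by (simp add: powr_diff)
      then show ?thesis using D y0 by (simp add: l1 powr_divide)
    qed
    also have "l powr (- q') * D = D powr (1 / q') * y powr (1 / q)"
    proof -
      have "1 / q' = 1 - 1 / q" using q' by simp
      then have "D powr (1 / q') = D / D powr (1 / q)" using D by (simp add: powr_diff)
      moreover have "(D / y) powr (- 1 / q) = y powr (1 / q) / D powr (1 / q)"
      proof -
        have "(D / y) powr (- 1 / q) = inverse ((D / y) powr (1 / q))"
          by (simp add: powr_minus flip: minus_divide_left)
        then show ?thesis using D y0 by (simp add: powr_divide)
      qed
      ultimately show ?thesis by (simp only: l2) simp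
    qed
    also have "D powr (1 / q') * y powr (1 / q) / q + D powr (1 / q') * y powr (1 / q) / q'
        = D powr (1 / q') * y powr (1 / q) * (1 / q + 1 / q')" by (simp add: distrib_left)
    finally have "A \<le> D powr (1 / q') * y powr (1 / q)" using q' by simp
    then have "A powr q \<le> (D powr (1 / q') * y powr (1 / q)) powr q"
      using A q by (intro powr_mono2) auto
    also have "\<dots> = D powr (q - 1) * y"
      using q y0 D by (simp add: powr_mult powr_powr q'_def)
    finally show ?thesis .
  qed
  have Dq: "0 < D powr (q - 1)" using D by simp
  have "A powr q / D powr (q - 1) \<le> x"
  proof (rule dense_ge)
    show "A powr q / D powr (q - 1) \<le> y" if "x < y" for y
      using main[OF that] Dq by (simp add: field_simps)
  qed
  then show ?thesis using Dq by (simp add: field_simps)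
qed

text \<open>
  Jensen's inequality bounds \<open>\<Psi>\<close> at the mean of \<open>\<bar>f\<bar>\<close> by the mean of \<open>\<Psi> f\<close>, Hoelder's inequality with
  exponents \<open>q\<close> and \<open>q / (q - 1)\<close> brings in the weight at the price of the integral of the dual weight,
  and the Muckenhoupt condition balances that integral against the integral of \<open>\<omega>\<close>.
\<close>

lemma weighted_jensen:
  fixes \<omega> f \<Psi> :: "real \<Rightarrow> real"
  assumes \<Psi>: "gauge_function \<Psi>" and q: "1 < q"
    and \<omega>m [measurable]: "\<omega> \<in> borel_measurable lebesgue" and \<omega>: "AE x in lebesgue. 0 < \<omega> x"
    and fm [measurable]: "f \<in> borel_measurable lebesgue" and fi: "set_integrable lebesgue {a..b} f"
    and ab: "a < b"
    and \<omega>i: "set_integrable lebesgue {a..b} \<omega>"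
    and \<sigma>i: "set_integrable lebesgue {a..b} (\<lambda>t. \<omega> t powr (- 1 / (q - 1)))"
    and C: "(1 / (b - a) * (LINT t:{a..b}|lebesgue. \<omega> t)) *
           (1 / (b - a) * (LINT t:{a..b}|lebesgue. \<omega> t powr (- 1 / (q - 1)))) powr (q - 1) \<le> C"
  shows "ennreal (\<Psi> ((LINT t:{a..b}|lebesgue. \<bar>f t\<bar>) / (b - a)) powr q) * (\<integral>\<^sup>+t\<in>{a..b}. ennreal (\<omega> t) \<partial>lebesgue)
    \<le> ennreal C * (\<integral>\<^sup>+t\<in>{a..b}. ennreal (\<Psi> (f t) powr q * \<omega> t) \<partial>lebesgue)"
proof -
  define W where "W = (LINT t:{a..b}|lebesgue. \<omega> t)"
  define D where "D = (LINT t:{a..b}|lebesgue. \<omega> t powr (- 1 / (q - 1)))"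
  define m where "m = (LINT t:{a..b}|lebesgue. \<bar>f t\<bar>) / (b - a)"
  define X where "X = (\<integral>\<^sup>+t\<in>{a..b}. ennreal (\<Psi> (f t) powr q * \<omega> t) \<partial>lebesgue)"
  have \<Psi>m [measurable]: "\<Psi> \<in> borel_measurable borel" by (rule gauge_measurable[OF \<Psi>])
  have \<Psi>0: "0 \<le> \<Psi> x" for x by (rule gauge_nonneg[OF \<Psi>])
  have WD: "0 < W" "0 < D"
    unfolding W_def D_def using \<omega> \<omega>i \<sigma>i ab
    by (auto intro!: set_integral_pos simp: powr_def elim: eventually_mono)
  have m0: "0 \<le> m" unfolding m_def set_lebesgue_integral_def using ab
    by (intro divide_nonneg_pos integral_nonneg_AE) auto
  have CW: "(W / (b - a)) * (D / (b - a)) powr (q - 1) \<le> C" using C by (simp add: W_def D_def)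
  moreover have "0 < (W / (b - a)) * (D / (b - a)) powr (q - 1)" using WD ab by simp
  ultimately have C0: "0 < C" by linarith
  have Wn: "(\<integral>\<^sup>+t\<in>{a..b}. ennreal (\<omega> t) \<partial>lebesgue) = ennreal W"
  proof -
    have "(\<integral>\<^sup>+t\<in>{a..b}. ennreal (\<omega> t) \<partial>lebesgue) = (\<integral>\<^sup>+t. ennreal (indicator {a..b} t *\<^sub>R \<omega> t) \<partial>lebesgue)"
      by (intro nn_integral_cong) (auto simp: indicator_def)
    also have "\<dots> = ennreal W" unfolding W_def set_lebesgue_integral_def
      using \<omega>i \<omega> by (intro nn_integral_eq_integral)
        (auto simp: set_integrable_def indicator_def elim: eventually_mono)
    finally show ?thesis .
  qed
  show ?thesis
  proof (cases "X = \<infinity>")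
    case True
    then show ?thesis using C0 unfolding X_def by (simp add: ennreal_mult_top)
  next
    case False
    define x where "x = enn2real X"
    have Xx: "X = ennreal x" and x0: "0 \<le> x" using False by (auto simp: x_def less_top)
    have nn: "AE t in lebesgue. 0 \<le> indicator {a..b} t *\<^sub>R (\<Psi> (f t) powr q * \<omega> t)"
      using \<omega> by eventually_elim (auto simp: indicator_def)
    have Xn: "(\<integral>\<^sup>+t. ennreal (indicator {a..b} t *\<^sub>R (\<Psi> (f t) powr q * \<omega> t)) \<partial>lebesgue) = ennreal x"
      unfolding Xx[symmetric] X_def by (intro nn_integral_cong) (auto simp: indicator_def)
    have Gi: "set_integrable lebesgue {a..b} (\<lambda>t. \<Psi> (f t) powr q * \<omega> t)"
      unfolding set_integrable_def by (rule integrableI_nn_integral_finite[OF _ nn Xn]) measurable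
    have Gx: "(LINT t:{a..b}|lebesgue. \<Psi> (f t) powr q * \<omega> t) = x"
      unfolding set_lebesgue_integral_def
      using nn_integral_eq_integral[OF Gi[unfolded set_integrable_def] nn] Xn x0 integral_nonneg_AE[OF nn]
      by simp
    have young: "AE t in lebesgue. \<Psi> (f t) \<le> l powr q / q * (\<Psi> (f t) powr q * \<omega> t)
        + l powr (- (q / (q - 1))) / (q / (q - 1)) * (\<omega> t powr (- 1 / (q - 1)))" if l: "0 < l" for l
      using \<omega>
    proof eventually_elim
      case (elim t)
      have "\<Psi> (f t) = (l * \<Psi> (f t) * \<omega> t powr (1 / q)) * (1 / l * \<omega> t powr (- 1 / q))"
        using l elim by (simp add: powr_minus_divide minus_divide_left[symmetric])
      also have "\<dots> \<le> (l * \<Psi> (f t) * \<omega> t powr (1 / q)) powr q / q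
          + (1 / l * \<omega> t powr (- 1 / q)) powr (q / (q - 1)) / (q / (q - 1))"
        using q l \<Psi>0[of "f t"] by (intro Youngs_inequality) (auto simp: field_simps)
      also have "(l * \<Psi> (f t) * \<omega> t powr (1 / q)) powr q = l powr q * (\<Psi> (f t) powr q * \<omega> t)"
        using l elim \<Psi>0[of "f t"] q by (simp add: powr_mult powr_powr)
      also have "(1 / l * \<omega> t powr (- 1 / q)) powr (q / (q - 1))
          = l powr (- (q / (q - 1))) * (\<omega> t powr (- 1 / (q - 1)))"
        using l elim q by (simp add: powr_mult powr_powr powr_divide powr_minus_divide)
      finally show ?case by (simp add: mult_ac)
    qed
    have rhsi: "set_integrable lebesgue {a..b} (\<lambda>t. l powr q / q * (\<Psi> (f t) powr q * \<omega> t)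
        + l powr (- (q / (q - 1))) / (q / (q - 1)) * (\<omega> t powr (- 1 / (q - 1))))" for l
      by (intro set_integral_add set_integrable_mult_right Gi \<sigma>i)
    have Fi: "set_integrable lebesgue {a..b} (\<lambda>t. \<Psi> (f t))"
    proof (rule set_integrable_bound[OF rhsi[of 1]])
      show "set_borel_measurable lebesgue {a..b} (\<lambda>t. \<Psi> (f t))"
        unfolding set_borel_measurable_def by measurable
      show "AE t in lebesgue. t \<in> {a..b} \<longrightarrow> norm (\<Psi> (f t)) \<le> norm (1 powr q / q * (\<Psi> (f t) powr q * \<omega> t)
        + 1 powr (- (q / (q - 1))) / (q / (q - 1)) * (\<omega> t powr (- 1 / (q - 1))))"
        using young[of 1, simplified] by eventually_elim (use \<Psi>0 in auto)
    qed
    define A where "A = (b - a) * \<Psi> m"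
    have A0: "0 \<le> A" using ab \<Psi>0[of m] by (simp add: A_def)
    (* Jensen's inequality, with the tangent of \<Psi> at the mean m. *)
    have AF: "A \<le> (LINT t:{a..b}|lebesgue. \<Psi> (f t))"
    proof -
      define k where "k = gauge_slope \<Psi> m"
      have j: "set_integrable lebesgue {a..b} (\<lambda>t. k * \<bar>f t\<bar>)" "set_integrable lebesgue {a..b} (\<lambda>t. \<Psi> m - k * m)"
        using set_integrable_abs[OF fi] by (auto intro: set_integrable_const_Icc)
      have "(LINT t:{a..b}|lebesgue. k * \<bar>f t\<bar> + (\<Psi> m - k * m)) = k * ((b - a) * m) + (b - a) * (\<Psi> m - k * m)"
      proof -
        have "(LINT t:{a..b}|lebesgue. \<bar>f t\<bar>) = (b - a) * m" using ab by (simp add: m_def)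
        moreover have "(LINT t:{a..b}|lebesgue. \<Psi> m - k * m) = (b - a) * (\<Psi> m - k * m)"
          using ab by (simp add: set_lebesgue_integral_def)
        ultimately show ?thesis using set_integral_add(2)[OF j] by simp
      qed
      also have "\<dots> = A" by (simp add: A_def algebra_simps)
      finally have "A = (LINT t:{a..b}|lebesgue. k * \<bar>f t\<bar> + (\<Psi> m - k * m))" by simp
      also have "\<dots> \<le> (LINT t:{a..b}|lebesgue. \<Psi> (f t))"
      proof (rule set_integral_mono)
        show "k * \<bar>f t\<bar> + (\<Psi> m - k * m) \<le> \<Psi> (f t)" for t
          using gauge_slope_tangent[OF \<Psi> m0, of "\<bar>f t\<bar>"] gauge_abs[OF \<Psi>, of "f t"]
          by (simp add: k_def algebra_simps)
      qed (use j Fi set_integral_add(1)[OF j] in auto)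
      finally show ?thesis .
    qed
    have "A powr q \<le> D powr (q - 1) * x"
    proof (rule holder_parameter[OF q A0 x0 WD(2)])
      fix l :: real assume l: "0 < l"
      have "A \<le> (LINT t:{a..b}|lebesgue. \<Psi> (f t))" by (rule AF)
      also have "\<dots> \<le> (LINT t:{a..b}|lebesgue. l powr q / q * (\<Psi> (f t) powr q * \<omega> t)
        + l powr (- (q / (q - 1))) / (q / (q - 1)) * (\<omega> t powr (- 1 / (q - 1))))"
        by (rule set_integral_mono_AE[OF Fi rhsi]) (use young[OF l] in \<open>auto elim: eventually_mono\<close>)
      also have "\<dots> = l powr q / q * x + l powr (- (q / (q - 1))) / (q / (q - 1)) * D"
      proof -
        have "(LINT t:{a..b}|lebesgue. u * (\<Psi> (f t) powr q * \<omega> t) + v * (\<omega> t powr (- 1 / (q - 1)))) = u * x + v * D"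
          for u v
          using set_integral_add(2)[OF set_integrable_mult_right[OF Gi] set_integrable_mult_right[OF \<sigma>i], of u v]
          by (simp add: Gx D_def)
        then show ?thesis .
      qed
      finally show "A \<le> l powr q * x / q + l powr (- (q / (q - 1))) * D / (q / (q - 1))" by (simp add: mult_ac)
    qed
    then have "(b - a) powr q * \<Psi> m powr q \<le> D powr (q - 1) * x"
      using ab \<Psi>0[of m] by (simp add: A_def powr_mult)
    then have "\<Psi> m powr q \<le> D powr (q - 1) * x / (b - a) powr q"
      using ab by (simp add: pos_le_divide_eq mult.commute)
    then have "\<Psi> m powr q * W \<le> D powr (q - 1) * x / (b - a) powr q * W"
      using WD by (intro mult_right_mono) auto
    also have "\<dots> = (W / (b - a)) * (D / (b - a)) powr (q - 1) * x"
    proof -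
      have "(b - a) powr q = (b - a) * (b - a) powr (q - 1)"
        using ab powr_add[of "b - a" 1 "q - 1"] by simp
      then show ?thesis using WD ab by (simp add: powr_divide)
    qed
    also have "\<dots> \<le> C * x" using CW x0 by (rule mult_right_mono)
    finally have "\<Psi> m powr q * W \<le> C * x" .
    then have "ennreal (\<Psi> m powr q) * ennreal W \<le> ennreal C * ennreal x"
      using C0 x0 WD by (simp add: ennreal_leI flip: ennreal_mult)
    then show ?thesis unfolding Wn using Xx by (simp add: X_def m_def)
  qed
qed

text \<open>
  Homogeneous estimates only have to be proved on the unit ball. The form with a scaling factor also
  covers the cases in which \<open>N\<close> is \<open>0\<close> or infinite.
\<close>

lemma ennreal_le_of_scaling:
  assumes A: "0 < A" and le: "\<And>s. 0 < s \<Longrightarrow> ennreal s * N \<le> 1 \<Longrightarrow> ennreal s * P \<le> ennreal A"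
  shows "P \<le> ennreal A * N"
proof (cases N)
  case (real r)
  show ?thesis
  proof (rule ennreal_le_epsilon)
    fix e :: real assume e: "0 < e"
    define s where "s = A / (A * r + e)"
    have den: "0 < A * r + e" using A real e by (simp add: add_nonneg_pos)
    have s: "0 < s" using A den by (simp add: s_def)
    have "s * r \<le> 1" using den e by (simp add: s_def)
    then have "ennreal s * N \<le> 1" using real s ennreal_leI[of "s * r" 1] by (simp add: ennreal_mult)
    then have "ennreal (1 / s) * (ennreal s * P) \<le> ennreal (1 / s) * ennreal A"
      using le[OF s] by (intro mult_left_mono) auto
    also have "ennreal (1 / s) * (ennreal s * P) = P"
    proof -
      have "ennreal (1 / s) * ennreal s = 1" using s ennreal_mult[of "1 / s" s] by simp
      then show ?thesis by (simp only: mult.assoc[symmetric] mult_1)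
    qed
    also have "ennreal (1 / s) * ennreal A = ennreal (A * r + e)"
    proof -
      have "1 / s * A = A * r + e" using A den by (simp add: s_def)
      then show ?thesis using s A ennreal_mult[of "1 / s" A] by simp
    qed
    also have "\<dots> = ennreal A * N + ennreal e"
      using A real e by (simp add: ennreal_mult)
    finally show "P \<le> ennreal A * N + ennreal e" .
  qed
next
  case top
  then show ?thesis using A by (simp add: ennreal_mult_top)
qed

text \<open>
  The line is cut into cells of length \<open>h = 2 * pi / N\<close>, and \<open>\<bar>f\<bar>\<close> is averaged over each cell and its
  two neighbours. The window around a point \<open>x\<close> thus contains every interval of radius at most \<open>h\<close>
  centred at \<open>x\<close>, and yet there are only \<open>N\<close> windows in a period.
\<close>

definition window_mean :: "nat \<Rightarrow> (real \<Rightarrow> real) \<Rightarrow> real \<Rightarrow> real" where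
  "window_mean N f x = (let h = 2 * pi / real N; j = real_of_int \<lfloor>x / h\<rfloor>
     in (LINT t:{(j - 1) * h..(j + 2) * h}|lebesgue. \<bar>f t\<bar>) / (3 * h))"

lemma window_mean_measurable: "window_mean N f \<in> borel_measurable lebesgue"
proof -
  define G where "G = (\<lambda>j::int. (LINT t:{(real_of_int j - 1) * (2 * pi / real N)..(real_of_int j + 2) * (2 * pi / real N)}|lebesgue. \<bar>f t\<bar>) / (3 * (2 * pi / real N)))"
  have "(\<lambda>x. \<lfloor>x / (2 * pi / real N)\<rfloor>) \<in> borel \<rightarrow>\<^sub>M count_space UNIV" by measurable
  then have "(\<lambda>x. G \<lfloor>x / (2 * pi / real N)\<rfloor>) \<in> borel_measurable borel"
    by (rule measurable_compose) simp
  moreover have "window_mean N f = (\<lambda>x. G \<lfloor>x / (2 * pi / real N)\<rfloor>)"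
    by (auto simp: window_mean_def G_def Let_def)
  ultimately show ?thesis using borel_imp_lebesgue_measurable by simp
qed

lemma window_mean_cmult: "window_mean N (\<lambda>x. s * f x) x = \<bar>s\<bar> * window_mean N f x"
  by (simp add: window_mean_def Let_def abs_mult)

lemma set_nn_integral_cmult_indep:
  assumes [measurable]: "F \<in> borel_measurable lebesgue" and "0 \<le> k"
  shows "(\<integral>\<^sup>+x\<in>{a..<b}. ennreal (k * F x) \<partial>lebesgue) = ennreal k * (\<integral>\<^sup>+x\<in>{a..<b::real}. ennreal (F x) \<partial>lebesgue)"
  using assms by (simp add: ennreal_mult' mult.assoc nn_integral_cmult)

text \<open>
  What the hypotheses on \<open>M\<close> and \<open>\<omega>\<close> amount to: up to a dilation of the argument \<open>M\<close> is the \<open>q\<close>-th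
  power of a convex function, with an exponent \<open>q\<close> for which the weight satisfies the Muckenhoupt
  condition.
\<close>

locale muckenhoupt_gauge =
  fixes M \<omega> \<Psi> :: "real \<Rightarrow> real" and q c C :: real
  assumes \<Psi>: "gauge_function \<Psi>" and q: "1 < q"
    and M: "0 \<le> x \<Longrightarrow> \<Psi> x powr q \<le> M x \<and> M x \<le> \<Psi> (c * x) powr q"
    and c: "0 < c"
    and \<omega>: "weight \<omega>"
    and Aq: "0 < b - a \<Longrightarrow> b - a \<le> 2 * pi \<Longrightarrow>
           set_integrable lebesgue {a..b} \<omega> \<and>
           set_integrable lebesgue {a..b} (\<lambda>t. \<omega> t powr (- 1 / (q - 1))) \<and>
           (1 / (b - a) * (LINT t:{a..b}|lebesgue. \<omega> t)) *
           (1 / (b - a) * (LINT t:{a..b}|lebesgue. \<omega> t powr (- 1 / (q - 1)))) powr (q - 1) \<le> C"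
begin

lemma \<omega>_measurable [measurable]: "\<omega> \<in> borel_measurable lebesgue"
  and \<omega>_periodic: "\<omega> (x + 2 * pi) = \<omega> x"
  and \<omega>_pos: "AE x in lebesgue. 0 < \<omega> x"
  using \<omega> by (auto simp: weight_def periodic_measurable_def)

lemma \<omega>_integrable: "set_integrable lebesgue {0..2 * pi} \<omega>"
  using Aq[of "2 * pi" 0] by simp

lemma C_nonneg: "0 \<le> C"
proof -
  have "0 \<le> (1 / (2 * pi - 0) * (LINT t:{0..2 * pi}|lebesgue. \<omega> t)) *
           (1 / (2 * pi - 0) * (LINT t:{0..2 * pi}|lebesgue. \<omega> t powr (- 1 / (q - 1)))) powr (q - 1)"
    using set_integral_pos[OF \<omega>_integrable _ \<omega>_pos] by (intro mult_nonneg_nonneg) auto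
  also have "\<dots> \<le> C" using Aq[of "2 * pi" 0] by simp
  finally show ?thesis .
qed

definition \<Phi> :: "real \<Rightarrow> real" where "\<Phi> x = \<Psi> x powr q"

lemma \<Phi>_gauge: "gauge_function \<Phi>"
  unfolding \<Phi>_def[abs_def] using \<Psi> q by (intro gauge_powr) auto

lemma \<Phi>_measurable [measurable]: "\<Phi> \<in> borel_measurable borel"
  by (rule gauge_measurable[OF \<Phi>_gauge])

lemma M_bounds: "0 \<le> x \<Longrightarrow> \<Phi> x \<le> M x \<and> M x \<le> \<Phi> (c * x)"
  using M by (simp add: \<Phi>_def)

lemma modular_interval_mean:
  assumes [measurable]: "f \<in> borel_measurable lebesgue" and "set_integrable lebesgue {a..b} f" "a < b" "b - a \<le> 2 * pi"
  shows "ennreal (\<Phi> ((LINT t:{a..b}|lebesgue. \<bar>f t\<bar>) / (b - a))) * (\<integral>\<^sup>+t\<in>{a..b}. ennreal (\<omega> t) \<partial>lebesgue)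
    \<le> ennreal C * (\<integral>\<^sup>+t\<in>{a..b}. ennreal (\<Phi> (f t) * \<omega> t) \<partial>lebesgue)"
  unfolding \<Phi>_def
  by (rule weighted_jensen[OF \<Psi> q]) (use assms Aq[of b a] \<omega>_pos in auto)

text \<open>
  \<open>modular_interval_mean\<close> is applied on every window. Each cell lies in three windows, hence the factor
  \<open>3\<close>; for \<open>N \<ge> 3\<close> a window is not longer than the period.
\<close>

lemma modular_window_mean:
  assumes f: "f \<in> L_per" and N: "3 \<le> N"
  shows "(\<integral>\<^sup>+t\<in>{0..2 * pi}. ennreal (\<Phi> (window_mean N f t) * \<omega> t) \<partial>lebesgue)
     \<le> ennreal (3 * C) * (\<integral>\<^sup>+t\<in>{0..2 * pi}. ennreal (\<Phi> (f t) * \<omega> t) \<partial>lebesgue)"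
proof -
  have fm [measurable]: "f \<in> borel_measurable lebesgue" and per: "\<And>x. f (x + 2 * pi) = f x"
    using f by (auto simp: L_per_def periodic_measurable_def)
  note [measurable] = window_mean_measurable
  define h where "h = 2 * pi / real N"
  have h: "0 < h" "real N * h = 2 * pi" "3 * h \<le> 2 * pi" using N by (auto simp: h_def field_simps)
  define F where "F = (\<lambda>t. ennreal (\<Phi> (f t) * \<omega> t))"
  have Fm [measurable]: "F \<in> borel_measurable lebesgue" unfolding F_def by measurable
  have Fper: "F (x + 2 * pi) = F x" for x by (simp add: F_def per \<omega>_periodic)
  define G where "G = (\<lambda>t. ennreal (\<Phi> (window_mean N f t) * \<omega> t))"
  have Gm [measurable]: "G \<in> borel_measurable lebesgue" unfolding G_def by measurable
  define P where "P = (\<integral>\<^sup>+t\<in>{0..<2 * pi}. F t \<partial>lebesgue)"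
  have cells: "(\<Sum>j<N. \<integral>\<^sup>+x\<in>{a + real j * h..<a + real j * h + h}. F x \<partial>lebesgue) = P" for a
    using set_nn_integral_cells[OF Fm, of h a N] periodic_set_nn_integral[OF Fm Fper, of a] h
    by (simp add: P_def)
  have cell: "(\<integral>\<^sup>+t\<in>{0 + real j * h..<0 + real j * h + h}. G t \<partial>lebesgue)
     \<le> ennreal C * ((\<integral>\<^sup>+x\<in>{- h + real j * h..<- h + real j * h + h}. F x \<partial>lebesgue)
       + ((\<integral>\<^sup>+x\<in>{0 + real j * h..<0 + real j * h + h}. F x \<partial>lebesgue)
         + (\<integral>\<^sup>+x\<in>{h + real j * h..<h + real j * h + h}. F x \<partial>lebesgue)))" for j
  proof -
    define a where "a = (real j - 1) * h"
    define b where "b = (real j + 2) * h"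
    have ab: "a < b" "b - a = 3 * h" using h by (auto simp: a_def b_def algebra_simps)
    define m where "m = (LINT t:{a..b}|lebesgue. \<bar>f t\<bar>) / (b - a)"
    have wm: "window_mean N f t = m" if "t \<in> {0 + real j * h..<0 + real j * h + h}" for t
    proof -
      have "\<lfloor>t / h\<rfloor> = int j" using that h by (intro floor_unique) (auto simp: field_simps)
      then show ?thesis using ab by (simp add: window_mean_def Let_def m_def a_def b_def flip: h_def)
    qed
    have "(\<integral>\<^sup>+t\<in>{0 + real j * h..<0 + real j * h + h}. G t \<partial>lebesgue)
        = (\<integral>\<^sup>+t\<in>{0 + real j * h..<0 + real j * h + h}. ennreal (\<Phi> m * \<omega> t) \<partial>lebesgue)"
      by (intro nn_integral_cong) (auto simp: indicator_def G_def wm)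
    also have "\<dots> = ennreal (\<Phi> m) * (\<integral>\<^sup>+t\<in>{0 + real j * h..<0 + real j * h + h}. ennreal (\<omega> t) \<partial>lebesgue)"
      by (rule set_nn_integral_cmult_indep) (auto simp: gauge_nonneg[OF \<Phi>_gauge])
    also have "\<dots> \<le> ennreal (\<Phi> m) * (\<integral>\<^sup>+t\<in>{a..b}. ennreal (\<omega> t) \<partial>lebesgue)"
      using h by (intro mult_left_mono nn_integral_mono) (auto simp: indicator_def a_def b_def algebra_simps)
    also have "\<dots> \<le> ennreal C * (\<integral>\<^sup>+t\<in>{a..b}. F t \<partial>lebesgue)"
      unfolding m_def F_def using ab h L_per_set_integrable[OF f] by (intro modular_interval_mean) auto
    also have "(\<integral>\<^sup>+t\<in>{a..b}. F t \<partial>lebesgue) = (\<integral>\<^sup>+t\<in>{a..<b}. F t \<partial>lebesgue)" by (rule set_nn_integral_Icc)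
    also have "\<dots> = (\<integral>\<^sup>+t\<in>{a..<a + h}. F t \<partial>lebesgue) + (\<integral>\<^sup>+t\<in>{a + h..<b}. F t \<partial>lebesgue)"
      using ab h by (intro set_nn_integral_split) auto
    also have "(\<integral>\<^sup>+t\<in>{a + h..<b}. F t \<partial>lebesgue)
       = (\<integral>\<^sup>+t\<in>{a + h..<a + 2 * h}. F t \<partial>lebesgue) + (\<integral>\<^sup>+t\<in>{a + 2 * h..<b}. F t \<partial>lebesgue)"
      using ab h by (intro set_nn_integral_split) auto
    finally show ?thesis by (simp add: a_def b_def algebra_simps)
  qed
  have "(\<integral>\<^sup>+t\<in>{0..2 * pi}. G t \<partial>lebesgue) = (\<Sum>j<N. \<integral>\<^sup>+t\<in>{0 + real j * h..<0 + real j * h + h}. G t \<partial>lebesgue)"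
    using set_nn_integral_cells[OF Gm, of h 0 N] h by (simp add: set_nn_integral_Icc)
  also have "\<dots> \<le> (\<Sum>j<N. ennreal C * ((\<integral>\<^sup>+x\<in>{- h + real j * h..<- h + real j * h + h}. F x \<partial>lebesgue)
       + ((\<integral>\<^sup>+x\<in>{0 + real j * h..<0 + real j * h + h}. F x \<partial>lebesgue)
         + (\<integral>\<^sup>+x\<in>{h + real j * h..<h + real j * h + h}. F x \<partial>lebesgue))))"
    by (intro sum_mono cell)
  also have "\<dots> = ennreal C * (P + (P + P))"
    by (simp only: sum_distrib_left[symmetric] sum.distrib cells)
  also have "\<dots> = ennreal (3 * C) * P"
  proof -
    have "(3::ennreal) = 1 + (1 + 1)" by simp
    then have "P + (P + P) = 3 * P" by (simp only: distrib_right mult_1)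
    moreover have "ennreal (3 * C) = 3 * ennreal C" using ennreal_mult'[of 3 C] by simp
    ultimately show ?thesis by (simp add: mult_ac)
  qed
  finally show ?thesis by (simp add: G_def F_def P_def set_nn_integral_Icc)
qed

lemma norm_window_mean:
  assumes f: "f \<in> L_per" and N: "3 \<le> N"
  shows "orlicz_norm M \<omega> (window_mean N f) \<le> ennreal (c * (3 * C + 1)) * orlicz_norm M \<omega> f"
proof (rule ennreal_le_of_scaling)
  have fm [measurable]: "f \<in> borel_measurable lebesgue" and per: "\<And>x. f (x + 2 * pi) = f x"
    using f by (auto simp: L_per_def periodic_measurable_def)
  show "0 < c * (3 * C + 1)" using c C_nonneg by simp
  fix s :: real assume s: "0 < s" and le: "ennreal s * orlicz_norm M \<omega> f \<le> 1"
  define u where "u = (\<lambda>x. s * f x)"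
  have um [measurable]: "u \<in> borel_measurable lebesgue" unfolding u_def by measurable
  have u: "u \<in> periodic_measurable" using per um by (auto simp: periodic_measurable_def u_def)
  have uL: "u \<in> L_per" using f u by (auto simp: L_per_def u_def)
  have "orlicz_norm M \<omega> u \<le> 1" using le s orlicz_norm_cmult[of \<omega> f M s] by (simp add: u_def)
  then have m1: "(\<integral>\<^sup>+t\<in>{0..2 * pi}. ennreal (\<Phi> (u t) * \<omega> t) \<partial>lebesgue) \<le> 1"
    using M_bounds by (intro modular_le_one[OF \<Phi>_gauge _ \<omega>_measurable u \<omega>_pos \<omega>_integrable]) auto
  have "(\<integral>\<^sup>+t\<in>{0..2 * pi}. ennreal (\<Phi> (window_mean N u t) * \<omega> t) \<partial>lebesgue) \<le> ennreal (3 * C) * 1"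
    by (rule order_trans[OF modular_window_mean[OF uL N]]) (intro mult_left_mono m1, simp)
  then have "orlicz_norm M \<omega> (window_mean N u) \<le> ennreal (c * (3 * C + 1))"
    using C_nonneg by (intro orlicz_norm_le_modular[OF \<Phi>_gauge M_bounds c \<omega>_measurable window_mean_measurable \<omega>_pos]) auto
  moreover have "window_mean N u = (\<lambda>x. s * window_mean N f x)"
    using s by (auto simp: u_def window_mean_cmult)
  ultimately show "ennreal s * orlicz_norm M \<omega> (window_mean N f) \<le> ennreal (c * (3 * C + 1))"
    using orlicz_norm_cmult[OF \<omega>_measurable window_mean_measurable, of M s] s by simp
qed

text \<open>
  On the unit ball, \<open>modular_interval_mean\<close> for the whole period bounds \<open>\<Phi>\<close> at the mean of \<open>\<bar>f\<bar>\<close>, and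
  the superlinear growth of \<open>\<Phi>\<close> then bounds the mean. Truncation removes the integrability of \<open>f\<close> that
  the use of its mean presupposes.
\<close>

lemma L1_le_norm:
  obtains A where "0 < A" "\<And>f. f \<in> periodic_measurable \<Longrightarrow>
    (\<integral>\<^sup>+t\<in>{0..2 * pi}. ennreal \<bar>f t\<bar> \<partial>lebesgue) \<le> ennreal A * orlicz_norm M \<omega> f"
proof -
  define W where "W = (LINT t:{0..2 * pi}|lebesgue. \<omega> t)"
  have W: "0 < W" unfolding W_def by (rule set_integral_pos[OF \<omega>_integrable _ \<omega>_pos]) simp
  have Wn: "(\<integral>\<^sup>+t\<in>{0..2 * pi}. ennreal (\<omega> t) \<partial>lebesgue) = ennreal W"
  proof -
    have "(\<integral>\<^sup>+t\<in>{0..2 * pi}. ennreal (\<omega> t) \<partial>lebesgue) = (\<integral>\<^sup>+t\<in>{0..2 * pi}. ennreal \<bar>\<omega> t\<bar> \<partial>lebesgue)"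
      by (rule nn_integral_cong_AE) (use \<omega>_pos in eventually_elim, simp)
    also have "\<dots> = ennreal (LINT t:{0..2 * pi}|lebesgue. \<bar>\<omega> t\<bar>)"
      by (rule set_nn_integral_abs_eq[OF \<omega>_integrable])
    also have "(LINT t:{0..2 * pi}|lebesgue. \<bar>\<omega> t\<bar>) = W"
      unfolding W_def
    proof (rule set_lebesgue_integral_cong_AE)
      show "AE x\<in>{0..2 * pi} in lebesgue. \<bar>\<omega> x\<bar> = \<omega> x"
        using \<omega>_pos by eventually_elim simp
    qed simp_all
    finally show ?thesis .
  qed
  obtain X where X: "0 < X" "\<And>x. X \<le> x \<Longrightarrow> 1 * x \<le> \<Phi> x" using gauge_large[OF \<Phi>_gauge] by blast
  define m0 where "m0 = max X (C / W)"
  have m0: "0 < m0" using X by (simp add: m0_def)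
  have bounded: "(\<integral>\<^sup>+t\<in>{0..2 * pi}. ennreal \<bar>f t\<bar> \<partial>lebesgue) \<le> ennreal (2 * pi * m0)"
    if f: "f \<in> periodic_measurable" and bd: "\<And>x. \<bar>f x\<bar> \<le> B" and n1: "orlicz_norm M \<omega> f \<le> 1" for f B
  proof -
    have fm [measurable]: "f \<in> borel_measurable lebesgue" using f by (auto simp: periodic_measurable_def)
    have fi: "set_integrable lebesgue {0..2 * pi} f"
      by (rule set_integrable_bound[OF set_integrable_const_Icc[of 0 "2 * pi" B]])
         (use bd in \<open>auto simp: set_borel_measurable_def intro: order_trans[OF _ abs_ge_self]\<close>)
    define m where "m = (LINT t:{0..2 * pi}|lebesgue. \<bar>f t\<bar>) / (2 * pi - 0)"
    have "ennreal (\<Phi> m) * ennreal W \<le> ennreal C * (\<integral>\<^sup>+t\<in>{0..2 * pi}. ennreal (\<Phi> (f t) * \<omega> t) \<partial>lebesgue)"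
      unfolding m_def Wn[symmetric] using fi by (intro modular_interval_mean) auto
    also have "\<dots> \<le> ennreal C * 1"
      using M_bounds n1 by (intro mult_left_mono modular_le_one[OF \<Phi>_gauge _ \<omega>_measurable f \<omega>_pos \<omega>_integrable]) auto
    finally have "\<Phi> m * W \<le> C"
      using W C_nonneg gauge_nonneg[OF \<Phi>_gauge] by (simp flip: ennreal_mult)
    then have "\<Phi> m \<le> C / W" using W by (simp add: field_simps)
    then have "X \<le> m \<longrightarrow> m \<le> C / W" using X(2)[of m] by linarith
    then have "m \<le> m0" unfolding m0_def le_max_iff_disj by linarith
    then have "(LINT t:{0..2 * pi}|lebesgue. \<bar>f t\<bar>) \<le> 2 * pi * m0"
      using pi_gt_zero by (simp add: m_def pos_divide_le_eq mult.commute)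
    then show ?thesis unfolding set_nn_integral_abs_eq[OF fi] by (rule ennreal_leI)
  qed
  have unit: "(\<integral>\<^sup>+t\<in>{0..2 * pi}. ennreal \<bar>f t\<bar> \<partial>lebesgue) \<le> ennreal (2 * pi * m0)"
    if f: "f \<in> periodic_measurable" and n1: "orlicz_norm M \<omega> f \<le> 1" for f
  proof -
    have fm [measurable]: "f \<in> borel_measurable lebesgue" and per: "\<And>x. f (x + 2 * pi) = f x"
      using f by (auto simp: periodic_measurable_def)
    define h where "h = (\<lambda>k x. min \<bar>f x\<bar> (real k))"
    have hm [measurable]: "h k \<in> borel_measurable lebesgue" for k unfolding h_def by measurable
    have hp: "h k \<in> periodic_measurable" for k using hm per by (auto simp: periodic_measurable_def h_def)
    have hn: "orlicz_norm M \<omega> (h k) \<le> 1" for k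
      by (rule order_trans[OF orlicz_norm_mono n1]) (auto simp: h_def)
    have hb: "(\<integral>\<^sup>+t\<in>{0..2 * pi}. ennreal (h k t) \<partial>lebesgue) \<le> ennreal (2 * pi * m0)" for k
      using bounded[OF hp _ hn, of k "real k"] by (auto simp: h_def min_def cong: if_cong)
    have "(\<integral>\<^sup>+t\<in>{0..2 * pi}. ennreal \<bar>f t\<bar> \<partial>lebesgue)
        \<le> (\<integral>\<^sup>+t. (SUP k. ennreal (h k t) * indicator {0..2 * pi} t) \<partial>lebesgue)"
    proof (rule nn_integral_mono)
      fix t
      obtain k :: nat where k: "\<bar>f t\<bar> \<le> real k" using real_arch_simple by blast
      then have "h k t = \<bar>f t\<bar>" by (simp add: h_def)
      then show "ennreal \<bar>f t\<bar> * indicator {0..2 * pi} t \<le> (SUP k. ennreal (h k t) * indicator {0..2 * pi} t)"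
        by (intro SUP_upper2[of k]) auto
    qed
    also have "\<dots> = (SUP k. \<integral>\<^sup>+t\<in>{0..2 * pi}. ennreal (h k t) \<partial>lebesgue)"
    proof (rule nn_integral_monotone_convergence_SUP)
      show "incseq (\<lambda>k t. ennreal (h k t) * indicator {0..2 * pi} t)"
        unfolding incseq_def le_fun_def
        by (intro allI impI mult_right_mono ennreal_leI) (auto simp: h_def)
    qed measurable
    also have "\<dots> \<le> ennreal (2 * pi * m0)" using hb by (intro SUP_least)
    finally show ?thesis .
  qed
  show thesis
  proof (rule that[of "2 * pi * m0"])
    show A: "0 < 2 * pi * m0" using m0 by simp
    fix f assume f: "f \<in> periodic_measurable"
    then have fm [measurable]: "f \<in> borel_measurable lebesgue" and per: "\<And>x. f (x + 2 * pi) = f x"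
      by (auto simp: periodic_measurable_def)
    show "(\<integral>\<^sup>+t\<in>{0..2 * pi}. ennreal \<bar>f t\<bar> \<partial>lebesgue) \<le> ennreal (2 * pi * m0) * orlicz_norm M \<omega> f"
    proof (rule ennreal_le_of_scaling[OF A])
      fix s :: real assume s: "0 < s" and le: "ennreal s * orlicz_norm M \<omega> f \<le> 1"
      have "(\<lambda>x. s * f x) \<in> periodic_measurable" using per by (auto simp: periodic_measurable_def)
      then have "(\<integral>\<^sup>+t\<in>{0..2 * pi}. ennreal \<bar>s * f t\<bar> \<partial>lebesgue) \<le> ennreal (2 * pi * m0)"
        using le s orlicz_norm_cmult[of \<omega> f M s] by (intro unit) auto
      moreover have "(\<integral>\<^sup>+t\<in>{0..2 * pi}. ennreal \<bar>s * f t\<bar> \<partial>lebesgue)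
          = ennreal s * (\<integral>\<^sup>+t\<in>{0..2 * pi}. ennreal \<bar>f t\<bar> \<partial>lebesgue)"
        using s by (simp add: abs_mult ennreal_mult' mult.assoc nn_integral_cmult)
      ultimately show "ennreal s * (\<integral>\<^sup>+t\<in>{0..2 * pi}. ennreal \<bar>f t\<bar> \<partial>lebesgue) \<le> ennreal (2 * pi * m0)"
        by simp
    qed
  qed
qed

lemma orlicz_space_if_norm_finite:
  assumes f: "f \<in> periodic_measurable" and fin: "orlicz_norm M \<omega> f < \<infinity>"
  shows "f \<in> orlicz_space M \<omega>"
proof -
  have fm [measurable]: "f \<in> borel_measurable lebesgue" and per: "\<And>x. f (x + 2 * pi) = f x"
    using f by (auto simp: periodic_measurable_def)
  define r where "r = enn2real (orlicz_norm M \<omega> f)"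
  have r: "orlicz_norm M \<omega> f = ennreal r" "0 \<le> r" using fin by (auto simp: r_def less_top)
  define s where "s = 1 / (r + 1)"
  have s: "0 < s" "s * r \<le> 1" using r by (auto simp: s_def field_simps)
  define v where "v = (\<lambda>x. s * f x)"
  have v: "v \<in> periodic_measurable" using per by (auto simp: periodic_measurable_def v_def)
  have "orlicz_norm M \<omega> v \<le> 1"
    using orlicz_norm_cmult[of \<omega> f M s] s r by (simp add: v_def flip: ennreal_mult)
  then have m1: "(\<integral>\<^sup>+t\<in>{0..2 * pi}. ennreal (\<Phi> (v t) * \<omega> t) \<partial>lebesgue) \<le> 1"
    using M_bounds by (intro modular_le_one[OF \<Phi>_gauge _ \<omega>_measurable v \<omega>_pos \<omega>_integrable]) auto
  define w where "w = (\<lambda>x. s / c * f x)"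
  have w: "w \<in> periodic_measurable" using per by (auto simp: periodic_measurable_def w_def)
  have "(\<integral>\<^sup>+t\<in>{0..2 * pi}. ennreal (M \<bar>w t\<bar> * \<omega> t) \<partial>lebesgue) \<le> (\<integral>\<^sup>+t\<in>{0..2 * pi}. ennreal (\<Phi> (v t) * \<omega> t) \<partial>lebesgue)"
  proof (rule nn_integral_mono_AE)
    show "AE t in lebesgue. ennreal (M \<bar>w t\<bar> * \<omega> t) * indicator {0..2 * pi} t
      \<le> ennreal (\<Phi> (v t) * \<omega> t) * indicator {0..2 * pi} t"
      using \<omega>_pos
    proof eventually_elim
      case (elim t)
      have "M \<bar>w t\<bar> \<le> \<Phi> (c * \<bar>w t\<bar>)" using M_bounds[of "\<bar>w t\<bar>"] by simp
      also have "c * \<bar>w t\<bar> = \<bar>v t\<bar>" using c s by (simp add: w_def v_def abs_mult)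
      also have "\<Phi> \<bar>v t\<bar> = \<Phi> (v t)" by (rule gauge_abs[OF \<Phi>_gauge])
      finally show ?case using elim by (auto intro!: mult_right_mono ennreal_leI)
    qed
  qed
  with m1 have wc: "w \<in> orlicz_class M \<omega>" using w by (auto simp: orlicz_class_def le_less_trans)
  have "f = (\<lambda>x. \<Sum>i<1::nat. (\<lambda>_. c / s) i * (\<lambda>_. w) i x)" using c s by (auto simp: w_def)
  with wc show ?thesis unfolding orlicz_space_def
    by (intro CollectI exI[of _ "1::nat"] exI[of _ "\<lambda>_. c / s"] exI[of _ "\<lambda>_. w"]) simp
qed

lemma orlicz_space_L_per:
  assumes "f \<in> orlicz_space M \<omega>"
  shows "f \<in> L_per"
proof -
  obtain A where A: "0 < A" "\<And>f. f \<in> periodic_measurable \<Longrightarrow>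
    (\<integral>\<^sup>+t\<in>{0..2 * pi}. ennreal \<bar>f t\<bar> \<partial>lebesgue) \<le> ennreal A * orlicz_norm M \<omega> f"
    using L1_le_norm by blast
  have base: "u \<in> L_per" if u: "u \<in> orlicz_class M \<omega>" for u
  proof -
    have um: "u \<in> borel_measurable lebesgue" and up: "u \<in> periodic_measurable"
      using u by (auto simp: orlicz_class_def periodic_measurable_def)
    have "(\<integral>\<^sup>+t\<in>{0..2 * pi}. ennreal (\<Phi> (u t) * \<omega> t) \<partial>lebesgue) \<le> (\<integral>\<^sup>+t\<in>{0..2 * pi}. ennreal (M \<bar>u t\<bar> * \<omega> t) \<partial>lebesgue)"
    proof (rule nn_integral_mono_AE)
      show "AE t in lebesgue. ennreal (\<Phi> (u t) * \<omega> t) * indicator {0..2 * pi} t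
        \<le> ennreal (M \<bar>u t\<bar> * \<omega> t) * indicator {0..2 * pi} t"
        using \<omega>_pos
        by eventually_elim (use M_bounds[of "\<bar>u _\<bar>"] gauge_abs[OF \<Phi>_gauge] in
          \<open>auto intro!: mult_right_mono ennreal_leI\<close>)
    qed
    also have "\<dots> < \<infinity>" using u by (simp add: orlicz_class_def)
    finally have fin: "(\<integral>\<^sup>+t\<in>{0..2 * pi}. ennreal (\<Phi> (u t) * \<omega> t) \<partial>lebesgue) < \<infinity>" .
    define D where "D = enn2real (\<integral>\<^sup>+t\<in>{0..2 * pi}. ennreal (\<Phi> (u t) * \<omega> t) \<partial>lebesgue)"
    have D: "0 \<le> D" "(\<integral>\<^sup>+t\<in>{0..2 * pi}. ennreal (\<Phi> (u t) * \<omega> t) \<partial>lebesgue) \<le> ennreal D"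
      using fin by (simp_all add: D_def)
    have "orlicz_norm M \<omega> u \<le> ennreal (c * (D + 1))"
      by (rule orlicz_norm_le_modular[OF \<Phi>_gauge M_bounds c \<omega>_measurable um \<omega>_pos D(2,1)])
    then have "ennreal A * orlicz_norm M \<omega> u < \<infinity>"
      by (auto simp: ennreal_mult_less_top intro: le_less_trans)
    then show ?thesis using A(2)[OF up] up by (auto simp: L_per_iff_nn intro: le_less_trans)
  qed
  obtain m c' u where u: "\<And>i. i < (m::nat) \<Longrightarrow> u i \<in> orlicz_class M \<omega>" and f: "f = (\<lambda>x. \<Sum>i<m. c' i * u i x)"
    using assms by (auto simp: orlicz_space_def)
  have L: "u i \<in> L_per" if "i < m" for i using base[OF u[OF that]] .
  have "f \<in> borel_measurable lebesgue"
    unfolding f using L by (intro borel_measurable_sum borel_measurable_times) (auto simp: L_per_def periodic_measurable_def)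
  moreover have "f (x + 2 * pi) = f x" for x
    unfolding f using L by (intro sum.cong) (auto simp: L_per_def periodic_measurable_def)
  moreover have "set_integrable lebesgue {0..2 * pi} f"
  proof -
    have "integrable lebesgue (\<lambda>x. \<Sum>i<m. indicator {0..2 * pi} x *\<^sub>R (c' i * u i x))"
    proof (rule Bochner_Integration.integrable_sum)
      fix i assume "i \<in> {..<m}"
      then have "set_integrable lebesgue {0..2 * pi} (\<lambda>x. c' i * u i x)"
        using L[of i] by (intro set_integrable_mult_right) (auto simp: L_per_def)
      then show "integrable lebesgue (\<lambda>x. indicator {0..2 * pi} x *\<^sub>R (c' i * u i x))"
        by (simp add: set_integrable_def)
    qed
    then show ?thesis unfolding f set_integrable_def by (simp add: sum_distrib_left)
  qed
  ultimately show ?thesis by (auto simp: L_per_def periodic_measurable_def)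
qed

end

section \<open>Reduction from the index of the Young function\<close>

lemma young_function_gauge:
  assumes "young_function \<Phi>"
  shows "gauge_function \<Phi>"
proof -
  have cont: "isCont \<Phi> 0" and lim: "((\<lambda>x. \<Phi> x / x) \<longlongrightarrow> 0) (at 0)"
    using assms by (auto simp: young_function_def continuous_on_eq_continuous_at)
  have "((\<lambda>x. \<Phi> x / x * x) \<longlongrightarrow> 0) (at 0)"
    using tendsto_mult[OF lim tendsto_ident_at] by simp
  then have "(\<Phi> \<longlongrightarrow> 0) (at 0)"
    by (rule Lim_transform_eventually) (auto simp: eventually_at_filter)
  moreover have "(\<Phi> \<longlongrightarrow> \<Phi> 0) (at 0)" using cont by (simp add: isCont_def)
  ultimately have "\<Phi> 0 = 0" using tendsto_unique[of "at (0::real)"] by fastforce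
  then show ?thesis using assms by (auto simp: young_function_def gauge_function_def)
qed

lemma quasiconvex_youngE:
  assumes "M \<in> quasiconvex_young"
  obtains \<Phi> c where "gauge_function \<Phi>" "1 < c" "\<And>x. 0 \<le> x \<Longrightarrow> \<Phi> x \<le> M x \<and> M x \<le> \<Phi> (c * x)"
  using assms unfolding quasiconvex_young_def by (auto dest: young_function_gauge)

lemma delta2_power_bound:
  fixes M :: "real \<Rightarrow> real" and c :: real
  assumes c: "0 \<le> c" "\<And>x. 0 \<le> x \<Longrightarrow> M (2 * x) \<le> c * M x" and M: "\<And>x::real. 0 \<le> x \<Longrightarrow> 0 \<le> M x"
  shows "M (2 ^ k) \<le> c ^ k * M 1"
proof (induction k)
  case (Suc k)
  have "M (2 ^ Suc k) \<le> c * M (2 ^ k)" using c(2)[of "2 ^ k"] by simp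
  also have "\<dots> \<le> c * (c ^ k * M 1)" using Suc c(1) by (auto intro: mult_left_mono)
  finally show ?case by simp
qed simp

text \<open>
  \<open>M powr p\<close> grows superlinearly, but by \<open>delta2\<close> at most like \<open>(c powr p) ^ k\<close> along \<open>2 ^ k\<close>. This
  keeps the admissible exponents \<open>p\<close> away from \<open>0\<close>, so that the index is finite.
\<close>

lemma delta2_exponent_bound:
  fixes M :: "real \<Rightarrow> real" and c :: real
  assumes c: "0 < c" "\<And>x. 0 \<le> x \<Longrightarrow> M (2 * x) \<le> c * M x" and M: "\<And>x::real. 0 \<le> x \<Longrightarrow> 0 \<le> M x"
    and p: "0 < p" "(\<lambda>x. M x powr p) \<in> quasiconvex_young"
  shows "2 \<le> c powr p"
proof (rule ccontr)
  assume neg: "\<not> 2 \<le> c powr p"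
  obtain \<Phi> d where \<Phi>: "gauge_function \<Phi>" and le: "\<And>x. 0 \<le> x \<Longrightarrow> \<Phi> x \<le> M x powr p"
    using quasiconvex_youngE[OF p(2)] by metis
  define K where "K = M 1 powr p"
  obtain X where X: "0 < X" "\<And>x. X \<le> x \<Longrightarrow> (K + 1) * x \<le> \<Phi> x" using gauge_large[OF \<Phi>] by blast
  obtain k :: nat where k: "X < 2 ^ k" using real_arch_pow[of 2 X] by auto
  have "(K + 1) * 2 ^ k \<le> \<Phi> (2 ^ k)" using X(2)[of "2 ^ k"] k by simp
  also have "\<dots> \<le> M (2 ^ k) powr p" using le by simp
  also have "\<dots> \<le> (c ^ k * M 1) powr p"
    using delta2_power_bound[of c M k] c M p by (intro powr_mono2) auto
  also have "\<dots> = (c powr p) ^ k * K"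
    using c M[of 1] by (simp add: powr_mult K_def powr_powr mult.commute flip: powr_realpow)
  also have "\<dots> \<le> 2 ^ k * K" using neg by (intro mult_right_mono power_mono) (auto simp: K_def)
  finally have "(2::real) ^ k \<le> 0" by (simp add: algebra_simps)
  then show False using zero_less_power[of "2::real" k] by linarith
qed

text \<open>
  Openness yields \<open>q\<close> below the index with \<open>\<omega> \<in> muckenhoupt q\<close>. As \<open>1 / q\<close> exceeds the infimum of
  the admissible exponents, there is an admissible \<open>s < 1 / q\<close>. If \<open>\<Phi>\<close> is comparable to \<open>M powr s\<close>,
  then \<open>\<Phi> powr (1 / s)\<close> is comparable to \<open>M\<close>, and it is the \<open>q\<close>-th power of \<open>\<Phi> powr (1 / (s * q))\<close>,
  which is convex because the exponent is at least \<open>1\<close>.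
\<close>

theorem young_index_reduction:
  assumes M: "M \<in> quasiconvex_young_theta2" and \<omega>: "\<omega> \<in> muckenhoupt (young_index M)"
  obtains \<Psi> q c C where "muckenhoupt_gauge M \<omega> \<Psi> q c C"
proof -
  define S where "S = {p. 0 < p \<and> (\<lambda>x. M x powr p) \<in> quasiconvex_young}"
  have Mn: "\<And>x. 0 \<le> x \<Longrightarrow> 0 \<le> M x" and d2: "delta2 M"
    using M by (auto simp: quasiconvex_young_theta2_def quasiconvex_young_def)
  obtain \<theta> where \<theta>: "\<theta> \<in> S" "\<theta> < 1" using M by (auto simp: quasiconvex_young_theta2_def S_def)
  obtain d where d: "0 < d" "\<And>x. 0 \<le> x \<Longrightarrow> M (2 * x) \<le> d * M x" using d2 by (auto simp: delta2_def)
  have bd: "bdd_below S" by (rule bdd_belowI[of _ 0]) (auto simp: S_def)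
  have I1: "Inf S < 1" using cInf_lower[OF \<theta>(1) bd] \<theta>(2) by simp
  have low: "ln 2 \<le> p * ln d" if "p \<in> S" for p
  proof -
    have "2 \<le> d powr p" using delta2_exponent_bound[of d M p] d Mn that by (simp add: S_def)
    then show ?thesis using ln_le_cancel_iff[of 2 "d powr p"] d(1) by (simp add: ln_powr)
  qed
  have "0 < \<theta> * ln d" using low[OF \<theta>(1)] ln_gt_zero[of "2::real"] by linarith
  then have lnd: "0 < ln d" using \<theta>(1) by (simp add: S_def zero_less_mult_iff)
  have "ln 2 / ln d \<le> Inf S" using \<theta>(1) low lnd by (intro cInf_greatest) (auto simp: field_simps)
  moreover have "0 < ln 2 / ln d" using lnd by simp
  ultimately have I0: "0 < Inf S" by linarith
  have p1: "1 < young_index M" using I0 I1 by (simp add: young_index_def S_def[symmetric])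
  obtain q where q: "1 < q" "q < young_index M" "\<omega> \<in> muckenhoupt q" using muckenhoupt_open[OF p1 \<omega>] by blast
  have "Inf S < 1 / q" using q I0 by (simp add: young_index_def S_def[symmetric] field_simps)
  then obtain s where s: "s \<in> S" "s < 1 / q" using cInf_lessD[of S "1 / q"] \<theta>(1) by blast
  have s0: "0 < s" using s by (simp add: S_def)
  obtain \<Phi> c where \<Phi>: "gauge_function \<Phi>" and c: "1 < c"
    and le: "\<And>x. 0 \<le> x \<Longrightarrow> \<Phi> x \<le> M x powr s \<and> M x powr s \<le> \<Phi> (c * x)"
    using quasiconvex_youngE s(1) unfolding S_def by (metis (mono_tags, lifting) mem_Collect_eq)
  define e where "e = 1 / (s * q)"
  have e: "1 \<le> e" using s(2) s0 q by (simp add: e_def field_simps)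
  have eq: "e * q = 1 / s" using q by (simp add: e_def)
  have root: "(M x powr s) powr (1 / s) = M x" if "0 \<le> x" for x
    using s0 Mn[OF that] by (simp add: powr_powr)
  obtain C where W: "weight \<omega>" and C: "\<And>a b. 0 < b - a \<Longrightarrow> b - a \<le> 2 * pi \<Longrightarrow>
           set_integrable lebesgue {a..b} \<omega> \<and>
           set_integrable lebesgue {a..b} (\<lambda>t. \<omega> t powr (- 1 / (q - 1))) \<and>
           (1 / (b - a) * (LINT t:{a..b}|lebesgue. \<omega> t)) *
           (1 / (b - a) * (LINT t:{a..b}|lebesgue. \<omega> t powr (- 1 / (q - 1)))) powr (q - 1) \<le> C"
    using q(3) unfolding muckenhoupt_def by blast
  have "muckenhoupt_gauge M \<omega> (\<lambda>x. \<Phi> x powr e) q c C"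
  proof
    show "gauge_function (\<lambda>x. \<Phi> x powr e)" by (rule gauge_powr[OF \<Phi> e])
    show "(\<Phi> x powr e) powr q \<le> M x \<and> M x \<le> (\<Phi> (c * x) powr e) powr q" if x: "0 \<le> x" for x
    proof -
      have "\<Phi> x powr (1 / s) \<le> (M x powr s) powr (1 / s)"
        using le[OF x] s0 gauge_nonneg[OF \<Phi>] by (intro powr_mono2) auto
      moreover have "(M x powr s) powr (1 / s) \<le> \<Phi> (c * x) powr (1 / s)"
        using le[OF x] s0 by (intro powr_mono2) auto
      ultimately have "\<Phi> x powr (1 / s) \<le> M x \<and> M x \<le> \<Phi> (c * x) powr (1 / s)"
        unfolding root[OF x] by blast
      then show ?thesis unfolding powr_powr eq .
    qed
  qed (use c q W C in auto)
  then show thesis by (rule that)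
qed

section \<open>Fourier multipliers dominated by window means\<close>

lemma one_minus_cos_ge:
  fixes t :: real
  assumes "\<bar>t\<bar> \<le> pi"
  shows "t\<^sup>2 / 16 \<le> 1 - cos t"
proof -
  have nonneg: "s\<^sup>2 / 16 \<le> 1 - cos s" if s: "0 < s" "s \<le> pi" for s :: real
  proof (cases "s \<le> 2")
    case True
    obtain u where "cos s = (\<Sum>m<4. cos_coeff m * s ^ m) + cos (u + 1 / 2 * real 4 * pi) / fact 4 * s ^ 4"
      using Maclaurin_cos_expansion2[of s 4] s by auto
    then have "cos s = 1 - s\<^sup>2 / 2 + cos (u + 2 * pi) / 24 * s ^ 4"
    proof -
      have "(\<Sum>m<4. F m) = F 0 + F 1 + F 2 + F 3" for F :: "nat \<Rightarrow> real" by (simp add: eval_nat_numeral)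
      then show ?thesis using \<open>cos s = _\<close> by (simp add: cos_coeff_def fact_numeral)
    qed
    also have "\<dots> \<le> 1 - s\<^sup>2 / 2 + 1 / 24 * s ^ 4"
      by (intro add_left_mono mult_right_mono divide_right_mono) auto
    finally have "s\<^sup>2 / 2 - s ^ 4 / 24 \<le> 1 - cos s" by simp
    moreover have "s ^ 4 \<le> 4 * s\<^sup>2"
    proof -
      have "s\<^sup>2 \<le> 2\<^sup>2" using True s by (intro power_mono) auto
      then have "s\<^sup>2 * s\<^sup>2 \<le> 4 * s\<^sup>2" by (intro mult_right_mono) auto
      then show ?thesis by (simp add: power2_eq_square power4_eq_xxxx mult.assoc)
    qed
    ultimately show ?thesis using zero_le_power2[of s] by linarith
  next
    case False
    then have "cos s \<le> cos 2" using s by (intro cos_monotone_0_pi_le) auto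
    then have "1 \<le> 1 - cos s" using cos_two_less_zero by linarith
    moreover have "s\<^sup>2 \<le> 4\<^sup>2" using s pi_less_4 by (intro power_mono) auto
    ultimately show ?thesis by simp
  qed
  show ?thesis
    using nonneg[of t] nonneg[of "- t"] assms by (cases "0 < t"; cases "t = 0") auto
qed

lemma green_summation:
  fixes m c :: "nat \<Rightarrow> real"
  shows "(\<Sum>k<n. (m (k + 2) - 2 * m (k + 1) + m k) * c (k + 1))
    = (\<Sum>k<n. m (k + 1) * (c (k + 2) - 2 * c (k + 1) + c k))
      + (m (n + 1) * c n - m n * c (n + 1)) - (m 1 * c 0 - m 0 * c 1)"
  by (induction n) (simp_all add: algebra_simps)

definition trig_kernel :: "(nat \<Rightarrow> real) \<Rightarrow> real \<Rightarrow> nat \<Rightarrow> real \<Rightarrow> real" where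
  "trig_kernel m \<gamma> L t = (\<Sum>k=1..L. m k * cos (real k * t - \<gamma>))"

text \<open>
  The absolute sum of all second differences of a sequence \<open>m\<close> that vanishes beyond \<open>L\<close> and is
  extended by \<open>0\<close> to negative indices. For
  \<open>m 0 = 0\<close> the second difference centred at \<open>0\<close> is \<open>m 1\<close>, which is the separate term.
\<close>

definition second_variation :: "(nat \<Rightarrow> real) \<Rightarrow> nat \<Rightarrow> real" where
  "second_variation m L = \<bar>m 1\<bar> + (\<Sum>k\<le>L. \<bar>m (k + 2) - 2 * m (k + 1) + m k\<bar>)"

lemma trig_kernel_le_sum: "\<bar>trig_kernel m \<gamma> L t\<bar> \<le> (\<Sum>k=1..L. \<bar>m k\<bar>)"
proof -
  have "\<bar>trig_kernel m \<gamma> L t\<bar> \<le> (\<Sum>k=1..L. \<bar>m k * cos (real k * t - \<gamma>)\<bar>)"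
    unfolding trig_kernel_def by (rule sum_abs)
  also have "\<dots> \<le> (\<Sum>k=1..L. \<bar>m k\<bar> * 1)"
    unfolding abs_mult by (intro sum_mono mult_left_mono) auto
  finally show ?thesis by simp
qed

text \<open>
  Multiplying the kernel by \<open>2 * (1 - cos t)\<close>, which is at least \<open>t\<^sup>2 / 8\<close>, replaces its coefficients by
  their negative second differences; this is summation by parts, applied twice.
\<close>

lemma trig_kernel_decay:
  assumes m0: "m 0 = 0" and mL: "\<And>k. L < k \<Longrightarrow> m k = 0" and t: "\<bar>t\<bar> \<le> pi" "t \<noteq> 0"
  shows "\<bar>trig_kernel m \<gamma> L t\<bar> \<le> 8 * second_variation m L / t\<^sup>2"
proof -
  define c where "c = (\<lambda>k::nat. cos (real k * t - \<gamma>))"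
  define q where "q = 2 * (1 - cos t)"
  have q0: "0 \<le> q" by (simp add: q_def)
  have c1: "\<bar>c k\<bar> \<le> 1" for k by (simp add: c_def)
  have cc: "c (k + 2) - 2 * c (k + 1) + c k = - (q * c (k + 1))" for k
  proof -
    define A where "A = real (k + 1) * t - \<gamma>"
    have "c (k + 2) = cos (A + t)" "c (k + 1) = cos A" "c k = cos (A - t)"
      by (simp_all add: c_def A_def algebra_simps)
    then show ?thesis by (simp add: q_def cos_add cos_diff algebra_simps)
  qed
  have K: "trig_kernel m \<gamma> L t = (\<Sum>k<L + 1. m (k + 1) * c (k + 1))"
  proof -
    have "trig_kernel m \<gamma> L t = (\<Sum>k=1..L. m k * c k)" by (simp add: trig_kernel_def c_def)
    also have "\<dots> = (\<Sum>k<L. m (k + 1) * c (k + 1))"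
      by (rule sum.reindex_bij_witness[of _ "\<lambda>k. k + 1" "\<lambda>k. k - 1"]) auto
    finally show ?thesis using mL[of "L + 1"] by simp
  qed
  have "(\<Sum>k<L + 1. (m (k + 2) - 2 * m (k + 1) + m k) * c (k + 1))
      = (\<Sum>k<L + 1. m (k + 1) * (c (k + 2) - 2 * c (k + 1) + c k)) - m 1 * c 0"
    using green_summation[of m c "L + 1"] m0 mL[of "L + 1"] mL[of "L + 2"] by simp
  also have "(\<Sum>k<L + 1. m (k + 1) * (c (k + 2) - 2 * c (k + 1) + c k)) = - (q * trig_kernel m \<gamma> L t)"
    unfolding cc K by (simp only: sum_distrib_left mult_ac sum_negf mult_minus_right)
  finally have "q * trig_kernel m \<gamma> L t
      = - (m 1 * c 0) - (\<Sum>k<L + 1. (m (k + 2) - 2 * m (k + 1) + m k) * c (k + 1))" by linarith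
  then have "q * \<bar>trig_kernel m \<gamma> L t\<bar>
      = \<bar>m 1 * c 0 + (\<Sum>k<L + 1. (m (k + 2) - 2 * m (k + 1) + m k) * c (k + 1))\<bar>"
    using abs_mult[of q "trig_kernel m \<gamma> L t"] q0 by simp
  also have "\<dots> \<le> \<bar>m 1 * c 0\<bar> + (\<Sum>k<L + 1. \<bar>(m (k + 2) - 2 * m (k + 1) + m k) * c (k + 1)\<bar>)"
    by (intro order_trans[OF abs_triangle_ineq] add_left_mono sum_abs)
  also have "\<dots> \<le> \<bar>m 1\<bar> * 1 + (\<Sum>k<L + 1. \<bar>m (k + 2) - 2 * m (k + 1) + m k\<bar> * 1)"
    unfolding abs_mult by (intro add_mono sum_mono mult_left_mono c1) auto
  also have "\<dots> = second_variation m L"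
    by (simp add: second_variation_def lessThan_Suc_atMost)
  finally have le: "q * \<bar>trig_kernel m \<gamma> L t\<bar> \<le> second_variation m L" .
  have "t\<^sup>2 / 8 * \<bar>trig_kernel m \<gamma> L t\<bar> \<le> q * \<bar>trig_kernel m \<gamma> L t\<bar>"
    using one_minus_cos_ge[OF t(1)] by (intro mult_right_mono) (auto simp: q_def)
  with le have "t\<^sup>2 / 8 * \<bar>trig_kernel m \<gamma> L t\<bar> \<le> second_variation m L" by linarith
  then show ?thesis using t(2) by (simp add: field_simps)
qed

text \<open>
  The phase shift \<open>\<gamma>\<close> is the rotation by \<open>\<beta> * pi / 2\<close> in the \<open>(\<psi>;\<beta>)\<close>-derivative.
\<close>

definition trig_multiplier :: "(nat \<Rightarrow> real) \<Rightarrow> real \<Rightarrow> nat \<Rightarrow> (real \<Rightarrow> real) \<Rightarrow> real \<Rightarrow> real" where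
  "trig_multiplier m \<gamma> L f x =
     (\<Sum>k=1..L. m k * (fourier_a f k * cos (real k * x + \<gamma>) + fourier_b f k * sin (real k * x + \<gamma>)))"

lemma L_perD:
  assumes "f \<in> L_per"
  shows "f \<in> borel_measurable lebesgue" "f (x + 2 * pi) = f x" "f \<in> periodic_measurable"
  using assms by (auto simp: L_per_def periodic_measurable_def)

lemma set_integrable_mult_bounded:
  fixes f g :: "real \<Rightarrow> real"
  assumes f: "set_integrable lebesgue {a..b} f" and g: "continuous_on UNIV g"
  shows "set_integrable lebesgue {a..b} (\<lambda>x. f x * g x)"
proof -
  have [measurable]: "g \<in> borel_measurable lebesgue"
    using borel_measurable_continuous_onI[OF g] by (rule borel_imp_lebesgue_measurable)
  have fm: "(\<lambda>x. indicator {a..b} x * f x) \<in> borel_measurable lebesgue"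
    using f by (simp add: set_integrable_def borel_measurable_integrable)
  have "compact (g ` {a..b})"
    by (intro compact_continuous_image continuous_on_subset[OF g] compact_Icc) auto
  then have "bounded (g ` {a..b})" by (rule compact_imp_bounded)
  then obtain B where "\<forall>y\<in>g ` {a..b}. norm y \<le> B" unfolding bounded_iff by blast
  then have B: "\<bar>g x\<bar> \<le> B" if "x \<in> {a..b}" for x using that by simp
  show ?thesis
  proof (rule set_integrable_bound[where f = "\<lambda>x. f x * B"])
    show "set_integrable lebesgue {a..b} (\<lambda>x. f x * B)" by (intro set_integrable_mult_left f)
    show "AE x in lebesgue. x \<in> {a..b} \<longrightarrow> norm (f x * g x) \<le> norm (f x * B)"
    proof (intro AE_I2 impI)
      fix x assume "x \<in> {a..b}"
      then have "\<bar>g x\<bar> \<le> \<bar>B\<bar>" using B[of x] by linarith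
      then show "norm (f x * g x) \<le> norm (f x * B)" by (simp add: abs_mult mult_left_mono)
    qed
    have "(\<lambda>x. (indicator {a..b} x * f x) * g x) \<in> borel_measurable lebesgue"
      by (intro borel_measurable_times fm) simp
    then show "set_borel_measurable lebesgue {a..b} (\<lambda>x. f x * g x)"
      by (simp add: set_borel_measurable_def mult.assoc)
  qed
qed

lemma harmonic_as_integral:
  assumes f: "f \<in> L_per"
  shows "fourier_a f k * cos (real k * x + \<gamma>) + fourier_b f k * sin (real k * x + \<gamma>)
    = 1 / pi * (LINT y:{0..2 * pi}|lebesgue. f y * cos (real k * (y - x) - \<gamma>))"
proof -
  have i: "set_integrable lebesgue {0..2 * pi} (\<lambda>y. f y * cos (real k * y))"
    "set_integrable lebesgue {0..2 * pi} (\<lambda>y. f y * sin (real k * y))"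
    by (intro set_integrable_mult_bounded L_per_set_integrable f continuous_intros)+
  define C where "C = cos (real k * x + \<gamma>)"
  define S where "S = sin (real k * x + \<gamma>)"
  have "(LINT y:{0..2 * pi}|lebesgue. f y * cos (real k * (y - x) - \<gamma>))
     = (LINT y:{0..2 * pi}|lebesgue. (f y * cos (real k * y)) * C + (f y * sin (real k * y)) * S)"
  proof -
    have "cos (real k * (y - x) - \<gamma>) = cos (real k * y) * C + sin (real k * y) * S" for y
      unfolding C_def S_def cos_diff[symmetric] by (simp add: algebra_simps)
    then show ?thesis by (simp add: algebra_simps)
  qed
  also have "\<dots> = (LINT y:{0..2 * pi}|lebesgue. f y * cos (real k * y)) * C
      + (LINT y:{0..2 * pi}|lebesgue. f y * sin (real k * y)) * S"
    using i by (subst set_integral_add) auto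
  finally show ?thesis by (simp add: fourier_a_def fourier_b_def C_def S_def algebra_simps)
qed

lemma trig_kernel_continuous: "continuous_on UNIV (trig_kernel m \<gamma> L)"
  unfolding trig_kernel_def[abs_def] by (intro continuous_intros)

lemma trig_kernel_periodic: "trig_kernel m \<gamma> L (t + 2 * pi) = trig_kernel m \<gamma> L t"
proof -
  have "cos (real k * (t + 2 * pi) - \<gamma>) = cos (real k * t - \<gamma>)" for k
  proof -
    have "real k * (t + 2 * pi) - \<gamma> = (real k * t - \<gamma>) + 2 * real k * pi" by (simp add: algebra_simps)
    then have "cos (real k * (t + 2 * pi) - \<gamma>)
        = cos (real k * t - \<gamma>) * cos (2 * real k * pi) - sin (real k * t - \<gamma>) * sin (2 * real k * pi)"
      by (simp only: cos_add)
    then show ?thesis by (simp only: cos_2npi sin_2npi mult_1_right mult_zero_right diff_zero)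
  qed
  then show ?thesis by (simp add: trig_kernel_def)
qed

lemma trig_multiplier_as_integral:
  assumes f: "f \<in> L_per"
  shows "trig_multiplier m \<gamma> L f x = 1 / pi * (LINT y:{0..2 * pi}|lebesgue. f y * trig_kernel m \<gamma> L (y - x))"
proof -
  have i: "set_integrable lebesgue {0..2 * pi} (\<lambda>y. f y * cos (real k * (y - x) - \<gamma>))" for k :: nat
    by (intro set_integrable_mult_bounded L_per_set_integrable f continuous_intros)
  have "(LINT y:{0..2 * pi}|lebesgue. f y * trig_kernel m \<gamma> L (y - x))
      = (LINT y:{0..2 * pi}|lebesgue. (\<Sum>k=1..L. m k * (f y * cos (real k * (y - x) - \<gamma>))))"
    by (simp add: trig_kernel_def sum_distrib_left mult_ac)
  also have "\<dots> = (\<Sum>k=1..L. m k * (LINT y:{0..2 * pi}|lebesgue. f y * cos (real k * (y - x) - \<gamma>)))"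
  proof -
    have "(LINT y|lebesgue. (\<Sum>k=1..L. indicator {0..2 * pi} y *\<^sub>R (m k * (f y * cos (real k * (y - x) - \<gamma>)))))
       = (\<Sum>k=1..L. LINT y|lebesgue. indicator {0..2 * pi} y *\<^sub>R (m k * (f y * cos (real k * (y - x) - \<gamma>))))"
      using set_integrable_mult_right[OF i]
      by (intro Bochner_Integration.integral_sum) (auto simp: set_integrable_def)
    also have "\<dots> = (\<Sum>k=1..L. m k * (LINT y:{0..2 * pi}|lebesgue. f y * cos (real k * (y - x) - \<gamma>)))"
      by (intro sum.cong refl) (subst set_lebesgue_integral_def[symmetric], simp)
    finally show ?thesis by (simp only: set_lebesgue_integral_def scaleR_sum_right)
  qed
  finally have E: "(LINT y:{0..2 * pi}|lebesgue. f y * trig_kernel m \<gamma> L (y - x))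
    = (\<Sum>k=1..L. m k * (LINT y:{0..2 * pi}|lebesgue. f y * cos (real k * (y - x) - \<gamma>)))" .
  show ?thesis
    unfolding trig_multiplier_def harmonic_as_integral[OF f] E by (simp add: sum_distrib_left)
qed

lemma ennreal_abs_integral_le: "ennreal \<bar>LINT x:S|lebesgue. f x\<bar> \<le> (\<integral>\<^sup>+x\<in>S. ennreal \<bar>f x\<bar> \<partial>lebesgue)"
  for f :: "real \<Rightarrow> real"
proof (cases "set_integrable lebesgue S f")
  case True
  show ?thesis
  proof -
    have "ennreal \<bar>LINT x:S|lebesgue. f x\<bar> \<le> (\<integral>\<^sup>+x. ennreal (norm (indicator S x *\<^sub>R f x)) \<partial>lebesgue)"
      using integral_norm_bound_ennreal[of lebesgue "\<lambda>x. indicator S x *\<^sub>R f x"] True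
      by (simp add: set_integrable_def set_lebesgue_integral_def)
    also have "\<dots> = (\<integral>\<^sup>+x\<in>S. ennreal \<bar>f x\<bar> \<partial>lebesgue)"
      by (intro nn_integral_cong) (auto simp: indicator_def)
    finally show ?thesis .
  qed
next
  case False
  then have "(LINT x:S|lebesgue. f x) = 0"
    unfolding set_integrable_def set_lebesgue_integral_def by (rule not_integrable_integral_eq)
  then show ?thesis by simp
qed

lemma trig_multiplier_convolution_bound:
  assumes f: "f \<in> L_per"
  shows "ennreal \<bar>trig_multiplier m \<gamma> L f x\<bar>
    \<le> ennreal (1 / pi) * (\<integral>\<^sup>+y\<in>{x - pi..<x + pi}. ennreal (\<bar>f y\<bar> * \<bar>trig_kernel m \<gamma> L (y - x)\<bar>) \<partial>lebesgue)"
proof -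
  note fD [measurable] = L_perD(1)[OF f]
  have cont: "continuous_on UNIV (\<lambda>y. trig_kernel m \<gamma> L (y - x))"
    by (rule continuous_on_compose2[OF trig_kernel_continuous]) (auto intro!: continuous_intros)
  have Km [measurable]: "(\<lambda>y. trig_kernel m \<gamma> L (y - x)) \<in> borel_measurable lebesgue"
    using borel_measurable_continuous_onI[OF cont] by (rule borel_imp_lebesgue_measurable)
  define F where "F = (\<lambda>y. ennreal (\<bar>f y\<bar> * \<bar>trig_kernel m \<gamma> L (y - x)\<bar>))"
  have Fm: "F \<in> borel_measurable lebesgue" unfolding F_def by measurable
  have Fper: "F (y + 2 * pi) = F y" for y
    using L_perD(2)[OF f, of y] trig_kernel_periodic[of m \<gamma> L "y - x"] by (simp add: F_def algebra_simps)
  have "ennreal \<bar>trig_multiplier m \<gamma> L f x\<bar>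
      = ennreal (1 / pi) * ennreal \<bar>LINT y:{0..2 * pi}|lebesgue. f y * trig_kernel m \<gamma> L (y - x)\<bar>"
    unfolding trig_multiplier_as_integral[OF f] abs_mult by (subst ennreal_mult') auto
  also have "\<dots> \<le> ennreal (1 / pi) * (\<integral>\<^sup>+y\<in>{0..2 * pi}. ennreal \<bar>f y * trig_kernel m \<gamma> L (y - x)\<bar> \<partial>lebesgue)"
    by (intro mult_left_mono ennreal_abs_integral_le) simp
  also have "(\<integral>\<^sup>+y\<in>{0..2 * pi}. ennreal \<bar>f y * trig_kernel m \<gamma> L (y - x)\<bar> \<partial>lebesgue) = (\<integral>\<^sup>+y\<in>{0..<2 * pi}. F y \<partial>lebesgue)"
    by (simp add: set_nn_integral_Icc F_def abs_mult)
  also have "\<dots> = (\<integral>\<^sup>+y\<in>{x - pi..<x + pi}. F y \<partial>lebesgue)"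
    using periodic_set_nn_integral[OF Fm Fper, of "x - pi"] by (simp add: algebra_simps)
  finally show ?thesis by (simp add: F_def)
qed

lemma window_mean_nonneg: "0 \<le> window_mean N f x"
  by (auto simp: window_mean_def Let_def set_lebesgue_integral_def intro!: divide_nonneg_nonneg integral_nonneg)

lemma window_mean_covers:
  assumes f: "f \<in> L_per" and N: "0 < N" and \<rho>: "\<rho> \<le> 2 * pi / real N"
  shows "(\<integral>\<^sup>+y\<in>{x - \<rho>..x + \<rho>}. ennreal \<bar>f y\<bar> \<partial>lebesgue) \<le> ennreal (3 * (2 * pi / real N) * window_mean N f x)"
proof -
  define h where "h = 2 * pi / real N"
  define j where "j = real_of_int \<lfloor>x / h\<rfloor>"
  have h: "0 < h" "\<rho> \<le> h" using N \<rho> by (auto simp: h_def)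
  have j: "j \<le> x / h" "x / h < j + 1" by (auto simp: j_def)
  then have jx: "j * h \<le> x" "x < (j + 1) * h" using h by (auto simp: field_simps)
  have "(\<integral>\<^sup>+y\<in>{x - \<rho>..x + \<rho>}. ennreal \<bar>f y\<bar> \<partial>lebesgue) \<le> (\<integral>\<^sup>+y\<in>{(j - 1) * h..(j + 2) * h}. ennreal \<bar>f y\<bar> \<partial>lebesgue)"
    using jx h by (intro nn_integral_mono) (auto simp: indicator_def algebra_simps)
  also have "\<dots> = ennreal (LINT y:{(j - 1) * h..(j + 2) * h}|lebesgue. \<bar>f y\<bar>)"
    by (rule set_nn_integral_abs_eq[OF L_per_set_integrable[OF f]])
  also have "(LINT y:{(j - 1) * h..(j + 2) * h}|lebesgue. \<bar>f y\<bar>) = 3 * h * window_mean N f x"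
    using h by (simp add: window_mean_def Let_def j_def flip: h_def)
  finally show ?thesis by (simp add: h_def)
qed

lemma window_mean_full_period:
  assumes f: "f \<in> L_per"
  shows "(\<integral>\<^sup>+y\<in>{x - pi..<x + pi}. ennreal \<bar>f y\<bar> \<partial>lebesgue) = ennreal (2 * pi * window_mean 3 f x)"
proof -
  note fD [measurable] = L_perD(1)[OF f]
  define h where "h = 2 * pi / 3"
  define j where "j = real_of_int \<lfloor>x / h\<rfloor>"
  define G where "G = (\<lambda>a. \<integral>\<^sup>+y\<in>{a..<a + 2 * pi}. ennreal \<bar>f y\<bar> \<partial>lebesgue)"
  have G: "G a = (\<integral>\<^sup>+y\<in>{0..<2 * pi}. ennreal \<bar>f y\<bar> \<partial>lebesgue)" for a
    unfolding G_def
  proof (rule periodic_set_nn_integral)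
    show "ennreal \<bar>f (y + 2 * pi)\<bar> = ennreal \<bar>f y\<bar>" for y by (simp add: L_perD(2)[OF f])
  qed measurable
  have "x - pi + 2 * pi = x + pi" by simp
  then have "(\<integral>\<^sup>+y\<in>{x - pi..<x + pi}. ennreal \<bar>f y\<bar> \<partial>lebesgue) = G (x - pi)" by (simp only: G_def)
  also have "\<dots> = G ((j - 1) * h)" by (simp only: G)
  also have "\<dots> = (\<integral>\<^sup>+y\<in>{(j - 1) * h..<(j - 1) * h + 2 * pi}. ennreal \<bar>f y\<bar> \<partial>lebesgue)"
    by (simp only: G_def)
  also have "(j - 1) * h + 2 * pi = (j + 2) * h" by (simp add: h_def field_simps)
  also have "(\<integral>\<^sup>+y\<in>{(j - 1) * h..<(j + 2) * h}. ennreal \<bar>f y\<bar> \<partial>lebesgue) = ennreal (LINT y:{(j - 1) * h..(j + 2) * h}|lebesgue. \<bar>f y\<bar>)"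
    using set_nn_integral_abs_eq[OF L_per_set_integrable[OF f]] by (simp add: set_nn_integral_Icc)
  also have "(LINT y:{(j - 1) * h..(j + 2) * h}|lebesgue. \<bar>f y\<bar>) = 2 * pi * window_mean 3 f x"
  proof -
    have "window_mean 3 f x = (LINT y:{(j - 1) * h..(j + 2) * h}|lebesgue. \<bar>f y\<bar>) / (3 * h)"
      by (simp add: window_mean_def Let_def j_def h_def)
    then show ?thesis by (simp add: h_def)
  qed
  finally show ?thesis .
qed

lemma sum_ennreal_mult:
  assumes "\<And>i. i \<in> I \<Longrightarrow> 0 \<le> a i" "\<And>i. i \<in> I \<Longrightarrow> 0 \<le> b i"
  shows "(\<Sum>i\<in>I. ennreal (a i) * ennreal (b i)) = ennreal (\<Sum>i\<in>I. a i * b i)"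
proof -
  have "(\<Sum>i\<in>I. ennreal (a i) * ennreal (b i)) = (\<Sum>i\<in>I. ennreal (a i * b i))"
    using assms by (intro sum.cong refl) (simp add: ennreal_mult)
  also have "\<dots> = ennreal (\<Sum>i\<in>I. a i * b i)" using assms by (intro sum_ennreal) auto
  finally show ?thesis .
qed

text \<open>
  The distances \<open>\<bar>t\<bar> \<le> pi\<close> are divided into dyadic shells. On the shell with outer radius \<open>R i\<close> the
  kernel is at most \<open>8 * second_variation m L / (\<rho> (Suc i))\<^sup>2\<close>, and the mass of \<open>\<bar>f\<bar>\<close> there is controlled
  by the window mean with cells of length \<open>\<rho> i\<close>; inside the smallest radius the trivial bound of the
  kernel is used.
\<close>

lemma trig_multiplier_window_bound:
  assumes f: "f \<in> L_per" and m0: "m 0 = 0" and mL: "\<And>k. L < k \<Longrightarrow> m k = 0"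
  shows "\<bar>trig_multiplier m \<gamma> L f x\<bar>
    \<le> (\<Sum>i<n. 48 * second_variation m L * (3 * 2 ^ i / pi\<^sup>2) * window_mean (3 * 2 ^ i) f x)
      + (\<Sum>k=1..L. \<bar>m k\<bar>) * (2 / 2 ^ n) * window_mean (3 * 2 ^ n) f x"
proof -
  note fD [measurable] = L_perD(1)[OF f]
  define \<rho> where "\<rho> = (\<lambda>i::nat. 2 * pi / (3 * 2 ^ i))"
  (* The outermost shell reaches up to pi, beyond \<rho> 0. It is still controlled by the window mean of
     three cells, whose windows are full periods. *)
  define R where "R = (\<lambda>i::nat. if i = 0 then pi else \<rho> i)"
  define S0 where "S0 = (\<Sum>k=1..L. \<bar>m k\<bar>)"
  define S2 where "S2 = second_variation m L"
  define K where "K = trig_kernel m \<gamma> L"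
  have S: "0 \<le> S0" "0 \<le> S2" by (auto simp: S0_def S2_def second_variation_def intro!: sum_nonneg add_nonneg_nonneg)
  have \<rho>0: "0 < \<rho> i" for i by (simp add: \<rho>_def)
  have \<rho>R: "\<rho> i \<le> R i" for i by (cases "i = 0") (simp_all add: R_def \<rho>_def)
  have pt: "\<bar>K t\<bar> \<le> (\<Sum>i<n. 8 * S2 / (\<rho> (Suc i))\<^sup>2 * indicator {- R i..R i} t) + S0 * indicator {- R n..R n} t"
    if t: "\<bar>t\<bar> \<le> pi" for t
  proof (cases "\<bar>t\<bar> \<le> R n")
    case True
    have "\<bar>K t\<bar> \<le> S0 * indicator {- R n..R n} t"
      using True trig_kernel_le_sum[of m \<gamma> L t] by (simp add: K_def S0_def abs_le_iff)
    moreover have "0 \<le> (\<Sum>i<n. 8 * S2 / (\<rho> (Suc i))\<^sup>2 * indicator {- R i..R i} t)"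
      using S by (intro sum_nonneg) auto
    ultimately show ?thesis by simp
  next
    case False
    define i where "i = (LEAST i. R (Suc i) < \<bar>t\<bar>)"
    have n0: "n \<noteq> 0"
    proof
      assume "n = 0"
      then show False using False t by (simp add: R_def)
    qed
    then have ex: "R (Suc (n - 1)) < \<bar>t\<bar>" using False by simp
    have i1: "R (Suc i) < \<bar>t\<bar>" unfolding i_def by (rule LeastI[of _ "n - 1"]) (rule ex)
    have "i \<le> n - 1" unfolding i_def by (rule Least_le) (rule ex)
    then have i2: "i < n" using n0 by simp
    have i3: "\<bar>t\<bar> \<le> R i"
    proof (cases i)
      case 0
      then show ?thesis using t by (simp add: R_def)
    next
      case (Suc i')
      then have "\<not> R (Suc i') < \<bar>t\<bar>" using not_less_Least[of i' "\<lambda>i. R (Suc i) < \<bar>t\<bar>"] by (simp add: i_def)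
      then show ?thesis using Suc by simp
    qed
    have big: "\<rho> (Suc i) < \<bar>t\<bar>" using i1 by (simp add: R_def)
    then have "t \<noteq> 0" using \<rho>0[of "Suc i"] by auto
    then have "\<bar>K t\<bar> \<le> 8 * S2 / t\<^sup>2"
      unfolding K_def S2_def using t by (intro trig_kernel_decay m0 mL) auto
    also have "\<dots> \<le> 8 * S2 / (\<rho> (Suc i))\<^sup>2"
    proof (intro divide_left_mono)
      show "(\<rho> (Suc i))\<^sup>2 \<le> t\<^sup>2" using big \<rho>0[of "Suc i"] by (subst power2_abs[symmetric]) (intro power_mono; simp)
    qed (use S \<rho>0[of "Suc i"] \<open>t \<noteq> 0\<close> in auto)
    also have "\<dots> = 8 * S2 / (\<rho> (Suc i))\<^sup>2 * indicator {- R i..R i} t" using i3 by (simp add: abs_le_iff)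
    also have "\<dots> \<le> (\<Sum>i<n. 8 * S2 / (\<rho> (Suc i))\<^sup>2 * indicator {- R i..R i} t)"
      using S i2 by (intro member_le_sum) auto
    also have "\<dots> \<le> \<dots> + S0 * indicator {- R n..R n} t" using S by simp
    finally show ?thesis .
  qed
  have mass: "(\<integral>\<^sup>+y\<in>{x - pi..<x + pi}. ennreal (\<bar>f y\<bar> * indicator {- R i..R i} (y - x)) \<partial>lebesgue)
      \<le> ennreal (3 * \<rho> i * window_mean (3 * 2 ^ i) f x)" for i
  proof (cases i)
    case 0
    have "(\<integral>\<^sup>+y\<in>{x - pi..<x + pi}. ennreal (\<bar>f y\<bar> * indicator {- R i..R i} (y - x)) \<partial>lebesgue)
        \<le> (\<integral>\<^sup>+y\<in>{x - pi..<x + pi}. ennreal \<bar>f y\<bar> \<partial>lebesgue)"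
      by (intro nn_integral_mono) (auto simp: indicator_def)
    also have "\<dots> = ennreal (2 * pi * window_mean 3 f x)" by (rule window_mean_full_period[OF f])
    finally show ?thesis using 0 by (simp add: \<rho>_def)
  next
    case (Suc i')
    have "(\<integral>\<^sup>+y\<in>{x - pi..<x + pi}. ennreal (\<bar>f y\<bar> * indicator {- R i..R i} (y - x)) \<partial>lebesgue)
        \<le> (\<integral>\<^sup>+y\<in>{x - \<rho> i..x + \<rho> i}. ennreal \<bar>f y\<bar> \<partial>lebesgue)"
      using Suc by (intro nn_integral_mono) (auto simp: indicator_def R_def)
    also have "\<dots> \<le> ennreal (3 * (2 * pi / real (3 * 2 ^ i)) * window_mean (3 * 2 ^ i) f x)"
      by (rule window_mean_covers[OF f]) (auto simp: \<rho>_def)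
    finally show ?thesis by (simp add: \<rho>_def)
  qed
  have mean0: "0 \<le> window_mean k f x" for k by (rule window_mean_nonneg)
  define w where "w = (\<lambda>i y. ennreal (\<bar>f y\<bar> * indicator {- R i..R i} (y - x)) * indicator {x - pi..<x + pi} y)"
  have wm [measurable]: "w i \<in> borel_measurable lebesgue" for i
  proof -
    have "(\<lambda>y. indicator {x - R i..x + R i} y :: real) \<in> borel_measurable lebesgue" by simp
    moreover have "indicator {- R i..R i} (y - x) = (indicator {x - R i..x + R i} y :: real)" for y
      by (auto simp: indicator_def)
    ultimately show ?thesis unfolding w_def by simp
  qed
  have "ennreal \<bar>trig_multiplier m \<gamma> L f x\<bar>
      \<le> ennreal (1 / pi) * (\<integral>\<^sup>+y\<in>{x - pi..<x + pi}. ennreal (\<bar>f y\<bar> * \<bar>K (y - x)\<bar>) \<partial>lebesgue)"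
    unfolding K_def by (rule trig_multiplier_convolution_bound[OF f])
  also have "\<dots> \<le> ennreal (1 / pi) * (\<integral>\<^sup>+y. (\<Sum>i<n. ennreal (8 * S2 / (\<rho> (Suc i))\<^sup>2) * w i y) + ennreal S0 * w n y \<partial>lebesgue)"
  proof (intro mult_left_mono nn_integral_mono)
    fix y
    show "ennreal (\<bar>f y\<bar> * \<bar>K (y - x)\<bar>) * indicator {x - pi..<x + pi} y
      \<le> (\<Sum>i<n. ennreal (8 * S2 / (\<rho> (Suc i))\<^sup>2) * w i y) + ennreal S0 * w n y"
    proof (cases "y \<in> {x - pi..<x + pi}")
      case True
      then have "\<bar>y - x\<bar> \<le> pi" by auto
      then have "\<bar>f y\<bar> * \<bar>K (y - x)\<bar> \<le> \<bar>f y\<bar> * ((\<Sum>i<n. 8 * S2 / (\<rho> (Suc i))\<^sup>2 * indicator {- R i..R i} (y - x))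
          + S0 * indicator {- R n..R n} (y - x))"
        by (intro mult_left_mono pt) auto
      also have "\<dots> = (\<Sum>i<n. 8 * S2 / (\<rho> (Suc i))\<^sup>2 * (\<bar>f y\<bar> * indicator {- R i..R i} (y - x)))
          + S0 * (\<bar>f y\<bar> * indicator {- R n..R n} (y - x))"
        by (simp add: algebra_simps sum_distrib_left)
      finally have "ennreal (\<bar>f y\<bar> * \<bar>K (y - x)\<bar>) \<le> ennreal \<dots>" by (rule ennreal_leI)
      also have "\<dots> = (\<Sum>i<n. ennreal (8 * S2 / (\<rho> (Suc i))\<^sup>2) * w i y) + ennreal S0 * w n y"
      proof -
        have w: "w i y = ennreal (\<bar>f y\<bar> * indicator {- R i..R i} (y - x))" for i
          using True by (simp add: w_def)
        have "(\<Sum>i<n. ennreal (8 * S2 / (\<rho> (Suc i))\<^sup>2) * w i y)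
            = ennreal (\<Sum>i<n. 8 * S2 / (\<rho> (Suc i))\<^sup>2 * (\<bar>f y\<bar> * indicator {- R i..R i} (y - x)))"
          unfolding w using S by (intro sum_ennreal_mult) auto
        moreover have "ennreal S0 * w n y = ennreal (S0 * (\<bar>f y\<bar> * indicator {- R n..R n} (y - x)))"
          unfolding w using S by (intro ennreal_mult'[symmetric])
        moreover have "0 \<le> (\<Sum>i<n. 8 * S2 / (\<rho> (Suc i))\<^sup>2 * (\<bar>f y\<bar> * indicator {- R i..R i} (y - x)))"
          using S by (intro sum_nonneg) auto
        moreover have "0 \<le> S0 * (\<bar>f y\<bar> * indicator {- R n..R n} (y - x))" using S by simp
        ultimately show ?thesis by (simp only: ennreal_plus)
      qed
      finally show ?thesis using True by simp
    qed simp
  qed simp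
  also have "\<dots> = ennreal (1 / pi) * ((\<Sum>i<n. ennreal (8 * S2 / (\<rho> (Suc i))\<^sup>2) * (\<integral>\<^sup>+y. w i y \<partial>lebesgue)) + ennreal S0 * (\<integral>\<^sup>+y. w n y \<partial>lebesgue))"
    by (simp add: nn_integral_add nn_integral_sum nn_integral_cmult)
  also have "\<dots> \<le> ennreal (1 / pi) * ((\<Sum>i<n. ennreal (8 * S2 / (\<rho> (Suc i))\<^sup>2) * ennreal (3 * \<rho> i * window_mean (3 * 2 ^ i) f x))
      + ennreal S0 * ennreal (3 * \<rho> n * window_mean (3 * 2 ^ n) f x))"
    using mass by (intro mult_left_mono add_mono sum_mono) (auto simp: w_def)
  also have "\<dots> = ennreal (1 / pi * ((\<Sum>i<n. 8 * S2 / (\<rho> (Suc i))\<^sup>2 * (3 * \<rho> i * window_mean (3 * 2 ^ i) f x))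
      + S0 * (3 * \<rho> n * window_mean (3 * 2 ^ n) f x)))"
  proof -
    have b0: "0 \<le> 3 * \<rho> i * window_mean (3 * 2 ^ i) f x" for i
      using \<rho>0[of i] mean0[of "3 * 2 ^ i"] by simp
    have "(\<Sum>i<n. ennreal (8 * S2 / (\<rho> (Suc i))\<^sup>2) * ennreal (3 * \<rho> i * window_mean (3 * 2 ^ i) f x))
        = ennreal (\<Sum>i<n. 8 * S2 / (\<rho> (Suc i))\<^sup>2 * (3 * \<rho> i * window_mean (3 * 2 ^ i) f x))"
      using S by (intro sum_ennreal_mult b0) auto
    moreover have "ennreal S0 * ennreal (3 * \<rho> n * window_mean (3 * 2 ^ n) f x)
        = ennreal (S0 * (3 * \<rho> n * window_mean (3 * 2 ^ n) f x))"
      using S by (intro ennreal_mult'[symmetric])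
    moreover have "0 \<le> (\<Sum>i<n. 8 * S2 / (\<rho> (Suc i))\<^sup>2 * (3 * \<rho> i * window_mean (3 * 2 ^ i) f x))"
      using S by (intro sum_nonneg mult_nonneg_nonneg b0) auto
    moreover have "0 \<le> S0 * (3 * \<rho> n * window_mean (3 * 2 ^ n) f x)"
      using S by (intro mult_nonneg_nonneg b0)
    moreover have "0 \<le> 1 / pi" by simp
    ultimately show ?thesis by (simp only: ennreal_plus ennreal_mult')
  qed
  finally have le: "ennreal \<bar>trig_multiplier m \<gamma> L f x\<bar> \<le> ennreal (1 / pi * ((\<Sum>i<n. 8 * S2 / (\<rho> (Suc i))\<^sup>2 * (3 * \<rho> i * window_mean (3 * 2 ^ i) f x))
      + S0 * (3 * \<rho> n * window_mean (3 * 2 ^ n) f x)))" .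
  have "0 \<le> 1 / pi * ((\<Sum>i<n. 8 * S2 / (\<rho> (Suc i))\<^sup>2 * (3 * \<rho> i * window_mean (3 * 2 ^ i) f x))
      + S0 * (3 * \<rho> n * window_mean (3 * 2 ^ n) f x))"
    using S \<rho>0 mean0 by (intro mult_nonneg_nonneg add_nonneg_nonneg sum_nonneg divide_nonneg_nonneg) (auto intro: less_imp_le)
  with le have "\<bar>trig_multiplier m \<gamma> L f x\<bar> \<le> 1 / pi * ((\<Sum>i<n. 8 * S2 / (\<rho> (Suc i))\<^sup>2 * (3 * \<rho> i * window_mean (3 * 2 ^ i) f x))
      + S0 * (3 * \<rho> n * window_mean (3 * 2 ^ n) f x))"
    by (simp only: ennreal_le_iff)
  also have "\<dots> = (\<Sum>i<n. 48 * S2 * (3 * 2 ^ i / pi\<^sup>2) * window_mean (3 * 2 ^ i) f x) + S0 * (2 / 2 ^ n) * window_mean (3 * 2 ^ n) f x"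
  proof -
    have "1 / pi * (8 * S2 / (\<rho> (Suc i))\<^sup>2 * (3 * \<rho> i * v)) = 48 * S2 * (3 * 2 ^ i / pi\<^sup>2) * v" for i v
    proof -
      have "\<rho> (Suc i) = \<rho> i / 2" by (simp add: \<rho>_def)
      then have "1 / pi * (8 * S2 / (\<rho> (Suc i))\<^sup>2 * (3 * \<rho> i * v)) = 96 * S2 / (pi * \<rho> i) * v"
      proof -
        have "1 / pi * (8 * S2 / (r / 2)\<^sup>2 * (3 * r * v)) = 96 * S2 / (pi * r) * v" if "0 < r" for r
          using that by (simp add: field_simps power2_eq_square)
        from this[OF \<rho>0[of i]] show ?thesis by (simp only: \<open>\<rho> (Suc i) = \<rho> i / 2\<close>)
      qed
      also have "\<dots> = 48 * S2 * (3 * 2 ^ i / pi\<^sup>2) * v" by (simp add: \<rho>_def power2_eq_square)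
      finally show ?thesis .
    qed
    moreover have "1 / pi * (S0 * (3 * \<rho> n * v)) = S0 * (2 / 2 ^ n) * v" for v by (simp add: \<rho>_def)
    ultimately show ?thesis by (simp only: distrib_left sum_distrib_left)
  qed
  finally show ?thesis by (simp only: S0_def S2_def)
qed

section \<open>Trigonometric polynomials and their Fourier coefficients\<close>

lemma set_integral_linear:
  fixes f g :: "real \<Rightarrow> real"
  assumes "set_integrable lebesgue S f" "set_integrable lebesgue S g"
  shows "(LINT x:S|lebesgue. p * f x + q * g x) = p * (LINT x:S|lebesgue. f x) + q * (LINT x:S|lebesgue. g x)"
  using set_integral_add(2)[OF set_integrable_mult_right[of p, OF assms(1)] set_integrable_mult_right[of q, OF assms(2)]]
  by simp

lemma set_integral_cos_period:
  "(LINT x:{0..2 * pi}|lebesgue. cos (real k * x)) = (if k = 0 then 2 * pi else 0)"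
proof (cases "k = 0")
  case True
  then show ?thesis by (simp add: set_lebesgue_integral_def)
next
  case False
  have i: "set_integrable lebesgue {0..2 * pi} (\<lambda>x. cos (real k * x))"
    by (intro absolutely_integrable_continuous_real continuous_intros)
  have "((\<lambda>x. cos (real k * x)) has_integral sin (real k * (2 * pi)) / real k - sin (real k * 0) / real k) {0..2 * pi}"
    using False by (intro fundamental_theorem_of_calculus)
      (auto intro!: derivative_eq_intros simp flip: has_real_derivative_iff_has_vector_derivative)
  moreover have "sin (real k * (2 * pi)) = 0" using sin_2npi[of k] by (simp add: mult_ac)
  ultimately have "integral {0..2 * pi} (\<lambda>x. cos (real k * x)) = 0" by (auto dest: integral_unique)
  then show ?thesis using False set_lebesgue_integral_eq_integral(2)[OF i] by simp
qed

lemma set_integral_sin_period: "(LINT x:{0..2 * pi}|lebesgue. sin (real k * x)) = 0"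
proof (cases "k = 0")
  case False
  have i: "set_integrable lebesgue {0..2 * pi} (\<lambda>x. sin (real k * x))"
    by (intro absolutely_integrable_continuous_real continuous_intros)
  have "((\<lambda>x. sin (real k * x)) has_integral - cos (real k * (2 * pi)) / real k - (- cos (real k * 0) / real k)) {0..2 * pi}"
    using False by (intro fundamental_theorem_of_calculus)
      (auto intro!: derivative_eq_intros simp flip: has_real_derivative_iff_has_vector_derivative)
  moreover have "cos (real k * (2 * pi)) = 1" using cos_2npi[of k] by (simp add: mult_ac)
  ultimately have "integral {0..2 * pi} (\<lambda>x. sin (real k * x)) = 0" by (auto dest: integral_unique)
  then show ?thesis using set_lebesgue_integral_eq_integral(2)[OF i] by simp
qed simp

lemma cos_int_diff: "cos (real j * x - real k * x) = cos (real (if k \<le> j then j - k else k - j) * x)"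
proof (cases "k \<le> j")
  case True
  then show ?thesis by (simp add: of_nat_diff algebra_simps)
next
  case False
  then have "cos (real j * x - real k * x) = cos (- (real (k - j) * x))" by (simp add: of_nat_diff algebra_simps)
  then show ?thesis using False by simp
qed

lemma trig_integrable:
  "set_integrable lebesgue {0..2 * pi} (\<lambda>x. cos (real j * x))" "set_integrable lebesgue {0..2 * pi} (\<lambda>x. sin (real j * x))"
  by (intro absolutely_integrable_continuous_real continuous_intros)+

lemma orthogonality_cos_cos:
  "(LINT x:{0..2 * pi}|lebesgue. cos (real j * x) * cos (real k * x)) = (if j = k then (if k = 0 then 2 * pi else pi) else 0)"
proof -
  define d where "d = (if k \<le> j then j - k else k - j)"
  have "cos (real j * x) * cos (real k * x) = 1 / 2 * cos (real d * x) + 1 / 2 * cos (real (j + k) * x)" for x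
    using cos_times_cos[of "real j * x" "real k * x"] unfolding cos_int_diff d_def[symmetric]
    by (simp add: algebra_simps add_divide_distrib)
  then have "(LINT x:{0..2 * pi}|lebesgue. cos (real j * x) * cos (real k * x))
      = 1 / 2 * (LINT x:{0..2 * pi}|lebesgue. cos (real d * x)) + 1 / 2 * (LINT x:{0..2 * pi}|lebesgue. cos (real (j + k) * x))"
    using trig_integrable(1)[of d] trig_integrable(1)[of "j + k"] by (simp only:) (rule set_integral_linear)
  then show ?thesis unfolding set_integral_cos_period by (auto simp: d_def)
qed

lemma orthogonality_sin_sin:
  "(LINT x:{0..2 * pi}|lebesgue. sin (real j * x) * sin (real k * x)) = (if j = k \<and> k \<noteq> 0 then pi else 0)"
proof -
  define d where "d = (if k \<le> j then j - k else k - j)"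
  have "sin (real j * x) * sin (real k * x) = 1 / 2 * cos (real d * x) + (- 1 / 2) * cos (real (j + k) * x)" for x
    using sin_times_sin[of "real j * x" "real k * x"] unfolding cos_int_diff d_def[symmetric]
    by (simp add: algebra_simps diff_divide_distrib)
  then have "(LINT x:{0..2 * pi}|lebesgue. sin (real j * x) * sin (real k * x))
      = 1 / 2 * (LINT x:{0..2 * pi}|lebesgue. cos (real d * x)) + (- 1 / 2) * (LINT x:{0..2 * pi}|lebesgue. cos (real (j + k) * x))"
    using trig_integrable(1)[of d] trig_integrable(1)[of "j + k"] by (simp only:) (rule set_integral_linear)
  then show ?thesis unfolding set_integral_cos_period by (auto simp: d_def)
qed

lemma orthogonality_sin_cos:
  "(LINT x:{0..2 * pi}|lebesgue. sin (real j * x) * cos (real k * x)) = 0"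
proof -
  define d where "d = (if k \<le> j then j - k else k - j)"
  define s :: real where "s = (if k \<le> j then 1 else - 1)"
  have sd: "sin (real j * x - real k * x) = s * sin (real d * x)" for x
  proof (cases "k \<le> j")
    case True
    then show ?thesis by (simp add: s_def d_def of_nat_diff algebra_simps)
  next
    case False
    then have "sin (real j * x - real k * x) = sin (- (real (k - j) * x))" by (simp add: of_nat_diff algebra_simps)
    then show ?thesis using False by (simp add: s_def d_def)
  qed
  have "sin (real j * x) * cos (real k * x) = 1 / 2 * sin (real (j + k) * x) + s / 2 * sin (real d * x)" for x
    using sin_times_cos[of "real j * x" "real k * x"] unfolding sd
    by (simp add: algebra_simps add_divide_distrib)
  then have "(LINT x:{0..2 * pi}|lebesgue. sin (real j * x) * cos (real k * x))
      = 1 / 2 * (LINT x:{0..2 * pi}|lebesgue. sin (real (j + k) * x)) + s / 2 * (LINT x:{0..2 * pi}|lebesgue. sin (real d * x))"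
    using trig_integrable(2)[of d] trig_integrable(2)[of "j + k"] by (simp only:) (rule set_integral_linear)
  then show ?thesis unfolding set_integral_sin_period by simp
qed

definition trig_sum :: "(nat \<Rightarrow> real) \<Rightarrow> (nat \<Rightarrow> real) \<Rightarrow> nat \<Rightarrow> real \<Rightarrow> real" where
  "trig_sum a b n x = (\<Sum>k\<le>n. a k * cos (real k * x) + b k * sin (real k * x))"

lemma trig_polys_eq: "trig_polys n = {trig_sum a b n | a b. True}"
  by (simp add: trig_polys_def trig_sum_def[abs_def])

lemma trig_sum_mem: "trig_sum a b n \<in> trig_polys n"
  by (auto simp: trig_polys_eq)

lemma trig_polysE:
  assumes "T \<in> trig_polys n"
  obtains a b where "T = trig_sum a b n"
  using assms by (auto simp: trig_polys_eq)

lemma trig_sum_continuous: "continuous_on S (trig_sum a b n)"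
  unfolding trig_sum_def[abs_def] by (intro continuous_intros)

lemma cos_nat_periodic: "cos (real k * (x + 2 * pi)) = cos (real k * x)"
  using trig_kernel_periodic[of "\<lambda>j. if j = k then 1 else 0" 0 "k" x] by (cases "k = 0") (auto simp: trig_kernel_def if_distrib[of "\<lambda>u. u * _"] cong: if_cong)

lemma sin_nat_periodic: "sin (real k * (x + 2 * pi)) = sin (real k * x)"
proof -
  have e: "real k * (x + 2 * pi) = real k * x + 2 * real k * pi" by (simp add: algebra_simps)
  show ?thesis unfolding e sin_add cos_2npi sin_2npi by simp
qed

lemma continuous_periodic_L_per:
  assumes c: "continuous_on UNIV f" and p: "\<And>x. f (x + 2 * pi) = f x"
  shows "f \<in> L_per"
  using borel_imp_lebesgue_measurable[OF borel_measurable_continuous_onI[OF c]] p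
    absolutely_integrable_continuous_real[OF continuous_on_subset[OF c subset_UNIV]]
  by (auto simp: L_per_def periodic_measurable_def)

lemma trig_polys_L_per:
  assumes "T \<in> trig_polys n"
  shows "T \<in> L_per"
proof -
  obtain a b where T: "T = trig_sum a b n" using assms by (rule trig_polysE)
  have "trig_sum a b n (x + 2 * pi) = trig_sum a b n x" for x
    by (simp only: trig_sum_def cos_nat_periodic sin_nat_periodic)
  then show ?thesis unfolding T by (intro continuous_periodic_L_per trig_sum_continuous)
qed

lemma set_integral_sum:
  fixes F :: "nat \<Rightarrow> real \<Rightarrow> real"
  assumes "\<And>i. i \<in> I \<Longrightarrow> set_integrable lebesgue S (F i)"
  shows "(LINT x:S|lebesgue. (\<Sum>i\<in>I. F i x)) = (\<Sum>i\<in>I. LINT x:S|lebesgue. F i x)"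
  using assms unfolding set_lebesgue_integral_def set_integrable_def scaleR_sum_right
  by (intro Bochner_Integration.integral_sum) auto

lemma trig_sum_times_integral:
  assumes g: "continuous_on UNIV g"
  shows "(LINT x:{0..2 * pi}|lebesgue. trig_sum a b n x * g x)
    = (\<Sum>k\<le>n. a k * (LINT x:{0..2 * pi}|lebesgue. cos (real k * x) * g x) + b k * (LINT x:{0..2 * pi}|lebesgue. sin (real k * x) * g x))"
proof -
  have i: "set_integrable lebesgue {0..2 * pi} (\<lambda>x. cos (real k * x) * g x)"
    "set_integrable lebesgue {0..2 * pi} (\<lambda>x. sin (real k * x) * g x)" for k :: nat
    by (intro absolutely_integrable_continuous_real continuous_intros continuous_on_subset[OF g]; simp)+
  have "(LINT x:{0..2 * pi}|lebesgue. trig_sum a b n x * g x)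
     = (LINT x:{0..2 * pi}|lebesgue. (\<Sum>k\<le>n. a k * (cos (real k * x) * g x) + b k * (sin (real k * x) * g x)))"
    by (simp only: trig_sum_def sum_distrib_right distrib_right mult.assoc)
  also have "\<dots> = (\<Sum>k\<le>n. LINT x:{0..2 * pi}|lebesgue. a k * (cos (real k * x) * g x) + b k * (sin (real k * x) * g x))"
    by (intro set_integral_sum set_integral_add set_integrable_mult_right i)
  also have "\<dots> = (\<Sum>k\<le>n. a k * (LINT x:{0..2 * pi}|lebesgue. cos (real k * x) * g x) + b k * (LINT x:{0..2 * pi}|lebesgue. sin (real k * x) * g x))"
    by (intro sum.cong refl set_integral_linear i)
  finally show ?thesis .
qed

lemma fourier_a_trig_sum:
  "fourier_a (trig_sum a b n) k = (if k \<le> n then (if k = 0 then 2 * a 0 else a k) else 0)"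
proof -
  have "continuous_on UNIV (\<lambda>x. cos (real k * x))" by (intro continuous_intros)
  from trig_sum_times_integral[OF this, of a b n]
  have "(LINT x:{0..2 * pi}|lebesgue. trig_sum a b n x * cos (real k * x))
    = (\<Sum>j\<le>n. if j = k then a k * (if k = 0 then 2 * pi else pi) else 0)"
    unfolding orthogonality_cos_cos orthogonality_sin_cos by (simp only:) (intro sum.cong; simp)
  then show ?thesis by (simp add: fourier_a_def)
qed

lemma fourier_b_trig_sum:
  "fourier_b (trig_sum a b n) k = (if k \<le> n \<and> k \<noteq> 0 then b k else 0)"
proof -
  have "continuous_on UNIV (\<lambda>x. sin (real k * x))" by (intro continuous_intros)
  from trig_sum_times_integral[OF this, of a b n]
  have "(LINT x:{0..2 * pi}|lebesgue. trig_sum a b n x * sin (real k * x))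
    = (\<Sum>j\<le>n. if j = k then b k * (if k = 0 then 0 else pi) else 0)"
    unfolding orthogonality_sin_sin mult.commute[of "cos _" "sin _"] orthogonality_sin_cos
    by (simp only:) (intro sum.cong; simp)
  then show ?thesis by (simp add: fourier_b_def)
qed

lemma trig_multiplier_trig_sum:
  "trig_multiplier m \<gamma> L (trig_sum a b n) x
    = (\<Sum>k=1..min L n. m k * (a k * cos (real k * x + \<gamma>) + b k * sin (real k * x + \<gamma>)))"
proof -
  have "trig_multiplier m \<gamma> L (trig_sum a b n) x = (\<Sum>k=1..L. if k \<le> n then m k * (a k * cos (real k * x + \<gamma>) + b k * sin (real k * x + \<gamma>)) else 0)"
    unfolding trig_multiplier_def fourier_a_trig_sum fourier_b_trig_sum by (intro sum.cong) auto
  also have "\<dots> = (\<Sum>k\<in>{1..L} \<inter> {k. k \<le> n}. m k * (a k * cos (real k * x + \<gamma>) + b k * sin (real k * x + \<gamma>)))"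
    by (subst sum.inter_restrict) auto
  also have "{1..L} \<inter> {k. k \<le> n} = {1..min L n}" by auto
  finally show ?thesis .
qed

lemma trig_multiplier_mem: "trig_multiplier m \<gamma> L f \<in> trig_polys L"
proof -
  define a where "a = (\<lambda>k. if k = 0 then 0 else m k * (fourier_a f k * cos \<gamma> + fourier_b f k * sin \<gamma>))"
  define b where "b = (\<lambda>k. if k = 0 then 0 else m k * (fourier_b f k * cos \<gamma> - fourier_a f k * sin \<gamma>))"
  have "trig_multiplier m \<gamma> L f x = trig_sum a b L x" for x
  proof -
    have "trig_sum a b L x = (\<Sum>k=1..L. a k * cos (real k * x) + b k * sin (real k * x))"
      unfolding trig_sum_def by (intro sum.mono_neutral_right) (auto simp: a_def b_def)
    also have "\<dots> = trig_multiplier m \<gamma> L f x"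
      unfolding trig_multiplier_def by (intro sum.cong) (auto simp: a_def b_def cos_add sin_add algebra_simps)
    finally show ?thesis by simp
  qed
  then show ?thesis using trig_sum_mem[of a b L] by presburger
qed

lemma fourier_trig_multiplier:
  "fourier_a (trig_multiplier m \<gamma> L f) k
     = (if 1 \<le> k \<and> k \<le> L then m k * (fourier_a f k * cos \<gamma> + fourier_b f k * sin \<gamma>) else 0)"
  "fourier_b (trig_multiplier m \<gamma> L f) k
     = (if 1 \<le> k \<and> k \<le> L then m k * (fourier_b f k * cos \<gamma> - fourier_a f k * sin \<gamma>) else 0)"
proof -
  define a where "a = (\<lambda>k. if k = 0 then 0 else m k * (fourier_a f k * cos \<gamma> + fourier_b f k * sin \<gamma>))"
  define b where "b = (\<lambda>k. if k = 0 then 0 else m k * (fourier_b f k * cos \<gamma> - fourier_a f k * sin \<gamma>))"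
  have "trig_multiplier m \<gamma> L f x = trig_sum a b L x" for x
  proof -
    have "trig_sum a b L x = (\<Sum>k=1..L. a k * cos (real k * x) + b k * sin (real k * x))"
      unfolding trig_sum_def by (intro sum.mono_neutral_right) (auto simp: a_def b_def)
    also have "\<dots> = trig_multiplier m \<gamma> L f x"
      unfolding trig_multiplier_def by (intro sum.cong) (auto simp: a_def b_def cos_add sin_add algebra_simps)
    finally show ?thesis by simp
  qed
  then have e: "trig_multiplier m \<gamma> L f = trig_sum a b L" by blast
  show "fourier_a (trig_multiplier m \<gamma> L f) k
     = (if 1 \<le> k \<and> k \<le> L then m k * (fourier_a f k * cos \<gamma> + fourier_b f k * sin \<gamma>) else 0)"
    unfolding e fourier_a_trig_sum by (auto simp: a_def)
  show "fourier_b (trig_multiplier m \<gamma> L f) k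
     = (if 1 \<le> k \<and> k \<le> L then m k * (fourier_b f k * cos \<gamma> - fourier_a f k * sin \<gamma>) else 0)"
    unfolding e fourier_b_trig_sum by (auto simp: b_def)
qed

lemma L_per_linear:
  assumes "f \<in> L_per" "g \<in> L_per"
  shows "(\<lambda>x. p * f x + q * g x) \<in> L_per"
  using assms by (auto simp: L_per_def periodic_measurable_def intro!: set_integral_add)

lemma fourier_linear:
  assumes "f \<in> L_per" "g \<in> L_per"
  shows "fourier_a (\<lambda>x. f x - g x) k = fourier_a f k - fourier_a g k"
    "fourier_b (\<lambda>x. f x - g x) k = fourier_b f k - fourier_b g k"
proof -
  have i: "set_integrable lebesgue {0..2 * pi} (\<lambda>x. u x * cos (real k * x))"
    "set_integrable lebesgue {0..2 * pi} (\<lambda>x. u x * sin (real k * x))" if "u \<in> L_per" for u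
    by (intro set_integrable_mult_bounded L_per_set_integrable that continuous_intros)+
  show "fourier_a (\<lambda>x. f x - g x) k = fourier_a f k - fourier_a g k"
    "fourier_b (\<lambda>x. f x - g x) k = fourier_b f k - fourier_b g k"
    using i[OF assms(1)] i[OF assms(2)] unfolding fourier_a_def fourier_b_def left_diff_distrib
    by (simp_all add: set_integral_diff right_diff_distrib)
qed

text \<open>
  This is how best approximations enter: a multiplier that vanishes at low frequencies has the same
  value at \<open>f\<close> and at the difference of \<open>f\<close> and a polynomial.
\<close>

lemma trig_multiplier_minus_poly:
  assumes f: "f \<in> L_per" and T: "T \<in> trig_polys n" and m: "\<And>k. k \<le> n \<Longrightarrow> m k = 0"
  shows "trig_multiplier m \<gamma> L (\<lambda>x. f x - T x) = trig_multiplier m \<gamma> L f"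
proof -
  obtain a b where Te: "T = trig_sum a b n" using T by (rule trig_polysE)
  have E: "m k * (fourier_a (\<lambda>x. f x - T x) k * u + fourier_b (\<lambda>x. f x - T x) k * v)
      = m k * (fourier_a f k * u + fourier_b f k * v)" for k u v
    using m[of k] unfolding fourier_linear[OF f trig_polys_L_per[OF T]]
    unfolding Te fourier_a_trig_sum fourier_b_trig_sum by auto
  show ?thesis unfolding trig_multiplier_def by (intro ext sum.cong refl E)
qed

lemma steklov_trig_polys:
  assumes T: "T \<in> trig_polys n"
  shows "steklov h T \<in> trig_polys n"
proof -
  obtain a b where Te: "T = trig_sum a b n" using T by (rule trig_polysE)
  define C where "C = (\<lambda>k::nat. 1 / (2 * h) * (LINT t:{-h..h}|lebesgue. cos (real k * t)))"
  define S where "S = (\<lambda>k::nat. 1 / (2 * h) * (LINT t:{-h..h}|lebesgue. sin (real k * t)))"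
  have i: "set_integrable lebesgue {-h..h} (\<lambda>t. cos (real k * t))" "set_integrable lebesgue {-h..h} (\<lambda>t. sin (real k * t))" for k :: nat
    by (intro absolutely_integrable_continuous_real continuous_intros)+
  define p where "p = (\<lambda>k x. a k * cos (real k * x) + b k * sin (real k * x))"
  define q where "q = (\<lambda>k x. b k * cos (real k * x) - a k * sin (real k * x))"
  have "steklov h T x = trig_sum (\<lambda>k. a k * C k + b k * S k) (\<lambda>k. b k * C k - a k * S k) n x" for x
  proof -
    have "T (x + t) = (\<Sum>k\<le>n. p k x * cos (real k * t) + q k x * sin (real k * t))" for t
      unfolding Te trig_sum_def p_def q_def by (intro sum.cong) (auto simp: distrib_left cos_add sin_add algebra_simps)
    then have "(LINT t:{-h..h}|lebesgue. T (x + t))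
        = (LINT t:{-h..h}|lebesgue. (\<Sum>k\<le>n. p k x * cos (real k * t) + q k x * sin (real k * t)))" by simp
    also have "\<dots> = (\<Sum>k\<le>n. LINT t:{-h..h}|lebesgue. p k x * cos (real k * t) + q k x * sin (real k * t))"
      by (intro set_integral_sum set_integral_add set_integrable_mult_right i)
    also have "\<dots> = (\<Sum>k\<le>n. p k x * (LINT t:{-h..h}|lebesgue. cos (real k * t)) + q k x * (LINT t:{-h..h}|lebesgue. sin (real k * t)))"
      by (intro sum.cong refl set_integral_linear i)
    finally have "steklov h T x = (\<Sum>k\<le>n. p k x * C k + q k x * S k)"
      by (simp add: steklov_def C_def S_def sum_distrib_left algebra_simps)
    also have "\<dots> = trig_sum (\<lambda>k. a k * C k + b k * S k) (\<lambda>k. b k * C k - a k * S k) n x"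
      unfolding trig_sum_def p_def q_def by (intro sum.cong) (auto simp: algebra_simps)
    finally show ?thesis .
  qed
  then have "steklov h T = trig_sum (\<lambda>k. a k * C k + b k * S k) (\<lambda>k. b k * C k - a k * S k) n" by blast
  then show ?thesis using trig_sum_mem by simp
qed

lemma trig_polys_diff:
  assumes "S \<in> trig_polys n" "T \<in> trig_polys n"
  shows "(\<lambda>x. S x - T x) \<in> trig_polys n"
proof -
  obtain a b where S: "S = trig_sum a b n" using assms(1) by (rule trig_polysE)
  obtain c d where T: "T = trig_sum c d n" using assms(2) by (rule trig_polysE)
  have "(\<lambda>x. S x - T x) = trig_sum (\<lambda>k. a k - c k) (\<lambda>k. b k - d k) n"
    by (auto simp: S T trig_sum_def algebra_simps simp flip: sum_subtractf)
  then show ?thesis by (simp add: trig_sum_mem)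
qed

lemma steklov_diff_trig_polys:
  assumes "T \<in> trig_polys n"
  shows "steklov_diff h r T \<in> trig_polys n"
  using assms by (induction r) (auto intro!: trig_polys_diff steklov_trig_polys)

section \<open>Steklov means\<close>

lemma L_per_shift:
  assumes f: "f \<in> L_per"
  shows "(\<lambda>t. f (s + t)) \<in> L_per"
proof -
  note fD [measurable] = L_perD(1)[OF f]
  have m: "(\<lambda>t. f (s + t)) \<in> borel_measurable lebesgue"
    by (rule measurable_compose[OF measurable_shift_lebesgue fD])
  have p: "f (s + (t + 2 * pi)) = f (s + t)" for t using L_perD(2)[OF f, of "s + t"] by (simp add: add.assoc)
  have Fm: "(\<lambda>x. ennreal \<bar>f x\<bar>) \<in> borel_measurable lebesgue" by measurable
  have "(\<integral>\<^sup>+t\<in>{0..<2 * pi}. ennreal \<bar>f (s + t)\<bar> \<partial>lebesgue) = (\<integral>\<^sup>+t\<in>{0 + s..<2 * pi + s}. ennreal \<bar>f t\<bar> \<partial>lebesgue)"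
    using set_nn_integral_shift[OF Fm, of 0 s "2 * pi"] by simp
  also have "\<dots> = (\<integral>\<^sup>+t\<in>{0..<2 * pi}. ennreal \<bar>f t\<bar> \<partial>lebesgue)"
    using periodic_set_nn_integral[OF Fm, of s] L_perD(2)[OF f] by (simp add: add.commute)
  also have "\<dots> < \<infinity>" using f by (simp add: L_per_iff_nn set_nn_integral_Icc)
  finally show ?thesis using m p by (auto simp: L_per_iff_nn periodic_measurable_def set_nn_integral_Icc)
qed

lemma steklov_as_window:
  assumes f: "f \<in> L_per"
  shows "steklov h f x = 1 / (2 * h) * (LINT y:{x - h..x + h}|lebesgue. f y)"
proof -
  note fD [measurable] = L_perD(1)[OF f]
  define F where "F = (\<lambda>y. indicator {x - h..x + h} y *\<^sub>R f y)"
  have Fm: "F \<in> borel_measurable lebesgue" unfolding F_def by measurable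
  have "integral\<^sup>L lebesgue F = integral\<^sup>L (distr lebesgue lebesgue (\<lambda>t. x + t)) F"
    by (simp only: lebesgue_distr_shift)
  also have "\<dots> = (LINT t|lebesgue. F (x + t))"
    by (rule integral_distr[OF measurable_shift_lebesgue Fm])
  also have "\<dots> = (LINT t:{-h..h}|lebesgue. f (x + t))"
    unfolding set_lebesgue_integral_def F_def
    by (intro Bochner_Integration.integral_cong refl) (auto simp: indicator_def)
  finally show ?thesis by (simp add: steklov_def F_def set_lebesgue_integral_def)
qed

lemma steklov_continuous:
  assumes f: "f \<in> L_per" and h: "0 < h"
  shows "continuous_on UNIV (steklov h f)"
proof -
  have io: "f integrable_on {a..b}" for a b
    using set_lebesgue_integral_eq_integral(1)[OF L_per_set_integrable[OF f]] .
  have on: "continuous_on {-R..R} (steklov h f)" for R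
  proof -
    define G where "G = (\<lambda>x. integral {- R - h..x} f)"
    have G: "continuous_on {- R - h..R + h} G"
      unfolding G_def by (rule indefinite_integral_continuous_1[OF io])
    have "continuous_on {-R..R} (\<lambda>x. 1 / (2 * h) * (G (x + h) - G (x - h)))"
      using h by (intro continuous_intros continuous_on_compose2[OF G]) auto
    moreover have "steklov h f x = 1 / (2 * h) * (G (x + h) - G (x - h))" if "x \<in> {-R..R}" for x
    proof -
      have "integral {- R - h..x - h} f + integral {x - h..x + h} f = integral {- R - h..x + h} f"
        using that h by (intro Henstock_Kurzweil_Integration.integral_combine io) auto
      then show ?thesis
        by (simp add: steklov_as_window[OF f] G_def set_lebesgue_integral_eq_integral(2)[OF L_per_set_integrable[OF f]])
    qed
    ultimately show ?thesis by (intro continuous_on_eq[of _ "\<lambda>x. 1 / (2 * h) * (G (x + h) - G (x - h))" "steklov h f"]) simp_all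
  qed
  have "isCont (steklov h f) x" for x
  proof -
    have "continuous_on {- (\<bar>x\<bar> + 1)<..<\<bar>x\<bar> + 1} (steklov h f)"
      by (rule continuous_on_subset[OF on[of "\<bar>x\<bar> + 1"]]) auto
    then show ?thesis by (rule continuous_on_interior) (auto simp: interior_open abs_less_iff)
  qed
  then show ?thesis by (simp add: continuous_on_eq_continuous_at)
qed

lemma steklov_L_per:
  assumes f: "f \<in> L_per" and h: "0 < h"
  shows "steklov h f \<in> L_per"
proof (rule continuous_periodic_L_per[OF steklov_continuous[OF f h]])
  fix x
  have "f (x + 2 * pi + t) = f (x + t)" for t using L_perD(2)[OF f, of "x + t"] by (simp add: algebra_simps)
  then show "steklov h f (x + 2 * pi) = steklov h f x" by (simp add: steklov_def)
qed

lemma L_per_add: "f \<in> L_per \<Longrightarrow> g \<in> L_per \<Longrightarrow> (\<lambda>x. f x + g x) \<in> L_per"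
  using L_per_linear[of f g 1 1] by simp

lemma L_per_diff: "f \<in> L_per \<Longrightarrow> g \<in> L_per \<Longrightarrow> (\<lambda>x. f x - g x) \<in> L_per"
  using L_per_linear[of f g 1 "-1"] by simp

lemma steklov_diff_L_per:
  assumes f: "f \<in> L_per" and h: "\<And>i. i < r \<Longrightarrow> 0 < h i"
  shows "steklov_diff h r f \<in> L_per"
  using h by (induction r) (auto simp: f intro!: L_per_diff steklov_L_per)

lemma steklov_add:
  assumes "f \<in> L_per" "g \<in> L_per"
  shows "steklov h (\<lambda>x. f x + g x) = (\<lambda>x. steklov h f x + steklov h g x)"
proof
  fix x
  show "steklov h (\<lambda>x. f x + g x) x = steklov h f x + steklov h g x"
    using L_per_set_integrable[OF L_per_shift[OF assms(1)], of "-h" h x] L_per_set_integrable[OF L_per_shift[OF assms(2)], of "-h" h x]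
    unfolding steklov_def by (subst set_integral_add) (auto simp: distrib_left)
qed

lemma steklov_diff_add:
  assumes f: "f \<in> L_per" and g: "g \<in> L_per" and h: "\<And>i. i < r \<Longrightarrow> 0 < h i"
  shows "steklov_diff h r (\<lambda>x. f x + g x) = (\<lambda>x. steklov_diff h r f x + steklov_diff h r g x)"
  using h
proof (induction r)
  case (Suc r)
  then have IH: "steklov_diff h r (\<lambda>x. f x + g x) = (\<lambda>x. steklov_diff h r f x + steklov_diff h r g x)" by simp
  have L: "steklov_diff h r f \<in> L_per" "steklov_diff h r g \<in> L_per"
    using Suc.prems by (auto intro!: steklov_diff_L_per f g)
  show ?case by (simp add: IH steklov_add[OF L] algebra_simps)
qed simp

lemma trig_sum_has_derivative:
  "(trig_sum a b n has_real_derivative trig_sum (\<lambda>k. real k * b k) (\<lambda>k. - real k * a k) n x) (at x)"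
  unfolding trig_sum_def[abs_def]
  by (rule DERIV_sum) (auto intro!: derivative_eq_intros simp: algebra_simps)

text \<open>
  The linear term of the Taylor expansion of \<open>g\<close> at \<open>x\<close> is odd and disappears in the symmetric mean.
  The remainder is governed by the increments of \<open>g1\<close>, hence by the integral of \<open>\<bar>g2\<bar>\<close>.
\<close>

lemma taylor_steklov:
  assumes g1: "\<And>x. (g has_real_derivative g1 x) (at x)" and g2: "\<And>x. (g1 has_real_derivative g2 x) (at x)"
    and c2: "continuous_on UNIV g2" and h: "0 < h"
  shows "ennreal \<bar>g x - steklov h g x\<bar> \<le> ennreal h * (\<integral>\<^sup>+y\<in>{x - h..x + h}. ennreal \<bar>g2 y\<bar> \<partial>lebesgue)"
proof -
  have cg: "continuous_on S g" for S using g1 by (meson DERIV_isCont continuous_at_imp_continuous_on)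
  have ca: "continuous_on S (\<lambda>y. \<bar>g2 y\<bar>)" for S by (intro continuous_intros continuous_on_subset[OF c2]) simp
  have ai: "set_integrable lebesgue {a..b} g2" for a b
    by (intro absolutely_integrable_continuous_real continuous_on_subset[OF c2]) simp
  define I where "I = integral {x - h..x + h} (\<lambda>y. \<bar>g2 y\<bar>)"
  have Iabs: "(\<integral>\<^sup>+y\<in>{x - h..x + h}. ennreal \<bar>g2 y\<bar> \<partial>lebesgue) = ennreal I"
    unfolding set_nn_integral_abs_eq[OF ai] I_def
    by (subst set_lebesgue_integral_eq_integral(2)) (auto intro: set_integrable_abs ai)
  have inc: "\<bar>g1 b - g1 a\<bar> \<le> I" if "x - h \<le> a" "a \<le> b" "b \<le> x + h" for a b
  proof -
    have "(g2 has_integral g1 b - g1 a) {a..b}"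
      using that(2) by (intro fundamental_theorem_of_calculus)
        (auto intro: has_field_derivative_at_within[OF g2] simp flip: has_real_derivative_iff_has_vector_derivative)
    then have "\<bar>g1 b - g1 a\<bar> = \<bar>integral {a..b} g2\<bar>" by (simp add: integral_unique)
    also have "\<dots> \<le> integral {a..b} (\<lambda>y. \<bar>g2 y\<bar>)"
      using integral_norm_bound_integral[of g2 "{a..b}" "\<lambda>y. \<bar>g2 y\<bar>"]
        integrable_continuous_real[OF continuous_on_subset[OF c2 subset_UNIV]] integrable_continuous_real[OF ca] by simp
    also have "\<dots> \<le> I" unfolding I_def
      using that by (intro integral_subset_le integrable_continuous_real ca) auto
    finally show ?thesis .
  qed
  have I0: "0 \<le> I" using inc[of x x] h by simp
  have rem: "\<bar>g x + t * g1 x - g (x + t)\<bar> \<le> h * I" if t: "t \<in> {-h..h}" for t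
  proof -
    define \<psi> where "\<psi> = (\<lambda>t. g (x + t) - t * g1 x)"
    have d: "(\<psi> has_real_derivative (g1 (x + s) - g1 x)) (at s)" for s
    proof -
      have "((\<lambda>t. g (x + t)) has_real_derivative g1 (x + s)) (at s)"
      proof -
        have "((\<lambda>t. x + t) has_real_derivative 1) (at s)" by (auto intro!: derivative_eq_intros)
        from DERIV_chain2[OF g1 this] show ?thesis by simp
      qed
      then show ?thesis unfolding \<psi>_def by (auto intro!: derivative_eq_intros)
    qed
    have "norm (\<psi> t - \<psi> 0) \<le> I * norm (t - 0)"
    proof (rule field_differentiable_bound[of "{-h..h}" \<psi> "\<lambda>s. g1 (x + s) - g1 x"])
      show "(\<psi> has_field_derivative g1 (x + s) - g1 x) (at s within {-h..h})" for s
        using d by (rule has_field_derivative_at_within)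
      show "norm (g1 (x + s) - g1 x) \<le> I" if "s \<in> {-h..h}" for s
        using inc[of x "x + s"] inc[of "x + s" x] that h by (cases "0 \<le> s") (auto simp: abs_minus_commute)
    qed (use t h in auto)
    also have "\<dots> \<le> I * h" using t I0 by (intro mult_left_mono) auto
    finally show ?thesis by (simp add: \<psi>_def abs_if mult.commute split: if_splits)
  qed
  have ii: "set_integrable lebesgue {-h..h} (\<lambda>t. g x + t * g1 x)" "set_integrable lebesgue {-h..h} (\<lambda>t. g (x + t))"
    by (intro absolutely_integrable_continuous_real continuous_intros continuous_on_compose2[OF cg[of UNIV]]; simp)+
  have "(LINT t:{-h..h}|lebesgue. g x + t * g1 x - g (x + t)) = 2 * h * (g x - steklov h g x)"
  proof -
    have it: "set_integrable lebesgue {-h..h} (\<lambda>t. t)"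
      by (intro absolutely_integrable_continuous_real continuous_intros)
    have "((\<lambda>t. t) has_integral h\<^sup>2 / 2 - (- h)\<^sup>2 / 2) {-h..h}"
      using h by (intro fundamental_theorem_of_calculus)
        (auto intro!: derivative_eq_intros simp flip: has_real_derivative_iff_has_vector_derivative)
    then have t0: "(LINT t:{-h..h}|lebesgue. t) = 0"
      using set_lebesgue_integral_eq_integral(2)[OF it] by (simp add: integral_unique)
    have "(LINT t:{-h..h}|lebesgue. g x + t * g1 x - g (x + t)) = (LINT t:{-h..h}|lebesgue. g x + t * g1 x) - (LINT t:{-h..h}|lebesgue. g (x + t))"
      by (rule set_integral_diff(2)[OF ii])
    also have "(LINT t:{-h..h}|lebesgue. g x + t * g1 x) = (LINT t:{-h..h}|lebesgue. g x) + (LINT t:{-h..h}|lebesgue. t) * g1 x"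
      using set_integral_add(2)[OF set_integrable_const_Icc set_integrable_mult_left[OF it], of "g x" "g1 x"] by simp
    also have "(LINT t:{-h..h}|lebesgue. g x) = 2 * h * g x" using h by (simp add: set_lebesgue_integral_def)
    finally show ?thesis using h t0 by (simp add: steklov_def right_diff_distrib)
  qed
  then have "ennreal (2 * h) * ennreal \<bar>g x - steklov h g x\<bar> = ennreal \<bar>LINT t:{-h..h}|lebesgue. g x + t * g1 x - g (x + t)\<bar>"
    using h by (simp add: abs_mult ennreal_mult')
  also have "\<dots> \<le> (\<integral>\<^sup>+t\<in>{-h..h}. ennreal \<bar>g x + t * g1 x - g (x + t)\<bar> \<partial>lebesgue)"
    by (rule ennreal_abs_integral_le)
  also have "\<dots> \<le> (\<integral>\<^sup>+t\<in>{-h..h}. ennreal (h * I) \<partial>lebesgue)"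
    using rem by (intro nn_integral_mono) (auto simp: indicator_def intro!: ennreal_leI)
  also have "\<dots> = ennreal (h * I) * ennreal (2 * h)"
    using h by (simp add: nn_integral_cmult_indicator)
  finally have "ennreal (2 * h * \<bar>g x - steklov h g x\<bar>) \<le> ennreal (2 * h * (h * I))"
    using h I0 by (simp add: ennreal_mult' mult_ac)
  then have "2 * h * \<bar>g x - steklov h g x\<bar> \<le> 2 * h * (h * I)"
    using h I0 by (subst (asm) ennreal_le_iff) auto
  then have "\<bar>g x - steklov h g x\<bar> \<le> h * I" using h by simp
  then show ?thesis unfolding Iabs using h by (simp add: ennreal_leI flip: ennreal_mult')
qed

text \<open>
  On polynomials of order \<open>n\<close> this is the negative of the second derivative. The linear continuation
  from \<open>n\<close> down to \<open>0\<close> at \<open>2 * n\<close> keeps the second variation of order \<open>n\<close>.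
\<close>

definition bernstein_multiplier :: "nat \<Rightarrow> nat \<Rightarrow> real" where
  "bernstein_multiplier n k =
     (if k \<le> n then (real k)\<^sup>2 else if k \<le> 2 * n then real n * (2 * real n - real k) else 0)"

lemma bernstein_multiplier_sum:
  assumes n: "1 \<le> n"
  shows "(\<Sum>k=1..2 * n. \<bar>bernstein_multiplier n k\<bar>) \<le> 12 * (real n)\<^sup>2 * real n"
proof -
  have "\<bar>bernstein_multiplier n k\<bar> \<le> (real n)\<^sup>2" for k
  proof (cases "k \<le> n")
    case True
    then show ?thesis by (simp add: bernstein_multiplier_def)
  next
    case False
    then have "real n * (2 * real n - real k) \<le> real n * real n" by (intro mult_left_mono) auto
    then show ?thesis using False by (auto simp: bernstein_multiplier_def power2_eq_square)
  qed
  then have "(\<Sum>k=1..2 * n. \<bar>bernstein_multiplier n k\<bar>) \<le> (\<Sum>k=1..2 * n. (real n)\<^sup>2)" by (intro sum_mono)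
  also have "\<dots> = 2 * real n * (real n)\<^sup>2" by simp
  also have "\<dots> \<le> 12 * (real n)\<^sup>2 * real n" by simp
  finally show ?thesis .
qed

lemma bernstein_multiplier_variation:
  assumes n: "1 \<le> n"
  shows "second_variation (bernstein_multiplier n) (2 * n) \<le> 12 * (real n)\<^sup>2 / real n"
proof -
  define d where "d = (\<lambda>k. bernstein_multiplier n (k + 2) - 2 * bernstein_multiplier n (k + 1) + bernstein_multiplier n k)"
  have dk: "\<bar>d k\<bar> \<le> 2 + (if k = n - 1 then 3 * real n else 0) + (if k = 2 * n - 1 then real n else 0)" for k
  proof -
    consider "k + 2 \<le> n" | "k + 1 = n" | "n \<le> k" "k + 2 \<le> 2 * n" | "k + 1 = 2 * n" "n \<le> k" | "2 * n \<le> k"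
      using n by linarith
    then show ?thesis
    proof cases
      case 1
      then have "d k = 2" by (simp add: d_def bernstein_multiplier_def power2_eq_square algebra_simps)
      then show ?thesis by simp
    next
      case 2
      then have "n = Suc k" by simp
      then have "d k = 1 - 3 * real n"
        by (simp add: d_def bernstein_multiplier_def power2_eq_square algebra_simps)
      then show ?thesis using 2 by auto
    next
      case 3
      then have "k = n \<Longrightarrow> d k = 0" "k \<noteq> n \<Longrightarrow> d k = 0"
        by (auto simp: d_def bernstein_multiplier_def power2_eq_square algebra_simps)
      then have "d k = 0" by blast
      then show ?thesis by auto
    next
      case 4
      then have "real k = 2 * real n - 1" by simp
      moreover have "bernstein_multiplier n k = real n * (2 * real n - real k)"
        using 4 by (cases "k = n") (auto simp: bernstein_multiplier_def power2_eq_square)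
      moreover have "bernstein_multiplier n (k + 1) = 0" "bernstein_multiplier n (k + 2) = 0"
        using 4 n by (auto simp: bernstein_multiplier_def)
      ultimately have "d k = real n" by (simp add: d_def)
      then show ?thesis using 4 by auto
    next
      case 5
      then have "d k = 0" using n by (auto simp: d_def bernstein_multiplier_def)
      then show ?thesis by auto
    qed
  qed
  have "(\<Sum>k\<le>2 * n. \<bar>d k\<bar>) \<le> (\<Sum>k\<le>2 * n. 2 + (if k = n - 1 then 3 * real n else 0) + (if k = 2 * n - 1 then real n else 0))"
    by (intro sum_mono dk)
  also have "\<dots> = 2 * real (2 * n + 1) + 3 * real n + real n"
    using n by (simp add: sum.distrib)
  also have "\<dots> \<le> 11 * real n" using n by simp
  finally have "(\<Sum>k\<le>2 * n. \<bar>d k\<bar>) \<le> 11 * real n" .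
  moreover have "\<bar>bernstein_multiplier n 1\<bar> \<le> real n" using n by (simp add: bernstein_multiplier_def)
  ultimately have "second_variation (bernstein_multiplier n) (2 * n) \<le> 12 * real n"
    by (simp add: second_variation_def d_def)
  then show ?thesis using n by (simp add: power2_eq_square)
qed

section \<open>Multipliers and Steklov means in norms with bounded window means\<close>

text \<open>
  Apart from general properties of Orlicz norms, the approximation argument depends on \<open>M\<close> and \<open>\<omega>\<close>
  only through these two bounds.
\<close>

locale averaged_norm =
  fixes M \<omega> :: "real \<Rightarrow> real" and A :: real
  assumes weight_measurable: "\<omega> \<in> borel_measurable lebesgue"
    and A: "1 \<le> A"
    and window: "f \<in> L_per \<Longrightarrow> 3 \<le> N \<Longrightarrow> orlicz_norm M \<omega> (window_mean N f) \<le> ennreal A * orlicz_norm M \<omega> f"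
    and L1: "f \<in> periodic_measurable \<Longrightarrow>
      (\<integral>\<^sup>+t\<in>{0..2 * pi}. ennreal \<bar>f t\<bar> \<partial>lebesgue) \<le> ennreal A * orlicz_norm M \<omega> f"
begin

abbreviation nrm :: "(real \<Rightarrow> real) \<Rightarrow> ennreal" where "nrm \<equiv> orlicz_norm M \<omega>"

lemma nrm_sum_le:
  fixes u :: "nat \<Rightarrow> real \<Rightarrow> real"
  assumes u: "\<And>i. i < n \<Longrightarrow> u i \<in> borel_measurable lebesgue" and c: "\<And>i. i < n \<Longrightarrow> 0 \<le> c i"
    and le: "\<And>x. \<bar>v x\<bar> \<le> (\<Sum>i<n. c i * \<bar>u i x\<bar>)"
  shows "nrm v \<le> (\<Sum>i<n. ennreal (c i) * nrm (u i))"
proof -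
  define w where "w = (\<lambda>i x. if i < n then c i * u i x else 0)"
  have wm: "w i \<in> borel_measurable lebesgue" for i
    using u[of i] by (cases "i < n") (auto simp: w_def[abs_def])
  have "nrm v \<le> (\<Sum>i. nrm (w i))"
  proof (rule orlicz_norm_countable_subadditive[OF weight_measurable wm], intro AE_I2)
    fix x
    have "ennreal \<bar>v x\<bar> \<le> ennreal (\<Sum>i<n. c i * \<bar>u i x\<bar>)" by (rule ennreal_leI[OF le])
    also have "\<dots> = (\<Sum>i<n. ennreal \<bar>w i x\<bar>)"
      using c by (subst sum_ennreal[symmetric]) (auto simp: w_def abs_mult intro!: sum.cong)
    also have "\<dots> = (\<Sum>i. ennreal \<bar>w i x\<bar>)" by (rule suminf_finite[symmetric]) (auto simp: w_def)
    finally show "ennreal \<bar>v x\<bar> \<le> (\<Sum>i. ennreal \<bar>w i x\<bar>)" .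
  qed
  also have "\<dots> = (\<Sum>i<n. nrm (w i))"
  proof (rule suminf_finite)
    fix i assume "i \<notin> {..<n}"
    then have "w i = (\<lambda>x. 0 * 0)" by (auto simp: w_def)
    then show "nrm (w i) = 0" using orlicz_norm_cmult[OF weight_measurable, of "\<lambda>_. 0" M 0] by simp
  qed simp
  also have "\<dots> = (\<Sum>i<n. ennreal (c i) * nrm (u i))"
  proof (intro sum.cong refl)
    fix i assume i: "i \<in> {..<n}"
    then have "w i = (\<lambda>x. c i * u i x)" by (auto simp: w_def)
    then show "nrm (w i) = ennreal (c i) * nrm (u i)"
      using orlicz_norm_cmult[OF weight_measurable u[of i], of M "c i"] i c[of i] by simp
  qed
  finally show ?thesis .
qed

lemma nrm_add_le:
  assumes "f \<in> borel_measurable lebesgue" "g \<in> borel_measurable lebesgue" "\<And>x. \<bar>v x\<bar> \<le> \<bar>f x\<bar> + \<bar>g x\<bar>"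
  shows "nrm v \<le> nrm f + nrm g"
proof -
  have "nrm v \<le> (\<Sum>i<2::nat. ennreal 1 * nrm ((\<lambda>i. if i = 0 then f else g) i))"
    by (rule nrm_sum_le) (use assms in \<open>auto simp: lessThan_Suc numeral_2_eq_2 add.commute\<close>)
  then show ?thesis by (simp add: numeral_2_eq_2)
qed

lemma nrm_window_le:
  assumes f: "f \<in> L_per" and N: "3 \<le> N" and c: "0 \<le> c" and le: "\<And>x. \<bar>v x\<bar> \<le> c * window_mean N f x"
  shows "nrm v \<le> ennreal (c * A) * nrm f"
proof -
  have "nrm v \<le> (\<Sum>i<(1::nat). ennreal c * nrm (window_mean N f))"
    using window_mean_measurable c le window_mean_nonneg by (intro nrm_sum_le) auto
  also have "\<dots> \<le> ennreal c * (ennreal A * nrm f)"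
    using window[OF f N] by (simp add: mult_left_mono)
  finally show ?thesis using c by (simp add: ennreal_mult' mult.assoc)
qed

text \<open>
  With about \<open>log 2 W\<close> shells, the weights in \<open>trig_multiplier_window_bound\<close> form a geometric series of
  sum at most \<open>16 * second_variation m L * W\<close>, and the innermost weight is at most \<open>4 / W\<close> times the
  absolute sum of \<open>m\<close>. Both are bounded by multiples of \<open>B\<close>.
\<close>

lemma multiplier_bound:
  assumes f: "f \<in> L_per" and m0: "m 0 = 0" and mL: "\<And>k. L < k \<Longrightarrow> m k = 0"
    and W: "1 \<le> W" and B: "0 \<le> B"
    and S0: "(\<Sum>k=1..L. \<bar>m k\<bar>) \<le> B * W" and S2: "second_variation m L \<le> B / W"
  shows "nrm (trig_multiplier m \<gamma> L f) \<le> ennreal (20 * A * B) * nrm f"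
proof -
  obtain n where n: "2 ^ n \<le> W" "W < 2 ^ Suc n"
  proof -
    obtain k0 :: nat where "W < 2 ^ k0" using real_arch_pow[of 2 W] by auto
    then have ex: "\<exists>k::nat. W < 2 ^ k" by blast
    define k where "k = (LEAST k::nat. W < 2 ^ k)"
    have k: "W < 2 ^ k" unfolding k_def by (rule LeastI_ex[OF ex])
    have "k \<noteq> 0" using k W by (intro notI) simp
    then obtain n where kn: "k = Suc n" using not0_implies_Suc by blast
    have "\<not> W < 2 ^ n" using not_less_Least[of n "\<lambda>k. W < 2 ^ k"] kn by (simp add: k_def)
    then show thesis using that[of n] k kn by simp
  qed
  define S2v where "S2v = second_variation m L"
  define S0v where "S0v = (\<Sum>k=1..L. \<bar>m k\<bar>)"
  have nn: "0 \<le> S2v" "0 \<le> S0v" by (auto simp: S2v_def S0v_def second_variation_def intro!: sum_nonneg add_nonneg_nonneg)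
  define c where "c = (\<lambda>i. if i < n then 48 * S2v * (3 * 2 ^ i / pi\<^sup>2) else S0v * (2 / 2 ^ n))"
  have c0: "0 \<le> c i" for i using nn by (simp add: c_def)
  have "nrm (trig_multiplier m \<gamma> L f) \<le> (\<Sum>i<Suc n. ennreal (c i) * nrm (window_mean (3 * 2 ^ i) f))"
  proof (rule nrm_sum_le)
    fix x
    have "\<bar>trig_multiplier m \<gamma> L f x\<bar> \<le> (\<Sum>i<n. 48 * S2v * (3 * 2 ^ i / pi\<^sup>2) * window_mean (3 * 2 ^ i) f x)
      + S0v * (2 / 2 ^ n) * window_mean (3 * 2 ^ n) f x"
      unfolding S2v_def S0v_def using mL by (intro trig_multiplier_window_bound[of f m, OF f m0]) auto
    also have "\<dots> = (\<Sum>i<Suc n. c i * \<bar>window_mean (3 * 2 ^ i) f x\<bar>)"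
      by (simp add: c_def window_mean_nonneg)
    finally show "\<bar>trig_multiplier m \<gamma> L f x\<bar> \<le> (\<Sum>i<Suc n. c i * \<bar>window_mean (3 * 2 ^ i) f x\<bar>)" .
  qed (use c0 window_mean_measurable in auto)
  also have "\<dots> \<le> (\<Sum>i<Suc n. ennreal (c i) * (ennreal A * nrm f))"
    by (intro sum_mono mult_left_mono window f) auto
  also have "\<dots> = ennreal ((\<Sum>i<Suc n. c i) * A) * nrm f"
  proof -
    have "ennreal ((\<Sum>i<Suc n. c i) * A) = (\<Sum>i<Suc n. ennreal (c i)) * ennreal A"
      using c0 A by (simp only: sum_ennreal ennreal_mult'' sum_nonneg)
    then show ?thesis by (simp only: sum_distrib_right mult.assoc)
  qed
  also have "\<dots> \<le> ennreal (20 * A * B) * nrm f"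
  proof (intro mult_right_mono ennreal_leI)
    have "(\<Sum>i<Suc n. c i) = (\<Sum>i<n. 48 * S2v * 3 / pi\<^sup>2 * 2 ^ i) + S0v * (2 / 2 ^ n)"
      by (simp add: c_def algebra_simps)
    also have "(\<Sum>i<n. 48 * S2v * 3 / pi\<^sup>2 * 2 ^ i) = 48 * S2v * 3 / pi\<^sup>2 * (2 ^ n - 1)"
    proof -
      have geo: "(\<Sum>i<n. (2::real) ^ i) = 2 ^ n - 1" by (induction n) simp_all
      show ?thesis by (simp only: sum_distrib_left[symmetric] geo)
    qed
    also have "\<dots> \<le> 16 * S2v * 2 ^ n"
    proof -
      have "3\<^sup>2 \<le> pi\<^sup>2" using pi_gt3 by (intro power_mono) auto
      then have "144 / pi\<^sup>2 \<le> 16" by (simp add: divide_simps)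
      then have "144 / pi\<^sup>2 * (S2v * (2 ^ n - 1)) \<le> 16 * (S2v * 2 ^ n)"
        using nn by (intro mult_mono) (auto intro!: mult_left_mono mult_nonneg_nonneg)
      then show ?thesis by (simp add: mult_ac)
    qed
    also have "\<dots> \<le> 16 * (B / W) * W"
      using n S2 nn W B by (intro mult_mono) (auto simp: S2v_def)
    also have "S0v * (2 / 2 ^ n) \<le> (B * W) * (4 / W)"
    proof (rule mult_mono)
      show "2 / 2 ^ n \<le> 4 / W" using n W by (simp add: field_simps)
    qed (use S0 B W in \<open>auto simp: S0v_def\<close>)
    finally have "(\<Sum>i<Suc n. c i) \<le> 20 * B" using W by simp
    then have "(\<Sum>i<Suc n. c i) * A \<le> 20 * B * A" using A by (intro mult_right_mono) auto
    then show "(\<Sum>i<Suc n. c i) * A \<le> 20 * A * B" by (simp add: mult_ac)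
  qed simp
  finally show ?thesis .
qed

lemma window_number:
  assumes h: "0 < h" "h \<le> 1"
  obtains N where "3 \<le> N" "h \<le> 2 * pi / real N" "2 * pi / real N \<le> 2 * h"
proof -
  define N where "N = nat \<lfloor>2 * pi / h\<rfloor>"
  have big: "6 \<le> 2 * pi / h"
  proof -
    have "6 * h \<le> 6" using h by simp
    then have "6 * h \<le> 2 * pi" using pi_gt3 by linarith
    then show ?thesis using h by (simp add: field_simps)
  qed
  have up: "real N \<le> 2 * pi / h" using big by (simp add: N_def)
  have "2 * pi / h < real N + 1" using big by (simp add: N_def)
  then have low: "pi / h \<le> real N" using big by simp
  have N0: "0 < real N" using low big by linarith
  have "h * real N \<le> 2 * pi" using up h by (simp add: field_simps)
  moreover have "pi \<le> h * real N" using low h by (simp add: field_simps)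
  moreover have "3 \<le> N" using low big by linarith
  ultimately show thesis using that[of N] N0 by (simp add: field_simps)
qed

lemma steklov_bounded:
  assumes f: "f \<in> L_per" and h: "0 < h" "h \<le> 1"
  shows "nrm (steklov h f) \<le> ennreal (3 * A) * nrm f"
proof -
  obtain N where N: "3 \<le> N" "h \<le> 2 * pi / real N" "2 * pi / real N \<le> 2 * h" using window_number[OF h] .
  show ?thesis
  proof (rule nrm_window_le[OF f N(1)])
    fix x
    have "ennreal \<bar>LINT y:{x - h..x + h}|lebesgue. f y\<bar> \<le> (\<integral>\<^sup>+y\<in>{x - h..x + h}. ennreal \<bar>f y\<bar> \<partial>lebesgue)"
      by (rule ennreal_abs_integral_le)
    also have "\<dots> \<le> ennreal (3 * (2 * pi / real N) * window_mean N f x)"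
      using N by (intro window_mean_covers[OF f]) auto
    finally have "\<bar>LINT y:{x - h..x + h}|lebesgue. f y\<bar> \<le> 3 * (2 * pi / real N) * window_mean N f x"
      using window_mean_nonneg[of N f x] by (subst (asm) ennreal_le_iff) auto
    also have "\<dots> \<le> 3 * (2 * h) * window_mean N f x"
      using N(3) window_mean_nonneg[of N f x] by (intro mult_right_mono mult_left_mono) auto
    finally have "\<bar>LINT y:{x - h..x + h}|lebesgue. f y\<bar> / (2 * h) \<le> 3 * window_mean N f x"
      using h by (simp add: pos_divide_le_eq mult_ac)
    then show "\<bar>steklov h f x\<bar> \<le> 3 * window_mean N f x"
      using h by (simp add: steklov_as_window[OF f] abs_mult)
  qed simp
qed

lemma steklov_diff_bounded:
  assumes f: "f \<in> L_per" and h: "\<And>i. i < r \<Longrightarrow> 0 < h i \<and> h i \<le> 1"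
  shows "nrm (steklov_diff h r f) \<le> ennreal ((4 * A) ^ r) * nrm f"
  using h
proof (induction r)
  case (Suc r)
  have L: "steklov_diff h r f \<in> L_per" using Suc.prems by (intro steklov_diff_L_per f) auto
  have Ls: "steklov (h r) (steklov_diff h r f) \<in> L_per" using Suc.prems by (intro steklov_L_per L) auto
  have "nrm (steklov_diff h (Suc r) f) \<le> nrm (steklov_diff h r f) + nrm (steklov (h r) (steklov_diff h r f))"
    by (rule nrm_add_le) (auto simp: L_perD(1)[OF L] L_perD(1)[OF Ls])
  also have "\<dots> \<le> nrm (steklov_diff h r f) + ennreal (3 * A) * nrm (steklov_diff h r f)"
    using Suc.prems by (intro add_left_mono steklov_bounded L) auto
  also have "\<dots> = ennreal (1 + 3 * A) * nrm (steklov_diff h r f)"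
    using A by (simp add: distrib_right)
  also have "\<dots> \<le> ennreal (4 * A) * nrm (steklov_diff h r f)"
    using A by (intro mult_right_mono ennreal_leI) auto
  also have "\<dots> \<le> ennreal (4 * A) * (ennreal ((4 * A) ^ r) * nrm f)"
    using Suc by (intro mult_left_mono) auto
  also have "\<dots> = ennreal ((4 * A) ^ Suc r) * nrm f"
    using A by (simp add: ennreal_mult' mult.assoc)
  finally show ?case .
qed simp

text \<open>
  \<open>taylor_steklov\<close> bounds the difference by a window mean of the second derivative, times \<open>6 * h\<^sup>2\<close>, and
  Bernstein's inequality for the second derivative is \<open>multiplier_bound\<close> for \<open>bernstein_multiplier\<close>.
\<close>

lemma steklov_poly_approx:
  assumes T: "T \<in> trig_polys n" and n: "1 \<le> n" and h: "0 < h" "h \<le> 1"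
  shows "nrm (\<lambda>x. T x - steklov h T x) \<le> ennreal (1440 * A\<^sup>2 * (h * real n)\<^sup>2) * nrm T"
proof -
  obtain a b where Te: "T = trig_sum a b n" using T by (rule trig_polysE)
  define g1 where "g1 = trig_sum (\<lambda>k. real k * b k) (\<lambda>k. - real k * a k) n"
  define g2 where "g2 = trig_sum (\<lambda>k. real k * (- real k * a k)) (\<lambda>k. - real k * (real k * b k)) n"
  have g2L: "g2 \<in> L_per" unfolding g2_def by (rule trig_polys_L_per[OF trig_sum_mem])
  have g2M: "g2 x = - trig_multiplier (bernstein_multiplier n) 0 (2 * n) T x" for x
  proof -
    have "trig_multiplier (bernstein_multiplier n) 0 (2 * n) T x
       = (\<Sum>k=1..n. bernstein_multiplier n k * (a k * cos (real k * x + 0) + b k * sin (real k * x + 0)))"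
      unfolding Te trig_multiplier_trig_sum by (simp add: min_def)
    also have "\<dots> = (\<Sum>k=1..n. (real k)\<^sup>2 * (a k * cos (real k * x) + b k * sin (real k * x)))"
      by (intro sum.cong) (auto simp: bernstein_multiplier_def)
    also have "\<dots> = (\<Sum>k\<le>n. (real k)\<^sup>2 * (a k * cos (real k * x) + b k * sin (real k * x)))"
      by (intro sum.mono_neutral_left) auto
    also have "\<dots> = - g2 x"
      unfolding g2_def trig_sum_def sum_negf[symmetric] by (intro sum.cong) (auto simp: power2_eq_square algebra_simps)
    finally show ?thesis by simp
  qed
  have bern: "nrm g2 \<le> ennreal (20 * A * (12 * (real n)\<^sup>2)) * nrm T"
  proof -
    have "nrm g2 \<le> nrm (trig_multiplier (bernstein_multiplier n) 0 (2 * n) T)"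
      by (rule orlicz_norm_mono[OF weight_measurable])
        (auto simp: g2M L_perD(1)[OF trig_polys_L_per[OF trig_multiplier_mem]])
    also have "\<dots> \<le> ennreal (20 * A * (12 * (real n)\<^sup>2)) * nrm T"
      using n bernstein_multiplier_sum[OF n] bernstein_multiplier_variation[OF n]
      by (intro multiplier_bound[of _ _ _ "real n"] trig_polys_L_per[OF T]) (auto simp: bernstein_multiplier_def)
    finally show ?thesis .
  qed
  obtain N where N: "3 \<le> N" "h \<le> 2 * pi / real N" "2 * pi / real N \<le> 2 * h" using window_number[OF h] .
  have "nrm (\<lambda>x. T x - steklov h T x) \<le> ennreal (6 * h\<^sup>2 * A) * nrm g2"
  proof (rule nrm_window_le[OF g2L N(1)])
    fix x
    have "ennreal \<bar>T x - steklov h T x\<bar> \<le> ennreal h * (\<integral>\<^sup>+y\<in>{x - h..x + h}. ennreal \<bar>g2 y\<bar> \<partial>lebesgue)"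
    proof (rule taylor_steklov[of _ g1])
      show "(T has_real_derivative g1 x) (at x)" for x unfolding Te g1_def by (rule trig_sum_has_derivative)
      show "(g1 has_real_derivative g2 x) (at x)" for x unfolding g1_def g2_def by (rule trig_sum_has_derivative)
      show "continuous_on UNIV g2" unfolding g2_def by (rule trig_sum_continuous)
    qed (rule h)
    also have "\<dots> \<le> ennreal h * ennreal (3 * (2 * pi / real N) * window_mean N g2 x)"
      using N by (intro mult_left_mono window_mean_covers[OF g2L]) auto
    also have "\<dots> = ennreal (h * (3 * (2 * pi / real N) * window_mean N g2 x))"
      using h by (intro ennreal_mult'[symmetric]) simp
    finally have "\<bar>T x - steklov h T x\<bar> \<le> h * (3 * (2 * pi / real N) * window_mean N g2 x)"
      using window_mean_nonneg[of N g2 x] h by (subst (asm) ennreal_le_iff) auto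
    also have "\<dots> \<le> h * (3 * (2 * h) * window_mean N g2 x)"
      using N(3) h window_mean_nonneg[of N g2 x] by (intro mult_left_mono mult_right_mono) auto
    finally show "\<bar>T x - steklov h T x\<bar> \<le> 6 * h\<^sup>2 * window_mean N g2 x" by (simp add: power2_eq_square mult_ac)
  qed simp
  also have "\<dots> \<le> ennreal (6 * h\<^sup>2 * A) * (ennreal (20 * A * (12 * (real n)\<^sup>2)) * nrm T)"
    by (intro mult_left_mono bern) simp
  also have "\<dots> = ennreal (1440 * A\<^sup>2 * (h * real n)\<^sup>2) * nrm T"
  proof -
    have "6 * h\<^sup>2 * A * (20 * A * (12 * (real n)\<^sup>2)) = 1440 * A\<^sup>2 * (h * real n)\<^sup>2"
      by (simp add: power_mult_distrib power2_eq_square)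
    moreover have "0 \<le> 6 * h\<^sup>2 * A" using A by simp
    ultimately show ?thesis using ennreal_mult'[of "6 * h\<^sup>2 * A" "20 * A * (12 * (real n)\<^sup>2)"] by (simp only: mult.assoc[symmetric])
  qed
  finally show ?thesis .
qed

lemma steklov_diff_poly_approx:
  assumes T: "T \<in> trig_polys n" and n: "1 \<le> n" and h: "\<And>i. i < r \<Longrightarrow> 0 < h i \<and> h i \<le> \<delta>" and \<delta>: "\<delta> \<le> 1"
  shows "nrm (steklov_diff h r T) \<le> ennreal ((1440 * A\<^sup>2) ^ r * (\<delta> * real n) ^ (2 * r)) * nrm T"
  using h
proof (induction r)
  case (Suc r)
  have hr: "0 < h r" "h r \<le> \<delta>" using Suc.prems by auto
  define K where "K = 1440 * A\<^sup>2 * (\<delta> * real n)\<^sup>2"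
  have K0: "0 \<le> K" by (simp add: K_def)
  have "nrm (steklov_diff h (Suc r) T) \<le> ennreal (1440 * A\<^sup>2 * (h r * real n)\<^sup>2) * nrm (steklov_diff h r T)"
    using hr \<delta> steklov_poly_approx[OF steklov_diff_trig_polys[OF T] n, of "h r" h r] by simp
  also have "\<dots> \<le> ennreal K * nrm (steklov_diff h r T)"
    unfolding K_def using hr by (intro mult_right_mono ennreal_leI mult_left_mono power_mono) auto
  also have "\<dots> \<le> ennreal K * (ennreal ((1440 * A\<^sup>2) ^ r * (\<delta> * real n) ^ (2 * r)) * nrm T)"
    using Suc by (intro mult_left_mono) auto
  also have "\<dots> = ennreal (K * ((1440 * A\<^sup>2) ^ r * (\<delta> * real n) ^ (2 * r))) * nrm T"
    using K0 by (simp only: ennreal_mult' mult.assoc)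
  also have "K * ((1440 * A\<^sup>2) ^ r * (\<delta> * real n) ^ (2 * r)) = (1440 * A\<^sup>2) ^ Suc r * (\<delta> * real n) ^ (2 * Suc r)"
    by (simp add: K_def power2_eq_square)
  finally show ?case .
qed simp

end

section \<open>Partition of the frequencies\<close>

lemma second_variation_le_sum:
  assumes m0: "m 0 = 0" and mL: "\<And>k. L < k \<Longrightarrow> m k = 0"
  shows "second_variation m L \<le> 5 * (\<Sum>k=1..L. \<bar>m k\<bar>)"
proof -
  define S where "S = (\<Sum>k=1..L. \<bar>m k\<bar>)"
  have part: "(\<Sum>k\<in>I. \<bar>m k\<bar>) \<le> S" if "finite I" for I
  proof -
    have "(\<Sum>k\<in>I. \<bar>m k\<bar>) = (\<Sum>k\<in>I \<inter> {1..L}. \<bar>m k\<bar>)"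
    proof (rule sum.mono_neutral_right)
      show "\<forall>k\<in>I - I \<inter> {1..L}. \<bar>m k\<bar> = 0"
      proof
        fix k assume "k \<in> I - I \<inter> {1..L}"
        then have "k = 0 \<or> L < k" by auto
        then show "\<bar>m k\<bar> = 0" using m0 mL by auto
      qed
    qed (use that in auto)
    also have "\<dots> \<le> S" unfolding S_def by (intro sum_mono2) auto
    finally show ?thesis .
  qed
  have a: "(\<Sum>k\<le>L. \<bar>m (k + c)\<bar>) \<le> S" for c
  proof -
    have "(\<Sum>k\<le>L. \<bar>m (k + c)\<bar>) = (\<Sum>k\<in>(\<lambda>k. k + c) ` {..L}. \<bar>m k\<bar>)"
      by (subst sum.reindex) (auto intro: inj_onI)
    also have "\<dots> \<le> S" by (intro part) auto
    finally show ?thesis .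
  qed
  have b: "\<bar>m 1\<bar> \<le> S" using part[of "{1}"] by simp
  have "(\<Sum>k\<le>L. \<bar>m (k + 2) - 2 * m (k + 1) + m k\<bar>) \<le> (\<Sum>k\<le>L. \<bar>m (k + 2)\<bar> + 2 * \<bar>m (k + 1)\<bar> + \<bar>m (k + 0)\<bar>)"
    by (intro sum_mono) simp
  also have "\<dots> = (\<Sum>k\<le>L. \<bar>m (k + 2)\<bar>) + 2 * (\<Sum>k\<le>L. \<bar>m (k + 1)\<bar>) + (\<Sum>k\<le>L. \<bar>m (k + 0)\<bar>)"
    by (simp add: sum.distrib sum_distrib_left)
  also have "\<dots> \<le> S + 2 * S + S" by (intro add_mono mult_left_mono a) auto
  finally show ?thesis using b by (simp add: second_variation_def S_def)
qed

text \<open>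
  \<open>p\<close> is the sequence \<open>\<psi>\<close> and \<open>\<nu> i\<close> are the nodes of the partition. From one node to the next, \<open>p\<close>, the
  nodes and the gaps between them change at most by the factor \<open>K\<close>. The weight \<open>lam\<close> is \<open>1 / k\<close> or
  \<open>1 / (eta k - k)\<close>, the factor of \<open>1 / \<psi> k\<close> in the tail series; \<open>lam_gap\<close> says that its sum over a
  gap is not small.
\<close>

locale block_scale =
  fixes p :: "nat \<Rightarrow> real" and \<nu> :: "nat \<Rightarrow> nat" and lam :: "nat \<Rightarrow> real" and K :: real
  assumes p_pos: "1 \<le> k \<Longrightarrow> 0 < p k"
    and p_dec: "1 \<le> k \<Longrightarrow> p (k + 1) \<le> p k"
    and p_convex: "1 \<le> k \<Longrightarrow> 0 \<le> p (k + 2) - 2 * p (k + 1) + p k"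
    and \<nu>0: "\<nu> 0 = 1"
    and \<nu>_less: "\<nu> i < \<nu> (Suc i)"
    and K1: "1 \<le> K"
    and p_ratio: "p (\<nu> i) \<le> K * p (\<nu> (Suc i))"
    and \<nu>_ratio: "real (\<nu> (Suc i)) \<le> K * real (\<nu> i)"
    and gap_up: "real (\<nu> (Suc (Suc i))) - real (\<nu> (Suc i)) \<le> K * (real (\<nu> (Suc i)) - real (\<nu> i))"
    and gap_down: "real (\<nu> (Suc i)) - real (\<nu> i) \<le> K * (real (\<nu> (Suc (Suc i))) - real (\<nu> (Suc i)))"
    and lam_pos: "1 \<le> k \<Longrightarrow> 0 < lam k"
    and lam_gap: "\<nu> i < k \<Longrightarrow> k \<le> \<nu> (Suc i) \<Longrightarrow> 1 \<le> K * lam k * (real (\<nu> (Suc i)) - real (\<nu> i))"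
begin

definition u :: "nat \<Rightarrow> real" where "u k = 1 / p k"

definition w :: "nat \<Rightarrow> real" where "w i = real (\<nu> (Suc i)) - real (\<nu> i)"

lemma w_ge_1: "1 \<le> w i"
  using \<nu>_less[of i] by (simp add: w_def)

lemma \<nu>_mono: "i \<le> j \<Longrightarrow> \<nu> i \<le> \<nu> j"
  using \<nu>_less by (metis lift_Suc_mono_le less_imp_le)

lemma \<nu>_strict: "i < j \<Longrightarrow> \<nu> i < \<nu> j"
  using \<nu>_less by (rule lift_Suc_mono_less)

lemma \<nu>_ge_1: "1 \<le> \<nu> i"
  using \<nu>_mono[of 0 i] \<nu>0 by simp

lemma \<nu>_ge: "i < \<nu> i"
proof (induction i)
  case (Suc i)
  then show ?case using \<nu>_less[of i] by linarith
qed (simp add: \<nu>0)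

lemma p_antimono: "1 \<le> j \<Longrightarrow> j \<le> k \<Longrightarrow> p k \<le> p j"
proof (induction k)
  case (Suc k)
  show ?case
  proof (cases "j = Suc k")
    case False
    then show ?thesis using Suc p_dec[of k] by simp
  qed simp
qed simp

lemma u_pos: "1 \<le> k \<Longrightarrow> 0 < u k"
  using p_pos by (simp add: u_def)

lemma u_mono: "1 \<le> j \<Longrightarrow> j \<le> k \<Longrightarrow> u j \<le> u k"
  using p_antimono[of j k] p_pos[of k] by (simp add: u_def frac_le)

lemma u_ratio: "u (\<nu> (i + j)) \<le> K ^ j * u (\<nu> i)"
proof (induction j)
  case (Suc j)
  have "u (\<nu> (Suc (i + j))) \<le> K * u (\<nu> (i + j))"
    using p_ratio[of "i + j"] p_pos[OF \<nu>_ge_1, of "i + j"] p_pos[OF \<nu>_ge_1, of "Suc (i + j)"]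
    by (simp add: u_def field_simps)
  also have "\<dots> \<le> K * (K ^ j * u (\<nu> i))" using Suc K1 by (intro mult_left_mono) auto
  finally show ?case by simp
qed simp

lemma \<nu>_power_ratio: "real (\<nu> (i + j)) \<le> K ^ j * real (\<nu> i)"
proof (induction j)
  case (Suc j)
  have "real (\<nu> (Suc (i + j))) \<le> K * real (\<nu> (i + j))" by (rule \<nu>_ratio)
  also have "\<dots> \<le> K * (K ^ j * real (\<nu> i))" using Suc K1 by (intro mult_left_mono) auto
  finally show ?case by simp
qed simp

definition slope :: "nat \<Rightarrow> real" where "slope k = p k - p (k + 1)"

lemma slope_nonneg: "1 \<le> k \<Longrightarrow> 0 \<le> slope k"
  using p_dec by (simp add: slope_def)

lemma slope_antimono: "1 \<le> j \<Longrightarrow> j \<le> k \<Longrightarrow> slope k \<le> slope j"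
proof (induction k)
  case (Suc k)
  show ?case
  proof (cases "j = Suc k")
    case False
    then have "slope k \<le> slope j" using Suc by simp
    moreover have "slope (Suc k) \<le> slope k" using p_convex[of k] False Suc.prems by (simp add: slope_def)
    ultimately show ?thesis by simp
  qed simp
qed simp

lemma slope_times_gap:
  assumes "1 \<le> j"
  shows "real l * slope (j + l) \<le> p j"
proof -
  have "real l * slope (j + l) \<le> p j - p (j + l)"
  proof (induction l)
    case (Suc l)
    have "real (Suc l) * slope (j + Suc l) = real l * slope (j + Suc l) + slope (j + Suc l)"
      by (simp add: algebra_simps)
    also have "\<dots> \<le> real l * slope (j + l) + slope (j + l)"
      using assms by (intro add_mono mult_left_mono slope_antimono) auto
    also have "\<dots> \<le> p j - p (j + l) + slope (j + l)" using Suc by simp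
    finally show ?case by (simp add: slope_def)
  qed simp
  then show ?thesis using p_pos[of "j + l"] assms by simp
qed

text \<open>
  By convexity the slope at \<open>\<nu> i\<close> is at most the mean slope over the preceding gap, and that gap and
  the value of \<open>p\<close> at its left end are comparable to \<open>w i\<close> and \<open>p (\<nu> i)\<close>.
\<close>

lemma slope_at_node: "slope (\<nu> i) \<le> K ^ 2 * p (\<nu> i) / w i"
proof (cases i)
  case 0
  have "slope 1 \<le> p 1" using p_pos[of 2] by (simp add: slope_def numeral_2_eq_2)
  also have "\<dots> \<le> K ^ 2 * p 1 / w 0"
  proof -
    have "w 0 \<le> K" using \<nu>_ratio[of 0] by (simp add: w_def \<nu>0)
    also have "\<dots> \<le> K ^ 2" using K1 self_le_power[of K 2] by simp
    finally have "w 0 * p 1 \<le> K ^ 2 * p 1" using p_pos[of 1] by (intro mult_right_mono) auto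
    then show ?thesis using w_ge_1[of 0] by (simp add: pos_le_divide_eq mult.commute)
  qed
  finally show ?thesis using 0 by (simp add: \<nu>0)
next
  case (Suc j)
  have "real (\<nu> i - \<nu> j) * slope (\<nu> j + (\<nu> i - \<nu> j)) \<le> p (\<nu> j)"
    by (rule slope_times_gap[OF \<nu>_ge_1])
  then have "w j * slope (\<nu> i) \<le> p (\<nu> j)"
    using \<nu>_less[of j] Suc by (simp add: w_def of_nat_diff)
  also have "\<dots> \<le> K * p (\<nu> i)" using p_ratio[of j] Suc by simp
  finally have a: "w j * slope (\<nu> i) \<le> K * p (\<nu> i)" .
  have "w i * slope (\<nu> i) \<le> K * w j * slope (\<nu> i)"
    using gap_up[of j] Suc slope_nonneg[OF \<nu>_ge_1, of i] by (intro mult_right_mono) (auto simp: w_def)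
  also have "\<dots> \<le> K * (K * p (\<nu> i))" using a K1 by (simp add: mult.assoc)
  finally have "w i * slope (\<nu> i) \<le> K ^ 2 * p (\<nu> i)" by (simp add: power2_eq_square mult.assoc)
  then show ?thesis using w_ge_1[of i] by (simp add: pos_le_divide_eq mult.commute)
qed

text \<open>
  The increments of \<open>u\<close> are \<open>slope k * v k\<close> with the decreasing factor \<open>slope\<close> and the increasing factor
  \<open>v k = u k * u (k + 1)\<close>. The increments of such a product can be summed separately for each factor.
\<close>

lemma reciprocal_variation:
  assumes a: "1 \<le> a" and "a \<le> b"
  shows "(\<Sum>k\<in>{a<..<b}. \<bar>u (k + 1) - 2 * u k + u (k - 1)\<bar>) \<le> 2 * slope a * (u b)\<^sup>2"
proof -
  define v where "v = (\<lambda>k. u k * u (k + 1))"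
  have du: "u (k + 1) - u k = slope k * v k" if "1 \<le> k" for k
    using p_pos[of k] p_pos[of "k + 1"] that by (simp add: u_def v_def slope_def diff_frac_eq mult.commute)
  have vm: "v j \<le> v k" if "1 \<le> j" "j \<le> k" for j k
    unfolding v_def using that u_pos[of j] u_pos[of k] u_pos[of "j + 1"] by (intro mult_mono u_mono) auto
  have v0: "0 \<le> v k" if "1 \<le> k" for k using u_pos[of k] u_pos[of "k + 1"] that by (simp add: v_def)
  have "(\<Sum>k\<in>{a<..<b}. \<bar>u (k + 1) - 2 * u k + u (k - 1)\<bar>)
      \<le> slope a * (v (b - 1) - v a) + (slope a - slope (b - 1)) * v (b - 1)" if "a < b"
    using that
  proof (induction b)
    case (Suc b)
    show ?case
    proof (cases "a = b")
      case True
      then have "{a<..<Suc b} = {}" by auto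
      then show ?thesis using True by simp
    next
      case False
      then have ab: "a < b" using Suc.prems by simp
      have b1: "1 \<le> b - 1" "Suc (b - 1) = b" using ab a by auto
      have e: "{a<..<Suc b} = insert b {a<..<b}" using ab by auto
      have "u (b + 1) - 2 * u b + u (b - 1) = slope b * v b - slope (b - 1) * v (b - 1)"
        using du[of b] du[of "b - 1"] b1 ab a by simp
      also have "\<dots> = slope b * (v b - v (b - 1)) - (slope (b - 1) - slope b) * v (b - 1)"
        by (simp add: algebra_simps)
      finally have "\<bar>u (b + 1) - 2 * u b + u (b - 1)\<bar>
          \<le> \<bar>slope b * (v b - v (b - 1))\<bar> + \<bar>(slope (b - 1) - slope b) * v (b - 1)\<bar>"
        by (simp only: abs_triangle_ineq4)
      also have "\<dots> = slope b * (v b - v (b - 1)) + (slope (b - 1) - slope b) * v (b - 1)"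
        using slope_nonneg[of b] slope_antimono[of "b - 1" b] vm[of "b - 1" b] v0[of "b - 1"] b1 ab a
        by simp
      also have "\<dots> \<le> slope a * (v b - v (b - 1)) + (slope (b - 1) - slope b) * v b"
        using slope_antimono[of a b] slope_antimono[of "b - 1" b] vm[of "b - 1" b] b1 ab a
        by (intro add_mono mult_right_mono mult_left_mono) auto
      finally have one: "\<bar>u (b + 1) - 2 * u b + u (b - 1)\<bar> \<le> \<dots>" .
      have "(slope a - slope (b - 1)) * v (b - 1) \<le> (slope a - slope (b - 1)) * v b"
        using slope_antimono[of a "b - 1"] vm[of "b - 1" b] b1 ab a by (intro mult_left_mono) auto
      then show ?thesis using Suc.IH[OF ab] one unfolding e by (simp add: algebra_simps)
    qed
  qed simp
  moreover have "slope a * (v (b - 1) - v a) + (slope a - slope (b - 1)) * v (b - 1) \<le> 2 * slope a * (u b)\<^sup>2" if ab: "a < b"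
  proof -
    have b1: "1 \<le> b - 1" "Suc (b - 1) = b" using ab a by auto
    have vb: "v (b - 1) \<le> (u b)\<^sup>2"
      using b1 u_mono[of "b - 1" b] u_pos[of b] by (simp add: v_def power2_eq_square mult_right_mono)
    have "slope a * (v (b - 1) - v a) \<le> slope a * v (b - 1)"
      using v0[OF a] slope_nonneg[OF a] by (intro mult_left_mono) auto
    moreover have "(slope a - slope (b - 1)) * v (b - 1) \<le> slope a * v (b - 1)"
      using v0[of "b - 1"] slope_nonneg[of "b - 1"] b1 by (intro mult_right_mono) auto
    moreover have "slope a * v (b - 1) \<le> slope a * (u b)\<^sup>2"
      using vb slope_nonneg[OF a] by (intro mult_left_mono)
    ultimately show ?thesis by simp
  qed
  moreover have "(\<Sum>k\<in>{a<..<b}. \<bar>u (k + 1) - 2 * u k + u (k - 1)\<bar>) \<le> 2 * slope a * (u b)\<^sup>2" if "a = b"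
    using slope_nonneg[OF a] that by simp
  ultimately show ?thesis using \<open>a \<le> b\<close> by linarith
qed

text \<open>
  For \<open>i > 0\<close> the ramp falls linearly from \<open>1\<close> at \<open>\<nu> (i - 1)\<close> to \<open>0\<close> at \<open>\<nu> i\<close>. The ramp with index \<open>0\<close>
  singles out the frequency \<open>0\<close>, so that the hats add up to \<open>1\<close> at all \<open>k \<ge> 1\<close> and to \<open>0\<close> at \<open>k = 0\<close>.
\<close>

definition ramp :: "nat \<Rightarrow> nat \<Rightarrow> real" where
  "ramp i k = (case i of 0 \<Rightarrow> if k = 0 then 1 else 0
     | Suc j \<Rightarrow> max 0 (min 1 ((real (\<nu> i) - real k) / w j)))"

definition hat :: "nat \<Rightarrow> nat \<Rightarrow> real" where "hat i k = ramp (Suc i) k - ramp i k"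

definition piece :: "nat \<Rightarrow> nat \<Rightarrow> real" where "piece i k = u k * hat i k"

lemma ramp_one: "k < \<nu> i \<Longrightarrow> 0 < i \<Longrightarrow> k \<le> \<nu> (i - 1) \<Longrightarrow> ramp i k = 1"
  using w_ge_1[of "i - 1"] by (cases i) (auto simp: ramp_def w_def field_simps min_def)

lemma ramp_zero: "\<nu> i \<le> k \<Longrightarrow> ramp i k = 0"
  using w_ge_1[of "i - 1"] \<nu>0 by (cases i) (auto simp: ramp_def divide_le_0_iff)

lemma sum_hat: "(\<Sum>i<n. hat i k) = ramp n k - ramp 0 k"
  by (induction n) (simp_all add: hat_def)

lemma hat_outside: "k < \<nu> (i - 1) \<or> \<nu> (Suc i) \<le> k \<Longrightarrow> hat i k = 0"
proof (elim disjE)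
  assume k: "k < \<nu> (i - 1)"
  show "hat i k = 0"
  proof (cases i)
    case 0
    then show ?thesis using k \<nu>0 ramp_one[of 0 1] \<nu>_less[of 0] by (simp add: hat_def ramp_def)
  next
    case (Suc j)
    have "k < \<nu> i" "k \<le> \<nu> i" "k < \<nu> (Suc i)"
      using k Suc \<nu>_less[of j] \<nu>_less[of i] by auto
    then show ?thesis using k Suc ramp_one[of k i] ramp_one[of k "Suc i"] by (simp add: hat_def)
  qed
next
  assume "\<nu> (Suc i) \<le> k"
  then show "hat i k = 0" using ramp_zero[of "Suc i" k] ramp_zero[of i k] \<nu>_less[of i] by (simp add: hat_def)
qed

lemma hat_up:
  assumes "\<nu> i \<le> k" "k \<le> \<nu> (Suc i)"
  shows "hat (Suc i) k = (real k - real (\<nu> i)) / w i"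
proof -
  have "ramp (Suc (Suc i)) k = 1"
    using assms \<nu>_less[of "Suc i"] by (intro ramp_one) auto
  moreover have "ramp (Suc i) k = (real (\<nu> (Suc i)) - real k) / w i"
    using assms w_ge_1[of i] by (simp add: ramp_def w_def max_def min_def field_simps)
  ultimately show ?thesis using w_ge_1[of i] by (simp add: hat_def w_def field_simps)
qed

lemma hat_down:
  assumes "\<nu> i \<le> k" "k \<le> \<nu> (Suc i)"
  shows "hat i k = (real (\<nu> (Suc i)) - real k) / w i"
proof -
  have "ramp i k = 0" using assms by (intro ramp_zero)
  moreover have "ramp (Suc i) k = (real (\<nu> (Suc i)) - real k) / w i"
    using assms w_ge_1[of i] by (simp add: ramp_def w_def max_def min_def field_simps)
  ultimately show ?thesis by (simp add: hat_def)
qed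

lemma piece_outside: "k < \<nu> (i - 1) \<or> \<nu> (Suc i) \<le> k \<Longrightarrow> piece i k = 0"
  by (simp add: piece_def hat_outside)

lemma piece_zero: "piece i 0 = 0"
  using piece_outside[of 0 i] \<nu>_ge_1[of "i - 1"] by simp

lemma hat_bounds: "0 \<le> hat i k" "hat i k \<le> 1"
proof -
  have "0 \<le> hat i k \<and> hat i k \<le> 1"
  proof (cases "\<nu> i \<le> k")
    case True
    show ?thesis
    proof (cases "k \<le> \<nu> (Suc i)")
      case True
      show ?thesis unfolding hat_down[OF \<open>\<nu> i \<le> k\<close> True]
        using True \<open>\<nu> i \<le> k\<close> w_ge_1[of i] by (auto simp: w_def field_simps)
    next
      case False
      then show ?thesis using hat_outside[of k i] by simp
    qed
  next
    case False
    show ?thesis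
    proof (cases i)
      case 0
      then show ?thesis using False \<nu>0 hat_outside[of k i] by simp
    next
      case (Suc j)
      show ?thesis
      proof (cases "k < \<nu> j")
        case True
        then show ?thesis using Suc hat_outside[of k i] by simp
      next
        case False2: False
        then have "hat i k = (real k - real (\<nu> j)) / w j" using False Suc hat_up[of j k] by simp
        then show ?thesis using False False2 Suc w_ge_1[of j] by (simp only:) (auto simp: w_def field_simps)
      qed
    qed
  qed
  then show "0 \<le> hat i k" "hat i k \<le> 1" by auto
qed

lemma piece_abs: "\<bar>piece i k\<bar> \<le> (if \<nu> (i - 1) \<le> k \<and> k < \<nu> (Suc i) then u (\<nu> (Suc i)) else 0)"
proof (cases "\<nu> (i - 1) \<le> k \<and> k < \<nu> (Suc i)")
  case True
  have k1: "1 \<le> k" using True \<nu>_ge_1[of "i - 1"] by linarith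
  have "\<bar>piece i k\<bar> = u k * hat i k" using u_pos[OF k1] hat_bounds[of i k] by (simp add: piece_def abs_mult)
  also have "\<dots> \<le> u (\<nu> (Suc i)) * 1"
    using True k1 u_pos[OF k1] u_pos[OF \<nu>_ge_1, of "Suc i"] hat_bounds[of i k] by (intro mult_mono u_mono) auto
  finally show ?thesis using True by simp
next
  case False
  then have "piece i k = 0" by (intro piece_outside) auto
  then show ?thesis by (simp only: if_not_P[OF False] abs_zero order_refl)
qed

lemma piece_sum: "(\<Sum>k=1..L. \<bar>piece i k\<bar>) \<le> u (\<nu> (Suc i)) * (real (\<nu> (Suc i)) - real (\<nu> (i - 1)))"
proof -
  have le: "\<nu> (i - 1) \<le> \<nu> (Suc i)" by (intro \<nu>_mono) auto
  have "(\<Sum>k=1..L. \<bar>piece i k\<bar>) \<le> (\<Sum>k=1..L. if \<nu> (i - 1) \<le> k \<and> k < \<nu> (Suc i) then u (\<nu> (Suc i)) else 0)"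
    by (intro sum_mono piece_abs)
  also have "\<dots> = (\<Sum>k\<in>{1..L} \<inter> {\<nu> (i - 1)..<\<nu> (Suc i)}. u (\<nu> (Suc i)))"
    by (subst sum.inter_restrict) (auto intro: sum.cong)
  also have "\<dots> \<le> (\<Sum>k\<in>{\<nu> (i - 1)..<\<nu> (Suc i)}. u (\<nu> (Suc i)))"
    using u_pos[OF \<nu>_ge_1, of "Suc i"] by (intro sum_mono2) auto
  also have "\<dots> = u (\<nu> (Suc i)) * (real (\<nu> (Suc i)) - real (\<nu> (i - 1)))"
    using le by (simp add: of_nat_diff)
  finally show ?thesis .
qed

lemma K_powers: "1 \<le> K ^ n" "K \<le> K ^ 5" "K ^ 2 \<le> K ^ 5"
  using K1 self_le_power[of K 5] power_increasing[of 2 5 K] by auto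

text \<open>
  As \<open>\<nu> 1 \<le> K\<close>, the first piece has boundedly many frequencies, and a crude bound is enough.
\<close>

lemma piece_first:
  "(\<Sum>k=1..\<nu> 1. \<bar>piece 0 k\<bar>) \<le> 8 * K ^ 5 * u (\<nu> 1) * 1"
  "second_variation (piece 0) (\<nu> 1) \<le> 8 * K ^ 5 * u (\<nu> 1) / 1"
proof -
  have u0: "0 < u (\<nu> 1)" by (rule u_pos[OF \<nu>_ge_1])
  have "(\<Sum>k=1..\<nu> 1. \<bar>piece 0 k\<bar>) \<le> u (\<nu> 1) * (real (\<nu> 1) - real (\<nu> 0))"
    using piece_sum[of 0 "\<nu> 1"] by simp
  also have "\<dots> \<le> u (\<nu> 1) * K"
    using u0 \<nu>_ratio[of 0] \<nu>0 by (intro mult_left_mono) auto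
  also have "\<dots> \<le> u (\<nu> 1) * K ^ 5" using u0 K_powers by (intro mult_left_mono) auto
  finally have s: "(\<Sum>k=1..\<nu> 1. \<bar>piece 0 k\<bar>) \<le> K ^ 5 * u (\<nu> 1)" by (simp add: mult.commute)
  moreover have "0 \<le> K ^ 5 * u (\<nu> 1)" using u0 K1 by simp
  ultimately show "(\<Sum>k=1..\<nu> 1. \<bar>piece 0 k\<bar>) \<le> 8 * K ^ 5 * u (\<nu> 1) * 1" by simp
  have "second_variation (piece 0) (\<nu> 1) \<le> 5 * (\<Sum>k=1..\<nu> 1. \<bar>piece 0 k\<bar>)"
    by (intro second_variation_le_sum piece_zero piece_outside) simp
  then show "second_variation (piece 0) (\<nu> 1) \<le> 8 * K ^ 5 * u (\<nu> 1) / 1"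
    using s \<open>0 \<le> K ^ 5 * u (\<nu> 1)\<close> by simp
qed

lemma hat_increment:
  assumes "\<nu> i \<le> k" "k < \<nu> (Suc (Suc i))"
  shows "\<bar>hat (Suc i) (k + 1) - hat (Suc i) k\<bar> \<le> K / w (Suc i)"
proof (cases "k < \<nu> (Suc i)")
  case True
  have "hat (Suc i) (k + 1) - hat (Suc i) k = 1 / w i"
    using assms True hat_up[of i k] hat_up[of i "k + 1"] by (simp add: diff_divide_distrib[symmetric])
  moreover have "1 / w i \<le> K / w (Suc i)"
    using gap_up[of i] w_ge_1[of i] w_ge_1[of "Suc i"] by (simp add: w_def field_simps)
  ultimately show ?thesis using w_ge_1[of i] by simp
next
  case False
  have "hat (Suc i) (k + 1) - hat (Suc i) k = - 1 / w (Suc i)"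
    using assms False hat_down[of "Suc i" k] hat_down[of "Suc i" "k + 1"] by (simp add: diff_divide_distrib[symmetric])
  moreover have "1 / w (Suc i) \<le> K / w (Suc i)"
    using K1 w_ge_1[of "Suc i"] by (intro divide_right_mono) auto
  ultimately show ?thesis using w_ge_1[of "Suc i"] by simp
qed

lemma hat_second_difference:
  assumes "\<nu> i < k" "k < \<nu> (Suc (Suc i))"
  shows "\<bar>hat (Suc i) (k + 1) - 2 * hat (Suc i) k + hat (Suc i) (k - 1)\<bar> \<le> (if k = \<nu> (Suc i) then 2 * K / w (Suc i) else 0)"
proof -
  consider "k = \<nu> (Suc i)" | "k < \<nu> (Suc i)" | "\<nu> (Suc i) < k" by linarith
  then show ?thesis
  proof cases
    case 1
    have k1: "Suc (k - 1) = k" using assms by simp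
    have "\<bar>hat (Suc i) (k + 1) - hat (Suc i) k\<bar> \<le> K / w (Suc i)" using assms by (intro hat_increment) auto
    moreover have "\<bar>hat (Suc i) (k - 1 + 1) - hat (Suc i) (k - 1)\<bar> \<le> K / w (Suc i)"
      using assms by (intro hat_increment) auto
    ultimately have "\<bar>hat (Suc i) (k + 1) - 2 * hat (Suc i) k + hat (Suc i) (k - 1)\<bar> \<le> K / w (Suc i) + K / w (Suc i)"
      using k1 by simp
    then show ?thesis using 1 by simp
  next
    case 2
    have "hat (Suc i) (k + 1) - 2 * hat (Suc i) k + hat (Suc i) (k - 1)
      = ((real (k + 1) - real (\<nu> i)) - 2 * (real k - real (\<nu> i)) + (real (k - 1) - real (\<nu> i))) / w i"
      using assms 2 hat_up[of i k] hat_up[of i "k + 1"] hat_up[of i "k - 1"]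
      by (simp add: add_divide_distrib diff_divide_distrib)
    also have "\<dots> = 0" using assms by (simp add: of_nat_diff)
    finally show ?thesis using 2 by simp
  next
    case 3
    have "hat (Suc i) (k + 1) - 2 * hat (Suc i) k + hat (Suc i) (k - 1)
      = ((real (\<nu> (Suc (Suc i))) - real (k + 1)) - 2 * (real (\<nu> (Suc (Suc i))) - real k) + (real (\<nu> (Suc (Suc i))) - real (k - 1))) / w (Suc i)"
      using assms 3 hat_down[of "Suc i" k] hat_down[of "Suc i" "k + 1"] hat_down[of "Suc i" "k - 1"]
      by (simp add: add_divide_distrib diff_divide_distrib)
    also have "\<dots> = 0" using assms 3 by (simp add: of_nat_diff)
    finally show ?thesis using 3 by simp
  qed
qed

lemma product_second_difference:
  fixes a b :: "nat \<Rightarrow> real"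
  shows "\<bar>a (k + 1) * b (k + 1) - 2 * (a k * b k) + a (k - 1) * b (k - 1)\<bar>
    \<le> \<bar>a k\<bar> * \<bar>b (k + 1) - 2 * b k + b (k - 1)\<bar> + \<bar>b k\<bar> * \<bar>a (k + 1) - 2 * a k + a (k - 1)\<bar>
      + \<bar>a (k + 1) - a k\<bar> * \<bar>b (k + 1) - b k\<bar> + \<bar>a k - a (k - 1)\<bar> * \<bar>b k - b (k - 1)\<bar>"
proof -
  have "a (k + 1) * b (k + 1) - 2 * (a k * b k) + a (k - 1) * b (k - 1)
      = a k * (b (k + 1) - 2 * b k + b (k - 1)) + b k * (a (k + 1) - 2 * a k + a (k - 1))
        + (a (k + 1) - a k) * (b (k + 1) - b k) + (a k - a (k - 1)) * (b k - b (k - 1))"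
    by (simp add: algebra_simps)
  then show ?thesis by (simp only: abs_mult[symmetric]) linarith
qed

text \<open>
  Second differences of \<open>u * hat\<close> are expanded with \<open>product_second_difference\<close>. The hat is piecewise
  linear and contributes only at its three nodes, with slopes of size \<open>K / w (Suc i)\<close>; the mixed terms
  telescope, as \<open>u\<close> is increasing; and the second differences of \<open>u\<close> are summed by
  \<open>reciprocal_variation\<close>.
\<close>

lemma piece_next:
  "(\<Sum>k=1..\<nu> (Suc (Suc i)). \<bar>piece (Suc i) k\<bar>) \<le> 8 * K ^ 5 * u (\<nu> (Suc (Suc i))) * w (Suc i)"
  "second_variation (piece (Suc i)) (\<nu> (Suc (Suc i))) \<le> 8 * K ^ 5 * u (\<nu> (Suc (Suc i))) / w (Suc i)"
proof -
  define a where "a = \<nu> i"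
  define c where "c = \<nu> (Suc i)"
  define b where "b = \<nu> (Suc (Suc i))"
  define W where "W = w (Suc i)"
  define m where "m = piece (Suc i)"
  define \<tau> where "\<tau> = hat (Suc i)"
  have W1: "1 \<le> W" unfolding W_def by (rule w_ge_1)
  have ab: "1 \<le> a" "a < c" "c < b" using \<nu>_ge_1[of i] \<nu>_less by (auto simp: a_def c_def b_def)
  have u0: "0 < u b" using ab by (intro u_pos) auto
  have "(\<Sum>k=1..b. \<bar>m k\<bar>) \<le> u b * (real b - real a)"
    using piece_sum[of "Suc i" b] by (simp add: m_def b_def a_def)
  also have "real b - real a = w i + W" by (simp add: w_def W_def a_def b_def)
  also have "u b * (w i + W) \<le> u b * (K * W + W)"
    using gap_down[of i] u0 by (intro mult_left_mono) (auto simp: w_def W_def)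
  also have "\<dots> \<le> u b * (8 * K ^ 5 * W)"
  proof (intro mult_left_mono)
    have "K * W \<le> K ^ 5 * W" "1 * W \<le> K ^ 5 * W" using K_powers W1 by (auto intro!: mult_right_mono)
    then show "K * W + W \<le> 8 * K ^ 5 * W" using W1 by linarith
  qed (use u0 in simp)
  finally show "(\<Sum>k=1..\<nu> (Suc (Suc i)). \<bar>piece (Suc i) k\<bar>) \<le> 8 * K ^ 5 * u (\<nu> (Suc (Suc i))) * w (Suc i)"
    by (simp add: m_def b_def W_def mult_ac)
  define D where "D = (\<lambda>k. \<bar>m (k + 1) - 2 * m k + m (k - 1)\<bar>)"
  have m1: "m 1 = 0"
  proof (cases "a = 1")
    case True
    then have "\<tau> 1 = 0" using hat_up[of i 1] ab by (simp add: \<tau>_def a_def c_def)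
    then show ?thesis by (simp add: m_def piece_def \<tau>_def)
  next
    case False
    then show ?thesis using ab piece_outside[of 1 "Suc i"] by (simp add: m_def a_def)
  qed
  have ma: "m k = 0" if "k \<le> a" for k
  proof (cases "k = a")
    case True
    then have "\<tau> k = 0" using hat_up[of i k] ab by (simp add: \<tau>_def a_def c_def)
    then show ?thesis by (simp add: m_def piece_def \<tau>_def)
  next
    case False
    then show ?thesis using that piece_outside[of k "Suc i"] by (simp add: m_def a_def)
  qed
  have mb: "m k = 0" if "b \<le> k" for k using that piece_outside[of k "Suc i"] by (simp add: m_def b_def)
  have K0: "0 \<le> K" using K1 by simp
  have uk: "0 < u k" "u k \<le> u b" if "a \<le> k" "k \<le> b" for k
    using that ab u_pos[of k] u_mono[of k b] by auto
  have ends: "D a \<le> u b * (K / W)" "D b \<le> u b * (K / W)"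
  proof -
    have "m (a + 1) - 2 * m a + m (a - 1) = u (a + 1) * (\<tau> (a + 1) - \<tau> a)"
      using ma[of a] ma[of "a - 1"] ab hat_up[of i a] by (simp add: m_def piece_def \<tau>_def a_def c_def)
    then have "D a = u (a + 1) * \<bar>\<tau> (a + 1) - \<tau> a\<bar>"
      using uk[of "a + 1"] ab by (simp add: D_def abs_mult)
    also have "\<dots> \<le> u b * (K / W)"
      using uk[of "a + 1"] ab hat_increment[of i a] u0 by (intro mult_mono) (auto simp: \<tau>_def W_def a_def b_def)
    finally show "D a \<le> u b * (K / W)" .
    have b1: "Suc (b - 1) = b" and ab1: "a \<le> b - 1" "b - 1 \<le> b" using ab by auto
    have "\<tau> b = 0" using hat_outside[of b "Suc i"] by (simp add: \<tau>_def b_def)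
    then have "m (b + 1) - 2 * m b + m (b - 1) = - (u (b - 1) * (\<tau> (b - 1 + 1) - \<tau> (b - 1)))"
      using mb[of b] mb[of "b + 1"] b1 by (simp add: m_def piece_def \<tau>_def)
    then have "D b = u (b - 1) * \<bar>\<tau> (b - 1 + 1) - \<tau> (b - 1)\<bar>"
      using uk(1)[OF ab1] by (simp add: D_def abs_mult)
    also have "\<dots> \<le> u b * (K / W)"
      using uk[OF ab1] ab hat_increment[of i "b - 1"] u0 by (intro mult_mono) (auto simp: \<tau>_def W_def a_def b_def c_def)
    finally show "D b \<le> u b * (K / W)" .
  qed
  have inner: "D k \<le> u b * (if k = c then 2 * K / W else 0) + \<bar>u (k + 1) - 2 * u k + u (k - 1)\<bar>
      + (u (k + 1) - u k) * (K / W) + (u k - u (k - 1)) * (K / W)" if k: "k \<in> {a<..<b}" for k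
  proof -
    have k1: "a \<le> k - 1" "k - 1 < b" "Suc (k - 1) = k" using k by auto
    have h1: "\<bar>\<tau> (k + 1) - \<tau> k\<bar> \<le> K / W" using k hat_increment[of i k] by (auto simp: \<tau>_def W_def a_def b_def)
    have h2: "\<bar>\<tau> k - \<tau> (k - 1)\<bar> \<le> K / W" using k1 hat_increment[of i "k - 1"] by (simp add: \<tau>_def W_def a_def b_def)
    have h3: "\<bar>\<tau> (k + 1) - 2 * \<tau> k + \<tau> (k - 1)\<bar> \<le> (if k = c then 2 * K / W else 0)"
      unfolding \<tau>_def W_def c_def using k by (intro hat_second_difference) (auto simp: a_def b_def)
    have h4: "\<bar>\<tau> k\<bar> \<le> 1" using hat_bounds[of "Suc i" k] by (simp add: \<tau>_def)
    have i1: "0 \<le> u (k + 1) - u k" using k ab u_mono[of k "k + 1"] by auto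
    have i2: "0 \<le> u k - u (k - 1)" using k1 ab u_mono[of "k - 1" k] by auto
    have "D k \<le> \<bar>u k\<bar> * \<bar>\<tau> (k + 1) - 2 * \<tau> k + \<tau> (k - 1)\<bar> + \<bar>\<tau> k\<bar> * \<bar>u (k + 1) - 2 * u k + u (k - 1)\<bar>
      + \<bar>u (k + 1) - u k\<bar> * \<bar>\<tau> (k + 1) - \<tau> k\<bar> + \<bar>u k - u (k - 1)\<bar> * \<bar>\<tau> k - \<tau> (k - 1)\<bar>"
      unfolding D_def m_def piece_def \<tau>_def by (rule product_second_difference)
    also have "\<dots> \<le> u b * (if k = c then 2 * K / W else 0) + 1 * \<bar>u (k + 1) - 2 * u k + u (k - 1)\<bar>
      + (u (k + 1) - u k) * (K / W) + (u k - u (k - 1)) * (K / W)"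
      using h1 h2 h3 h4 i1 i2 uk[of k] k by (intro add_mono mult_mono) auto
    finally show ?thesis by simp
  qed
  have tele: "(\<Sum>k\<in>{x<..<y}. f (k + 1) - f k) = f y - f (x + 1)" if "x < y" for f :: "nat \<Rightarrow> real" and x y
    using that
  proof (induction y)
    case (Suc y)
    show ?case
    proof (cases "x = y")
      case True
      then have "{x<..<Suc y} = {}" by auto
      then show ?thesis using True by simp
    next
      case False
      then have "{x<..<Suc y} = insert y {x<..<y}" using Suc.prems by auto
      then show ?thesis using Suc False by simp
    qed
  qed simp
  have s1: "(\<Sum>k\<in>{a<..<b}. u (k + 1) - u k) \<le> u b"
    using tele[of a b u] ab u_pos[of "a + 1"] by simp
  have s2: "(\<Sum>k\<in>{a<..<b}. u k - u (k - 1)) \<le> u b"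
  proof -
    have "(\<Sum>k\<in>{a<..<b}. u k - u (k - 1)) = (\<Sum>k\<in>{a<..<b}. (\<lambda>k. u (k - 1)) (k + 1) - (\<lambda>k. u (k - 1)) k)" by simp
    also have "\<dots> = u (b - 1) - u a" using tele[of a b "\<lambda>k. u (k - 1)"] ab by simp
    also have "\<dots> \<le> u b"
    proof -
      have "a \<le> b - 1" "b - 1 \<le> b" "a \<le> b" using ab by auto
      then show ?thesis using uk(2)[of "b - 1"] uk(1)[of a] by simp
    qed
    finally show ?thesis .
  qed
  have s3: "(\<Sum>k\<in>{a<..<b}. \<bar>u (k + 1) - 2 * u k + u (k - 1)\<bar>) \<le> 2 * K ^ 5 * u b / W"
  proof -
    have "(\<Sum>k\<in>{a<..<b}. \<bar>u (k + 1) - 2 * u k + u (k - 1)\<bar>) \<le> 2 * slope a * (u b)\<^sup>2"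
      using ab by (intro reciprocal_variation) auto
    also have "\<dots> \<le> 2 * (K ^ 5 * p b / W) * (u b)\<^sup>2"
    proof (intro mult_right_mono mult_left_mono)
      have pb: "0 < p b" using ab by (intro p_pos) auto
      have "p a \<le> K * p c" "p c \<le> K * p b" using p_ratio by (auto simp: a_def b_def c_def)
      then have "p a \<le> K * (K * p b)" using K0 by (meson mult_left_mono order_trans)
      then have pa: "K ^ 2 * p a \<le> K ^ 2 * (K * (K * p b))" using K0 by (intro mult_left_mono) auto
      have wi: "1 / w i \<le> K / W"
        using gap_up[of i] w_ge_1[of i] W1 by (simp add: w_def W_def field_simps)
      have "slope a \<le> K ^ 2 * p a / w i" using slope_at_node[of i] by (simp add: a_def)
      also have "\<dots> \<le> K ^ 2 * (K * (K * p b)) / w i" using pa w_ge_1[of i] by (intro divide_right_mono) auto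
      also have "\<dots> = K ^ 4 * p b * (1 / w i)" by (simp add: eval_nat_numeral mult_ac)
      also have "\<dots> \<le> K ^ 4 * p b * (K / W)" using wi pb K0 by (intro mult_left_mono) auto
      finally show "slope a \<le> K ^ 5 * p b / W" by (simp add: eval_nat_numeral mult_ac)
    qed auto
    also have "\<dots> = 2 * K ^ 5 * u b / W"
      using p_pos[of b] ab by (simp add: u_def power2_eq_square)
    finally show ?thesis .
  qed
  have reix: "(\<Sum>k\<le>b. \<bar>m (k + 2) - 2 * m (k + 1) + m k\<bar>) = (\<Sum>k=1..b + 1. D k)"
    by (rule sum.reindex_bij_witness[of _ "\<lambda>k. k - 1" "\<lambda>k. k + 1"]) (auto simp: D_def)
  define Z where "Z = u b / W"
  have Z0: "0 \<le> Z" using u0 W1 by (simp add: Z_def)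
  have peak: "(\<Sum>k\<in>{a<..<b}. u b * (if k = c then 2 * K / W else 0)) = u b * (2 * K / W)"
    unfolding sum_distrib_left[symmetric] using ab by simp
  have "(\<Sum>k\<in>{a<..<b}. D k) \<le> (\<Sum>k\<in>{a<..<b}. u b * (if k = c then 2 * K / W else 0) + \<bar>u (k + 1) - 2 * u k + u (k - 1)\<bar>
      + (u (k + 1) - u k) * (K / W) + (u k - u (k - 1)) * (K / W))"
    by (intro sum_mono inner)
  also have "\<dots> = u b * (2 * K / W) + (\<Sum>k\<in>{a<..<b}. \<bar>u (k + 1) - 2 * u k + u (k - 1)\<bar>)
      + (\<Sum>k\<in>{a<..<b}. u (k + 1) - u k) * (K / W) + (\<Sum>k\<in>{a<..<b}. u k - u (k - 1)) * (K / W)"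
    by (simp only: sum.distrib sum_distrib_right peak)
  also have "\<dots> \<le> u b * (2 * K / W) + 2 * K ^ 5 * u b / W + u b * (K / W) + u b * (K / W)"
    using s1 s2 s3 K0 W1 by (intro add_mono mult_right_mono) auto
  also have "\<dots> = 4 * (K * Z) + 2 * (K ^ 5 * Z)" by (simp add: Z_def)
  finally have inner_sum: "(\<Sum>k\<in>{a<..<b}. D k) \<le> 4 * (K * Z) + 2 * (K ^ 5 * Z)" .
  have "(\<Sum>k=1..b + 1. D k) = (\<Sum>k\<in>{a..b}. D k)"
  proof (rule sum.mono_neutral_right)
    show "\<forall>k\<in>{1..b + 1} - {a..b}. D k = 0"
    proof
      fix k assume "k \<in> {1..b + 1} - {a..b}"
      then have "k < a \<or> k = b + 1" by auto
      then show "D k = 0" using ma[of k] ma[of "k + 1"] ma[of "k - 1"] mb[of k] mb[of "k + 1"] mb[of "k - 1"]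
        by (auto simp: D_def)
    qed
  qed (use ab in auto)
  also have "{a..b} = insert a (insert b {a<..<b})" using ab by auto
  also have "(\<Sum>k\<in>insert a (insert b {a<..<b}). D k) = D a + (D b + (\<Sum>k\<in>{a<..<b}. D k))"
    using ab by simp
  finally have total: "(\<Sum>k=1..b + 1. D k) = D a + (D b + (\<Sum>k\<in>{a<..<b}. D k))" .
  have KZ: "K * Z \<le> K ^ 5 * Z" using K_powers Z0 by (intro mult_right_mono) auto
  have uKW: "u b * (K / W) = K * Z" by (simp add: Z_def)
  have "(\<Sum>k=1..b + 1. D k) \<le> K * Z + (K * Z + (4 * (K * Z) + 2 * (K ^ 5 * Z)))"
    unfolding total using ends inner_sum unfolding uKW by (intro add_mono)
  also have "\<dots> \<le> 8 * (K ^ 5 * Z)" using KZ by linarith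
  finally have "(\<Sum>k=1..b + 1. D k) \<le> 8 * (K ^ 5 * Z)" .
  then show "second_variation (piece (Suc i)) (\<nu> (Suc (Suc i))) \<le> 8 * K ^ 5 * u (\<nu> (Suc (Suc i))) / w (Suc i)"
    using reix m1 by (simp add: second_variation_def m_def b_def W_def Z_def)
qed

lemma piece_bounds:
  obtains W where "1 \<le> W" "(\<Sum>k=1..\<nu> (Suc i). \<bar>piece i k\<bar>) \<le> (8 * K ^ 5 * u (\<nu> (Suc i))) * W"
    "second_variation (piece i) (\<nu> (Suc i)) \<le> (8 * K ^ 5 * u (\<nu> (Suc i))) / W"
proof (cases i)
  case 0
  then show ?thesis using that[of 1] piece_first by simp
next
  case (Suc j)
  then show ?thesis using that[of "w i"] piece_next[of j] w_ge_1[of i] by simp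
qed

end

section \<open>The series of blocks\<close>

lemma trig_polys_mono:
  assumes "m \<le> n"
  shows "trig_polys m \<subseteq> trig_polys n"
proof
  fix T assume "T \<in> trig_polys m"
  then obtain a b where T: "T = trig_sum a b m" by (rule trig_polysE)
  have "T = trig_sum (\<lambda>k. if k \<le> m then a k else 0) (\<lambda>k. if k \<le> m then b k else 0) n"
    unfolding T trig_sum_def using assms by (intro ext sum.mono_neutral_cong_left) auto
  then show "T \<in> trig_polys n" by (simp add: trig_sum_mem)
qed

lemma best_approx_antimono:
  assumes "m \<le> n"
  shows "best_approx M \<omega> f n \<le> best_approx M \<omega> f m"
  unfolding best_approx_def using assms by (intro INF_superset_mono trig_polys_mono) auto

locale block_approximation = averaged_norm M \<omega> A + block_scale p \<nu> lam K
  for M \<omega> :: "real \<Rightarrow> real" and A :: real and p :: "nat \<Rightarrow> real" and \<nu> :: "nat \<Rightarrow> nat"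
    and lam :: "nat \<Rightarrow> real" and K :: real
begin

abbreviation E :: "(real \<Rightarrow> real) \<Rightarrow> nat \<Rightarrow> ennreal" where "E \<equiv> best_approx M \<omega>"

text \<open>
  The product of the constants in \<open>multiplier_bound\<close> and \<open>piece_bounds\<close>.
\<close>

definition D :: real where "D = 160 * A * K ^ 5"

lemma D_pos: "0 < D"
  using A K1 by (simp add: D_def)

definition block :: "(real \<Rightarrow> real) \<Rightarrow> real \<Rightarrow> nat \<Rightarrow> real \<Rightarrow> real" where
  "block f \<gamma> i = trig_multiplier (piece i) \<gamma> (\<nu> (Suc i)) f"

lemma block_trig_polys: "block f \<gamma> i \<in> trig_polys (\<nu> (Suc i))"
  unfolding block_def by (rule trig_multiplier_mem)

lemmas block_L_per = trig_polys_L_per[OF block_trig_polys]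

text \<open>
  The piece vanishes at all frequencies up to \<open>\<nu> (i - 1) - 1\<close>, so \<open>f\<close> may be replaced by \<open>f - T\<close> with
  any polynomial \<open>T\<close> of that order before \<open>multiplier_bound\<close> is applied.
\<close>

lemma block_norm:
  assumes f: "f \<in> L_per"
  shows "nrm (block f \<gamma> i) \<le> ennreal (D * u (\<nu> (Suc i))) * E f (\<nu> (i - 1))"
proof -
  define c where "c = D * u (\<nu> (Suc i))"
  have c: "0 < c" using D_pos u_pos[OF \<nu>_ge_1] by (simp add: c_def)
  have one: "nrm (block f \<gamma> i) \<le> ennreal c * nrm (\<lambda>x. f x - T x)" if T: "T \<in> trig_polys (\<nu> (i - 1) - 1)" for T
  proof -
    have fT: "(\<lambda>x. f x - T x) \<in> L_per" by (intro L_per_diff f trig_polys_L_per[OF T])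
    have "block f \<gamma> i = trig_multiplier (piece i) \<gamma> (\<nu> (Suc i)) (\<lambda>x. f x - T x)"
      unfolding block_def
    proof (rule trig_multiplier_minus_poly[OF f T, symmetric])
      show "piece i k = 0" if "k \<le> \<nu> (i - 1) - 1" for k
        using that \<nu>_ge_1[of "i - 1"] by (intro piece_outside disjI1) linarith
    qed
    moreover have "nrm (trig_multiplier (piece i) \<gamma> (\<nu> (Suc i)) (\<lambda>x. f x - T x))
        \<le> ennreal (20 * A * (8 * K ^ 5 * u (\<nu> (Suc i)))) * nrm (\<lambda>x. f x - T x)"
    proof -
      obtain W where W: "1 \<le> W" "(\<Sum>k=1..\<nu> (Suc i). \<bar>piece i k\<bar>) \<le> (8 * K ^ 5 * u (\<nu> (Suc i))) * W"
        "second_variation (piece i) (\<nu> (Suc i)) \<le> (8 * K ^ 5 * u (\<nu> (Suc i))) / W"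
        using piece_bounds .
      have "0 \<le> 8 * K ^ 5 * u (\<nu> (Suc i))" using K1 u_pos[OF \<nu>_ge_1, of "Suc i"] by simp
      then show ?thesis
        by (intro multiplier_bound[OF fT piece_zero _ W(1) _ W(2,3)] piece_outside) auto
    qed
    moreover have "20 * A * (8 * K ^ 5 * u (\<nu> (Suc i))) = c" by (simp add: c_def D_def)
    ultimately show ?thesis by simp
  qed
  have "ennreal (1 / c) * nrm (block f \<gamma> i) \<le> E f (\<nu> (i - 1))"
    unfolding best_approx_def
  proof (rule INF_greatest)
    fix T assume "T \<in> trig_polys (\<nu> (i - 1) - 1)"
    then have "ennreal (1 / c) * nrm (block f \<gamma> i) \<le> ennreal (1 / c) * (ennreal c * nrm (\<lambda>x. f x - T x))"
      by (intro mult_left_mono one) auto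
    also have "\<dots> = nrm (\<lambda>x. f x - T x)"
      using c ennreal_mult[of "1 / c" c] by (simp add: mult.assoc[symmetric])
    finally show "ennreal (1 / c) * nrm (block f \<gamma> i) \<le> nrm (\<lambda>x. f x - T x)" .
  qed
  then have "ennreal c * (ennreal (1 / c) * nrm (block f \<gamma> i)) \<le> ennreal c * E f (\<nu> (i - 1))"
    by (intro mult_left_mono) auto
  also have "ennreal c * (ennreal (1 / c) * nrm (block f \<gamma> i)) = nrm (block f \<gamma> i)"
    using c ennreal_mult[of c "1 / c"] by (simp add: mult.assoc[symmetric])
  finally show ?thesis by (simp add: c_def)
qed

definition deriv_sum :: "(real \<Rightarrow> real) \<Rightarrow> real \<Rightarrow> real \<Rightarrow> real" where
  "deriv_sum f \<gamma> x = (\<Sum>i. block f \<gamma> i x)"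

definition remainder :: "(real \<Rightarrow> real) \<Rightarrow> real \<Rightarrow> nat \<Rightarrow> real \<Rightarrow> real" where
  "remainder f \<gamma> m x = deriv_sum f \<gamma> x - (\<Sum>i<m. block f \<gamma> i x)"

lemma deriv_sum_periodic_measurable: "deriv_sum f \<gamma> \<in> periodic_measurable"
proof -
  have "deriv_sum f \<gamma> \<in> borel_measurable lebesgue"
    unfolding deriv_sum_def[abs_def] using L_perD(1)[OF block_L_per] by (intro borel_measurable_suminf) auto
  then show ?thesis
    by (simp add: periodic_measurable_def deriv_sum_def L_perD(2)[OF block_L_per])
qed

lemma partial_sum_L_per: "(\<lambda>x. \<Sum>i<m. block f \<gamma> i x) \<in> L_per"
proof (induction m)
  case 0
  show ?case by (simp add: L_per_def periodic_measurable_def set_integrable_def)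
next
  case (Suc m)
  then show ?case using L_per_add[OF Suc block_L_per[of f \<gamma> m]] by simp
qed

text \<open>
  At points where the blocks are not absolutely summable the right-hand side is infinite, and the
  default value of \<open>suminf\<close> in \<open>deriv_sum\<close> does no harm.
\<close>

lemma remainder_pointwise: "ennreal \<bar>remainder f \<gamma> m x\<bar> \<le> (\<Sum>i. ennreal \<bar>block f \<gamma> (i + m) x\<bar>)"
proof (cases "(\<Sum>i. ennreal \<bar>block f \<gamma> (i + m) x\<bar>) = top")
  case False
  then have s: "summable (\<lambda>i. \<bar>block f \<gamma> (i + m) x\<bar>)" by (intro summable_suminf_not_top) auto
  then have s1: "summable (\<lambda>i. block f \<gamma> (i + m) x)" by (rule summable_rabs_cancel)
  then have s2: "summable (\<lambda>i. block f \<gamma> i x)" by (simp only: summable_iff_shift[of "\<lambda>i. block f \<gamma> i x"])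
  have "remainder f \<gamma> m x = (\<Sum>i. block f \<gamma> (i + m) x)"
    unfolding remainder_def deriv_sum_def by (rule suminf_minus_initial_segment[OF s2, symmetric])
  then have "\<bar>remainder f \<gamma> m x\<bar> \<le> (\<Sum>i. \<bar>block f \<gamma> (i + m) x\<bar>)" using summable_rabs[OF s] by simp
  then have "ennreal \<bar>remainder f \<gamma> m x\<bar> \<le> ennreal (\<Sum>i. \<bar>block f \<gamma> (i + m) x\<bar>)" by (rule ennreal_leI)
  also have "\<dots> = (\<Sum>i. ennreal \<bar>block f \<gamma> (i + m) x\<bar>)" using s by (intro suminf_ennreal2[symmetric]) auto
  finally show ?thesis .
qed simp

lemma remainder_norm: "nrm (remainder f \<gamma> m) \<le> (\<Sum>i. nrm (block f \<gamma> (i + m)))"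
  using L_perD(1)[OF block_L_per] remainder_pointwise
  by (intro orlicz_norm_countable_subadditive[OF weight_measurable]) auto

lemma remainder_periodic_measurable: "remainder f \<gamma> m \<in> periodic_measurable"
proof -
  have d: "deriv_sum f \<gamma> \<in> borel_measurable lebesgue" "\<And>x. deriv_sum f \<gamma> (x + 2 * pi) = deriv_sum f \<gamma> x"
    using deriv_sum_periodic_measurable by (auto simp: periodic_measurable_def)
  have "remainder f \<gamma> m \<in> borel_measurable lebesgue"
    unfolding remainder_def[abs_def] using d(1) L_perD(1)[OF partial_sum_L_per] by measurable
  then show ?thesis using d(2) by (simp add: periodic_measurable_def remainder_def L_perD(2)[OF block_L_per])
qed

lemma norm_finite_L_per:
  assumes f: "f \<in> periodic_measurable" and fin: "nrm f < \<infinity>"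
  shows "f \<in> L_per"
proof -
  have "ennreal A * nrm f < \<infinity>" using fin by (simp add: ennreal_mult_less_top)
  then show ?thesis using L1[OF f] f by (auto simp: L_per_iff_nn intro: le_less_trans)
qed

lemma fourier_le_norm:
  assumes f: "f \<in> periodic_measurable"
  shows "ennreal \<bar>fourier_a f k\<bar> \<le> ennreal A * nrm f" "ennreal \<bar>fourier_b f k\<bar> \<le> ennreal A * nrm f"
proof -
  have gen: "ennreal \<bar>1 / pi * (LINT x:{0..2 * pi}|lebesgue. f x * c x)\<bar> \<le> ennreal A * nrm f"
    if c: "\<And>x. \<bar>c x\<bar> \<le> 1" for c :: "real \<Rightarrow> real"
  proof -
    have "1 / pi * \<bar>LINT x:{0..2 * pi}|lebesgue. f x * c x\<bar> \<le> 1 * \<bar>LINT x:{0..2 * pi}|lebesgue. f x * c x\<bar>"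
      using pi_gt3 by (intro mult_right_mono) auto
    then have "ennreal \<bar>1 / pi * (LINT x:{0..2 * pi}|lebesgue. f x * c x)\<bar> \<le> ennreal \<bar>LINT x:{0..2 * pi}|lebesgue. f x * c x\<bar>"
      by (intro ennreal_leI) (simp add: abs_mult)
    also have "\<dots> \<le> (\<integral>\<^sup>+x\<in>{0..2 * pi}. ennreal \<bar>f x * c x\<bar> \<partial>lebesgue)" by (rule ennreal_abs_integral_le)
    also have "\<dots> \<le> (\<integral>\<^sup>+x\<in>{0..2 * pi}. ennreal \<bar>f x\<bar> \<partial>lebesgue)"
      using c by (intro nn_integral_mono mult_right_mono ennreal_leI) (auto simp: abs_mult mult_left_le)
    also have "\<dots> \<le> ennreal A * nrm f" by (rule L1[OF f])
    finally show ?thesis .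
  qed
  show "ennreal \<bar>fourier_a f k\<bar> \<le> ennreal A * nrm f" "ennreal \<bar>fourier_b f k\<bar> \<le> ennreal A * nrm f"
    unfolding fourier_a_def fourier_b_def by (intro gen abs_cos_le_one abs_sin_le_one)+
qed

lemma trig_multiplier_extend:
  assumes "L \<le> L'" "\<And>k. L < k \<Longrightarrow> m k = 0"
  shows "trig_multiplier m \<gamma> L f x = trig_multiplier m \<gamma> L' f x"
  unfolding trig_multiplier_def using assms by (intro sum.mono_neutral_left) auto

lemma partial_sum_multiplier:
  "(\<Sum>i<m. block f \<gamma> i x) = trig_multiplier (\<lambda>k. u k * (ramp m k - ramp 0 k)) \<gamma> (\<nu> m) f x"
proof -
  have "(\<Sum>i<m. block f \<gamma> i x) = (\<Sum>i<m. trig_multiplier (piece i) \<gamma> (\<nu> m) f x)"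
    unfolding block_def
    by (intro sum.cong refl trig_multiplier_extend \<nu>_mono piece_outside) auto
  also have "\<dots> = trig_multiplier (\<lambda>k. \<Sum>i<m. piece i k) \<gamma> (\<nu> m) f x"
    unfolding trig_multiplier_def sum_distrib_right by (rule sum.swap)
  also have "(\<lambda>k. \<Sum>i<m. piece i k) = (\<lambda>k. u k * (ramp m k - ramp 0 k))"
    by (simp only: piece_def sum_distrib_left[symmetric] sum_hat)
  finally show ?thesis .
qed

lemma fourier_partial_sum:
  assumes "k < m"
  shows "fourier_a (\<lambda>x. \<Sum>i<m. block f \<gamma> i x) k
      = (if k = 0 then 0 else u k * (fourier_a f k * cos \<gamma> + fourier_b f k * sin \<gamma>))"
    "fourier_b (\<lambda>x. \<Sum>i<m. block f \<gamma> i x) k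
      = (if k = 0 then 0 else u k * (fourier_b f k * cos \<gamma> - fourier_a f k * sin \<gamma>))"
proof -
  have "k \<le> \<nu> (m - 1)" "\<nu> (m - 1) < \<nu> m" using \<nu>_ge[of "m - 1"] \<nu>_strict[of "m - 1" m] assms by auto
  then have r: "ramp m k = 1" "k \<le> \<nu> m" using assms by (auto intro!: ramp_one)
  have z: "ramp 0 k = (if k = 0 then 1 else 0)" by (simp add: ramp_def)
  show "fourier_a (\<lambda>x. \<Sum>i<m. block f \<gamma> i x) k
      = (if k = 0 then 0 else u k * (fourier_a f k * cos \<gamma> + fourier_b f k * sin \<gamma>))"
    "fourier_b (\<lambda>x. \<Sum>i<m. block f \<gamma> i x) k
      = (if k = 0 then 0 else u k * (fourier_b f k * cos \<gamma> - fourier_a f k * sin \<gamma>))"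
    unfolding partial_sum_multiplier fourier_trig_multiplier using r z by auto
qed

text \<open>
  Fourier coefficients depend continuously on the function with respect to the norm, and those with
  index \<open>k\<close> have reached their final value in all partial sums of more than \<open>k\<close> blocks.
\<close>

lemma fourier_deriv_sum:
  assumes fin: "(\<Sum>i. nrm (block f \<gamma> i)) < \<infinity>" and g: "deriv_sum f \<gamma> \<in> L_per"
  shows "fourier_a (deriv_sum f \<gamma>) k
      = (if k = 0 then 0 else u k * (fourier_a f k * cos \<gamma> + fourier_b f k * sin \<gamma>))"
    "fourier_b (deriv_sum f \<gamma>) k
      = (if k = 0 then 0 else u k * (fourier_b f k * cos \<gamma> - fourier_a f k * sin \<gamma>))"
proof -
  define r where "r = (\<lambda>i. enn2real (nrm (block f \<gamma> i)))"
  have nf: "nrm (block f \<gamma> i) < top" for i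
    using ennreal_suminf_lessD[of "\<lambda>i. nrm (block f \<gamma> i)" top i] fin by simp
  then have r: "nrm (block f \<gamma> i) = ennreal (r i)" "0 \<le> r i" for i by (simp_all add: r_def)
  have sr: "summable r" using fin r by (intro summable_suminf_not_top) auto
  have small: "\<exists>m>k. nrm (remainder f \<gamma> m) \<le> ennreal e" if e: "0 < e" for e
  proof -
    obtain N where N: "\<And>n. N \<le> n \<Longrightarrow> norm (\<Sum>i. r (i + n)) < e" using suminf_exist_split[OF e sr] by blast
    define m where "m = max N (Suc k)"
    have "nrm (remainder f \<gamma> m) \<le> (\<Sum>i. ennreal (r (i + m)))" using remainder_norm[of f \<gamma> m] r(1) by simp
    also have "\<dots> = ennreal (\<Sum>i. r (i + m))"
      using r(2) summable_ignore_initial_segment[OF sr] by (intro suminf_ennreal2) auto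
    also have "\<dots> \<le> ennreal e" using N[of m] by (intro ennreal_leI) (simp add: m_def)
    finally show ?thesis by (intro exI[of _ m]) (simp add: m_def)
  qed
  have diff: "fourier_a (remainder f \<gamma> m) k = fourier_a (deriv_sum f \<gamma>) k - fourier_a (\<lambda>x. \<Sum>i<m. block f \<gamma> i x) k"
    "fourier_b (remainder f \<gamma> m) k = fourier_b (deriv_sum f \<gamma>) k - fourier_b (\<lambda>x. \<Sum>i<m. block f \<gamma> i x) k" for m
    unfolding remainder_def[abs_def] by (rule fourier_linear[OF g partial_sum_L_per])+
  have zero: "y = z" if "\<And>e. 0 < e \<Longrightarrow> ennreal \<bar>y - z\<bar> \<le> ennreal A * ennreal e" for y z :: real
  proof (rule ccontr)
    assume ne: "y \<noteq> z"
    define e where "e = \<bar>y - z\<bar> / (2 * A)"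
    have e: "0 < e" using ne A by (simp add: e_def)
    have "ennreal \<bar>y - z\<bar> \<le> ennreal (A * e)" using that[OF e] A by (simp add: ennreal_mult')
    then have "\<bar>y - z\<bar> \<le> A * e" using e A by (subst (asm) ennreal_le_iff) auto
    then show False using ne A by (simp add: e_def)
  qed
  show "fourier_a (deriv_sum f \<gamma>) k
      = (if k = 0 then 0 else u k * (fourier_a f k * cos \<gamma> + fourier_b f k * sin \<gamma>))"
  proof (rule zero)
    fix e :: real assume "0 < e"
    then obtain m where m: "k < m" "nrm (remainder f \<gamma> m) \<le> ennreal e" using small by blast
    have "ennreal \<bar>fourier_a (remainder f \<gamma> m) k\<bar> \<le> ennreal A * ennreal e"
      using fourier_le_norm(1)[OF remainder_periodic_measurable] mult_left_mono[OF m(2)] by (meson order_trans zero_le)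
    then show "ennreal \<bar>fourier_a (deriv_sum f \<gamma>) k
      - (if k = 0 then 0 else u k * (fourier_a f k * cos \<gamma> + fourier_b f k * sin \<gamma>))\<bar> \<le> ennreal A * ennreal e"
      unfolding diff fourier_partial_sum[OF m(1)] .
  qed
  show "fourier_b (deriv_sum f \<gamma>) k
      = (if k = 0 then 0 else u k * (fourier_b f k * cos \<gamma> - fourier_a f k * sin \<gamma>))"
  proof (rule zero)
    fix e :: real assume "0 < e"
    then obtain m where m: "k < m" "nrm (remainder f \<gamma> m) \<le> ennreal e" using small by blast
    have "ennreal \<bar>fourier_b (remainder f \<gamma> m) k\<bar> \<le> ennreal A * ennreal e"
      using fourier_le_norm(2)[OF remainder_periodic_measurable] mult_left_mono[OF m(2)] by (meson order_trans zero_le)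
    then show "ennreal \<bar>fourier_b (deriv_sum f \<gamma>) k
      - (if k = 0 then 0 else u k * (fourier_b f k * cos \<gamma> - fourier_a f k * sin \<gamma>))\<bar> \<le> ennreal A * ennreal e"
      unfolding diff fourier_partial_sum[OF m(1)] .
  qed
qed

definition tail_term :: "(real \<Rightarrow> real) \<Rightarrow> nat \<Rightarrow> ennreal" where
  "tail_term f k = E f k * ennreal (lam k * u k)"

text \<open>
  The sum of \<open>lam\<close> over the gap from \<open>\<nu> i\<close> to \<open>\<nu> (Suc i)\<close> is at least \<open>1 / K\<close>, so \<open>u (\<nu> i)\<close>, and with it
  \<open>u (\<nu> (i + 3))\<close>, is dominated by the sum of \<open>lam k * u k\<close> over this gap. The gap lies two blocks
  earlier because there \<open>best_approx M \<omega> f k\<close> is not smaller than the one in \<open>block_norm\<close>.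
\<close>

lemma tail_block:
  assumes f: "f \<in> L_per"
  shows "nrm (block f \<gamma> (i + 2)) \<le> ennreal (D * K ^ 4) * (\<Sum>k\<in>{\<nu> i<..\<nu> (Suc i)}. tail_term f k)"
proof -
  have u0: "0 < u (\<nu> i)" by (rule u_pos[OF \<nu>_ge_1])
  have "D * u (\<nu> (i + 3)) \<le> D * K ^ 4 * (\<Sum>k\<in>{\<nu> i<..\<nu> (Suc i)}. lam k * u k)"
  proof -
    have "u (\<nu> i) / (K * w i) \<le> lam k * u k" if k: "k \<in> {\<nu> i<..\<nu> (Suc i)}" for k
    proof -
      have k1: "1 \<le> k" using k by auto
      have Kw: "0 < K * w i" using K1 w_ge_1[of i] by simp
      have "1 \<le> K * lam k * w i" using lam_gap[of i k] k by (simp add: w_def)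
      then have "1 / (K * w i) \<le> lam k" using Kw by (simp add: field_simps)
      moreover have "u (\<nu> i) \<le> u k" using k \<nu>_ge_1[of i] by (intro u_mono) auto
      ultimately have "1 / (K * w i) * u (\<nu> i) \<le> lam k * u k"
        using u0 lam_pos[OF k1] by (intro mult_mono) auto
      then show ?thesis by simp
    qed
    then have "(\<Sum>k\<in>{\<nu> i<..\<nu> (Suc i)}. u (\<nu> i) / (K * w i)) \<le> (\<Sum>k\<in>{\<nu> i<..\<nu> (Suc i)}. lam k * u k)"
      by (rule sum_mono)
    moreover have "(\<Sum>k\<in>{\<nu> i<..\<nu> (Suc i)}. u (\<nu> i) / (K * w i)) = u (\<nu> i) / K"
      using \<nu>_less[of i] w_ge_1[of i] by (simp add: w_def of_nat_diff)
    ultimately have "u (\<nu> i) / K \<le> (\<Sum>k\<in>{\<nu> i<..\<nu> (Suc i)}. lam k * u k)" by simp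
    then have "K ^ 4 * (u (\<nu> i) / K) \<le> K ^ 4 * (\<Sum>k\<in>{\<nu> i<..\<nu> (Suc i)}. lam k * u k)"
      using K1 by (intro mult_left_mono) auto
    moreover have "K ^ 4 * (u (\<nu> i) / K) = K ^ 3 * u (\<nu> i)" using K1 by (simp add: eval_nat_numeral)
    ultimately have "u (\<nu> (i + 3)) \<le> K ^ 4 * (\<Sum>k\<in>{\<nu> i<..\<nu> (Suc i)}. lam k * u k)"
      using u_ratio[of i 3] by linarith
    then show ?thesis using D_pos by (simp add: mult.assoc)
  qed
  then have le: "ennreal (D * u (\<nu> (i + 3))) \<le> ennreal (D * K ^ 4 * (\<Sum>k\<in>{\<nu> i<..\<nu> (Suc i)}. lam k * u k))"
    by (rule ennreal_leI)
  have nonneg: "0 \<le> lam k * u k" if "k \<in> {\<nu> i<..\<nu> (Suc i)}" for k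
    using that lam_pos[of k] u_pos[of k] by auto
  have "nrm (block f \<gamma> (i + 2)) \<le> ennreal (D * u (\<nu> (i + 3))) * E f (\<nu> (Suc i))"
    using block_norm[OF f, of \<gamma> "i + 2"] by (simp add: numeral_3_eq_3)
  also have "\<dots> \<le> ennreal (D * K ^ 4 * (\<Sum>k\<in>{\<nu> i<..\<nu> (Suc i)}. lam k * u k)) * E f (\<nu> (Suc i))"
    using le by (rule mult_right_mono) simp
  also have "\<dots> = ennreal (D * K ^ 4) * ((\<Sum>k\<in>{\<nu> i<..\<nu> (Suc i)}. ennreal (lam k * u k)) * E f (\<nu> (Suc i)))"
  proof -
    have "ennreal (D * K ^ 4 * (\<Sum>k\<in>{\<nu> i<..\<nu> (Suc i)}. lam k * u k)) = ennreal (D * K ^ 4) * ennreal (\<Sum>k\<in>{\<nu> i<..\<nu> (Suc i)}. lam k * u k)"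
      using D_pos K1 by (intro ennreal_mult') auto
    moreover have "ennreal (\<Sum>k\<in>{\<nu> i<..\<nu> (Suc i)}. lam k * u k) = (\<Sum>k\<in>{\<nu> i<..\<nu> (Suc i)}. ennreal (lam k * u k))"
      by (rule sum_ennreal[symmetric]) (rule nonneg)
    ultimately show ?thesis by (simp only: mult.assoc)
  qed
  also have "\<dots> \<le> ennreal (D * K ^ 4) * (\<Sum>k\<in>{\<nu> i<..\<nu> (Suc i)}. tail_term f k)"
    unfolding sum_distrib_right tail_term_def mult.commute[of "ennreal (lam _ * u _)"]
    by (intro mult_left_mono sum_mono mult_right_mono best_approx_antimono) auto
  finally show ?thesis .
qed

lemma tail_bound:
  assumes f: "f \<in> L_per" and nj: "n \<le> \<nu> j"
  shows "(\<Sum>i. nrm (block f \<gamma> (i + (j + 2)))) \<le> ennreal (D * K ^ 4) * (\<Sum>l. tail_term f (n + 1 + l))"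
proof -
  define P where "P = (\<lambda>i. \<Sum>k\<in>{\<nu> (i + j)<..\<nu> (Suc (i + j))}. tail_term f k)"
  have part: "(\<Sum>i<N. P i) = (\<Sum>k\<in>{\<nu> j<..\<nu> (N + j)}. tail_term f k)" for N
  proof (induction N)
    case (Suc N)
    have "{\<nu> j<..\<nu> (Suc N + j)} = {\<nu> j<..\<nu> (N + j)} \<union> {\<nu> (N + j)<..\<nu> (Suc (N + j))}"
      using \<nu>_mono[of j "N + j"] \<nu>_less[of "N + j"] by auto
    then show ?case using Suc by (simp add: P_def sum.union_disjoint[symmetric] ivl_disj_int)
  qed simp
  have "(\<Sum>i<N. P i) \<le> (\<Sum>l. tail_term f (n + 1 + l))" for N
  proof -
    have "(\<Sum>k\<in>{\<nu> j<..\<nu> (N + j)}. tail_term f k) \<le> (\<Sum>k\<in>(\<lambda>l. n + 1 + l) ` {..<\<nu> (N + j)}. tail_term f k)"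
    proof (rule sum_mono2)
      show "{\<nu> j<..\<nu> (N + j)} \<subseteq> (\<lambda>l. n + 1 + l) ` {..<\<nu> (N + j)}"
      proof
        fix k assume k: "k \<in> {\<nu> j<..\<nu> (N + j)}"
        then show "k \<in> (\<lambda>l. n + 1 + l) ` {..<\<nu> (N + j)}" using nj by (intro image_eqI[of _ _ "k - (n + 1)"]) auto
      qed
    qed auto
    also have "\<dots> = (\<Sum>l<\<nu> (N + j). tail_term f (n + 1 + l))" by (subst sum.reindex) (auto intro: inj_onI)
    also have "\<dots> \<le> (\<Sum>l. tail_term f (n + 1 + l))" by (intro sum_le_suminf summableI) auto
    finally show ?thesis unfolding part .
  qed
  then have P: "(\<Sum>i. P i) \<le> (\<Sum>l. tail_term f (n + 1 + l))" by (intro suminf_le_const summableI) auto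
  have "(\<Sum>i. nrm (block f \<gamma> (i + (j + 2)))) \<le> (\<Sum>i. ennreal (D * K ^ 4) * P i)"
    unfolding P_def using tail_block[OF f, of \<gamma> "_ + j"] by (intro suminf_le summableI) (simp add: add.assoc)
  also have "\<dots> = ennreal (D * K ^ 4) * (\<Sum>i. P i)" by simp
  also have "\<dots> \<le> ennreal (D * K ^ 4) * (\<Sum>l. tail_term f (n + 1 + l))" using P by (rule mult_left_mono) simp
  finally show ?thesis .
qed

lemma block_sum_finite:
  assumes f: "f \<in> L_per" and fin: "(\<Sum>l. tail_term f (1 + l)) < \<infinity>"
  shows "(\<Sum>i. nrm (block f \<gamma> i)) < \<infinity>"
proof -
  have "tail_term f (1 + 0) < top" using ennreal_suminf_lessD[of "\<lambda>l. tail_term f (1 + l)" top 0] fin by simp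
  then have E1: "E f 1 < top" using lam_pos[of 1] u_pos[of 1]
    by (auto simp: tail_term_def ennreal_mult_less_top)
  have bfin: "nrm (block f \<gamma> i) < top" for i
  proof -
    have "nrm (block f \<gamma> i) \<le> ennreal (D * u (\<nu> (Suc i))) * E f (\<nu> (i - 1))" by (rule block_norm[OF f])
    also have "\<dots> \<le> ennreal (D * u (\<nu> (Suc i))) * E f 1"
      by (intro mult_left_mono best_approx_antimono \<nu>_ge_1) auto
    also have "\<dots> < top" using E1 by (simp add: ennreal_mult_less_top)
    finally show ?thesis .
  qed
  have "(\<Sum>i. nrm (block f \<gamma> (i + (0 + 2)))) \<le> ennreal (D * K ^ 4) * (\<Sum>l. tail_term f (0 + 1 + l))"
    by (rule tail_bound[OF f]) simp
  also have "\<dots> < top" using fin by (simp add: ennreal_mult_less_top)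
  finally have t: "(\<Sum>i. nrm (block f \<gamma> (i + 2))) < top" by simp
  have "(\<Sum>i. nrm (block f \<gamma> i)) = (\<Sum>i. nrm (block f \<gamma> (i + 2))) + (\<Sum>i<2. nrm (block f \<gamma> i))"
    by (rule suminf_offset) (rule summableI)
  also have "\<dots> < top" using t bfin by (simp add: numeral_2_eq_2)
  finally show ?thesis by simp
qed

definition head_term :: "(real \<Rightarrow> real) \<Rightarrow> nat \<Rightarrow> nat \<Rightarrow> ennreal" where
  "head_term f r k = ennreal (real k ^ (2 * r) * u k) * E f k"

text \<open>
  The gain from the Steklov differences and the norm of the block are both transferred from the node
  \<open>\<nu> (Suc i)\<close> to \<open>\<nu> (i - 1)\<close>, at most two nodes earlier, at the cost of powers of \<open>K\<close>. For the last
  blocks \<open>\<nu> (i - 1)\<close> may exceed \<open>n\<close>; then \<open>n\<close> itself is used, which lies beyond \<open>\<nu> (i - 2)\<close>.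
\<close>

lemma head_block:
  assumes f: "f \<in> L_per" and n: "1 \<le> n" and j: "\<And>i. i < j \<Longrightarrow> \<nu> i < n" and i: "i < j + 2"
  shows "ennreal ((1 / real n * real (\<nu> (Suc i))) ^ (2 * r)) * nrm (block f \<gamma> i)
    \<le> ennreal (D * K ^ (6 * r + 3) * (1 / real n ^ (2 * r))) * head_term f r (min (\<nu> (i - 1)) n)"
proof -
  define k where "k = min (\<nu> (i - 1)) n"
  have k: "1 \<le> k" "k \<le> \<nu> (i - 1)" using \<nu>_ge_1[of "i - 1"] n by (auto simp: k_def)
  have K3: "K ^ a * y \<le> K ^ 3 * y" if "a \<le> 3" "0 \<le> y" for a :: nat and y
    using that K1 by (intro mult_right_mono power_increasing) auto
  have ratios: "u (\<nu> (Suc i)) \<le> K ^ 3 * u k" "real (\<nu> (Suc i)) \<le> K ^ 3 * real k"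
  proof -
    have "u (\<nu> (Suc i)) \<le> K ^ 3 * u k \<and> real (\<nu> (Suc i)) \<le> K ^ 3 * real k"
    proof (cases "\<nu> (i - 1) \<le> n")
      case True
      then have kk: "k = \<nu> (i - 1)" by (simp add: k_def)
      obtain a where a: "a \<le> 2" "Suc i = i - 1 + a"
        by (cases i) (use that[of 1] that[of 2] in auto)
      have "0 \<le> u (\<nu> (i - 1))" using u_pos[OF \<nu>_ge_1, of "i - 1"] by simp
      then have "u (\<nu> (i - 1 + a)) \<le> K ^ 3 * u (\<nu> (i - 1))"
        using a(1) by (intro order_trans[OF u_ratio[of "i - 1" a] K3]) auto
      moreover have "real (\<nu> (i - 1 + a)) \<le> K ^ 3 * real (\<nu> (i - 1))"
        using a(1) by (intro order_trans[OF \<nu>_power_ratio[of "i - 1" a] K3]) auto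
      ultimately show ?thesis unfolding kk a(2) by blast
    next
      case False
      then have kn: "k = n" by (simp add: k_def)
      have "i - 1 \<noteq> 0" using False \<nu>0 n by (intro notI) simp
      then have "i = Suc (Suc (i - 2))" by arith
      then obtain l where l: "i = Suc (Suc l)" by blast
      have "\<nu> l < n" using i l by (intro j) simp
      then have ln: "u (\<nu> l) \<le> u n" "real (\<nu> l) \<le> real n" using \<nu>_ge_1[of l] by (auto intro: u_mono)
      have K3': "0 \<le> K ^ 3" using K1 by simp
      have "u (\<nu> (l + 3)) \<le> K ^ 3 * u n"
        by (rule order_trans[OF u_ratio[of l 3] mult_left_mono[OF ln(1) K3']])
      moreover have "real (\<nu> (l + 3)) \<le> K ^ 3 * real n"
        by (rule order_trans[OF \<nu>_power_ratio[of l 3] mult_left_mono[OF ln(2) K3']])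
      ultimately have "u (\<nu> (l + 3)) \<le> K ^ 3 * u n" "real (\<nu> (l + 3)) \<le> K ^ 3 * real n" by auto
      then show ?thesis unfolding kn l by (simp add: numeral_3_eq_3)
    qed
    then show "u (\<nu> (Suc i)) \<le> K ^ 3 * u k" "real (\<nu> (Suc i)) \<le> K ^ 3 * real k" by auto
  qed
  have uk: "0 < u k" by (rule u_pos[OF k(1)])
  have "(1 / real n * real (\<nu> (Suc i))) ^ (2 * r) * (D * u (\<nu> (Suc i)))
      \<le> (1 / real n * (K ^ 3 * real k)) ^ (2 * r) * (D * (K ^ 3 * u k))"
    using ratios D_pos K1 uk n u_pos[OF \<nu>_ge_1, of "Suc i"] by (intro mult_mono power_mono) auto
  also have "\<dots> = D * K ^ (6 * r + 3) * (1 / real n ^ (2 * r)) * (real k ^ (2 * r) * u k)"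
    by (simp add: power_mult_distrib power_divide power_add flip: power_mult)
  finally have real_le: "(1 / real n * real (\<nu> (Suc i))) ^ (2 * r) * (D * u (\<nu> (Suc i)))
      \<le> D * K ^ (6 * r + 3) * (1 / real n ^ (2 * r)) * (real k ^ (2 * r) * u k)" .
  have "ennreal ((1 / real n * real (\<nu> (Suc i))) ^ (2 * r)) * nrm (block f \<gamma> i)
     \<le> ennreal ((1 / real n * real (\<nu> (Suc i))) ^ (2 * r)) * (ennreal (D * u (\<nu> (Suc i))) * E f k)"
    using order_trans[OF block_norm[OF f] mult_left_mono[OF best_approx_antimono[OF k(2)]]]
    by (intro mult_left_mono) auto
  also have "\<dots> = ennreal ((1 / real n * real (\<nu> (Suc i))) ^ (2 * r) * (D * u (\<nu> (Suc i)))) * E f k"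
    by (subst ennreal_mult') (auto simp: mult.assoc)
  also have "\<dots> \<le> ennreal (D * K ^ (6 * r + 3) * (1 / real n ^ (2 * r)) * (real k ^ (2 * r) * u k)) * E f k"
    using real_le by (intro mult_right_mono ennreal_leI) auto
  also have "\<dots> = ennreal (D * K ^ (6 * r + 3) * (1 / real n ^ (2 * r))) * head_term f r k"
    unfolding head_term_def using D_pos K1 by (subst ennreal_mult') (auto simp: mult.assoc)
  finally show ?thesis by (simp add: k_def)
qed

text \<open>
  The nodes \<open>\<nu> 0, \<dots>, \<nu> (j - 1)\<close> are distinct and less than \<open>n\<close>. The first summand repeats the node
  \<open>\<nu> 0\<close> and the last one may repeat any index, so each of these two costs at most the whole sum.
\<close>

lemma head_multiplicity:
  assumes n: "1 \<le> n" and j: "\<And>i. i < j \<Longrightarrow> \<nu> i < n"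
  shows "(\<Sum>i<j + 2. head_term f r (min (\<nu> (i - 1)) n)) \<le> 3 * (\<Sum>k=1..n. head_term f r k)"
proof -
  define S where "S = (\<Sum>k=1..n. head_term f r k)"
  define H where "H = (\<lambda>i. head_term f r (min (\<nu> (i - 1)) n))"
  have one: "H i \<le> S" for i
    unfolding S_def H_def using n \<nu>_ge_1[of "i - 1"] by (intro member_le_sum) auto
  have "(\<Sum>i<j. H (Suc i)) = (\<Sum>k\<in>\<nu> ` {..<j}. head_term f r k)"
  proof -
    have "inj_on \<nu> {..<j}" by (intro inj_onI) (metis \<nu>_strict less_irrefl linorder_neqE_nat)
    then have "(\<Sum>k\<in>\<nu> ` {..<j}. head_term f r k) = (\<Sum>i<j. head_term f r (\<nu> i))" by (simp add: sum.reindex)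
    also have "\<dots> = (\<Sum>i<j. H (Suc i))" by (intro sum.cong refl) (use less_imp_le[OF j] in \<open>simp add: H_def min_absorb1\<close>)
    finally show ?thesis by simp
  qed
  also have "\<dots> \<le> S" unfolding S_def using less_imp_le[OF j] \<nu>_ge_1 by (intro sum_mono2) auto
  finally have mid: "(\<Sum>i<j. H (Suc i)) \<le> S" .
  have "(\<Sum>i<j + 2. H i) = H 0 + ((\<Sum>i<j. H (Suc i)) + H (Suc j))"
    by (simp only: add_2_eq_Suc' sum.lessThan_Suc_shift[of _ "Suc j"] sum.lessThan_Suc[of "\<lambda>i. H (Suc i)"])
  also have "\<dots> \<le> S + (S + S)" by (intro add_mono one mid)
  also have "\<dots> = 3 * S"
  proof -
    have "(3::ennreal) = 1 + (1 + 1)" by simp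
    then show ?thesis by (simp only: distrib_right mult_1)
  qed
  finally show ?thesis by (simp add: H_def S_def)
qed

lemma steklov_diff_partial_sum:
  assumes h: "\<And>i. i < r \<Longrightarrow> 0 < h i \<and> h i \<le> 1"
  shows "nrm (steklov_diff h r (\<lambda>x. \<Sum>i<m. block f \<gamma> i x)) \<le> (\<Sum>i<m. nrm (steklov_diff h r (block f \<gamma> i)))"
proof (induction m)
  case 0
  have z: "(\<lambda>x. 0) \<in> L_per" using partial_sum_L_per[of f \<gamma> 0] by simp
  have "nrm (\<lambda>x. 0 * 0) = 0" using orlicz_norm_cmult[OF weight_measurable, of "\<lambda>_. 0" M 0] by simp
  then show ?case using steklov_diff_bounded[OF z h] by simp
next
  case (Suc m)
  have hp: "\<And>i. i < r \<Longrightarrow> 0 < h i" using h by blast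
  have L: "steklov_diff h r (\<lambda>x. \<Sum>i<m. block f \<gamma> i x) \<in> L_per" "steklov_diff h r (block f \<gamma> m) \<in> L_per"
    by (intro steklov_diff_L_per partial_sum_L_per block_L_per hp; simp)+
  have "steklov_diff h r (\<lambda>x. \<Sum>i<Suc m. block f \<gamma> i x)
     = (\<lambda>x. steklov_diff h r (\<lambda>x. \<Sum>i<m. block f \<gamma> i x) x + steklov_diff h r (block f \<gamma> m) x)"
    using steklov_diff_add[OF partial_sum_L_per[of f \<gamma> m] block_L_per[of f \<gamma> m] hp] by simp
  then have "nrm (steklov_diff h r (\<lambda>x. \<Sum>i<Suc m. block f \<gamma> i x))
      \<le> nrm (steklov_diff h r (\<lambda>x. \<Sum>i<m. block f \<gamma> i x)) + nrm (steklov_diff h r (block f \<gamma> m))"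
    by (intro nrm_add_le L_perD(1)[OF L(1)] L_perD(1)[OF L(2)]) simp
  also have "\<dots> \<le> (\<Sum>i<m. nrm (steklov_diff h r (block f \<gamma> i))) + nrm (steklov_diff h r (block f \<gamma> m))"
    by (intro add_right_mono Suc)
  finally show ?case by simp
qed

text \<open>
  The first summand comes from the blocks on which the Steklov differences gain, the second from the
  others.
\<close>

definition C :: "nat \<Rightarrow> real" where
  "C r = (1440 * A\<^sup>2) ^ r * (D * K ^ (6 * r + 3) * 3) + (4 * A) ^ r * (D * K ^ 4)"

lemma C_parts: "(1440 * A\<^sup>2) ^ r * (D * K ^ (6 * r + 3) * 3) \<le> C r" "(4 * A) ^ r * (D * K ^ 4) \<le> C r" "0 < C r"
proof -
  have "0 < (1440 * A\<^sup>2) ^ r * (D * K ^ (6 * r + 3) * 3)" "0 < (4 * A) ^ r * (D * K ^ 4)"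
    using A D_pos K1 by auto
  then show "(1440 * A\<^sup>2) ^ r * (D * K ^ (6 * r + 3) * 3) \<le> C r" "(4 * A) ^ r * (D * K ^ 4) \<le> C r" "0 < C r"
    unfolding C_def by linarith+
qed

text \<open>
  The blocks are divided at the first node \<open>\<nu> j \<ge> n\<close>. The first \<open>j + 2\<close> of them are polynomials of order
  at most a constant times \<open>n\<close>, and the differences gain \<open>(\<nu> (Suc i) / n) ^ (2 * r)\<close> on each; on the
  remainder the differences are merely bounded.
\<close>

theorem deriv_sum_modulus:
  assumes f: "f \<in> L_per" and fin: "(\<Sum>l. tail_term f (1 + l)) < \<infinity>" and n: "1 \<le> n"
  shows "modulus M \<omega> r (deriv_sum f \<gamma>) (1 / real n)
    \<le> ennreal (C r) * (ennreal (1 / real n ^ (2 * r)) * (\<Sum>k=1..n. head_term f r k) + (\<Sum>l. tail_term f (n + 1 + l)))"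
  unfolding modulus_def
proof (rule SUP_least)
  fix h assume "h \<in> {h. \<forall>i<r. 0 < h i \<and> h i < 1 / real n}"
  then have h: "\<And>i. i < r \<Longrightarrow> 0 < h i \<and> h i \<le> 1 / real n" by auto
  have n1: "1 / real n \<le> 1" using n by simp
  have h1: "\<And>i. i < r \<Longrightarrow> 0 < h i \<and> h i \<le> 1" using h n1 by force
  have hp: "\<And>i. i < r \<Longrightarrow> 0 < h i" using h by blast
  define j where "j = (LEAST j. n \<le> \<nu> j)"
  have ex: "n \<le> \<nu> n" using \<nu>_ge[of n] by simp
  have nj: "n \<le> \<nu> j" unfolding j_def by (rule LeastI[of _ n]) (rule ex)
  have below: "\<nu> i < n" if "i < j" for i using not_less_Least[of i "\<lambda>j. n \<le> \<nu> j"] that by (simp add: j_def)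
  define m where "m = j + 2"
  define G where "G = (\<lambda>x. \<Sum>i<m. block f \<gamma> i x)"
  have GL: "G \<in> L_per" unfolding G_def by (rule partial_sum_L_per)
  have rn: "nrm (remainder f \<gamma> m) \<le> ennreal (D * K ^ 4) * (\<Sum>l. tail_term f (n + 1 + l))"
    using order_trans[OF remainder_norm tail_bound[OF f nj]] by (simp add: m_def)
  have "nrm (remainder f \<gamma> m) < \<infinity>"
  proof -
    have "(\<Sum>i. nrm (block f \<gamma> i)) < top" using block_sum_finite[OF f fin] by simp
    moreover have "(\<Sum>i. nrm (block f \<gamma> i)) = (\<Sum>i. nrm (block f \<gamma> (i + m))) + (\<Sum>i<m. nrm (block f \<gamma> i))"
      by (rule suminf_offset) (rule summableI)
    ultimately have "(\<Sum>i. nrm (block f \<gamma> (i + m))) < top" by simp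
    then show ?thesis using remainder_norm[of f \<gamma> m] by (simp add: le_less_trans)
  qed
  then have RL: "remainder f \<gamma> m \<in> L_per" by (intro norm_finite_L_per remainder_periodic_measurable)
  define X where "X = (\<Sum>k=1..n. head_term f r k)"
  define Y where "Y = (\<Sum>l. tail_term f (n + 1 + l))"
  have head: "nrm (steklov_diff h r G) \<le> ennreal (C r) * (ennreal (1 / real n ^ (2 * r)) * X)"
  proof -
    have "nrm (steklov_diff h r G) \<le> (\<Sum>i<m. nrm (steklov_diff h r (block f \<gamma> i)))"
      unfolding G_def by (rule steklov_diff_partial_sum[OF h1])
    also have "\<dots> \<le> (\<Sum>i<m. ennreal ((1440 * A\<^sup>2) ^ r * (1 / real n * real (\<nu> (Suc i))) ^ (2 * r)) * nrm (block f \<gamma> i))"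
      by (intro sum_mono steklov_diff_poly_approx block_trig_polys \<nu>_ge_1 h n1)
    also have "\<dots> = (\<Sum>i<m. ennreal ((1440 * A\<^sup>2) ^ r) * (ennreal ((1 / real n * real (\<nu> (Suc i))) ^ (2 * r)) * nrm (block f \<gamma> i)))"
      by (intro sum.cong refl) (subst ennreal_mult', auto simp: mult.assoc)
    also have "\<dots> \<le> (\<Sum>i<m. ennreal ((1440 * A\<^sup>2) ^ r) * (ennreal (D * K ^ (6 * r + 3) * (1 / real n ^ (2 * r))) * head_term f r (min (\<nu> (i - 1)) n)))"
      using head_block[OF f n below] by (intro sum_mono mult_left_mono) (auto simp: m_def)
    also have "\<dots> = ennreal ((1440 * A\<^sup>2) ^ r) * (ennreal (D * K ^ (6 * r + 3) * (1 / real n ^ (2 * r))) * (\<Sum>i<m. head_term f r (min (\<nu> (i - 1)) n)))"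
      by (simp only: sum_distrib_left)
    also have "\<dots> \<le> ennreal ((1440 * A\<^sup>2) ^ r) * (ennreal (D * K ^ (6 * r + 3) * (1 / real n ^ (2 * r))) * (3 * X))"
      unfolding m_def X_def by (intro mult_left_mono head_multiplicity n below) auto
    also have "\<dots> = ennreal ((1440 * A\<^sup>2) ^ r * (D * K ^ (6 * r + 3) * 3)) * (ennreal (1 / real n ^ (2 * r)) * X)"
    proof -
      have e: "ennreal (D * K ^ (6 * r + 3) * (1 / real n ^ (2 * r))) = ennreal (D * K ^ (6 * r + 3)) * ennreal (1 / real n ^ (2 * r))"
        using D_pos K1 by (intro ennreal_mult') auto
      have e2: "ennreal ((1440 * A\<^sup>2) ^ r * (D * K ^ (6 * r + 3) * 3)) = ennreal ((1440 * A\<^sup>2) ^ r) * (ennreal (D * K ^ (6 * r + 3)) * 3)"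
        using D_pos K1 by (simp add: ennreal_mult' ennreal_mult'')
      show ?thesis unfolding e e2 by (simp only: mult_ac)
    qed
    also have "\<dots> \<le> ennreal (C r) * (ennreal (1 / real n ^ (2 * r)) * X)"
      by (intro mult_right_mono ennreal_leI C_parts) auto
    finally show ?thesis .
  qed
  have tail: "nrm (steklov_diff h r (remainder f \<gamma> m)) \<le> ennreal (C r) * Y"
  proof -
    have "nrm (steklov_diff h r (remainder f \<gamma> m)) \<le> ennreal ((4 * A) ^ r) * nrm (remainder f \<gamma> m)"
      by (rule steklov_diff_bounded[OF RL h1])
    also have "\<dots> \<le> ennreal ((4 * A) ^ r) * (ennreal (D * K ^ 4) * Y)"
      using rn by (intro mult_left_mono) (auto simp: Y_def)
    also have "\<dots> = ennreal ((4 * A) ^ r * (D * K ^ 4)) * Y"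
      using A by (subst ennreal_mult') (auto simp: mult.assoc)
    also have "\<dots> \<le> ennreal (C r) * Y" by (intro mult_right_mono ennreal_leI C_parts) auto
    finally show ?thesis .
  qed
  have "deriv_sum f \<gamma> = (\<lambda>x. G x + remainder f \<gamma> m x)" by (auto simp: remainder_def G_def)
  then have "steklov_diff h r (deriv_sum f \<gamma>) = (\<lambda>x. steklov_diff h r G x + steklov_diff h r (remainder f \<gamma> m) x)"
    using steklov_diff_add[OF GL RL hp] by simp
  then have "nrm (steklov_diff h r (deriv_sum f \<gamma>)) \<le> nrm (steklov_diff h r G) + nrm (steklov_diff h r (remainder f \<gamma> m))"
    by (intro nrm_add_le L_perD(1)[OF steklov_diff_L_per[OF GL hp]] L_perD(1)[OF steklov_diff_L_per[OF RL hp]]) auto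
  also have "\<dots> \<le> ennreal (C r) * (ennreal (1 / real n ^ (2 * r)) * X) + ennreal (C r) * Y"
    by (intro add_mono head tail)
  finally show "nrm (steklov_diff h r (deriv_sum f \<gamma>))
    \<le> ennreal (C r) * (ennreal (1 / real n ^ (2 * r)) * (\<Sum>k=1..n. head_term f r k) + (\<Sum>l. tail_term f (n + 1 + l)))"
    unfolding X_def Y_def by (simp add: distrib_left)
qed

lemma deriv_sum_norm_finite:
  assumes f: "f \<in> L_per" and fin: "(\<Sum>l. tail_term f (1 + l)) < \<infinity>"
  shows "nrm (deriv_sum f \<gamma>) < \<infinity>"
proof -
  have "nrm (remainder f \<gamma> 0) \<le> (\<Sum>i. nrm (block f \<gamma> i))" using remainder_norm[of f \<gamma> 0] by simp
  moreover have "remainder f \<gamma> 0 = deriv_sum f \<gamma>" by (auto simp: remainder_def)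
  ultimately show ?thesis using block_sum_finite[OF f fin, of \<gamma>] by simp
qed

end

section \<open>The classes of sequences\<close>

locale psi_function =
  fixes \<psi> :: "real \<Rightarrow> real"
  assumes psi: "\<psi> \<in> psi_class"
begin

lemma
  shows psi_nat_pos: "1 \<le> k \<Longrightarrow> 0 < \<psi> (real k)"
    and psi_nat_convex: "1 \<le> k \<Longrightarrow> 0 \<le> \<psi> (real (k + 2)) - 2 * \<psi> (real (k + 1)) + \<psi> (real k)"
    and psi_continuous: "continuous_on {1..} \<psi>"
    and psi_strict: "1 \<le> x \<Longrightarrow> x < y \<Longrightarrow> \<psi> y < \<psi> x"
    and psi_tendsto: "(\<psi> \<longlongrightarrow> 0) at_top"
  using psi unfolding psi_class_def monotone_on_def by (auto intro: less_imp_le)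

lemma psi_mono: "1 \<le> x \<Longrightarrow> x \<le> y \<Longrightarrow> \<psi> y \<le> \<psi> x"
  using psi_strict[of x y] by (cases "x = y") auto

lemma psi_pos: "0 < \<psi> x" if "1 \<le> x"
proof -
  define k where "k = nat \<lceil>x\<rceil>"
  have "x \<le> real k" unfolding k_def by (rule real_nat_ceiling_ge)
  moreover have "1 \<le> k" using that calculation by linarith
  ultimately show ?thesis using psi_mono[of x "real k"] psi_nat_pos[of k] that by linarith
qed

lemma eta_props:
  assumes t: "1 \<le> t"
  shows "\<psi> (eta \<psi> t) = \<psi> t / 2" "t < eta \<psi> t"
proof -
  have "\<forall>\<^sub>F x in at_top. \<psi> x < \<psi> t / 2"
    using psi_pos[OF t] by (intro order_tendstoD(2)[OF psi_tendsto]) simp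
  then obtain b where b: "\<And>x. b \<le> x \<Longrightarrow> \<psi> x < \<psi> t / 2" by (auto simp: eventually_at_top_linorder)
  define B where "B = max b t"
  have "\<exists>s. t \<le> s \<and> s \<le> B \<and> \<psi> s = \<psi> t / 2"
  proof (rule IVT2')
    show "\<psi> B \<le> \<psi> t / 2" using b[of B] by (simp add: B_def)
    show "\<psi> t / 2 \<le> \<psi> t" using psi_pos[OF t] by simp
    show "t \<le> B" by (simp add: B_def)
    show "continuous_on {t..B} \<psi>" using t by (intro continuous_on_subset[OF psi_continuous]) auto
  qed
  then obtain s where s: "t \<le> s" "\<psi> s = \<psi> t / 2" by blast
  then have mem: "\<psi> t / 2 \<in> \<psi> ` {1..}" using t by (metis atLeast_iff image_eqI order_trans)
  show e: "\<psi> (eta \<psi> t) = \<psi> t / 2" unfolding eta_def by (rule f_inv_into_f[OF mem])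
  have "eta \<psi> t \<in> {1..}" unfolding eta_def by (rule inv_into_into[OF mem])
  then show "t < eta \<psi> t"
    using psi_mono[of "eta \<psi> t" t] e psi_pos[OF t] by (cases "t < eta \<psi> t") auto
qed

lemma psi_half_le: "1 \<le> t \<Longrightarrow> 1 \<le> s \<Longrightarrow> s \<le> eta \<psi> t \<Longrightarrow> \<psi> t / 2 \<le> \<psi> s"
  using psi_mono[of s "eta \<psi> t"] eta_props(1)[of t] by simp

text \<open>
  The mean slope of a convex sequence over \<open>{j..k}\<close> is not steeper than the one over \<open>{i..j}\<close>.
\<close>

lemma convex_slopes:
  assumes "1 \<le> i" "i \<le> j" "j \<le> k"
  shows "(\<psi> (real j) - \<psi> (real k)) * (real j - real i) \<le> (\<psi> (real i) - \<psi> (real j)) * (real k - real j)"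
proof -
  define d where "d = (\<lambda>k. \<psi> (real k) - \<psi> (real (Suc k)))"
  have d_step: "d (Suc k) \<le> d k" if "1 \<le> k" for k
    using psi_nat_convex[OF that] by (simp add: d_def add.commute)
  have d_mono: "d (a + l) \<le> d a" if "1 \<le> a" for a l
  proof (induction l)
    case (Suc l)
    then show ?case using d_step[of "a + l"] that by simp
  qed simp
  have upper: "\<psi> (real j) - \<psi> (real (j + l)) \<le> real l * d j" for l
  proof (induction l)
    case (Suc l)
    then show ?case using d_mono[of j l] assms by (simp add: d_def distrib_right)
  qed simp
  have lower: "real l * d (i + l) \<le> \<psi> (real i) - \<psi> (real (i + l))" for l
  proof (induction l)
    case (Suc l)
    have "real l * d (i + Suc l) \<le> real l * d (i + l)"
      using d_step[of "i + l"] assms by (intro mult_left_mono) auto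
    moreover have "d (i + Suc l) \<le> d (i + l)" using d_step[of "i + l"] assms by simp
    ultimately have "real l * d (i + Suc l) + d (i + Suc l) \<le> real l * d (i + l) + d (i + l)" by simp
    also have "\<dots> \<le> \<psi> (real i) - \<psi> (real (i + l)) + d (i + l)" using Suc by simp
    finally show ?case by (simp add: d_def distrib_right)
  qed simp
  have "(\<psi> (real j) - \<psi> (real k)) * (real j - real i) \<le> (real (k - j) * d j) * (real j - real i)"
    using upper[of "k - j"] assms by (intro mult_right_mono) auto
  also have "\<dots> = (real (j - i) * d j) * (real k - real j)" using assms by (simp add: of_nat_diff)
  also have "\<dots> \<le> (\<psi> (real i) - \<psi> (real j)) * (real k - real j)"
    using lower[of "j - i"] assms by (intro mult_right_mono) auto
  finally show ?thesis .
qed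

text \<open>
  A step from \<open>t\<close> to a point not beyond \<open>eta \<psi> t\<close> at most halves \<open>\<psi>\<close>.
\<close>

lemma psi_halving_steps:
  assumes step: "\<And>t. 1 \<le> t \<Longrightarrow> t \<le> s t \<and> s t \<le> eta \<psi> t" and t: "1 \<le> t"
  shows "1 \<le> (s ^^ m) t \<and> \<psi> t \<le> 2 ^ m * \<psi> ((s ^^ m) t)"
proof (induction m)
  case (Suc m)
  have "1 \<le> s ((s ^^ m) t)" using step[of "(s ^^ m) t"] Suc by linarith
  then have "\<psi> ((s ^^ m) t) / 2 \<le> \<psi> (s ((s ^^ m) t))"
    using Suc step[of "(s ^^ m) t"] by (intro psi_half_le) auto
  then have "2 ^ m * \<psi> ((s ^^ m) t) \<le> 2 ^ m * (2 * \<psi> (s ((s ^^ m) t)))"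
    by (intro mult_left_mono) auto
  also have "\<dots> = 2 ^ Suc m * \<psi> ((s ^^ Suc m) t)" by simp
  finally have "2 ^ m * \<psi> ((s ^^ m) t) \<le> 2 ^ Suc m * \<psi> ((s ^^ Suc m) t)" .
  then have "\<psi> t \<le> 2 ^ Suc m * \<psi> ((s ^^ Suc m) t)" using Suc by (blast intro: order_trans)
  with \<open>1 \<le> s ((s ^^ m) t)\<close> show ?case by (simp only: funpow.simps comp_apply simp_thms)
qed (use t in auto)

text \<open>
  The hypothesis says that \<open>eta \<psi> t \<ge> b * t\<close> with \<open>b = 1 + 1 / K > 1\<close>. Finitely many multiplications by
  \<open>b\<close> exceed the factor \<open>2\<close>, so doubling the argument decreases \<open>\<psi>\<close> at most by a constant factor.
\<close>

lemma block_scale_dyadic: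
  assumes K: "\<And>t. 1 \<le> t \<Longrightarrow> 0 < t / (eta \<psi> t - t) \<and> t / (eta \<psi> t - t) \<le> K"
  obtains K' where "block_scale (\<lambda>k. \<psi> (real k)) (\<lambda>i. 2 ^ i) (\<lambda>k. 1 / real k) K'"
proof -
  have K0: "0 < K" using K[of 1] by linarith
  define b where "b = 1 + 1 / K"
  have b1: "1 < b" using K0 by (simp add: b_def)
  have step: "t \<le> b * t \<and> b * t \<le> eta \<psi> t" if t: "1 \<le> t" for t
  proof -
    have "0 < eta \<psi> t - t" using eta_props(2)[OF t] by simp
    then have "t \<le> K * (eta \<psi> t - t)" using K[OF t] by (simp add: pos_divide_le_eq)
    then have "t / K \<le> eta \<psi> t - t" using K0 by (simp add: pos_divide_le_eq mult.commute)
    moreover have "b * t = t + t / K" by (simp add: b_def distrib_right)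
    ultimately show ?thesis using t K0 by simp
  qed
  obtain m where m: "2 < b ^ m" using real_arch_pow[OF b1] by blast
  have pw: "((\<lambda>t. b * t) ^^ m) t = b ^ m * t" for t by (induction m) auto
  have dbl: "\<psi> t \<le> 2 ^ m * \<psi> (2 * t)" if t: "1 \<le> t" for t
  proof -
    have "\<psi> t \<le> 2 ^ m * \<psi> (b ^ m * t)" using psi_halving_steps[OF step t, of m] unfolding pw by simp
    also have "\<dots> \<le> 2 ^ m * \<psi> (2 * t)" using m t by (intro mult_left_mono psi_mono) auto
    finally show ?thesis .
  qed
  define K' where "K' = (2::real) ^ (m + 1)"
  have K'2: "2 \<le> K'" using one_le_power[of "2::real" m] by (simp add: K'_def)
  have "block_scale (\<lambda>k. \<psi> (real k)) (\<lambda>i. 2 ^ i) (\<lambda>k. 1 / real k) K'"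
  proof
    fix i k :: nat
    show "1 \<le> K'" using K'2 by simp
    have "\<psi> (2 ^ i) \<le> 2 ^ m * \<psi> (2 * 2 ^ i)" by (rule dbl) simp
    also have "\<dots> \<le> K' * \<psi> (2 * 2 ^ i)"
    proof (rule mult_right_mono)
      show "0 \<le> \<psi> (2 * 2 ^ i)" using psi_pos[of "2 * 2 ^ i"] one_le_power[of "2::real" i] by linarith
    qed (simp add: K'_def)
    finally show "\<psi> (real (2 ^ i)) \<le> K' * \<psi> (real (2 ^ Suc i))" by simp
    show "real (2 ^ Suc i) \<le> K' * real (2 ^ i)" using mult_right_mono[OF K'2, of "2 ^ i"] by simp
    show "real (2 ^ Suc (Suc i)) - real (2 ^ Suc i) \<le> K' * (real (2 ^ Suc i) - real (2 ^ i))"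
      using mult_right_mono[OF K'2, of "2 ^ i"] by simp
    have "(2::real) ^ i * 1 \<le> 2 ^ i * K'" using K'2 by (intro mult_left_mono) auto
    moreover have "0 \<le> K' * (2::real) ^ i" using K'2 by simp
    ultimately show "real (2 ^ Suc i) - real (2 ^ i) \<le> K' * (real (2 ^ Suc (Suc i)) - real (2 ^ Suc i))"
      by (simp add: mult_ac)
    show "1 \<le> K' * (1 / real k) * (real (2 ^ Suc i) - real (2 ^ i))" if k: "2 ^ i < k" "k \<le> 2 ^ Suc i"
    proof -
      have kr: "0 < real k" "real k \<le> 2 * 2 ^ i"
        using k of_nat_le_iff[of k "2 ^ Suc i", where 'a = real] by auto
      have "2 * (2::real) ^ i \<le> K' * 2 ^ i" using K'2 by (intro mult_right_mono) auto
      then have "real k \<le> K' * 2 ^ i" using kr(2) by linarith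
      then show ?thesis using kr(1) by (simp add: pos_le_divide_eq)
    qed
  qed (use psi_nat_pos psi_nat_convex psi_mono in auto)
  then show thesis by (rule that)
qed

primrec eta_nodes :: "nat \<Rightarrow> nat" where
  "eta_nodes 0 = 1"
| "eta_nodes (Suc i) = nat \<lceil>eta \<psi> (real (eta_nodes i))\<rceil>"

lemma eta_nodes_bounds:
  "1 \<le> eta_nodes i" "eta \<psi> (real (eta_nodes i)) \<le> real (eta_nodes (Suc i))"
  "real (eta_nodes (Suc i)) < eta \<psi> (real (eta_nodes i)) + 1"
proof -
  have pos: "1 \<le> eta_nodes i" for i
  proof (induction i)
    case (Suc i)
    have "1 \<le> eta \<psi> (real (eta_nodes i))" using eta_props(2)[of "real (eta_nodes i)"] Suc by simp
    then show ?case using real_nat_ceiling_ge[of "eta \<psi> (real (eta_nodes i))"] by simp linarith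
  qed simp
  show "1 \<le> eta_nodes i" by (rule pos)
  show "eta \<psi> (real (eta_nodes i)) \<le> real (eta_nodes (Suc i))" by (simp add: real_nat_ceiling_ge)
  have "1 < eta \<psi> (real (eta_nodes i))" using eta_props(2)[of "real (eta_nodes i)"] pos[of i] by simp
  then show "real (eta_nodes (Suc i)) < eta \<psi> (real (eta_nodes i)) + 1" by simp linarith
qed

declare eta_nodes.simps(2) [simp del]

text \<open>
  Write \<open>gap t = eta \<psi> t - t\<close>. The bound on the derivative makes \<open>gap\<close> grow at most linearly, so the
  gap at any point between two consecutive nodes is at most a constant times the gap at the lower node;
  rounding the nodes up to integers only costs a constant factor since \<open>gap \<ge> c0\<close>. This gives the upper
  comparison of consecutive gaps and the bound on \<open>lam\<close>. The lower comparison comes from the convexity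
  of \<open>\<psi>\<close>: over each gap \<open>\<psi>\<close> loses a fixed portion of its value, and slopes do not get steeper.
\<close>

lemma block_scale_eta:
  assumes D: "\<And>t. 1 \<le> t \<Longrightarrow> \<exists>D. (eta \<psi> has_real_derivative D) (at t within {1..}) \<and> D \<le> K"
    and c0: "0 < c0" "\<And>t. 1 \<le> t \<Longrightarrow> c0 \<le> eta \<psi> t - t"
  obtains K' where "block_scale (\<lambda>k. \<psi> (real k)) eta_nodes (\<lambda>k. 1 / (eta \<psi> (real k) - real k)) K'"
proof -
  define L where "L = max 1 K"
  have L1: "1 \<le> L" "K \<le> L" by (auto simp: L_def)
  have lip: "eta \<psi> y - eta \<psi> x \<le> L * (y - x)" if x: "1 \<le> x" "x \<le> y" for x y
  proof (cases "x = y")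
    case False
    then have xy: "x < y" using x by simp
    obtain d where d: "\<And>t. 1 \<le> t \<Longrightarrow> (eta \<psi> has_real_derivative d t) (at t within {1..}) \<and> d t \<le> K"
      using D by metis
    have "continuous_on {x..y} (eta \<psi>)"
    proof (rule continuous_on_subset)
      show "continuous_on {1..} (eta \<psi>)" using d by (auto intro: DERIV_continuous_on)
    qed (use x in auto)
    moreover have "(eta \<psi> has_derivative (\<lambda>h. d t * h)) (at t)" if "x < t" "t < y" for t
    proof -
      have "at t within {1..} = at t" using that x by (intro at_within_interior) (simp add: interior_real_atLeast)
      then have "(eta \<psi> has_real_derivative d t) (at t)" using d[of t] that x by simp
      then show ?thesis by (rule has_field_derivative_imp_has_derivative)
    qed
    ultimately obtain z where z: "x < z" "z < y" "eta \<psi> y - eta \<psi> x = d z * (y - x)"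
      using mvt[OF xy, of "eta \<psi>" "\<lambda>t h. d t * h"] by blast
    have "d z * (y - x) \<le> L * (y - x)" using d[of z] z x L1 by (intro mult_right_mono) auto
    then show ?thesis using z(3) by simp
  qed simp
  define gap where "gap = (\<lambda>t. eta \<psi> t - t)"
  define v where "v = (\<lambda>i. real (eta_nodes i))"
  have vb: "eta \<psi> (v i) \<le> v (Suc i)" "v (Suc i) < eta \<psi> (v i) + 1" for i
    unfolding v_def by (rule eta_nodes_bounds)+
  have v1: "1 \<le> v i" for i using eta_nodes_bounds(1)[of i] by (simp add: v_def)
  have g: "c0 \<le> gap t" if "1 \<le> t" for t using c0(2)[OF that] by (simp add: gap_def)
  define a where "a = 1 + 1 / c0"
  have a1: "1 \<le> a" using c0 by (simp add: a_def)
  have plus1: "gap t + 1 \<le> a * gap t" if "1 \<le> t" for t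
    using g[OF that] c0(1) by (simp add: a_def distrib_right pos_le_divide_eq)
  have g_lip: "gap y \<le> gap x + L * (y - x)" if "1 \<le> x" "x \<le> y" for x y
    using lip[OF that] that by (simp add: gap_def)
  have w1: "gap (v i) \<le> v (Suc i) - v i" "v (Suc i) - v i \<le> a * gap (v i)" for i
    using vb[of i] plus1[OF v1[of i]] by (simp_all add: gap_def)
  (* m steps of length c0 cover a step of length 1, so rounding up decreases \<psi> by a bounded factor. *)
  define m where "m = nat \<lceil>1 / c0\<rceil>"
  have mc: "1 \<le> real m * c0"
  proof -
    have "1 / c0 \<le> real m" unfolding m_def by (rule real_nat_ceiling_ge)
    then show ?thesis using c0(1) by (simp add: pos_divide_le_eq)
  qed
  have shift: "\<psi> t \<le> 2 ^ m * \<psi> (t + 1)" if t: "1 \<le> t" for t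
  proof -
    have pw: "((\<lambda>t. t + c0) ^^ m) t = t + real m * c0" for t by (induction m) (auto simp: distrib_right)
    have "t \<le> t + c0 \<and> t + c0 \<le> eta \<psi> t" if "1 \<le> t" for t using c0(2)[OF that] c0(1) by simp
    then have "\<psi> t \<le> 2 ^ m * \<psi> (t + real m * c0)"
      using psi_halving_steps[of "\<lambda>t. t + c0" t m] t unfolding pw by simp
    also have "\<dots> \<le> 2 ^ m * \<psi> (t + 1)" using mc t by (intro mult_left_mono psi_mono) auto
    finally show ?thesis .
  qed
  define P where "P = 2 * (2::real) ^ m"
  have P2: "2 \<le> P" using one_le_power[of "2::real" m] by (simp add: P_def)
  have ratio: "\<psi> (v i) \<le> P * \<psi> (v (Suc i))" for i
  proof -
    have e: "1 \<le> eta \<psi> (v i)" using eta_props(2)[OF v1[of i]] v1[of i] by linarith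
    have "\<psi> (v i) = 2 * \<psi> (eta \<psi> (v i))" using eta_props(1)[OF v1[of i]] by simp
    also have "\<dots> \<le> 2 * (2 ^ m * \<psi> (eta \<psi> (v i) + 1))" using shift[OF e] by simp
    also have "\<dots> \<le> 2 * (2 ^ m * \<psi> (v (Suc i)))"
      using vb(2)[of i] v1[of "Suc i"] by (intro mult_left_mono psi_mono) auto
    finally show ?thesis by (simp add: P_def)
  qed
  have half: "\<psi> (v (Suc i)) \<le> \<psi> (v i) / 2" for i
    using psi_mono[OF _ vb(1)[of i]] eta_props[OF v1[of i]] v1[of i] by simp
  have inc: "v i < v (Suc i)" for i using w1(1)[of i] g[OF v1[of i]] c0(1) by linarith
  define N where "N = gap 1 + L + 1"
  have g1: "0 \<le> gap 1" using g[of 1] c0(1) by simp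
  have ratio_v: "v (Suc i) \<le> (N + 1) * v i" for i
  proof -
    have "v (Suc i) \<le> v i + gap (v i) + 1" using vb(2)[of i] by (simp add: gap_def)
    also have "\<dots> \<le> v i + (gap 1 + L * (v i - 1)) + 1" using g_lip[of 1 "v i"] v1[of i] by simp
    also have "\<dots> \<le> v i + (gap 1 * v i + L * v i) + v i"
    proof -
      have "gap 1 * 1 \<le> gap 1 * v i" using g1 v1[of i] by (intro mult_left_mono) auto
      moreover have "L * (v i - 1) \<le> L * v i" using L1 by (intro mult_left_mono) auto
      ultimately show ?thesis using v1[of i] by simp
    qed
    finally show ?thesis by (simp add: N_def distrib_right)
  qed
  have gap_grow: "gap y \<le> (1 + L * a) * gap (v i)" if y: "v i \<le> y" "y \<le> v (Suc i)" for i y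
  proof -
    have "gap y \<le> gap (v i) + L * (y - v i)" by (rule g_lip[OF v1 y(1)])
    also have "\<dots> \<le> gap (v i) + L * (a * gap (v i))"
      using w1(2)[of i] y L1 by (intro add_left_mono mult_left_mono) auto
    finally show ?thesis by (simp add: distrib_right mult.assoc)
  qed
  have up: "v (Suc (Suc i)) - v (Suc i) \<le> a * (1 + L * a) * (v (Suc i) - v i)" for i
  proof -
    have "v (Suc (Suc i)) - v (Suc i) \<le> a * gap (v (Suc i))" by (rule w1)
    also have "\<dots> \<le> a * ((1 + L * a) * gap (v i))"
      using a1 gap_grow[of i "v (Suc i)"] inc[of i] by (intro mult_left_mono) auto
    also have "\<dots> \<le> a * ((1 + L * a) * (v (Suc i) - v i))"
      using a1 L1 w1(1)[of i] by (intro mult_left_mono) auto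
    finally show ?thesis by (simp add: mult.assoc)
  qed
  have down: "v (Suc i) - v i \<le> 2 * P * (v (Suc (Suc i)) - v (Suc i))" for i
  proof -
    define x where "x = v (Suc i) - v i"
    define y where "y = v (Suc (Suc i)) - v (Suc i)"
    have xy: "0 < x" "0 < y" using inc[of i] inc[of "Suc i"] by (auto simp: x_def y_def)
    have slopes: "(\<psi> (v (Suc i)) - \<psi> (v (Suc (Suc i)))) * x \<le> (\<psi> (v i) - \<psi> (v (Suc i))) * y"
      using convex_slopes[of "eta_nodes i" "eta_nodes (Suc i)" "eta_nodes (Suc (Suc i))"] eta_nodes_bounds(1)[of i]
        inc[of i] inc[of "Suc i"] by (simp add: v_def x_def y_def)
    have "\<psi> (v (Suc i)) / 2 * x \<le> (\<psi> (v (Suc i)) - \<psi> (v (Suc (Suc i)))) * x"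
      using half[of "Suc i"] xy by (intro mult_right_mono) auto
    also note slopes
    also have "(\<psi> (v i) - \<psi> (v (Suc i))) * y \<le> (P * \<psi> (v (Suc i))) * y"
      using ratio[of i] psi_pos[OF v1[of "Suc i"]] xy by (intro mult_right_mono) auto
    finally have "\<psi> (v (Suc i)) * x \<le> \<psi> (v (Suc i)) * (2 * P * y)" by (simp add: mult_ac)
    then show ?thesis using psi_pos[OF v1[of "Suc i"]] by (simp add: x_def y_def)
  qed
  define K' where "K' = P * 2 + (N + 1) + a * (1 + L * a)"
  have nn: "0 \<le> P * 2" "0 \<le> N + 1" "0 \<le> a * (1 + L * a)" "1 \<le> P * 2" "1 + L * a \<le> a * (1 + L * a)"
    using P2 g1 L1 a1 mult_right_mono[OF a1, of "1 + L * a"] by (auto simp: N_def)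
  have "block_scale (\<lambda>k. \<psi> (real k)) eta_nodes (\<lambda>k. 1 / (eta \<psi> (real k) - real k)) K'"
  proof
    fix i k :: nat
    have lift: "x \<le> K' * z" if "x \<le> b * z" "b \<le> K'" "0 \<le> z" for x b z
      using that mult_right_mono[of b K' z] by linarith
    show "eta_nodes 0 = 1" by simp
    show "eta_nodes i < eta_nodes (Suc i)" using inc[of i] unfolding v_def by (simp only: of_nat_less_iff)
    show "1 \<le> K'" using nn by (simp add: K'_def)
    show "\<psi> (real (eta_nodes i)) \<le> K' * \<psi> (real (eta_nodes (Suc i)))"
      using nn P2 psi_pos[OF v1[of "Suc i"]] by (intro lift[OF ratio[of i, unfolded v_def]]) (auto simp: K'_def v_def)
    show "real (eta_nodes (Suc i)) \<le> K' * real (eta_nodes i)"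
      using nn by (intro lift[OF ratio_v[of i, unfolded v_def]]) (auto simp: K'_def)
    show "real (eta_nodes (Suc (Suc i))) - real (eta_nodes (Suc i)) \<le> K' * (real (eta_nodes (Suc i)) - real (eta_nodes i))"
      using nn inc[of i] by (intro lift[OF up[of i, unfolded v_def]]) (auto simp: K'_def v_def)
    show "real (eta_nodes (Suc i)) - real (eta_nodes i) \<le> K' * (real (eta_nodes (Suc (Suc i))) - real (eta_nodes (Suc i)))"
      using nn inc[of "Suc i"] by (intro lift[OF down[of i, unfolded v_def]]) (auto simp: K'_def v_def)
    show "0 < 1 / (eta \<psi> (real k) - real k)" if "1 \<le> k" using eta_props(2)[of "real k"] that by simp
    show "1 \<le> K' * (1 / (eta \<psi> (real k) - real k)) * (real (eta_nodes (Suc i)) - real (eta_nodes i))"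
      if k: "eta_nodes i < k" "k \<le> eta_nodes (Suc i)"
    proof -
      have kr: "v i \<le> real k" "real k \<le> v (Suc i)" using k by (auto simp: v_def)
      have pos: "0 < gap (real k)" using g[of "real k"] c0(1) kr(1) v1[of i] by linarith
      have "gap (real k) \<le> (1 + L * a) * gap (v i)" by (rule gap_grow[OF kr])
      also have "\<dots> \<le> K' * (v (Suc i) - v i)"
        using w1(1)[of i] g[OF v1[of i]] c0(1) nn L1 a1 by (intro mult_mono) (auto simp: K'_def)
      finally have "1 \<le> K' * (v (Suc i) - v i) / gap (real k)" using pos by (simp add: pos_le_divide_eq)
      then show ?thesis by (simp add: gap_def v_def)
    qed
  qed (use psi_nat_pos psi_nat_convex psi_mono in auto)
  then show thesis by (rule that)
qed

end

section \<open>The estimate for the derivative\<close>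

lemma averaged_norm_of_class:
  assumes M: "M \<in> quasiconvex_young_theta2" and w: "\<omega> \<in> muckenhoupt (young_index M)"
  obtains A where "averaged_norm M \<omega> A"
    and "\<And>f. f \<in> orlicz_space M \<omega> \<Longrightarrow> f \<in> L_per"
    and "\<And>f. f \<in> periodic_measurable \<Longrightarrow> orlicz_norm M \<omega> f < \<infinity> \<Longrightarrow> f \<in> orlicz_space M \<omega>"
proof -
  obtain \<Psi> q c C where "muckenhoupt_gauge M \<omega> \<Psi> q c C" by (rule young_index_reduction[OF M w])
  then interpret muckenhoupt_gauge M \<omega> \<Psi> q c C .
  obtain B where B: "0 < B" "\<And>f. f \<in> periodic_measurable \<Longrightarrow>
      (\<integral>\<^sup>+t\<in>{0..2 * pi}. ennreal \<bar>f t\<bar> \<partial>lebesgue) \<le> ennreal B * orlicz_norm M \<omega> f"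
    by (rule L1_le_norm) blast
  define A where "A = max 1 (max (c * (3 * C + 1)) B)"
  have AA: "1 \<le> A" "c * (3 * C + 1) \<le> A" "B \<le> A" by (auto simp: A_def)
  have "averaged_norm M \<omega> A"
  proof
    show "orlicz_norm M \<omega> (window_mean N f) \<le> ennreal A * orlicz_norm M \<omega> f" if "f \<in> L_per" "3 \<le> N" for f N
      using AA(2) by (intro order_trans[OF norm_window_mean[OF that]] mult_right_mono ennreal_leI) auto
    show "(\<integral>\<^sup>+t\<in>{0..2 * pi}. ennreal \<bar>f t\<bar> \<partial>lebesgue) \<le> ennreal A * orlicz_norm M \<omega> f"
      if "f \<in> periodic_measurable" for f
      using AA(3) by (intro order_trans[OF B(2)[OF that]] mult_right_mono ennreal_leI) auto
  qed (use AA in auto)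
  then show thesis by (rule that) (auto intro: orlicz_space_L_per orlicz_space_if_norm_finite)
qed

text \<open>
  The addition theorems translate the rotated Fourier coefficients of \<open>deriv_sum\<close> into the shifted
  harmonics of the definition.
\<close>

lemma (in block_approximation) psi_beta_derivative_exists:
  assumes p: "\<And>k. p k = \<psi> (real k)"
    and f: "f \<in> L_per" and fin: "(\<Sum>l. tail_term f (1 + l)) < \<infinity>"
  shows "deriv_sum f (\<beta> * pi / 2) \<in> L_per" "is_psi_beta_derivative \<psi> \<beta> f (deriv_sum f (\<beta> * pi / 2))"
proof -
  let ?\<gamma> = "\<beta> * pi / 2"
  show g: "deriv_sum f ?\<gamma> \<in> L_per"
    by (rule norm_finite_L_per[OF deriv_sum_periodic_measurable deriv_sum_norm_finite[OF f fin]])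
  note F = fourier_deriv_sum[OF block_sum_finite[OF f fin] g]
  show "is_psi_beta_derivative \<psi> \<beta> f (deriv_sum f ?\<gamma>)"
    unfolding is_psi_beta_derivative_def
  proof (intro conjI allI impI f g)
    show "fourier_a (deriv_sum f ?\<gamma>) 0 = 0" by (simp add: F)
    fix k :: nat and x :: real
    assume "1 \<le> k"
    then have F': "fourier_a (deriv_sum f ?\<gamma>) k = 1 / \<psi> (real k) * (fourier_a f k * cos ?\<gamma> + fourier_b f k * sin ?\<gamma>)"
      "fourier_b (deriv_sum f ?\<gamma>) k = 1 / \<psi> (real k) * (fourier_b f k * cos ?\<gamma> - fourier_a f k * sin ?\<gamma>)"
      by (simp_all add: F u_def p)
    have e: "v * (a * c + b * s) * X + v * (b * c - a * s) * Y = v * (a * (X * c - Y * s) + b * (Y * c + X * s))"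
      for v a b c s X Y :: real by algebra
    show "fourier_a (deriv_sum f ?\<gamma>) k * cos (real k * x) + fourier_b (deriv_sum f ?\<gamma>) k * sin (real k * x) =
        1 / \<psi> (real k) * (fourier_a f k * cos (real k * x + ?\<gamma>) + fourier_b f k * sin (real k * x + ?\<gamma>))"
      unfolding F' e cos_add sin_add ..
  qed
qed

lemma (in block_approximation) head_terms_recip:
  assumes p: "\<And>k. p k = \<psi> (real k)"
  shows "(\<Sum>k=1..n. head_term f r k) = (\<Sum>k=1..n. ennreal (real k ^ (2 * r) * recip \<psi> k) * best_approx M \<omega> f k)"
  by (intro sum.cong refl) (auto simp: head_term_def u_def p recip_def)

theorem theorem2:
  fixes M \<omega> :: "real \<Rightarrow> real" and \<beta> :: real
  assumes "M \<in> quasiconvex_young_theta2"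
    and "\<omega> \<in> muckenhoupt (young_index M)"
  shows
    "(\<forall>\<psi> \<in> psi_class0. \<exists>C :: nat \<Rightarrow> real. (\<forall>r. 0 < C r) \<and>
       (\<forall>f \<in> orlicz_space M \<omega>.
          (\<Sum>j. let k = 1 + j in
             best_approx M \<omega> f k * ennreal (1 / \<bar>real k * \<psi> (real k)\<bar>)) < \<infinity> \<longrightarrow>
          (\<exists>g \<in> orlicz_space M \<omega>. is_psi_beta_derivative \<psi> \<beta> f g \<and>
             (\<forall>r. \<forall>n::nat. 1 \<le> n \<longrightarrow>
                modulus M \<omega> r g (1 / real n) \<le>
                  ennreal (C r / real n ^ (2 * r)) *
                    (\<Sum>\<nu>=0..n. ennreal (real \<nu> ^ (2 * r) * recip \<psi> \<nu>) * best_approx M \<omega> f \<nu>) +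
                  ennreal (C r) *
                    (\<Sum>j. let \<nu> = n + 1 + j in
                       best_approx M \<omega> f \<nu> * ennreal (1 / (real \<nu> * \<psi> (real \<nu>))))))))
     \<and>
     (\<forall>\<psi> \<in> psi_classF. (\<exists>c0>0. \<forall>t\<ge>1. c0 \<le> eta \<psi> t - t) \<longrightarrow>
       (\<exists>C :: nat \<Rightarrow> real. (\<forall>r. 0 < C r) \<and>
       (\<forall>f \<in> orlicz_space M \<omega>.
          (\<Sum>j. let k = 1 + j in
             best_approx M \<omega> f k *
               ennreal (1 / \<bar>\<psi> (real k) * (eta \<psi> (real k) - real k)\<bar>)) < \<infinity> \<longrightarrow>
          (\<exists>g \<in> orlicz_space M \<omega>. is_psi_beta_derivative \<psi> \<beta> f g \<and>
             (\<forall>r. \<forall>n::nat. 1 \<le> n \<longrightarrow>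
                modulus M \<omega> r g (1 / real n) \<le>
                  ennreal (C r) *
                    (ennreal (1 / real n ^ (2 * r)) *
                       (\<Sum>\<nu>=1..n. ennreal (real \<nu> ^ (2 * r) * recip \<psi> \<nu>) * best_approx M \<omega> f \<nu>) +
                     (\<Sum>j. let \<nu> = n + 1 + j in
                       best_approx M \<omega> f \<nu> *
                         ennreal (1 / (\<psi> (real \<nu>) * (eta \<psi> (real \<nu>) - real \<nu>))))))))))"
proof -
  obtain A where A: "averaged_norm M \<omega> A"
    and L: "\<And>f. f \<in> orlicz_space M \<omega> \<Longrightarrow> f \<in> L_per"
    and space: "\<And>f. f \<in> periodic_measurable \<Longrightarrow> orlicz_norm M \<omega> f < \<infinity> \<Longrightarrow> f \<in> orlicz_space M \<omega>"
    by (rule averaged_norm_of_class[OF assms]) blast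
  let ?\<gamma> = "\<beta> * pi / 2"
  show ?thesis
  proof (intro conjI ballI impI)
    fix \<psi> assume cls: "\<psi> \<in> psi_class0"
    interpret psi_function \<psi> using cls by unfold_locales (simp add: psi_class0_def)
    obtain K where K: "\<And>t. 1 \<le> t \<Longrightarrow> 0 < t / (eta \<psi> t - t) \<and> t / (eta \<psi> t - t) \<le> K"
      using cls unfolding psi_class0_def by blast
    obtain K' where "block_scale (\<lambda>k. \<psi> (real k)) (\<lambda>i. 2 ^ i) (\<lambda>k. 1 / real k) K'"
      by (rule block_scale_dyadic[OF K])
    then interpret block_approximation M \<omega> A "\<lambda>k. \<psi> (real k)" "\<lambda>i. 2 ^ i" "\<lambda>k. 1 / real k" K'
      using A by (intro block_approximation.intro)
    have tail: "(let k = n + 1 + j in best_approx M \<omega> f k * ennreal (1 / (real k * \<psi> (real k)))) = tail_term f (n + 1 + j)"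
      for f n j by (simp add: tail_term_def u_def Let_def)
    have abs: "(let k = 1 + j in best_approx M \<omega> f k * ennreal (1 / \<bar>real k * \<psi> (real k)\<bar>)) = tail_term f (1 + j)"
      for f j using psi_nat_pos[of "1 + j"] by (simp add: tail_term_def u_def Let_def abs_mult)
    show "\<exists>C :: nat \<Rightarrow> real. (\<forall>r. 0 < C r) \<and>
       (\<forall>f \<in> orlicz_space M \<omega>.
          (\<Sum>j. let k = 1 + j in
             best_approx M \<omega> f k * ennreal (1 / \<bar>real k * \<psi> (real k)\<bar>)) < \<infinity> \<longrightarrow>
          (\<exists>g \<in> orlicz_space M \<omega>. is_psi_beta_derivative \<psi> \<beta> f g \<and>
             (\<forall>r. \<forall>n::nat. 1 \<le> n \<longrightarrow>
                modulus M \<omega> r g (1 / real n) \<le>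
                  ennreal (C r / real n ^ (2 * r)) *
                    (\<Sum>\<nu>=0..n. ennreal (real \<nu> ^ (2 * r) * recip \<psi> \<nu>) * best_approx M \<omega> f \<nu>) +
                  ennreal (C r) *
                    (\<Sum>j. let \<nu> = n + 1 + j in
                       best_approx M \<omega> f \<nu> * ennreal (1 / (real \<nu> * \<psi> (real \<nu>)))))))"
    proof (rule exI[of _ C], intro conjI allI ballI impI)
      show "0 < C r" for r by (rule C_parts)
      fix f assume fo: "f \<in> orlicz_space M \<omega>"
        and "(\<Sum>j. let k = 1 + j in best_approx M \<omega> f k * ennreal (1 / \<bar>real k * \<psi> (real k)\<bar>)) < \<infinity>"
      then have fin: "(\<Sum>l. tail_term f (1 + l)) < \<infinity>" unfolding abs by simp
      note f = L[OF fo]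
      show "\<exists>g \<in> orlicz_space M \<omega>. is_psi_beta_derivative \<psi> \<beta> f g \<and>
             (\<forall>r. \<forall>n::nat. 1 \<le> n \<longrightarrow>
                modulus M \<omega> r g (1 / real n) \<le>
                  ennreal (C r / real n ^ (2 * r)) *
                    (\<Sum>\<nu>=0..n. ennreal (real \<nu> ^ (2 * r) * recip \<psi> \<nu>) * best_approx M \<omega> f \<nu>) +
                  ennreal (C r) *
                    (\<Sum>j. let \<nu> = n + 1 + j in
                       best_approx M \<omega> f \<nu> * ennreal (1 / (real \<nu> * \<psi> (real \<nu>)))))"
      proof (intro bexI[of _ "deriv_sum f ?\<gamma>"] conjI allI impI)
        show "deriv_sum f ?\<gamma> \<in> orlicz_space M \<omega>"
          by (rule space[OF deriv_sum_periodic_measurable deriv_sum_norm_finite[OF f fin]])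
        show "is_psi_beta_derivative \<psi> \<beta> f (deriv_sum f ?\<gamma>)"
          by (rule psi_beta_derivative_exists[OF refl f fin])
        fix r n :: nat assume n: "1 \<le> n"
        have zero: "(\<Sum>k=0..n. ennreal (real k ^ (2 * r) * recip \<psi> k) * best_approx M \<omega> f k)
            = (\<Sum>k=1..n. head_term f r k)"
          unfolding head_terms_recip[OF refl] by (simp add: sum.atLeast_Suc_atMost recip_def)
        have const: "ennreal (C r / real n ^ (2 * r)) = ennreal (C r) * ennreal (1 / real n ^ (2 * r))"
          using ennreal_mult'[of "C r" "1 / real n ^ (2 * r)"] C_parts(3)[of r] by simp
        show "modulus M \<omega> r (deriv_sum f ?\<gamma>) (1 / real n) \<le>
                  ennreal (C r / real n ^ (2 * r)) *
                    (\<Sum>\<nu>=0..n. ennreal (real \<nu> ^ (2 * r) * recip \<psi> \<nu>) * best_approx M \<omega> f \<nu>) +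
                  ennreal (C r) *
                    (\<Sum>j. let \<nu> = n + 1 + j in
                       best_approx M \<omega> f \<nu> * ennreal (1 / (real \<nu> * \<psi> (real \<nu>))))"
          unfolding tail zero const using deriv_sum_modulus[OF f fin n, of r ?\<gamma>]
          by (simp only: distrib_left mult.assoc)
      qed
    qed
  next
    fix \<psi> assume cls: "\<psi> \<in> psi_classF" and "\<exists>c0>0. \<forall>t\<ge>1. c0 \<le> eta \<psi> t - t"
    then obtain c0 where c0: "0 < c0" "\<And>t. 1 \<le> t \<Longrightarrow> c0 \<le> eta \<psi> t - t" by blast
    interpret psi_function \<psi> using cls by unfold_locales (simp add: psi_classF_def)
    obtain K where K: "\<And>t. 1 \<le> t \<Longrightarrow> \<exists>D. (eta \<psi> has_real_derivative D) (at t within {1..}) \<and> D \<le> K"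
      using cls unfolding psi_classF_def by blast
    obtain K' where "block_scale (\<lambda>k. \<psi> (real k)) eta_nodes (\<lambda>k. 1 / (eta \<psi> (real k) - real k)) K'"
      by (rule block_scale_eta[OF K c0])
    then interpret block_approximation M \<omega> A "\<lambda>k. \<psi> (real k)" eta_nodes "\<lambda>k. 1 / (eta \<psi> (real k) - real k)" K'
      using A by (intro block_approximation.intro)
    have tail: "(let k = n + 1 + j in best_approx M \<omega> f k * ennreal (1 / (\<psi> (real k) * (eta \<psi> (real k) - real k))))
      = tail_term f (n + 1 + j)"
      for f n j by (simp add: tail_term_def u_def Let_def mult.commute)
    have abs: "(let k = 1 + j in best_approx M \<omega> f k * ennreal (1 / \<bar>\<psi> (real k) * (eta \<psi> (real k) - real k)\<bar>))
      = tail_term f (1 + j)" for f j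
      using psi_nat_pos[of "1 + j"] eta_props(2)[of "real (1 + j)"]
      by (simp add: tail_term_def u_def Let_def abs_mult mult.commute)
    show "\<exists>C :: nat \<Rightarrow> real. (\<forall>r. 0 < C r) \<and>
       (\<forall>f \<in> orlicz_space M \<omega>.
          (\<Sum>j. let k = 1 + j in
             best_approx M \<omega> f k *
               ennreal (1 / \<bar>\<psi> (real k) * (eta \<psi> (real k) - real k)\<bar>)) < \<infinity> \<longrightarrow>
          (\<exists>g \<in> orlicz_space M \<omega>. is_psi_beta_derivative \<psi> \<beta> f g \<and>
             (\<forall>r. \<forall>n::nat. 1 \<le> n \<longrightarrow>
                modulus M \<omega> r g (1 / real n) \<le>
                  ennreal (C r) *
                    (ennreal (1 / real n ^ (2 * r)) *
                       (\<Sum>\<nu>=1..n. ennreal (real \<nu> ^ (2 * r) * recip \<psi> \<nu>) * best_approx M \<omega> f \<nu>) +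
                     (\<Sum>j. let \<nu> = n + 1 + j in
                       best_approx M \<omega> f \<nu> *
                         ennreal (1 / (\<psi> (real \<nu>) * (eta \<psi> (real \<nu>) - real \<nu>))))))))"
      unfolding tail abs
    proof (rule exI[of _ C], intro conjI allI ballI impI)
      show "0 < C r" for r by (rule C_parts)
      fix f assume fo: "f \<in> orlicz_space M \<omega>" and fin: "(\<Sum>l. tail_term f (1 + l)) < \<infinity>"
      note f = L[OF fo]
      show "\<exists>g \<in> orlicz_space M \<omega>. is_psi_beta_derivative \<psi> \<beta> f g \<and>
             (\<forall>r. \<forall>n::nat. 1 \<le> n \<longrightarrow>
                modulus M \<omega> r g (1 / real n) \<le>
                  ennreal (C r) *
                    (ennreal (1 / real n ^ (2 * r)) *
                       (\<Sum>\<nu>=1..n. ennreal (real \<nu> ^ (2 * r) * recip \<psi> \<nu>) * best_approx M \<omega> f \<nu>) +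
                     (\<Sum>j. tail_term f (n + 1 + j))))"
        unfolding head_terms_recip[OF refl, symmetric]
        by (intro bexI[of _ "deriv_sum f ?\<gamma>"] conjI allI impI deriv_sum_modulus[OF f fin]
            psi_beta_derivative_exists[OF refl f fin] space[OF deriv_sum_periodic_measurable deriv_sum_norm_finite[OF f fin]])
    qed
  qed
qed

end
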